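(* Let $R>0$, $r_0\in(0,R)$, $\Gamma,\theta_0\in\mathbb{R}\setminus\{0\}$, $\rho_0=\frac{r_0}{R}$, $\phi_0=\frac{2\pi R^2\theta_0}{\Gamma}$, and suppose $(\rho_0,\phi_0)\in\mathcal R_2\cup\mathcal R_3\cup\mathcal R_4$ (regions defined in the context). Let $T>0$ and let $r_\varepsilon(t)=r_0+\varepsilon f(t)+g(t;\varepsilon)$ be a smooth $T$-periodic perturbation of $r_0$, where $f$ and $g(\cdot;\varepsilon)$ are $T$-periodic analytic functions and $g(t;\varepsilon)\to0$ uniformly in $t\in\mathbb{R}$ as $\varepsilon\to0$ (with $r_\varepsilon\equiv r_0$ for $\varepsilon=0$). Let $$\Psi(t,x,y;\varepsilon)=-\frac{\theta_0}{2}(x^2+y^2)+\frac{\Gamma}{2\pi}\ln\sqrt{\frac{(x-r_\varepsilon(t))^2+y^2}{(x-\frac{R^2}{r_\varepsilon(t)})^2+y^2}}.$$ Then for any positive integer $N$ there is $\bar\varepsilon_N>0$ such that, if $|\varepsilon|<\bar\varepsilon_N$, the Hamiltonian system $$\dot x=\frac{\partial\Psi}{\partial y}(t,x,y;\varepsilon),\qquad \dot y=-\frac{\partial\Psi}{\partial x}(t,x,y;\varepsilon)$$ has at least $N$ periodic solutions contained in $D_R=\{(x,y)\in\mathbb{R}^2:x^2+y^2\le R^2\}$. In particular, for $|\varepsilon|$ sufficiently small, when the protocol $z_\varepsilon(t)=r_\varepsilon(t)\exp(i\theta_0t)$ is $T$-periodic, the flow induced by $$\dot{\zeta}^*=\frac{\Gamma}{2\pi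 i}\left(\frac{1}{\zeta-z_\varepsilon(t)}-\frac{1}{\zeta-\frac{R^2}{|z_\varepsilon(t)|^2}z_\varepsilon(t)}\right)$$ has infinitely many periodic trajectories with zero winding number.
   Context: Here $\zeta\in\mathbb{C}\cong\mathbb{R}^2$ and the asterisk denotes complex conjugation. The change to the corotating frame $\zeta(t)=\eta(t)\exp(i\theta_0t)$, $\eta=x+iy$, transforms the $\zeta$-equation into the Hamiltonian system with Hamiltonian $\Psi(t,x,y;\varepsilon)$. Regions: with $\Lambda=\{(\rho_0,\phi_0)\in\mathbb{R}^2:0<\rho_0<1,\ \phi_0\ne0\}$ and $$F(\rho_0,\phi_0)=27\rho_0^2(\rho_0^2-1)+\phi_0\left(2-3\rho_0^2-3\rho_0^4+2\rho_0^6-2(1-\rho_0^2+\rho_0^4)^{3/2}\right),$$ - $\mathcal R_2=\{(\rho_0,\phi_0)\in\Lambda:\phi_0>0,\ \rho_0>\max\{\frac{1-\phi_0}{1+\phi_0},\frac{\phi_0-1}{1+\phi_0}\}\}$, - $\mathcal R_3=\{(\rho_0,\phi_0)\in\Lambda:\phi_0>0,\ \rho_0<\frac{\phi_0-1}{1+\phi_0}\}$, - $\mathcal R_4=\{(\rho_0,\phi_0)\in\Lambda:\phi_0<0,\ F(\rho_0,\phi_0)>0\}$. These are the parameters for which the unperturbed ($\varepsilon=0$) autonomous system has a non-degenerate center in the interior of $D_R$. Winding number: a periodic trajectory $\zeta(t)=\eta(t)\exp(i\theta_0t)$ has zero winding number if, in the corotating frame, it does not rotate around the vortex, i.e. the closed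 curve $t\mapsto\eta(t)-r_\varepsilon(t)$, over a common period, has winding number zero about $0$. *)

theory Defs
  imports "HOL-Complex_Analysis.Complex_Analysis" "HOL-Library.Periodic_Fun"
begin

text \<open>Real analyticity on the whole line: a convergent Taylor expansion at every point.\<close>

definition real_analytic :: "(real \<Rightarrow> real) \<Rightarrow> bool" where
  "real_analytic f \<longleftrightarrow> (\<forall>t. \<exists>A. (\<lambda>h. f (t + h)) has_fps_expansion A)"

definition Lambda_region :: "(real \<times> real) set" where
  "Lambda_region = {(\<rho>, \<phi>). 0 < \<rho> \<and> \<rho> < 1 \<and> \<phi> \<noteq> 0}"

definition F_region :: "real \<Rightarrow> real \<Rightarrow> real" where
  "F_region \<rho> \<phi> = 27 * \<rho>^2 * (\<rho>^2 - 1)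
     + \<phi> * (2 - 3 * \<rho>^2 - 3 * \<rho>^4 + 2 * \<rho>^6 - 2 * (1 - \<rho>^2 + \<rho>^4) powr (3/2))"

definition R2 :: "(real \<times> real) set" where
  "R2 = {(\<rho>, \<phi>) \<in> Lambda_region. \<phi> > 0 \<and> \<rho> > max ((1 - \<phi>) / (1 + \<phi>)) ((\<phi> - 1) / (1 + \<phi>))}"

definition R3 :: "(real \<times> real) set" where
  "R3 = {(\<rho>, \<phi>) \<in> Lambda_region. \<phi> > 0 \<and> \<rho> < (\<phi> - 1) / (1 + \<phi>)}"

definition R4 :: "(real \<times> real) set" where
  "R4 = {(\<rho>, \<phi>) \<in> Lambda_region. \<phi> < 0 \<and> F_region \<rho> \<phi> > 0}"

definition disc :: "real \<Rightarrow> (real \<times> real) set" where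
  "disc R = {(x, y). x^2 + y^2 \<le> R^2}"

text \<open>In the following, \<open>r\<close> is the radial motion of the vortex, i.e. \<open>r\<^sub>\<epsilon>\<close> for one fixed \<open>\<epsilon>\<close>.\<close>

definition Psi :: "real \<Rightarrow> real \<Rightarrow> real \<Rightarrow> (real \<Rightarrow> real) \<Rightarrow> real \<Rightarrow> real \<Rightarrow> real \<Rightarrow> real" where
  "Psi R \<Gamma> \<theta> r t x y =
     - (\<theta> / 2) * (x^2 + y^2)
     + \<Gamma> / (2 * pi) * ln (sqrt (((x - r t)^2 + y^2) / ((x - R^2 / r t)^2 + y^2)))"

text \<open>
  Solutions are defined for all times and have to stay in the domain of \<open>Psi\<close>, that is, away
  from the vortex and from its image. This has to be demanded explicitly, because in HOL the
  logarithm, the quotient and \<open>deriv\<close> are total functions.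
\<close>

definition hamiltonian_solution ::
    "real \<Rightarrow> real \<Rightarrow> real \<Rightarrow> (real \<Rightarrow> real) \<Rightarrow> (real \<Rightarrow> real \<times> real) \<Rightarrow> bool" where
  "hamiltonian_solution R \<Gamma> \<theta> r u \<longleftrightarrow>
     (\<forall>t. u t \<noteq> (r t, 0) \<and> u t \<noteq> (R^2 / r t, 0) \<and>
       ((\<lambda>s. fst (u s)) has_real_derivative
          deriv (\<lambda>y. Psi R \<Gamma> \<theta> r t (fst (u t)) y) (snd (u t))) (at t) \<and>
       ((\<lambda>s. snd (u s)) has_real_derivative
          - deriv (\<lambda>x. Psi R \<Gamma> \<theta> r t x (snd (u t))) (fst (u t))) (at t))"

definition protocol :: "real \<Rightarrow> (real \<Rightarrow> real) \<Rightarrow> real \<Rightarrow> complex" where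
  "protocol \<theta> r t = of_real (r t) * exp (\<i> * of_real (\<theta> * t))"

definition vortex_solution ::
    "real \<Rightarrow> real \<Rightarrow> (real \<Rightarrow> complex) \<Rightarrow> (real \<Rightarrow> complex) \<Rightarrow> bool" where
  "vortex_solution R \<Gamma> z \<zeta> \<longleftrightarrow>
     (\<forall>t. \<zeta> t \<noteq> z t \<and> \<zeta> t \<noteq> of_real (R^2 / (cmod (z t))^2) * z t \<and>
       ((\<lambda>s. cnj (\<zeta> s)) has_vector_derivative
          of_real \<Gamma> / (2 * of_real pi * \<i>) *
            (1 / (\<zeta> t - z t) - 1 / (\<zeta> t - of_real (R^2 / (cmod (z t))^2) * z t))) (at t))"

definition is_periodic :: "(real \<Rightarrow> 'a) \<Rightarrow> bool" where
  "is_periodic u \<longleftrightarrow> (\<exists>P>0. periodic_fun_simple u P)"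

definition corotating :: "real \<Rightarrow> (real \<Rightarrow> complex) \<Rightarrow> real \<Rightarrow> complex" where
  "corotating \<theta> \<zeta> t = \<zeta> t * exp (- \<i> * of_real (\<theta> * t))"

text \<open>
  The library's winding numbers are for paths parametrised by the unit interval, so a common
  period \<open>P\<close> is rescaled to \<open>1\<close>.
\<close>

definition zero_winding :: "real \<Rightarrow> (real \<Rightarrow> real) \<Rightarrow> (real \<Rightarrow> complex) \<Rightarrow> bool" where
  "zero_winding \<theta> r \<zeta> \<longleftrightarrow>
     (\<exists>P>0. periodic_fun_simple (corotating \<theta> \<zeta>) P \<and> periodic_fun_simple r P \<and>
        (\<forall>t. corotating \<theta> \<zeta> t \<noteq> of_real (r t)) \<and>
        winding_number (\<lambda>s. corotating \<theta> \<zeta> (P * s) - of_real (r (P * s))) 0 = 0)"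

text \<open>
  Solutions are counted up to translation in time: with \<open>u\<close>, a \<open>T\<close>-periodic system also has
  the solutions \<open>u (t + k * T)\<close> (and an autonomous one all \<open>u (t + s)\<close>), which trace the same
  trajectory and count once.
\<close>

definition time_translates :: "(real \<Rightarrow> 'a) \<Rightarrow> (real \<Rightarrow> 'a) \<Rightarrow> bool" where
  "time_translates u v \<longleftrightarrow> (\<exists>s. \<forall>t. v t = u (t + s))"

definition geometrically_distinct :: "(real \<Rightarrow> 'a) set \<Rightarrow> bool" where
  "geometrically_distinct S \<longleftrightarrow> pairwise (\<lambda>u v. \<not> time_translates u v) S"

end

theory Submission
  imports Defs
begin

text \<open>
  In the corotating frame with \<open>\<epsilon> = 0\<close> the system has an equilibrium \<open>c\<close> on the line through the
  vortex. The region conditions produce it through the intermediate value theorem and make it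
  elliptic; after reversing time one may assume \<open>\<theta> > 0\<close>. The normal form of order three at \<open>c\<close> is
  \<open>w' = i w (\<omega> + \<beta> |w|\<^sup>2)\<close>, and \<open>\<beta> < 0\<close> for all parameters, so the return time to the ray to the
  right of \<open>c\<close> is strictly increasing in the amplitude.

  Let \<open>r\<close> be close to \<open>r\<^sub>0\<close>. By this twist there is, for given times \<open>t\<close> and \<open>t'\<close>, exactly one orbit that
  leaves the ray at \<open>t\<close> and returns to it at \<open>t'\<close>; its action \<open>h(t, t')\<close> has an antitone mixed derivative.
  As in Aubry's theory, the action sum over \<open>q\<close> consecutive crossing times has a minimizer among the
  configurations with \<open>x(n + q) = x(n) + p T\<close>, which can be chosen ordered with respect to its
  translates. Comparison with equally spaced times, for which the unperturbed action is strictly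
  convex, keeps the minimizer away from the boundary of the domain of \<open>h\<close>. Hence it is stationary,
  and the orbit pieces fit together to a periodic orbit. The smallness of \<open>r - r\<^sub>0\<close> needed here is uniform for
  \<open>p / q\<close> in a whole interval, so infinitely many periods occur for the same \<open>\<epsilon>\<close>.

  The fraction \<open>p / q\<close> can be read off the crossing times, and these are determined by the function
  \<open>t \<mapsto> |\<eta> t|\<close> alone; therefore orbits with different fractions are not time translates of each
  other, in the corotating as well as in the inertial frame. They do not rotate around the vortex
  because they stay to the left of it.
\<close>

section \<open>Minimal periodic configurations of a discrete action\<close>

lemma sum_int_period_shift:
  fixes F :: "int \<Rightarrow> real"
  assumes q: "q > 0" and per: "\<And>n. F (n + q) = F n"
  shows "(\<Sum>i\<in>{0..<q}. F (i + a)) = (\<Sum>i\<in>{0..<q}. F i)"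
proof -
  have per': "F (n + k * q) = F n" for n k
  proof (induction k rule: int_induct[where k=0])
    case (step1 i) then show ?case using per[of "n + i*q"] by (simp add: algebra_simps)
  next
    case (step2 i) then show ?case using per[of "n + (i-1)*q"] by (simp add: algebra_simps)
  qed simp
  have modF: "F n = F (n mod q)" for n
    using per'[of "n mod q" "n div q"] by (simp add: add.commute)
  have bij: "bij_betw (\<lambda>i. (i + a) mod q) {0..<q} {0..<q}"
  proof (rule bij_betwI[where g="\<lambda>i. (i - a) mod q"])
    show "(\<lambda>i. (i + a) mod q) \<in> {0..<q} \<rightarrow> {0..<q}" using q by auto
    show "(\<lambda>i. (i - a) mod q) \<in> {0..<q} \<rightarrow> {0..<q}" using q by auto
  qed (auto simp: mod_simps)
  have "(\<Sum>i\<in>{0..<q}. F (i + a)) = (\<Sum>i\<in>{0..<q}. F ((i + a) mod q))"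
    using modF by (intro sum.cong) auto
  also have "\<dots> = (\<Sum>i\<in>{0..<q}. F i)"
    using sum.reindex_bij_betw[OF bij, of F] by simp
  finally show ?thesis .
qed

locale discrete_action =
  fixes h :: "real \<Rightarrow> real \<Rightarrow> real" and T lo hi :: real
  assumes T: "T > 0"
    and per: "\<And>x y. h (x + T) (y + T) = h x y"
    and submod: "\<And>x1 x2 y1 y2. x1 \<le> x2 \<Longrightarrow> y1 \<le> y2 \<Longrightarrow> lo \<le> y1 - x2 \<Longrightarrow> y2 - x1 \<le> hi
        \<Longrightarrow> h x1 y1 + h x2 y2 \<le> h x1 y2 + h x2 y1"
    and cont: "continuous_on {(x, y). lo \<le> y - x \<and> y - x \<le> hi} (\<lambda>(x, y). h x y)"
begin

definition adm :: "int \<Rightarrow> int \<Rightarrow> (int \<Rightarrow> real) set" where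
  "adm p q = {x. \<forall>n. lo \<le> x (n + 1) - x n \<and> x (n + 1) - x n \<le> hi \<and> x (n + q) = x n + p * T}"

definition act :: "int \<Rightarrow> (int \<Rightarrow> real) \<Rightarrow> real" where
  "act q x = (\<Sum>i\<in>{0..<q}. h (x i) (x (i + 1)))"

definition trans :: "int \<Rightarrow> int \<Rightarrow> (int \<Rightarrow> real) \<Rightarrow> int \<Rightarrow> real" where
  "trans a b x = (\<lambda>n. x (n + a) + b * T)"

definition minimal :: "int \<Rightarrow> int \<Rightarrow> (int \<Rightarrow> real) \<Rightarrow> bool" where
  "minimal p q x \<longleftrightarrow> x \<in> adm p q \<and> (\<forall>y\<in>adm p q. act q x \<le> act q y)"

lemma per_int: "h (x + real_of_int k * T) (y + real_of_int k * T) = h x y"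
proof (induction k rule: int_induct[where k=0])
  case (step1 i) then show ?case using per[of "x + i*T" "y + i*T"] by (simp add: algebra_simps)
next
  case (step2 i) then show ?case using per[of "x + (i-1)*T" "y + (i-1)*T"] by (simp add: algebra_simps)
qed simp

lemma adm_period: "x \<in> adm p q \<Longrightarrow> x (n + k * q) = x n + k * p * T"
proof (induction k rule: int_induct[where k=0])
  case (step1 i)
  then have "x (n + i*q + q) = x (n + i*q) + p*T" by (auto simp: adm_def)
  then show ?case using step1 by (simp add: algebra_simps)
next
  case (step2 i)
  then have "x (n + (i-1)*q + q) = x (n + (i-1)*q) + p*T" by (auto simp: adm_def)
  then show ?case using step2 by (simp add: algebra_simps)
qed simp

lemma trans_adm: "x \<in> adm p q \<Longrightarrow> trans a b x \<in> adm p q"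
  by (auto simp: adm_def trans_def algebra_simps) (metis add.assoc add.commute)+

lemma act_trans:
  assumes "x \<in> adm p q" "q > 0"
  shows "act q (trans a b x) = act q x"
proof -
  have x: "x (n + q) = x n + p*T" for n using assms by (auto simp: adm_def)
  have "act q (trans a b x) = (\<Sum>i\<in>{0..<q}. h (x (i+a)) (x (i + a + 1)))"
    unfolding act_def trans_def per_int by (simp add: ac_simps)
  also have "\<dots> = act q x"
  proof -
    have "h (x (n + q)) (x (n + q + 1)) = h (x n) (x (n + 1))" for n
      using x[of n] x[of "n+1"] per_int[of "x n" p "x (n+1)"] by (simp add: algebra_simps)
    then show ?thesis unfolding act_def
      using sum_int_period_shift[OF assms(2), of "\<lambda>i. h (x i) (x (i + 1))" a] by simp
  qed
  finally show ?thesis .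
qed

lemma minimal_trans: "minimal p q x \<Longrightarrow> q > 0 \<Longrightarrow> minimal p q (trans a b x)"
  by (auto simp: minimal_def trans_adm act_trans)

lemma adm_min: "x \<in> adm p q \<Longrightarrow> y \<in> adm p q \<Longrightarrow> (\<lambda>n. min (x n) (y n)) \<in> adm p q"
  by (auto simp: adm_def min_def algebra_simps) (smt (verit))+

lemma adm_max: "x \<in> adm p q \<Longrightarrow> y \<in> adm p q \<Longrightarrow> (\<lambda>n. max (x n) (y n)) \<in> adm p q"
  by (auto simp: adm_def max_def algebra_simps) (smt (verit))+

lemma act_min_max:
  assumes x: "x \<in> adm p q" and y: "y \<in> adm p q"
  shows "act q (\<lambda>n. min (x n) (y n)) + act q (\<lambda>n. max (x n) (y n)) \<le> act q x + act q y"
proof -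
  have "h (min (x i) (y i)) (min (x (i+1)) (y (i+1))) + h (max (x i) (y i)) (max (x (i+1)) (y (i+1)))
      \<le> h (x i) (x (i+1)) + h (y i) (y (i+1))" for i
  proof -
    have b: "lo \<le> x (i+1) - x i" "x (i+1) - x i \<le> hi" "lo \<le> y (i+1) - y i" "y (i+1) - y i \<le> hi"
      using x y by (auto simp: adm_def)
    show ?thesis
      using submod[of "x i" "y i" "y (i+1)" "x (i+1)"] submod[of "y i" "x i" "x (i+1)" "y (i+1)"] b
      by (auto simp: min_def max_def)
  qed
  then show ?thesis unfolding act_def sum.distrib[symmetric] by (intro sum_mono)
qed

lemma minimal_min:
  assumes "minimal p q x" "minimal p q y"
  shows "minimal p q (\<lambda>n. min (x n) (y n))"
proof -
  have a: "x \<in> adm p q" "y \<in> adm p q" using assms by (auto simp: minimal_def)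
  have "act q y \<le> act q (\<lambda>n. max (x n) (y n))"
    using assms(2) adm_max[OF a] by (auto simp: minimal_def)
  then have "act q (\<lambda>n. min (x n) (y n)) \<le> act q x" using act_min_max[OF a] by simp
  then show ?thesis using assms(1) adm_min[OF a] by (fastforce simp: minimal_def)
qed

lemma minimal_Min:
  assumes "finite A" "A \<noteq> {}" "\<And>a. a \<in> A \<Longrightarrow> minimal p q (f a)"
  shows "minimal p q (\<lambda>n. Min ((\<lambda>a. f a n) ` A))"
  using assms
proof (induction A rule: finite_ne_induct)
  case (singleton x) then show ?case by simp
next
  case (insert x F)
  have "minimal p q (\<lambda>n. min (f x n) (Min ((\<lambda>a. f a n) ` F)))"
    using insert by (intro minimal_min) auto
  then show ?case using insert by simp
qed

lemma ex_minimal: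
  assumes q: "q > 0" and W: "lo \<le> p * T / q" "p * T / q \<le> hi"
  shows "\<exists>x. minimal p q x"
proof -
  define K where "K = {x \<in> adm p q. x 0 \<in> {0..T}}"
  define C where "C = (\<lambda>n::int. T + \<bar>n\<bar> * (\<bar>lo\<bar> + \<bar>hi\<bar>))"
  have comp: "compact (Pi UNIV (\<lambda>n. {- C n..C n}))"
  proof -
    have "compactin (product_topology (\<lambda>n::int. euclidean) UNIV) (PiE UNIV (\<lambda>n. {- C n..C n}))"
      by (subst compactin_PiE) auto
    then show ?thesis by (simp add: euclidean_product_topology PiE_UNIV_domain)
  qed
  have coord: "continuous_on A (\<lambda>x::int\<Rightarrow>real. x n)" for n A
    by (rule continuous_on_product_coordinates[THEN continuous_on_subset]) simp
  have clos: "closed K"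
  proof -
    have "K = (\<Inter>n. {x. lo \<le> x (n + 1) - x n} \<inter> {x. x (n + 1) - x n \<le> hi} \<inter> {x. x (n + q) = x n + p * T})
        \<inter> ({x. 0 \<le> x 0} \<inter> {x. x 0 \<le> T})" by (auto simp: K_def adm_def)
    also have "closed \<dots>"
      by (intro closed_Int closed_INT ballI closed_Collect_le closed_Collect_eq continuous_intros coord)
    finally show ?thesis .
  qed
  have sub: "K \<subseteq> Pi UNIV (\<lambda>n. {- C n..C n})"
  proof
    fix x assume x: "x \<in> K"
    have st: "\<bar>x (n+1) - x n\<bar> \<le> \<bar>lo\<bar> + \<bar>hi\<bar>" for n using x by (auto simp: K_def adm_def dest!: spec[of _ n])
    have "\<bar>x n\<bar> \<le> C n" for n
    proof (induction n rule: int_induct[where k=0])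
      case base show ?case using x by (auto simp: K_def C_def)
    next
      case (step1 i)
      then have "C (i + 1) = C i + (\<bar>lo\<bar> + \<bar>hi\<bar>)" by (simp add: C_def algebra_simps)
      then show ?case using st[of i] step1 by linarith
    next
      case (step2 i)
      then have "C (i - 1) = C i + (\<bar>lo\<bar> + \<bar>hi\<bar>)" by (simp add: C_def algebra_simps)
      then show ?case using st[of "i - 1"] step2 by simp
    qed
    then show "x \<in> Pi UNIV (\<lambda>n. {- C n..C n})" by (auto simp: abs_le_iff minus_le_iff)
  qed
  have cK: "compact K" using compact_Int_closed[OF comp clos] sub by (metis inf.absorb_iff2 inf_commute)
  have ne: "K \<noteq> {}"
  proof -
    have "(\<lambda>n. n * (p*T/q)) \<in> K" using q W T by (auto simp: K_def adm_def field_simps)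
    then show ?thesis by auto
  qed
  have cact: "continuous_on K (act q)"
    unfolding act_def
  proof (intro continuous_on_sum)
    fix i
    have "continuous_on K (\<lambda>x. (x i, x (i+1)))" by (intro continuous_intros coord)
    moreover have "(\<lambda>x. (x i, x (i+1))) ` K \<subseteq> {(x, y). lo \<le> y - x \<and> y - x \<le> hi}"
      by (auto simp: K_def adm_def)
    ultimately show "continuous_on K (\<lambda>x. h (x i) (x (i+1)))"
      using continuous_on_compose2[OF cont, of K "\<lambda>x. (x i, x (i+1))"] by simp
  qed
  obtain x where x: "x \<in> K" "\<And>y. y \<in> K \<Longrightarrow> act q x \<le> act q y"
    using continuous_attains_inf[OF cK ne cact] by auto
  have "act q x \<le> act q y" if y: "y \<in> adm p q" for y
  proof -
    define b where "b = - \<lfloor>y 0 / T\<rfloor>"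
    have "trans 0 b y \<in> K"
    proof -
      have "real_of_int \<lfloor>y 0 / T\<rfloor> \<le> y 0 / T" "y 0 / T \<le> real_of_int \<lfloor>y 0 / T\<rfloor> + 1" by linarith+
      then have "real_of_int \<lfloor>y 0 / T\<rfloor> * T \<le> y 0" "y 0 \<le> real_of_int \<lfloor>y 0 / T\<rfloor> * T + T"
        using T by (simp_all add: field_simps pos_le_divide_eq del: of_int_floor_le)
      then show ?thesis using trans_adm[OF y, of 0 b] by (simp add: K_def trans_def b_def)
    qed
    then show ?thesis using x(2) act_trans[OF y q] by metis
  qed
  then show ?thesis using x(1) by (auto simp: minimal_def K_def)
qed

text \<open>The minimum over all translates that lie to the right on average is again minimal, and by
  construction comparable with each of its own translates; no strict twist is needed for this.\<close>

lemma ex_ordered_minimal: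
  assumes q: "q > 0" and W: "lo \<le> p * T / q" "p * T / q \<le> hi"
  shows "\<exists>x. minimal p q x \<and> (\<forall>a b n. 0 \<le> a * p + b * q \<longrightarrow> x n \<le> x (n + a) + real_of_int b * T)"
proof -
  obtain z where z: "minimal p q z" using ex_minimal[OF assms] by auto
  have zp: "z (n + k * q) = z n + k * p * T" for n k using z adm_period by (auto simp: minimal_def)
  define B where "B = (\<lambda>a::int. - ((a * p) div q))"
  define x where "x = (\<lambda>n. Min ((\<lambda>a. trans a (B a) z n) ` {0..<q}))"
  have mx: "minimal p q x" unfolding x_def
    using q by (intro minimal_Min minimal_trans[OF z]) auto
  have le: "x n \<le> z (n + a) + b * T" if ab: "0 \<le> a * p + b * q" for a b n
  proof -
    define a' where "a' = a mod q"
    define k where "k = a div q"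
    have a: "a = a' + k * q" by (simp add: a'_def k_def)
    have a'q: "a' \<in> {0..<q}" using q by (auto simp: a'_def)
    have "0 \<le> a' * p + (b + k * p) * q" using ab a by (simp add: algebra_simps)
    then have "- (b + k*p) * q \<le> a' * p" by (simp add: algebra_simps)
    then have "- (b + k*p) \<le> (a' * p) div q"
      using q by (metis nonzero_mult_div_cancel_right order_less_irrefl zdiv_mono1)
    then have Bb: "B a' \<le> b + k * p" by (simp add: B_def)
    have "x n \<le> trans a' (B a') z n" unfolding x_def using a'q by (intro Min_le) auto
    also have "\<dots> = z (n + a') + B a' * T" by (simp add: trans_def)
    also have "\<dots> \<le> z (n + a') + (b + k*p) * T"
    proof -
      have "real_of_int (B a') \<le> real_of_int (b + k*p)" using Bb by (subst of_int_le_iff)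
      then have "real_of_int (B a') * T \<le> real_of_int (b + k*p) * T" using T by (intro mult_right_mono) auto
      then show ?thesis by simp
    qed
    also have "\<dots> = z (n + a) + b * T" using zp[of "n + a'" k] by (simp add: a algebra_simps)
    finally show ?thesis .
  qed
  have "x n \<le> x (n + a) + b * T" if ab: "0 \<le> a * p + b * q" for a b n
  proof -
    have "x (n + a) \<in> (\<lambda>a'. trans a' (B a') z (n + a)) ` {0..<q}"
      unfolding x_def using q by (intro Min_in) auto
    then obtain a' where a': "a' \<in> {0..<q}" "x (n + a) = z (n + a + a') + B a' * T"
      by (auto simp: trans_def)
    have "0 \<le> a' * p + B a' * q"
    proof -
      have "(a' * p) div q * q \<le> a' * p" using q by (metis add.commute mult.commute mult_div_mod_eq pos_mod_sign le_add_same_cancel1)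
      then show ?thesis by (simp add: B_def)
    qed
    then have "0 \<le> (a + a') * p + (b + B a') * q" using ab by (simp add: algebra_simps)
    then have "x n \<le> z (n + (a + a')) + (b + B a') * T" by (metis le of_int_add)
    then show ?thesis using a' by (simp add: algebra_simps)
  qed
  then show ?thesis using mx by blast
qed


lemma minimal_compare:
  assumes x: "minimal p q x" and m: "0 \<le> m" "m \<le> q" and q: "q > 0"
    and out: "\<And>j. j \<le> 0 \<or> m \<le> j \<Longrightarrow> y j = x j"
    and st: "\<And>j. 0 \<le> j \<Longrightarrow> j < m \<Longrightarrow> lo \<le> y (j + 1) - y j \<and> y (j + 1) - y j \<le> hi"
  shows "(\<Sum>i\<in>{0..<m}. h (x i) (x (i + 1))) \<le> (\<Sum>i\<in>{0..<m}. h (y i) (y (i + 1)))"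
proof -
  define e where "e = (\<lambda>j. y (j mod q) + (j div q) * p * T)"
  have xa: "x \<in> adm p q" using x by (simp add: minimal_def)
  have yq: "y q = y 0 + p * T" using out[of 0] out[of q] m adm_period[OF xa, of 0 1] by simp
  have e: "e j = y j" if "0 \<le> j" "j \<le> q" for j
    using that yq q by (cases "j = q") (auto simp: e_def)
  have eper: "e (j + q) = e j + p * T" for j using q by (simp add: e_def algebra_simps)
  have eper': "e (j + k * q) = e j + k * p * T" for j k using q by (simp add: e_def algebra_simps)
  have st': "lo \<le> y (j + 1) - y j \<and> y (j + 1) - y j \<le> hi" if "0 \<le> j" for j
  proof (cases "j < m")
    case False then show ?thesis using out[of j] out[of "j+1"] xa by (auto simp: adm_def)
  qed (use st that in auto)
  have "e \<in> adm p q"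
  proof -
    have "lo \<le> e (n + 1) - e n \<and> e (n + 1) - e n \<le> hi" for n
    proof -
      have n: "n = n mod q + (n div q) * q" by simp
      have "e (n + 1) - e n = e (n mod q + 1) - e (n mod q)"
        using eper'[of "n mod q + 1" "n div q"] eper'[of "n mod q" "n div q"] n by (simp add: ac_simps)
      also have "\<dots> = y (n mod q + 1) - y (n mod q)"
        using q pos_mod_bound[OF q, of n] pos_mod_sign[OF q, of n] by (subst (1 2) e) auto
      finally show ?thesis using st'[of "n mod q"] q by simp
    qed
    then show ?thesis using eper by (auto simp: adm_def)
  qed
  then have "act q x \<le> act q e" using x by (auto simp: minimal_def)
  moreover have "act q z = (\<Sum>i\<in>{0..<m}. h (z i) (z (i + 1))) + (\<Sum>i\<in>{m..<q}. h (z i) (z (i + 1)))" for z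
    unfolding act_def using m by (subst sum.union_disjoint[symmetric]) (auto intro!: sum.cong)
  moreover have "(\<Sum>i\<in>{m..<q}. h (e i) (e (i + 1))) = (\<Sum>i\<in>{m..<q}. h (x i) (x (i + 1)))"
    using m out by (intro sum.cong refl) (auto simp: e)
  moreover have "(\<Sum>i\<in>{0..<m}. h (e i) (e (i + 1))) = (\<Sum>i\<in>{0..<m}. h (y i) (y (i + 1)))"
    using m by (intro sum.cong refl) (auto simp: e)
  ultimately show ?thesis by simp
qed

lemma ordered_displacement:
  assumes x: "minimal p q x" and q: "q > 0"
    and ord: "\<And>a b n. 0 \<le> a * p + b * q \<Longrightarrow> x n \<le> x (n + a) + real_of_int b * T"
  shows "\<bar>x (n + k) - x n - k * (p * T / q)\<bar> \<le> T"
proof -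
  have *: "x n - x (n + k) \<le> T - k * (p * T / q)" for n k
  proof -
    define b where "b = - ((k * p) div q)"
    have "(k * p) div q * q \<le> k * p"
      using q by (metis add.commute mult.commute mult_div_mod_eq pos_mod_sign le_add_same_cancel1)
    then have "0 \<le> k * p + b * q" by (simp add: b_def)
    then have 1: "x n \<le> x (n + k) + real_of_int b * T" by (rule ord)
    have "k * p < (k * p) div q * q + q"
      using q by (metis add.commute mult.commute mult_div_mod_eq pos_mod_bound add_less_cancel_left)
    then have "real_of_int (k * p) < real_of_int ((k * p) div q * q + q)" by (simp only: of_int_less_iff)
    then have "real_of_int b \<le> 1 - k * p / q" using q by (simp add: b_def field_simps)
    then have "real_of_int b * T \<le> (1 - k * p / q) * T" using T by (intro mult_right_mono) auto
    then show ?thesis using 1 by (simp add: algebra_simps)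
  qed
  show ?thesis using *[of n k] *[of "n + k" "- k"] by (simp add: abs_le_iff algebra_simps)
qed

lemma minimal_localised:
  fixes m :: int and \<kappa> \<mu> :: real and h0 s0 :: "real \<Rightarrow> real"
  assumes x: "minimal p q x" and m: "1 \<le> m" "m \<le> q"
    and ord: "\<And>a b n. 0 \<le> a * p + b * q \<Longrightarrow> x n \<le> x (n + a) + real_of_int b * T"
    and near: "\<And>x y. lo \<le> y - x \<Longrightarrow> y - x \<le> hi \<Longrightarrow> \<bar>h x y - h0 (y - x)\<bar> \<le> \<kappa>"
    and conv: "\<And>v w. v \<in> {lo..hi} \<Longrightarrow> w \<in> {lo..hi} \<Longrightarrow> h0 w + s0 w * (v - w) + \<mu> * (v - w)\<^sup>2 \<le> h0 v"
    and mu: "\<mu> > 0"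
  shows "\<bar>x (n + 1) - x n - p * T / q\<bar> \<le> T / m + sqrt (2 * m * \<kappa> / \<mu>)"
proof -
  have q: "q > 0" using m by auto
  have main: "\<bar>x 1 - x 0 - p * T / q\<bar> \<le> T / m + sqrt (2 * m * \<kappa> / \<mu>)"
    if x: "minimal p q x" and ord: "\<And>a b n. 0 \<le> a * p + b * q \<Longrightarrow> x n \<le> x (n + a) + real_of_int b * T" for x
  proof -
    have xa: "x \<in> adm p q" using x by (simp add: minimal_def)
    define v where "v = (\<lambda>i. x (i + 1) - x i)"
    have v: "v i \<in> {lo..hi}" for i using xa by (auto simp: adm_def v_def)
    define w where "w = (x m - x 0) / m"
    have tele: "(\<Sum>i\<in>{0..<j}. v i) = x j - x 0" if "0 \<le> j" for j
      using that
    proof (induction j rule: int_ge_induct)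
      case (step i)
      have "{0..<i+1} = insert i {0..<i}" using step by auto
      then show ?case using step by (simp add: v_def)
    qed simp
    have w: "w \<in> {lo..hi}"
    proof -
      have "(\<Sum>i\<in>{0..<m}. lo) \<le> (\<Sum>i\<in>{0..<m}. v i)" "(\<Sum>i\<in>{0..<m}. v i) \<le> (\<Sum>i\<in>{0..<m}. hi)"
        using v by (intro sum_mono; force)+
      then show ?thesis using m tele[of m] by (simp add: w_def field_simps)
    qed
    define y where "y = (\<lambda>j. if 0 \<le> j \<and> j \<le> m then x 0 + j * w else x j)"
    have ym: "x 0 + m * w = x m" using m by (simp add: w_def)
    have "(\<Sum>i\<in>{0..<m}. h (x i) (x (i + 1))) \<le> (\<Sum>i\<in>{0..<m}. h (y i) (y (i + 1)))"
    proof (rule minimal_compare[OF x])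
      show "y j = x j" if "j \<le> 0 \<or> m \<le> j" for j using that ym by (auto simp: y_def)
      show "lo \<le> y (j + 1) - y j \<and> y (j + 1) - y j \<le> hi" if "0 \<le> j" "j < m" for j
        using that w by (auto simp: y_def algebra_simps)
    qed (use m q in auto)
    moreover have "(\<Sum>i\<in>{0..<m}. h (y i) (y (i + 1))) \<le> (\<Sum>i\<in>{0..<m}. h0 w + \<kappa>)"
    proof (intro sum_mono)
      fix i assume i: "i \<in> {0..<m}"
      then have "y (i + 1) - y i = w" by (auto simp: y_def algebra_simps)
      then show "h (y i) (y (i + 1)) \<le> h0 w + \<kappa>" using near[of "y (i+1)" "y i"] w by auto
    qed
    moreover have "(\<Sum>i\<in>{0..<m}. h0 w + s0 w * (v i - w) + \<mu> * (v i - w)\<^sup>2 - \<kappa>) \<le> (\<Sum>i\<in>{0..<m}. h (x i) (x (i + 1)))"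
    proof (intro sum_mono)
      fix i
      show "h0 w + s0 w * (v i - w) + \<mu> * (v i - w)\<^sup>2 - \<kappa> \<le> h (x i) (x (i + 1))"
        using near[of "x (i+1)" "x i"] conv[OF v[of i] w] v[of i] by (auto simp: v_def)
    qed
    moreover have "(\<Sum>i\<in>{0..<m}. h0 w + s0 w * (v i - w) + \<mu> * (v i - w)\<^sup>2 - \<kappa>)
        = m * h0 w + \<mu> * (\<Sum>i\<in>{0..<m}. (v i - w)\<^sup>2) - m * \<kappa>"
    proof -
      have "(\<Sum>i\<in>{0..<m}. v i - w) = 0" using m tele[of m] by (simp add: sum_subtractf w_def)
      then have "(\<Sum>i\<in>{0..<m}. s0 w * (v i - w)) = 0" by (simp add: sum_distrib_left[symmetric])
      then show ?thesis using m by (simp add: sum.distrib sum_subtractf sum_distrib_left[symmetric])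
    qed
    moreover have "(\<Sum>i\<in>{0..<m}. h0 w + \<kappa>) = m * h0 w + m * \<kappa>" using m by (simp add: algebra_simps)
    ultimately have "\<mu> * (\<Sum>i\<in>{0..<m}. (v i - w)\<^sup>2) \<le> 2 * m * \<kappa>" by linarith
    moreover have "(v 0 - w)\<^sup>2 \<le> (\<Sum>i\<in>{0..<m}. (v i - w)\<^sup>2)"
      using m by (intro member_le_sum) auto
    ultimately have "\<mu> * (v 0 - w)\<^sup>2 \<le> 2 * m * \<kappa>" using mu
      by (meson order_trans mult_left_mono less_imp_le)
    then have "(v 0 - w)\<^sup>2 \<le> 2 * m * \<kappa> / \<mu>" using mu by (simp add: field_simps)
    then have "\<bar>v 0 - w\<bar> \<le> sqrt (2 * m * \<kappa> / \<mu>)" by (metis real_sqrt_abs real_sqrt_le_iff)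
    moreover have "\<bar>w - p * T / q\<bar> \<le> T / m"
    proof -
      have "m * (w - p * T / q) = x (0 + m) - x 0 - m * (p * T / q)"
        using m ym by (simp add: algebra_simps)
      then have "\<bar>m * (w - p * T / q)\<bar> \<le> T"
        using ordered_displacement[OF x q ord, of 0 m] by simp
      then have "m * \<bar>w - p * T / q\<bar> \<le> T" using m by (simp add: abs_mult)
      then show ?thesis using m by (simp add: field_simps)
    qed
    ultimately show ?thesis by (simp add: v_def)
  qed
  have "\<bar>trans n 0 x 1 - trans n 0 x 0 - p * T / q\<bar> \<le> T / m + sqrt (2 * m * \<kappa> / \<mu>)"
  proof (rule main[OF minimal_trans[OF x q]])
    fix a b k assume "0 \<le> a * p + b * q"
    then show "trans n 0 x k \<le> trans n 0 x (k + a) + real_of_int b * T"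
      using ord[of a b "k + n"] by (simp add: trans_def ac_simps)
  qed
  then show ?thesis by (simp add: trans_def add.commute)
qed

lemma minimal_stationary:
  assumes x: "minimal p q x" and q: "2 \<le> q"
    and int: "\<And>n. lo < x (n + 1) - x n \<and> x (n + 1) - x n < hi"
    and d2: "\<And>x y. lo < y - x \<Longrightarrow> y - x < hi \<Longrightarrow> (h x has_real_derivative - e1 x y) (at y)"
    and d1: "\<And>x y. lo < y - x \<Longrightarrow> y - x < hi \<Longrightarrow> ((\<lambda>s. h s y) has_real_derivative e0 x y) (at x)"
  shows "e1 (x (n - 1)) (x n) = e0 (x n) (x (n + 1))"
proof -
  define z where "z = trans (n - 1) 0 x"
  have z: "minimal p q z" using minimal_trans[OF x] q by (auto simp: z_def)
  have zi: "lo < z (n + 1) - z n \<and> z (n + 1) - z n < hi" for n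
    using int[of "n + (k - 1)" for k] int by (auto simp: z_def trans_def ac_simps)
  define f where "f = (\<lambda>s. h (z 0) s + h s (z 2))"
  have b: "lo < z 1 - z 0" "z 1 - z 0 < hi" "lo < z 2 - z 1" "z 2 - z 1 < hi"
    using zi[of 0] zi[of 1] by auto
  have D: "(f has_real_derivative (- e1 (z 0) (z 1) + e0 (z 1) (z 2))) (at (z 1))"
    unfolding f_def using b by (intro DERIV_add d1 d2) auto
  define d where "d = Min {z 1 - z 0 - lo, hi - (z 1 - z 0), z 2 - z 1 - lo, hi - (z 2 - z 1)}"
  have d: "d > 0" "d \<le> z 1 - z 0 - lo" "d \<le> hi - (z 1 - z 0)" "d \<le> z 2 - z 1 - lo" "d \<le> hi - (z 2 - z 1)"
    using b by (auto simp: d_def)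
  have "f (z 1) \<le> f s" if s: "\<bar>z 1 - s\<bar> < d" for s
  proof -
    have "(\<Sum>i\<in>{0..<2}. h (z i) (z (i + 1))) \<le> (\<Sum>i\<in>{0..<2}. h ((z(1:=s)) i) ((z(1:=s)) (i + 1)))"
    proof (rule minimal_compare[OF z])
      show "lo \<le> (z(1 := s)) (j + 1) - (z(1 := s)) j \<and> (z(1 := s)) (j + 1) - (z(1 := s)) j \<le> hi"
        if "0 \<le> j" "j < 2" for j
      proof -
        have "j = 0 \<or> j = 1" using that by auto
        then show ?thesis using s d by (auto simp: abs_less_iff)
      qed
    qed (use q in auto)
    moreover have "{0..<2::int} = {0, 1}" by auto
    ultimately show ?thesis by (simp add: f_def)
  qed
  then have "- e1 (z 0) (z 1) + e0 (z 1) (z 2) = 0"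
    using DERIV_local_min[OF D d(1)] by auto
  then show ?thesis by (simp add: z_def trans_def add.commute)
qed

end

section \<open>Differential inequalities and equations\<close>

lemma diff_ge_of_deriv_ge:
  fixes u :: "real \<Rightarrow> real"
  assumes "a \<le> b" and "\<And>t. t \<in> {a..b} \<Longrightarrow> (u has_real_derivative u' t) (at t within {a..b})"
    and "\<And>t. t \<in> {a..b} \<Longrightarrow> m \<le> u' t"
  shows "m * (b - a) \<le> u b - u a"
proof -
  have "(u' has_integral (u b - u a)) {a..b}"
    using assms by (intro fundamental_theorem_of_calculus)
      (auto simp: has_real_derivative_iff_has_vector_derivative)
  moreover have "((\<lambda>_. m) has_integral (m * (b - a))) {a..b}"
    using has_integral_const_real[of m a b] assms by (simp add: mult.commute)
  ultimately show ?thesis using assms(3) by (auto intro: has_integral_le)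
qed

lemma diff_le_of_deriv_le:
  fixes u :: "real \<Rightarrow> real"
  assumes "a \<le> b" and "\<And>t. t \<in> {a..b} \<Longrightarrow> (u has_real_derivative u' t) (at t within {a..b})"
    and "\<And>t. t \<in> {a..b} \<Longrightarrow> u' t \<le> m"
  shows "u b - u a \<le> m * (b - a)"
proof -
  have "(- m) * (b - a) \<le> - u b - - u a"
    using assms by (intro diff_ge_of_deriv_ge[of a b "\<lambda>t. - u t" "\<lambda>t. - u' t"] DERIV_minus) auto
  then show ?thesis by simp
qed

lemma gronwall_norm:
  fixes d d' :: "real \<Rightarrow> 'a::real_inner"
  assumes der: "\<And>t. t \<in> {0..T} \<Longrightarrow> (d has_vector_derivative d' t) (at t within {0..T})"
    and bd: "\<And>t. t \<in> {0..T} \<Longrightarrow> norm (d' t) \<le> L * norm (d t) + K"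
    and K: "0 \<le> K" and L: "0 \<le> L" and t: "t \<in> {0..T}"
  shows "norm (d t) \<le> exp ((L + 1) * t) * (norm (d 0) + K)"
proof -
  define u where "u = (\<lambda>t. exp (- (2 * L + 1) * t) * (d t \<bullet> d t + K\<^sup>2))"
  have T: "0 \<le> T" using t by auto
  have u': "(u has_real_derivative exp (- (2 * L + 1) * s) * (2 * (d s \<bullet> d' s) - (2 * L + 1) * (d s \<bullet> d s + K\<^sup>2)))
      (at s within {0..T})" if "s \<in> {0..T}" for s
  proof -
    have "((\<lambda>t. d t \<bullet> d t) has_real_derivative 2 * (d s \<bullet> d' s)) (at s within {0..T})"
      unfolding has_field_derivative_def
      by (rule has_derivative_eq_rhs[OF has_derivative_inner[OF der[OF that, unfolded has_vector_derivative_def]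
              der[OF that, unfolded has_vector_derivative_def]]])
        (auto simp: fun_eq_iff inner_commute)
    then show ?thesis unfolding u_def by (auto intro!: derivative_eq_intros simp: algebra_simps)
  qed
  have neg: "exp (- (2 * L + 1) * s) * (2 * (d s \<bullet> d' s) - (2 * L + 1) * (d s \<bullet> d s + K\<^sup>2)) \<le> 0"
    if "s \<in> {0..T}" for s
  proof -
    have "d s \<bullet> d' s \<le> norm (d s) * (L * norm (d s) + K)"
      using norm_cauchy_schwarz[of "d s" "d' s"] mult_left_mono[OF bd[OF that], of "norm (d s)"] by simp
    moreover have "2 * norm (d s) * K \<le> norm (d s)^2 + K^2" using sum_squares_bound[of "norm (d s)" K] by simp
    ultimately have "2 * (d s \<bullet> d' s) \<le> (2 * L + 1) * (d s \<bullet> d s) + K\<^sup>2"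
      by (simp add: dot_square_norm power2_eq_square algebra_simps)
    moreover have "K\<^sup>2 \<le> (2 * L + 1) * K\<^sup>2" using L by (simp add: algebra_simps)
    ultimately show ?thesis by (intro mult_nonneg_nonpos) (auto simp: algebra_simps)
  qed
  have "u t \<le> u 0"
  proof -
    have "u t - u 0 \<le> 0 * (t - 0)"
      using t neg by (intro diff_le_of_deriv_le[OF _ DERIV_subset[OF u']]) auto
    then show ?thesis by simp
  qed
  have "d t \<bullet> d t + K\<^sup>2 \<le> exp ((2 * L + 1) * t) * (d 0 \<bullet> d 0 + K\<^sup>2)"
  proof -
    have e: "exp ((2 * L + 1) * t) * exp (- (2 * L + 1) * t) = 1" by (simp only: exp_add[symmetric]) (simp add: algebra_simps)
    have "exp ((2 * L + 1) * t) * u t \<le> exp ((2 * L + 1) * t) * u 0"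
      using \<open>u t \<le> u 0\<close> by (intro mult_left_mono) auto
    then have "exp ((2 * L + 1) * t) * exp (- (2 * L + 1) * t) * (d t \<bullet> d t + K\<^sup>2)
        \<le> exp ((2 * L + 1) * t) * (d 0 \<bullet> d 0 + K\<^sup>2)" by (simp add: u_def mult.assoc)
    then show ?thesis by (simp only: e mult_1)
  qed
  moreover have "d 0 \<bullet> d 0 + K\<^sup>2 \<le> (norm (d 0) + K)\<^sup>2"
    using K by (simp add: dot_square_norm power2_sum)
  moreover have "exp ((2 * L + 1) * t) \<le> (exp ((L + 1) * t))\<^sup>2"
    using t by (simp add: exp_double[symmetric] algebra_simps)
  ultimately have "(norm (d t))\<^sup>2 \<le> (exp ((L + 1) * t))\<^sup>2 * (norm (d 0) + K)\<^sup>2"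
  proof -
    assume 1: "d t \<bullet> d t + K\<^sup>2 \<le> exp ((2 * L + 1) * t) * (d 0 \<bullet> d 0 + K\<^sup>2)"
      and 2: "d 0 \<bullet> d 0 + K\<^sup>2 \<le> (norm (d 0) + K)\<^sup>2"
      and 3: "exp ((2 * L + 1) * t) \<le> (exp ((L + 1) * t))\<^sup>2"
    have "(norm (d t))\<^sup>2 \<le> d t \<bullet> d t + K\<^sup>2" by (simp add: dot_square_norm)
    also note 1
    also have "exp ((2 * L + 1) * t) * (d 0 \<bullet> d 0 + K\<^sup>2) \<le> (exp ((L + 1) * t))\<^sup>2 * (norm (d 0) + K)\<^sup>2"
      by (intro mult_mono 2 3) auto
    finally show ?thesis .
  qed
  then have "(norm (d t))\<^sup>2 \<le> (exp ((L + 1) * t) * (norm (d 0) + K))\<^sup>2" by (simp add: power_mult_distrib)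
  then show ?thesis by (rule power2_le_imp_le) (use K in simp)
qed

lemma gronwall_norm_backward:
  fixes d d' :: "real \<Rightarrow> 'a::real_inner"
  assumes der: "\<And>t. t \<in> {0..T} \<Longrightarrow> (d has_vector_derivative d' t) (at t within {0..T})"
    and bd: "\<And>t. t \<in> {0..T} \<Longrightarrow> norm (d' t) \<le> L * norm (d t) + K"
    and K: "0 \<le> K" and L: "0 \<le> L" and t: "t \<in> {0..T}"
  shows "norm (d 0) \<le> exp ((L + 1) * t) * (norm (d t) + K)"
proof -
  have "norm ((\<lambda>s. d (t - s)) t) \<le> exp ((L + 1) * t) * (norm ((\<lambda>s. d (t - s)) 0) + K)"
  proof (rule gronwall_norm[where T=t and d'="\<lambda>s. - d' (t - s)"])
    fix s assume s: "s \<in> {0..t}"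
    have "(d has_vector_derivative d' (t - s)) (at (t - s) within (\<lambda>s. t - s) ` {0..t})"
      using der[of "t - s"] s t by (auto intro!: has_vector_derivative_within_subset[OF der])
    moreover have "((\<lambda>s. t - s) has_vector_derivative -1) (at s within {0..t})"
      by (auto intro!: derivative_eq_intros)
    ultimately show "((\<lambda>s. d (t - s)) has_vector_derivative - d' (t - s)) (at s within {0..t})"
      using vector_diff_chain_within[of "\<lambda>s. t - s" "-1" s "{0..t}" d] by (simp add: o_def)
    show "norm (- d' (t - s)) \<le> L * norm (d (t - s)) + K" using bd[of "t - s"] s t by auto
  qed (use K L t in auto)
  then show ?thesis by simp
qed

text \<open>Picard iteration in the norm weighted by \<open>exp (- 2 L t)\<close>, in which it contracts on the
  whole half line.\<close>

lemma ode_exists: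
  fixes G :: "real \<Rightarrow> 'a::euclidean_space \<Rightarrow> 'a"
  assumes cont: "continuous_on ({0..} \<times> UNIV) (\<lambda>(t, x). G t x)"
    and lip: "\<And>t x y. 0 \<le> t \<Longrightarrow> norm (G t x - G t y) \<le> L * norm (x - y)"
    and bd: "\<And>t x. 0 \<le> t \<Longrightarrow> norm (G t x) \<le> B"
    and L: "L > 0"
  shows "\<exists>\<xi>. \<xi> 0 = x0 \<and> (\<forall>t\<ge>0. (\<xi> has_vector_derivative G t (\<xi> t)) (at t within {0..}))"
proof -
  define E where "E = (\<lambda>s. exp (2 * L * s))"
  define g where "g = (\<lambda>(b::real \<Rightarrow>\<^sub>C 'a) s. G s (x0 + E s *\<^sub>R apply_bcontfun b s))"
  define J where "J = (\<lambda>b t. integral {0..t} (g b))"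
  define \<Phi> where "\<Phi> = (\<lambda>b t. (1 / E (max 0 t)) *\<^sub>R J b (max 0 t))"
  have Epos: "E s > 0" for s by (simp add: E_def)
  have B: "B \<ge> 0" using bd[of 0 0] norm_ge_zero order_trans by blast
  have cg: "continuous_on {0..} (g b)" for b
  proof -
    have "continuous_on {0..} (\<lambda>s. (s, x0 + E s *\<^sub>R apply_bcontfun b s))"
      unfolding E_def by (intro continuous_intros continuous_on_subset[OF continuous_on_apply_bcontfun]) auto
    then show ?thesis unfolding g_def
      using continuous_on_compose2[OF cont, of "{0..}" "\<lambda>s. (s, x0 + E s *\<^sub>R apply_bcontfun b s)"] by auto
  qed
  have cgt: "continuous_on {0..t} (g b)" for b t by (rule continuous_on_subset[OF cg]) auto
  have int: "g b integrable_on {0..t}" for b t by (rule integrable_continuous_real[OF cgt])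
  have Jder: "(J b has_vector_derivative g b t) (at t within {0..})" if "t \<ge> 0" for b t
  proof -
    have "(J b has_vector_derivative g b t) (at t within {0..t+1})"
      unfolding J_def using that by (intro integral_has_vector_derivative[OF cgt]) auto
    moreover have "at t within {0..t+1} = at t within {0..}"
      using that by (intro at_within_nhd[where S="{..<t+1}"]) auto
    ultimately show ?thesis by simp
  qed
  have Jc: "continuous_on {0..} (J b)" for b
    using Jder by (auto intro!: continuous_on_vector_derivative)
  have Jb: "norm (J b t) \<le> B * t" if "t \<ge> 0" for b t
  proof -
    have "norm (integral {0..t} (g b)) \<le> B * (t - 0)"
      using that bd by (intro integral_bound cgt) (auto simp: g_def)
    then show ?thesis by (simp add: J_def)
  qed
  have \<Phi>b: "\<Phi> b \<in> bcontfun" for b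
  proof -
    have "continuous_on UNIV (\<lambda>t. J b (max 0 t))"
      by (rule continuous_on_compose2[OF Jc]) (auto intro!: continuous_intros)
    then have "continuous_on UNIV (\<Phi> b)"
      unfolding \<Phi>_def E_def by (intro continuous_intros) auto
    moreover have "norm (\<Phi> b t) \<le> B / (2 * L)" for t
    proof -
      define s where "s = max 0 t"
      have s: "s \<ge> 0" by (auto simp: s_def)
      have "2 * L * s \<le> E s" unfolding E_def using exp_ge_add_one_self[of "2 * L * s"] by linarith
      then have "B * (2 * L * s) \<le> B * E s" using B by (intro mult_left_mono)
      then have "B * s \<le> E s * (B / (2 * L))" using L by (simp add: field_simps)
      then have "norm (J b s) \<le> E s * (B / (2 * L))" using Jb[OF s] by (rule order_trans[rotated])
      then show ?thesis using Epos[of s] by (simp add: \<Phi>_def s_def[symmetric] field_simps)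
    qed
    ultimately show ?thesis by (auto simp: bcontfun_def bounded_iff)
  qed
  have contr: "dist (Bcontfun (\<Phi> a)) (Bcontfun (\<Phi> b)) \<le> (1/2) * dist a b" for a b
  proof (rule dist_bound)
    fix t :: real
    define s where "s = max 0 t"
    have s: "s \<ge> 0" by (auto simp: s_def)
    have "norm (integral {0..s} (\<lambda>r. g a r - g b r)) \<le> integral {0..s} (\<lambda>r. L * E r * dist a b)"
    proof (rule integral_norm_bound_integral)
      show "(\<lambda>r. g a r - g b r) integrable_on {0..s}" by (intro integrable_diff int)
      show "(\<lambda>r. L * E r * dist a b) integrable_on {0..s}"
        unfolding E_def by (intro integrable_continuous_real continuous_intros)
      fix r assume r: "r \<in> {0..s}"
      have "norm (g a r - g b r) \<le> L * norm (E r *\<^sub>R apply_bcontfun a r - E r *\<^sub>R apply_bcontfun b r)"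
        unfolding g_def using lip[of r] r by (metis (no_types, lifting) add_diff_cancel_left atLeastAtMost_iff)
      also have "\<dots> = L * E r * dist (apply_bcontfun a r) (apply_bcontfun b r)"
        using Epos[of r] by (simp add: scaleR_diff_right[symmetric] dist_norm)
      also have "\<dots> \<le> L * E r * dist a b"
        using L Epos[of r] by (intro mult_left_mono dist_bounded) auto
      finally show "norm (g a r - g b r) \<le> L * E r * dist a b" .
    qed
    also have "integral {0..s} (\<lambda>r. L * E r * dist a b) = (E s / 2 - 1 / 2) * dist a b"
    proof -
      have "((\<lambda>r. L * E r * dist a b) has_integral (E s / 2 * dist a b - E 0 / 2 * dist a b)) {0..s}"
        unfolding E_def using s
        by (intro fundamental_theorem_of_calculus)
          (auto intro!: derivative_eq_intros simp: has_real_derivative_iff_has_vector_derivative[symmetric])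
      then show ?thesis by (subst integral_unique[of _ "E s / 2 * dist a b - E 0 / 2 * dist a b"]) (auto simp: E_def algebra_simps)
    qed
    also have "\<dots> \<le> E s / 2 * dist a b" by (simp add: algebra_simps)
    finally have "norm (J a s - J b s) \<le> E s / 2 * dist a b"
      unfolding J_def using int by (simp add: integral_diff)
    then have "norm (J a s - J b s) / E s \<le> 1/2 * dist a b" using Epos[of s] by (simp add: field_simps)
    moreover have "norm ((1 / E s) *\<^sub>R (J a s - J b s)) = norm (J a s - J b s) / E s"
      unfolding norm_scaleR using Epos[of s] by simp
    ultimately have "norm ((1 / E s) *\<^sub>R (J a s - J b s)) \<le> 1/2 * dist a b"
      by (simp only:)
    then show "dist (apply_bcontfun (Bcontfun (\<Phi> a)) t) (apply_bcontfun (Bcontfun (\<Phi> b)) t) \<le> 1/2 * dist a b"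
      using \<Phi>b by (simp add: Bcontfun_inverse \<Phi>_def s_def[symmetric] dist_norm scaleR_diff_right)
  qed
  have "\<exists>!b. Bcontfun (\<Phi> b) = b"
    by (rule banach_fix_type[where c="1/2"]) (use contr in auto)
  then obtain b where b: "Bcontfun (\<Phi> b) = b" by auto
  then have bfix: "apply_bcontfun b t = \<Phi> b t" for t using \<Phi>b by (metis Bcontfun_inverse)
  have eq: "x0 + E t *\<^sub>R apply_bcontfun b t = x0 + J b t" if "t \<ge> 0" for t
    using that Epos[of t] by (simp add: bfix \<Phi>_def)
  have "((\<lambda>t. x0 + J b t) has_vector_derivative G t (x0 + J b t)) (at t within {0..})" if "t \<ge> 0" for t
    using has_vector_derivative_add[OF has_vector_derivative_const Jder[OF that, of b], of x0]
    by (simp add: g_def eq[OF that])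
  moreover have "x0 + J b 0 = x0" by (simp add: J_def)
  ultimately show ?thesis by (intro exI[of _ "\<lambda>t. x0 + J b t"]) auto
qed

section \<open>Periodic orbits through a twist section\<close>

locale reversible_field =
  fixes V :: "real \<Rightarrow> complex \<Rightarrow> complex" and H :: "real \<Rightarrow> complex \<Rightarrow> real" and r0 \<kappa>1 d L :: real
  assumes pos: "\<kappa>1 > 0" "d > 0" "L > 0"
    and V_bound: "\<And>\<rho> x. \<bar>\<rho> - r0\<bar> \<le> \<kappa>1 \<Longrightarrow> cmod x \<le> d \<Longrightarrow> cmod (V \<rho> x) \<le> L"
    and V_lip: "\<And>\<rho> x y. \<bar>\<rho> - r0\<bar> \<le> \<kappa>1 \<Longrightarrow> cmod x \<le> d \<Longrightarrow> cmod y \<le> d \<Longrightarrow>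
      cmod (V \<rho> x - V \<rho> y) \<le> L * cmod (x - y)"
    and V_param: "\<And>\<rho> \<sigma> x. \<bar>\<rho> - r0\<bar> \<le> \<kappa>1 \<Longrightarrow> \<bar>\<sigma> - r0\<bar> \<le> \<kappa>1 \<Longrightarrow> cmod x \<le> d \<Longrightarrow>
      cmod (V \<rho> x - V \<sigma> x) \<le> L * \<bar>\<rho> - \<sigma>\<bar>"
    and V_rev: "\<And>\<rho> x. V \<rho> (cnj x) = - cnj (V \<rho> x)"
    and H_rev: "\<And>\<rho> x. H \<rho> (cnj x) = H \<rho> x"
    and H_grad: "\<And>\<rho> x y. \<bar>\<rho> - r0\<bar> \<le> \<kappa>1 \<Longrightarrow> cmod x \<le> d \<Longrightarrow> cmod y \<le> d \<Longrightarrow>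
      \<bar>H \<rho> y - H \<rho> x - Im (cnj (V \<rho> x) * (y - x))\<bar> \<le> L * (cmod (y - x))\<^sup>2"
    and H_param: "\<And>\<rho> \<sigma> x. \<bar>\<rho> - r0\<bar> \<le> \<kappa>1 \<Longrightarrow> \<bar>\<sigma> - r0\<bar> \<le> \<kappa>1 \<Longrightarrow> cmod x \<le> d \<Longrightarrow>
      \<bar>H \<rho> x - H \<sigma> x\<bar> \<le> L * \<bar>\<rho> - \<sigma>\<bar>"
begin

definition proj :: "complex \<Rightarrow> complex" where "proj = closest_point (cball 0 d)"

lemma proj_id [simp]: "cmod x \<le> d \<Longrightarrow> proj x = x"
  by (simp add: proj_def closest_point_self)

lemma proj_le: "cmod (proj x) \<le> d"
  using closest_point_in_set[of "cball 0 d" x] pos by (simp add: proj_def)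

lemma proj_lip: "cmod (proj x - proj y) \<le> cmod (x - y)"
  using closest_point_lipschitz[of "cball 0 d" x y] pos by (simp add: proj_def dist_norm)

definition path_near :: "real \<Rightarrow> (real \<Rightarrow> real) \<Rightarrow> bool" where
  "path_near \<kappa> r \<longleftrightarrow> continuous_on UNIV r \<and> (\<forall>t. \<bar>r t - r0\<bar> \<le> \<kappa>)"

lemma path_nearD: "path_near \<kappa> r \<Longrightarrow> \<bar>r t - r0\<bar> \<le> \<kappa>"
  by (simp add: path_near_def)

lemma path_near_mono: "path_near \<kappa> r \<Longrightarrow> \<kappa> \<le> \<kappa>' \<Longrightarrow> path_near \<kappa>' r"
  unfolding path_near_def by (meson order_trans)

lemma path_near_const: "0 \<le> \<kappa> \<Longrightarrow> path_near \<kappa> (\<lambda>_. r0)"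
  by (simp add: path_near_def)

lemma path_near_shift: "path_near \<kappa> r \<Longrightarrow> path_near \<kappa> (\<lambda>s. r (t + s))"
  by (auto simp: path_near_def intro!: continuous_on_compose2[of UNIV r] continuous_intros)

lemma path_near_reflect: "path_near \<kappa> r \<Longrightarrow> path_near \<kappa> (\<lambda>s. r (t - s))"
  by (auto simp: path_near_def intro!: continuous_on_compose2[of UNIV r] continuous_intros)

definition orb :: "(real \<Rightarrow> real) \<Rightarrow> complex \<Rightarrow> real \<Rightarrow> complex" where
  "orb r x = (SOME \<xi>. \<xi> 0 = x \<and> (\<forall>t\<ge>0. (\<xi> has_vector_derivative V (r t) (proj (\<xi> t))) (at t within {0..})))"

lemma V_proj_lip: "\<bar>\<rho> - r0\<bar> \<le> \<kappa>1 \<Longrightarrow> cmod (V \<rho> (proj x) - V \<rho> (proj y)) \<le> L * cmod (x - y)"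
  using V_lip[of \<rho> "proj x" "proj y"] proj_le[of x] proj_le[of y] proj_lip[of x y] pos
  by (meson mult_left_mono order_trans less_imp_le)

lemma continuous_V_proj:
  assumes r: "path_near \<kappa>1 r"
  shows "continuous_on UNIV (\<lambda>(t, x). V (r t) (proj x))"
  unfolding continuous_on_iff
proof (intro ballI allI impI)
  fix z :: "real \<times> complex" and e :: real assume e: "e > 0"
  obtain t x where z: "z = (t, x)" by (cases z)
  have "continuous (at t) r" using r by (auto simp: path_near_def continuous_on_eq_continuous_at)
  then obtain \<delta> where \<delta>: "\<delta> > 0" "\<And>s. dist s t < \<delta> \<Longrightarrow> dist (r s) (r t) < e / (2 * L)"
    using e pos unfolding continuous_at by (metis LIM_def dist_self divide_pos_pos mult_pos_pos zero_less_numeral)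
  have "dist (V (r s) (proj y)) (V (r t) (proj x)) < e" if "dist (s, y) (t, x) < min \<delta> (e / (2 * L))" for s y
  proof -
    have "dist s t < \<delta>" using that dist_fst_le[of "(s,y)" "(t,x)"] by simp
    then have "\<bar>r s - r t\<bar> < e / (2 * L)" using \<delta>(2) by (simp add: dist_real_def)
    then have 1: "L * \<bar>r s - r t\<bar> < e / 2" using pos by (simp add: field_simps)
    have "dist y x < e / (2 * L)" using that dist_snd_le[of "(s,y)" "(t,x)"] by simp
    then have 2: "L * cmod (y - x) < e / 2" using pos by (simp add: dist_norm field_simps)
    have "dist (V (r s) (proj y)) (V (r t) (proj x)) \<le> cmod (V (r s) (proj y) - V (r t) (proj y)) + cmod (V (r t) (proj y) - V (r t) (proj x))"
      unfolding dist_norm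
      using norm_triangle_ineq[of "V (r s) (proj y) - V (r t) (proj y)" "V (r t) (proj y) - V (r t) (proj x)"] by simp
    also have "\<dots> \<le> L * \<bar>r s - r t\<bar> + L * cmod (y - x)"
      using r by (intro add_mono V_param V_proj_lip proj_le) (auto dest: path_nearD)
    finally show ?thesis using 1 2 by linarith
  qed
  then show "\<exists>\<delta>>0. \<forall>z'\<in>UNIV. dist z' z < \<delta> \<longrightarrow> dist (case z' of (t, x) \<Rightarrow> V (r t) (proj x)) (case z of (t, x) \<Rightarrow> V (r t) (proj x)) < e"
    using \<delta>(1) e pos z by (intro exI[of _ "min \<delta> (e / (2 * L))"]) auto
qed

lemma orb_spec:
  assumes r: "path_near \<kappa>1 r"
  shows "orb r x 0 = x" "t \<ge> 0 \<Longrightarrow> (orb r x has_vector_derivative V (r t) (proj (orb r x t))) (at t within {0..})"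
proof -
  have "\<exists>\<xi>. \<xi> 0 = x \<and> (\<forall>t\<ge>0. (\<xi> has_vector_derivative V (r t) (proj (\<xi> t))) (at t within {0..}))"
    using r pos by (intro ode_exists[where L=L and B=L] continuous_on_subset[OF continuous_V_proj] V_proj_lip V_bound proj_le)
      (auto dest: path_nearD)
  from someI_ex[OF this] show "orb r x 0 = x"
    "t \<ge> 0 \<Longrightarrow> (orb r x has_vector_derivative V (r t) (proj (orb r x t))) (at t within {0..})"
    by (auto simp: orb_def)
qed

lemma orb_deriv_Icc:
  assumes "path_near \<kappa>1 r" "t \<in> {0..v}"
  shows "(orb r x has_vector_derivative V (r t) (proj (orb r x t))) (at t within {0..v})"
  using assms by (intro has_vector_derivative_within_subset[OF orb_spec(2)]) auto

lemma orb_deriv_at: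
  assumes "path_near \<kappa>1 r" "t > 0"
  shows "(orb r x has_vector_derivative V (r t) (proj (orb r x t))) (at t)"
proof -
  have "at t within {0..} = at t" using assms by (intro at_within_open_subset[of t "{0<..}"]) auto
  then show ?thesis using orb_spec(2)[OF assms(1), of t x] assms(2) by simp
qed

definition growth :: "real \<Rightarrow> real" where "growth v = exp ((L + 1) * v)"

lemma growth_pos: "growth v > 0" by (simp add: growth_def)

lemma growth_mono: "u \<le> v \<Longrightarrow> growth u \<le> growth v"
  using pos by (simp add: growth_def)

lemma sol_compare:
  assumes r: "path_near \<kappa>1 r" and s: "path_near \<kappa>1 s"
    and x: "\<And>t. t \<in> {0..v} \<Longrightarrow> (x has_vector_derivative V (r t) (proj (x t))) (at t within {0..v})"
    and y: "\<And>t. t \<in> {0..v} \<Longrightarrow> (y has_vector_derivative V (s t) (proj (y t))) (at t within {0..v})"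
    and k: "\<And>t. t \<in> {0..v} \<Longrightarrow> \<bar>r t - s t\<bar> \<le> \<kappa>" "0 \<le> \<kappa>" and t: "t \<in> {0..v}"
  shows "cmod (x t - y t) \<le> growth t * (cmod (x 0 - y 0) + L * \<kappa>)"
  unfolding growth_def
proof (rule gronwall_norm[OF has_vector_derivative_diff[OF x y] _ _ _ t])
  fix t assume t: "t \<in> {0..v}"
  have "cmod (V (r t) (proj (x t)) - V (s t) (proj (y t)))
      \<le> cmod (V (r t) (proj (x t)) - V (r t) (proj (y t))) + cmod (V (r t) (proj (y t)) - V (s t) (proj (y t)))"
    using norm_triangle_ineq[of "V (r t) (proj (x t)) - V (r t) (proj (y t))" "V (r t) (proj (y t)) - V (s t) (proj (y t))"] by simp
  also have "\<dots> \<le> L * cmod (x t - y t) + L * \<kappa>"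
    using r s k(1)[OF t] pos
    by (intro add_mono V_proj_lip order_trans[OF V_param] proj_le mult_left_mono) (auto dest: path_nearD)
  finally show "cmod (V (r t) (proj (x t)) - V (s t) (proj (y t))) \<le> L * cmod (x t - y t) + L * \<kappa>" .
qed (use pos k in auto)

lemma orb_compare:
  assumes "path_near \<kappa>1 r" "path_near \<kappa>1 s" "\<And>t. t \<in> {0..v} \<Longrightarrow> \<bar>r t - s t\<bar> \<le> \<kappa>" "0 \<le> \<kappa>" "0 \<le> v"
  shows "cmod (orb r x v - orb s y v) \<le> growth v * (cmod (x - y) + L * \<kappa>)"
  using sol_compare[OF assms(1,2) orb_deriv_Icc[OF assms(1)] orb_deriv_Icc[OF assms(2)] assms(3,4), of v v x y] assms
  by (simp add: orb_spec(1))

lemma orb_lip: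
  assumes "path_near \<kappa>1 r" "0 \<le> v"
  shows "cmod (orb r x v - orb r y v) \<le> growth v * cmod (x - y)"
  using orb_compare[OF assms(1,1) _ _ assms(2), of 0 x y] by simp

lemma orb_unique:
  assumes r: "path_near \<kappa>1 r"
    and x: "\<And>t. t \<in> {0..v} \<Longrightarrow> (x has_vector_derivative V (r t) (proj (x t))) (at t within {0..v})"
    and t: "t \<in> {0..v}"
  shows "x t = orb r (x 0) t"
  using sol_compare[OF r r x orb_deriv_Icc[OF r] _ _ t, of 0 "x 0"] by (simp add: orb_spec(1)[OF r])

lemma orb_semiflow:
  assumes r: "path_near \<kappa>1 r" and st: "0 \<le> s" "0 \<le> t"
  shows "orb r x (s + t) = orb (\<lambda>u. r (s + u)) (orb r x s) t"
proof -
  have "(\<lambda>t. orb r x (s + t)) t = orb (\<lambda>u. r (s + u)) ((\<lambda>t. orb r x (s + t)) 0) t"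
  proof (rule orb_unique[OF path_near_shift[OF r], where v=t])
    fix u assume u: "u \<in> {0..t}"
    have "(orb r x has_vector_derivative V (r (s + u)) (proj (orb r x (s + u)))) (at (s + u) within (\<lambda>u. s + u) ` {0..t})"
      using u st by (intro has_vector_derivative_within_subset[OF orb_spec(2)[OF r]]) auto
    moreover have "((\<lambda>u. s + u) has_vector_derivative 1) (at u within {0..t})"
      by (auto intro!: derivative_eq_intros)
    ultimately show "((\<lambda>t. orb r x (s + t)) has_vector_derivative V (r (s + u)) (proj (orb r x (s + u)))) (at u within {0..t})"
      using vector_diff_chain_within[of "\<lambda>u. s + u" 1 u "{0..t}" "orb r x"] by (simp add: o_def)
  qed (use st in auto)
  then show ?thesis by simp
qed

lemma orb_time_lip:
  assumes r: "path_near \<kappa>1 r" and st: "0 \<le> s" "0 \<le> t"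
  shows "cmod (orb r x t - orb r x s) \<le> L * \<bar>t - s\<bar>"
proof -
  have "norm (orb r x t - orb r x s) \<le> L * norm (t - s)"
  proof (rule differentiable_bound[of "{0..}"])
    fix u :: real assume u: "u \<in> {0..}"
    show "(orb r x has_derivative (\<lambda>h. h *\<^sub>R V (r u) (proj (orb r x u)))) (at u within {0..})"
      using orb_spec(2)[OF r, of u x] u by (simp add: has_vector_derivative_def)
    show "onorm (\<lambda>h. h *\<^sub>R V (r u) (proj (orb r x u))) \<le> L"
    proof (rule onorm_le)
      fix h :: real
      have "\<bar>h\<bar> * cmod (V (r u) (proj (orb r x u))) \<le> \<bar>h\<bar> * L"
        using r by (intro mult_left_mono V_bound proj_le) (auto dest: path_nearD)
      then show "norm (h *\<^sub>R V (r u) (proj (orb r x u))) \<le> L * norm h" by (simp add: mult.commute)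
    qed
  qed (use st in auto)
  then show ?thesis by simp
qed

lemma orb_reverse:
  assumes r: "path_near \<kappa>1 r" and b: "\<And>s. s \<in> {0..v} \<Longrightarrow> cmod (orb r x s) \<le> d" and s: "s \<in> {0..v}"
  shows "orb (\<lambda>s. r (v - s)) (cnj (orb r x v)) s = cnj (orb r x (v - s))"
proof -
  have "(\<lambda>s. cnj (orb r x (v - s))) s = orb (\<lambda>s. r (v - s)) ((\<lambda>s. cnj (orb r x (v - s))) 0) s"
  proof (rule orb_unique[OF path_near_reflect[OF r] _ s])
    fix u assume u: "u \<in> {0..v}"
    have "(orb r x has_vector_derivative V (r (v - u)) (proj (orb r x (v - u)))) (at (v - u) within (\<lambda>u. v - u) ` {0..v})"
      using u by (intro has_vector_derivative_within_subset[OF orb_spec(2)[OF r]]) auto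
    moreover have "((\<lambda>u. v - u) has_vector_derivative - 1) (at u within {0..v})"
      by (auto intro!: derivative_eq_intros)
    ultimately have "((\<lambda>u. orb r x (v - u)) has_vector_derivative - V (r (v - u)) (proj (orb r x (v - u)))) (at u within {0..v})"
      using vector_diff_chain_within[of "\<lambda>u. v - u" "- 1" u "{0..v}" "orb r x"] by (simp add: o_def)
    then have "((\<lambda>u. cnj (orb r x (v - u))) has_vector_derivative cnj (- V (r (v - u)) (proj (orb r x (v - u))))) (at u within {0..v})"
      by (rule has_vector_derivative_cnj)
    then show "((\<lambda>u. cnj (orb r x (v - u))) has_vector_derivative V (r (v - u)) (proj (cnj (orb r x (v - u))))) (at u within {0..v})"
      using b[of "v - u"] u by (simp add: V_rev)
  qed
  then show ?thesis by simp
qed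

lemma H_lip:
  assumes "\<bar>\<rho> - r0\<bar> \<le> \<kappa>1" "cmod x \<le> d" "cmod y \<le> d"
  shows "\<bar>H \<rho> y - H \<rho> x\<bar> \<le> L * (1 + 2 * d) * cmod (y - x)"
proof -
  have "\<bar>Im (cnj (V \<rho> x) * (y - x))\<bar> \<le> L * cmod (y - x)"
  proof -
    have "\<bar>Im (cnj (V \<rho> x) * (y - x))\<bar> \<le> cmod (V \<rho> x) * cmod (y - x)"
      using abs_Im_le_cmod[of "cnj (V \<rho> x) * (y - x)"] by (simp add: norm_mult)
    also have "\<dots> \<le> L * cmod (y - x)" using V_bound assms by (intro mult_right_mono) auto
    finally show ?thesis .
  qed
  moreover have "(cmod (y - x))\<^sup>2 \<le> 2 * d * cmod (y - x)"
    using norm_triangle_ineq4[of y x] assms unfolding power2_eq_square by (intro mult_right_mono) auto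
  then have "L * (cmod (y - x))\<^sup>2 \<le> L * (2 * d * cmod (y - x))" using pos by (intro mult_left_mono) auto
  ultimately show ?thesis using H_grad[OF assms] by (simp add: algebra_simps)
qed

definition Lag :: "(real \<Rightarrow> real) \<Rightarrow> (real \<Rightarrow> complex) \<Rightarrow> real \<Rightarrow> real" where
  "Lag r \<xi> t = Im (\<xi> t) * Re (V (r t) (\<xi> t)) - H (r t) (\<xi> t)"

end

lemma abs_diff_le_of_deriv_le:
  fixes u :: "real \<Rightarrow> real"
  assumes "a \<le> b" and "\<And>t. t \<in> {a..b} \<Longrightarrow> (u has_real_derivative u' t) (at t within {a..b})"
    and "\<And>t. t \<in> {a..b} \<Longrightarrow> \<bar>u' t\<bar> \<le> m"
  shows "\<bar>u b - u a\<bar> \<le> m * (b - a)"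
  using diff_le_of_deriv_le[of a b u u' m] diff_ge_of_deriv_ge[of a b u u' "- m"] assms
  by (force simp: abs_le_iff)

locale twist_section = reversible_field V H r0 \<kappa>1 d L
  for V H r0 \<kappa>1 d L +
  fixes W :: "complex \<Rightarrow> complex" and a1 a4 lo hi lam \<kappa>0 :: real
  assumes par: "0 < a1" "a1 < a4" "a4 \<le> d" "0 < lo" "lo < hi" "0 < lam" "0 < \<kappa>0" "\<kappa>0 \<le> \<kappa>1"
    and W_lip: "\<And>x y. cmod x \<le> d \<Longrightarrow> cmod y \<le> d \<Longrightarrow> cmod (W x - W y) \<le> L * cmod (x - y)"
    and W_0: "W 0 = 0"
    and W_real: "\<And>x. 0 < x \<Longrightarrow> x \<le> d \<Longrightarrow> Im (W (of_real x)) = 0 \<and> Re (W (of_real x)) > 0"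
    and orb_in: "\<And>r a s. path_near \<kappa>0 r \<Longrightarrow> a \<in> {a1..a4} \<Longrightarrow> s \<in> {0..hi} \<Longrightarrow> cmod (orb r (of_real a) s) < d"
    and twist: "\<And>r a b s. path_near \<kappa>0 r \<Longrightarrow> a1 \<le> a \<Longrightarrow> a \<le> b \<Longrightarrow> b \<le> a4 \<Longrightarrow> s \<in> {lo..hi} \<Longrightarrow>
        Im (W (orb r (of_real b) s) * cnj (W (orb r (of_real a) s))) \<le> - lam * (b - a)"
    and transversal: "\<And>r a s s'. path_near \<kappa>0 r \<Longrightarrow> a \<in> {a1..a4} \<Longrightarrow> lo \<le> s \<Longrightarrow> s \<le> s' \<Longrightarrow> s' \<le> hi \<Longrightarrow>
        lam * (s' - s) \<le> Im (W (orb r (of_real a) s')) - Im (W (orb r (of_real a) s))"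
    and ex_return: "\<And>r s. path_near \<kappa>0 r \<Longrightarrow> s \<in> {lo..hi} \<Longrightarrow>
        \<exists>a\<in>{a1..a4}. Im (orb r (of_real a) s) = 0 \<and> Re (orb r (of_real a) s) \<in> {a1..a4}"
    and return_pos: "\<And>r a s. path_near \<kappa>0 r \<Longrightarrow> a \<in> {a1..a4} \<Longrightarrow> s \<in> {lo..hi} \<Longrightarrow>
        Im (orb r (of_real a) s) = 0 \<Longrightarrow> Re (orb r (of_real a) s) > 0"
    and first_return: "\<And>r a s s'. path_near \<kappa>0 r \<Longrightarrow> a \<in> {a1..a4} \<Longrightarrow> s \<in> {lo..hi} \<Longrightarrow>
        Im (orb r (of_real a) s) = 0 \<Longrightarrow> 0 < s' \<Longrightarrow> s' < s \<Longrightarrow>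
        \<not> (Im (orb r (of_real a) s') = 0 \<and> Re (orb r (of_real a) s') > 0)"
    and H_decr: "\<And>\<rho> a b. \<bar>\<rho> - r0\<bar> \<le> \<kappa>0 \<Longrightarrow> a1 \<le> a \<Longrightarrow> a \<le> b \<Longrightarrow> b \<le> a4 \<Longrightarrow>
        lam * (b - a) \<le> H \<rho> (of_real a) - H \<rho> (of_real b)"
begin

lemma near1: "path_near \<kappa>0 r \<Longrightarrow> path_near \<kappa>1 r"
  using par by (auto intro: path_near_mono)

lemma return_orb:
  assumes "path_near \<kappa>0 r" "a \<in> {a1..a4}" "s \<in> {lo..hi}" "Im (orb r (of_real a) s) = 0"
  shows "Im (W (orb r (of_real a) s)) = 0" "0 < Re (W (orb r (of_real a) s))"
    "Re (W (orb r (of_real a) s)) \<le> L * d"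
proof -
  define x where "x = Re (orb r (of_real a) s)"
  have x: "orb r (of_real a) s = of_real x" using assms by (simp add: x_def complex_eq_iff)
  have n: "cmod (orb r (of_real a) s) \<le> d" using orb_in[OF assms(1,2), of s] assms(3) par by auto
  have xp: "0 < x" using return_pos[OF assms] by (simp add: x_def)
  have "x \<le> d" using n x by simp
  then show "Im (W (orb r (of_real a) s)) = 0" "0 < Re (W (orb r (of_real a) s))"
    using W_real[OF xp] x by auto
  have "cmod (W (orb r (of_real a) s)) \<le> L * cmod (orb r (of_real a) s)"
    using W_lip[OF n, of 0] pos by (simp add: W_0)
  also have "\<dots> \<le> L * d" using n pos by simp
  finally show "Re (W (orb r (of_real a) s)) \<le> L * d" using complex_Re_le_cmod order_trans by blast
qed

lemma twist_at_return:
  assumes r: "path_near \<kappa>0 r" and s: "s \<in> {lo..hi}" and a: "a \<in> {a1..a4}" "b \<in> {a1..a4}"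
    and z: "Im (orb r (of_real a) s) = 0"
  shows "lam * \<bar>b - a\<bar> \<le> L * d * \<bar>Im (W (orb r (of_real b) s))\<bar>"
    "a < b \<Longrightarrow> Im (W (orb r (of_real b) s)) < 0" "b < a \<Longrightarrow> 0 < Im (W (orb r (of_real b) s))"
proof -
  define w where "w = Re (W (orb r (of_real a) s))"
  have w: "W (orb r (of_real a) s) = of_real w" "0 < w" "w \<le> L * d"
    using return_orb[OF r a(1) s z] by (auto simp: w_def complex_eq_iff)
  define y where "y = Im (W (orb r (of_real b) s))"
  have 1: "y * w \<le> - lam * (b - a)" if "a \<le> b"
    using twist[OF r _ that _ s] a by (simp add: w y_def)
  have 2: "w * (- y) \<le> - lam * (a - b)" if "b \<le> a"
    using twist[OF r _ that _ s] a by (simp add: w y_def)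
  have "lam * \<bar>b - a\<bar> \<le> w * \<bar>y\<bar>"
  proof -
    have "w * - y \<le> w * \<bar>y\<bar>" "w * y \<le> w * \<bar>y\<bar>"
      using w(2) by (intro mult_left_mono; simp)+
    then show ?thesis using 1 2 by (cases "a \<le> b") (simp_all add: algebra_simps)
  qed
  also have "\<dots> \<le> L * d * \<bar>y\<bar>" using w by (intro mult_right_mono) auto
  finally show "lam * \<bar>b - a\<bar> \<le> L * d * \<bar>Im (W (orb r (of_real b) s))\<bar>" by (simp add: y_def)
  show "Im (W (orb r (of_real b) s)) < 0" if "a < b"
  proof -
    have "y * w < 0" using 1 that mult_pos_pos[OF par(6), of "b - a"] by simp
    then show ?thesis using w(2) by (simp add: y_def mult_less_0_iff)
  qed
  show "0 < Im (W (orb r (of_real b) s))" if "b < a"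
  proof -
    have "0 < w * y" using 2 that mult_pos_pos[OF par(6), of "a - b"] by simp
    then show ?thesis using w(2) by (simp add: y_def zero_less_mult_iff)
  qed
qed

definition amp :: "(real \<Rightarrow> real) \<Rightarrow> real \<Rightarrow> real" where
  "amp r v = (THE a. a \<in> {a1..a4} \<and> Im (orb r (of_real a) v) = 0)"

lemma amp_unique:
  assumes "path_near \<kappa>0 r" "v \<in> {lo..hi}" "a \<in> {a1..a4}" "Im (orb r (of_real a) v) = 0"
  shows "amp r v = a"
  unfolding amp_def
proof (rule the_equality)
  fix b assume b: "b \<in> {a1..a4} \<and> Im (orb r (of_real b) v) = 0"
  then have "Im (W (orb r (of_real b) v)) = 0" using return_orb assms by blast
  then show "b = a" using twist_at_return(2,3)[OF assms(1,2,3) _ assms(4), of b] b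
    by (metis less_irrefl linorder_neqE_linordered_idom)
qed (use assms in auto)

lemma amp:
  assumes "path_near \<kappa>0 r" "v \<in> {lo..hi}"
  shows "amp r v \<in> {a1..a4}" "Im (orb r (of_real (amp r v)) v) = 0" "Re (orb r (of_real (amp r v)) v) \<in> {a1..a4}"
  using ex_return[OF assms] amp_unique[OF assms] by (metis, metis, metis)

lemma amp_reverse:
  assumes r: "path_near \<kappa>0 r" and v: "v \<in> {lo..hi}"
  shows "orb r (of_real (amp r v)) v = of_real (amp (\<lambda>s. r (v - s)) v)"
    "\<And>s. s \<in> {0..v} \<Longrightarrow> orb (\<lambda>s. r (v - s)) (of_real (amp (\<lambda>s. r (v - s)) v)) s = cnj (orb r (of_real (amp r v)) (v - s))"
proof -
  define a' where "a' = Re (orb r (of_real (amp r v)) v)"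
  have a': "orb r (of_real (amp r v)) v = of_real a'" "a' \<in> {a1..a4}"
    using amp[OF r v] by (auto simp: a'_def complex_eq_iff)
  have *: "orb (\<lambda>s. r (v - s)) (of_real a') s = cnj (orb r (of_real (amp r v)) (v - s))" if "s \<in> {0..v}" for s
    using orb_reverse[OF near1[OF r], of v "of_real (amp r v)" s] orb_in[OF r amp(1)[OF r v]] that v
    by (force simp: a')
  have "Im (orb (\<lambda>s. r (v - s)) (of_real a') v) = 0"
    using *[of v] v par orb_spec(1)[OF near1[OF r]] by simp
  then have "amp (\<lambda>s. r (v - s)) v = a'" using amp_unique[OF path_near_reflect[OF r] v a'(2)] by simp
  with a' * show "orb r (of_real (amp r v)) v = of_real (amp (\<lambda>s. r (v - s)) v)"
    "\<And>s. s \<in> {0..v} \<Longrightarrow> orb (\<lambda>s. r (v - s)) (of_real (amp (\<lambda>s. r (v - s)) v)) s = cnj (orb r (of_real (amp r v)) (v - s))"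
    by auto
qed

lemma amp_mono:
  assumes r: "path_near \<kappa>0 r" and v: "lo \<le> v" "v < v'" "v' \<le> hi"
  shows "amp r v < amp r v'" "lam * (v' - v) \<le> L * growth hi * (amp r v' - amp r v)"
    "lam * (amp r v' - amp r v) \<le> L * d * (L * L) * (v' - v)"
proof -
  have vI: "v \<in> {lo..hi}" "v' \<in> {lo..hi}" using v by auto
  note A = amp[OF r vI(1)] and A' = amp[OF r vI(2)]
  have t1: "lam * (v' - v) \<le> Im (W (orb r (of_real (amp r v)) v'))"
    using transversal[OF r A(1), of v v'] return_orb(1)[OF r A(1) vI(1) A(2)] v by simp
  then have "0 < Im (W (orb r (of_real (amp r v)) v'))" using v par mult_pos_pos[of lam "v' - v"] by linarith
  then show less: "amp r v < amp r v'"
    using twist_at_return(2,3)[OF r vI(2) A'(1) A(1) A'(2)] return_orb(1)[OF r A'(1) vI(2) A'(2)]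
    by (metis less_asym less_irrefl linorder_neqE_linordered_idom)
  have "Im (W (orb r (of_real (amp r v)) v')) = Im (W (orb r (of_real (amp r v)) v') - W (orb r (of_real (amp r v')) v'))"
    using return_orb(1)[OF r A'(1) vI(2) A'(2)] by simp
  also have "\<dots> \<le> cmod (W (orb r (of_real (amp r v)) v') - W (orb r (of_real (amp r v')) v'))"
    using abs_Im_le_cmod abs_le_D1 by blast
  also have "\<dots> \<le> L * cmod (orb r (of_real (amp r v)) v' - orb r (of_real (amp r v')) v')"
    using orb_in[OF r A(1), of v'] orb_in[OF r A'(1), of v'] v par by (intro W_lip) auto
  also have "\<dots> \<le> L * (growth v' * cmod (of_real (amp r v) - of_real (amp r v')))"
    using v par pos by (intro mult_left_mono orb_lip[OF near1[OF r]]) auto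
  also have "cmod (of_real (amp r v) - of_real (amp r v') :: complex) = amp r v' - amp r v"
    using less by (simp flip: of_real_diff)
  also have "L * (growth v' * (amp r v' - amp r v)) \<le> L * (growth hi * (amp r v' - amp r v))"
    using less pos v growth_mono by (intro mult_left_mono mult_right_mono) auto
  finally show "lam * (v' - v) \<le> L * growth hi * (amp r v' - amp r v)" using t1 by simp
  have "\<bar>Im (W (orb r (of_real (amp r v')) v))\<bar> = \<bar>Im (W (orb r (of_real (amp r v')) v) - W (orb r (of_real (amp r v')) v'))\<bar>"
    using return_orb(1)[OF r A'(1) vI(2) A'(2)] by simp
  also have "\<dots> \<le> cmod (W (orb r (of_real (amp r v')) v) - W (orb r (of_real (amp r v')) v'))"
    by (rule abs_Im_le_cmod)
  also have "\<dots> \<le> L * cmod (orb r (of_real (amp r v')) v - orb r (of_real (amp r v')) v')"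
    using orb_in[OF r A'(1), of v'] orb_in[OF r A'(1), of v] v par by (intro W_lip) auto
  also have "\<dots> \<le> L * (L * \<bar>v - v'\<bar>)"
    using v par pos by (intro mult_left_mono orb_time_lip[OF near1[OF r]]) auto
  finally have "\<bar>Im (W (orb r (of_real (amp r v')) v))\<bar> \<le> L * L * (v' - v)" using v by simp
  then have "L * d * \<bar>Im (W (orb r (of_real (amp r v')) v))\<bar> \<le> L * d * (L * L * (v' - v))"
    using pos by (intro mult_left_mono) auto
  then show "lam * (amp r v' - amp r v) \<le> L * d * (L * L) * (v' - v)"
    using twist_at_return(1)[OF r vI(1) A(1) A'(1) A(2)] less by simp
qed

lemma amp_lip:
  assumes r: "path_near \<kappa>0 r" and v: "v \<in> {lo..hi}" "v' \<in> {lo..hi}"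
  shows "\<bar>amp r v' - amp r v\<bar> \<le> L * d * (L * L) / lam * \<bar>v' - v\<bar>"
  using amp_mono[OF r, of v v'] amp_mono[OF r, of v' v] v par
  by (cases v v' rule: linorder_cases) (auto simp: field_simps)

lemma amp_close:
  assumes r: "path_near \<kappa>0 r" and s: "path_near \<kappa>0 s" and v: "v \<in> {lo..hi}"
    and rs: "\<And>t. t \<in> {0..v} \<Longrightarrow> \<bar>r t - s t\<bar> \<le> \<kappa>" "0 \<le> \<kappa>"
  shows "\<bar>amp s v - amp r v\<bar> \<le> L * d * (L * (growth hi * (L * \<kappa>))) / lam"
proof -
  note A = amp[OF r v] and A' = amp[OF s v]
  have "\<bar>Im (W (orb r (of_real (amp s v)) v))\<bar> = \<bar>Im (W (orb r (of_real (amp s v)) v) - W (orb s (of_real (amp s v)) v))\<bar>"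
    using return_orb(1)[OF s A'(1) v A'(2)] by simp
  also have "\<dots> \<le> cmod (W (orb r (of_real (amp s v)) v) - W (orb s (of_real (amp s v)) v))"
    by (rule abs_Im_le_cmod)
  also have "\<dots> \<le> L * cmod (orb r (of_real (amp s v)) v - orb s (of_real (amp s v)) v)"
    using orb_in[OF r A'(1), of v] orb_in[OF s A'(1), of v] v par by (intro W_lip) auto
  also have "\<dots> \<le> L * (growth v * (L * \<kappa>))"
    using orb_compare[OF near1[OF r] near1[OF s] rs, of v "of_real (amp s v)" "of_real (amp s v)"] v par pos
    by (intro mult_left_mono) auto
  also have "\<dots> \<le> L * (growth hi * (L * \<kappa>))"
    using growth_mono[of v hi] v pos rs by (intro mult_left_mono mult_right_mono) auto
  finally have "L * d * \<bar>Im (W (orb r (of_real (amp s v)) v))\<bar> \<le> L * d * (L * (growth hi * (L * \<kappa>)))"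
    using pos by (intro mult_left_mono) auto
  then have "lam * \<bar>amp s v - amp r v\<bar> \<le> L * d * (L * (growth hi * (L * \<kappa>)))"
    using twist_at_return(1)[OF r v A(1) A'(1) A(2)] by simp
  then show ?thesis using par by (simp add: field_simps)
qed

lemma orb_deriv_in:
  assumes "path_near \<kappa>0 r" "a \<in> {a1..a4}" "t \<in> {0..hi}"
  shows "(orb r (of_real a) has_vector_derivative V (r t) (orb r (of_real a) t)) (at t within {0..hi})"
  using orb_deriv_Icc[OF near1[OF assms(1)] assms(3), of "of_real a"] orb_in[OF assms] by simp

lemma continuous_Lag:
  assumes r: "path_near \<kappa>0 r" and a: "a \<in> {a1..a4}"
  shows "continuous_on {0..hi} (Lag r (orb r (of_real a)))"
proof -
  let ?x = "orb r (of_real a)"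
  have cx: "continuous_on {0..hi} ?x"
    by (rule continuous_on_vector_derivative) (rule orb_deriv_in[OF r a])
  have cr: "continuous_on {0..hi} r" using r by (auto simp: path_near_def intro: continuous_on_subset)
  have "continuous_on {0..hi} (\<lambda>t. V (r t) (proj (?x t)))"
    using continuous_on_compose2[OF continuous_V_proj[OF near1[OF r]], of "{0..hi}" "\<lambda>t. (t, ?x t)"] cx
    by (simp add: continuous_intros)
  then have cV: "continuous_on {0..hi} (\<lambda>t. V (r t) (?x t))"
    using orb_in[OF r a] by (subst continuous_on_cong[OF refl, of _ _ "\<lambda>t. V (r t) (proj (?x t))"]) (auto simp: less_imp_le)
  have cH: "continuous_on {0..hi} (\<lambda>t. H (r t) (?x t))"
    unfolding continuous_on_def
  proof
    fix t assume t: "t \<in> {0..hi}"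
    have lim: "((\<lambda>u. L * \<bar>r u - r t\<bar> + L * (1 + 2 * d) * cmod (?x u - ?x t)) \<longlongrightarrow> L * \<bar>r t - r t\<bar> + L * (1 + 2 * d) * cmod (?x t - ?x t)) (at t within {0..hi})"
      using cx cr t unfolding continuous_on_def by (intro tendsto_intros) auto
    have ev: "\<forall>\<^sub>F u in at t within {0..hi}. norm (H (r u) (?x u) - H (r t) (?x t)) \<le> L * \<bar>r u - r t\<bar> + L * (1 + 2 * d) * cmod (?x u - ?x t)"
      unfolding eventually_at_filter
    proof (intro always_eventually allI impI)
      fix u assume u: "u \<in> {0..hi}"
      have "\<bar>H (r u) (?x u) - H (r t) (?x u)\<bar> \<le> L * \<bar>r u - r t\<bar>"
        using path_nearD[OF near1[OF r]] orb_in[OF r a u] by (intro H_param) auto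
      moreover have "\<bar>H (r t) (?x u) - H (r t) (?x t)\<bar> \<le> L * (1 + 2 * d) * cmod (?x u - ?x t)"
        using path_nearD[OF near1[OF r]] orb_in[OF r a u] orb_in[OF r a t] by (intro H_lip) auto
      ultimately show "norm (H (r u) (?x u) - H (r t) (?x t)) \<le> L * \<bar>r u - r t\<bar> + L * (1 + 2 * d) * cmod (?x u - ?x t)"
        by simp
    qed
    show "((\<lambda>t. H (r t) (?x t)) \<longlongrightarrow> H (r t) (?x t)) (at t within {0..hi})"
      using Lim_null_comparison[OF ev lim[simplified]] by (subst Lim_null)
  qed
  show ?thesis unfolding Lag_def by (intro continuous_intros cx cV cH)
qed

definition B :: "(real \<Rightarrow> real) \<Rightarrow> real \<Rightarrow> real \<Rightarrow> real" where
  "B r a t = integral {0..t} (Lag r (orb r (of_real a)))"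

lemma B_deriv:
  assumes r: "path_near \<kappa>0 r" and a: "a \<in> {a1..a4}" and t: "t \<in> {0..hi}"
  shows "(B r a has_real_derivative Lag r (orb r (of_real a)) t) (at t within {0..hi})"
  using integral_has_real_derivative[OF continuous_Lag[OF r a] t] by (simp add: B_def[abs_def])

text \<open>The first variation of the action vanishes up to the boundary term \<open>y \<delta>x\<close>; only Lipschitz
  dependence on the initial point is needed for this.\<close>

lemma action_first_variation:
  assumes r: "path_near \<kappa>0 r" and a: "a \<in> {a1..a4}" and b: "b \<in> {a1..a4}" and t: "t \<in> {0..hi}"
  shows "\<bar>B r b t - B r a t - Im (orb r (of_real a) t) * Re (orb r (of_real b) t - orb r (of_real a) t)\<bar>
    \<le> 2 * L * (growth hi * \<bar>b - a\<bar>)\<^sup>2 * hi"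
proof -
  let ?x = "orb r (of_real a)" and ?y = "orb r (of_real b)"
  define D where "D = (\<lambda>t. B r b t - B r a t - Im (?x t) * Re (?y t - ?x t))"
  define D' where "D' = (\<lambda>t. Lag r ?y t - Lag r ?x t - (Im (V (r t) (?x t)) * Re (?y t - ?x t) + Im (?x t) * Re (V (r t) (?y t) - V (r t) (?x t))))"
  have D: "(D has_real_derivative D' u) (at u within {0..t})" if u: "u \<in> {0..t}" for u
  proof -
    have u': "u \<in> {0..hi}" using u t by auto
    have "(D has_real_derivative D' u) (at u within {0..hi})"
      unfolding D_def D'_def
    proof (intro DERIV_diff B_deriv r a b u')
      have X: "(?x has_vector_derivative V (r u) (?x u)) (at u within {0..hi})"
        and Y: "(?y has_vector_derivative V (r u) (?y u)) (at u within {0..hi})"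
        using orb_deriv_in r a b u' by auto
      have 1: "((\<lambda>t. Im (?x t)) has_real_derivative Im (V (r u) (?x u))) (at u within {0..hi})"
        using bounded_linear.has_vector_derivative[OF bounded_linear_Im X] by (simp add: has_real_derivative_iff_has_vector_derivative)
      have 2: "((\<lambda>t. Re (?y t - ?x t)) has_real_derivative Re (V (r u) (?y u) - V (r u) (?x u))) (at u within {0..hi})"
        using bounded_linear.has_vector_derivative[OF bounded_linear_Re has_vector_derivative_diff[OF Y X]] by (simp add: has_real_derivative_iff_has_vector_derivative)
      show "((\<lambda>t. Im (?x t) * Re (?y t - ?x t)) has_real_derivative
          Im (V (r u) (?x u)) * Re (?y u - ?x u) + Im (?x u) * Re (V (r u) (?y u) - V (r u) (?x u))) (at u within {0..hi})"
        using DERIV_mult[OF 1 2] by (simp add: algebra_simps)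
    qed
    then show ?thesis using t by (auto intro: DERIV_subset)
  qed
  have bd: "\<bar>D' u\<bar> \<le> 2 * L * (growth hi * \<bar>b - a\<bar>)\<^sup>2" if u: "u \<in> {0..t}" for u
  proof -
    have u': "u \<in> {0..hi}" using u t by auto
    define \<delta> where "\<delta> = ?y u - ?x u"
    have n: "cmod (?x u) \<le> d" "cmod (?y u) \<le> d" using orb_in[OF r a u'] orb_in[OF r b u'] by auto
    have ru: "\<bar>r u - r0\<bar> \<le> \<kappa>1" using path_nearD[OF near1[OF r]] .
    have "cmod \<delta> \<le> growth u * cmod (of_real b - of_real a)"
      unfolding \<delta>_def using u by (intro orb_lip[OF near1[OF r]]) auto
    also have "cmod (of_real b - of_real a :: complex) = \<bar>b - a\<bar>" by (simp flip: of_real_diff)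
    also have "growth u * \<bar>b - a\<bar> \<le> growth hi * \<bar>b - a\<bar>" using u' by (intro mult_right_mono growth_mono) auto
    finally have dl: "(cmod \<delta>)\<^sup>2 \<le> (growth hi * \<bar>b - a\<bar>)\<^sup>2" by (intro power_mono) auto
    have eq: "D' u = Im \<delta> * Re (V (r u) (?y u) - V (r u) (?x u)) - (H (r u) (?y u) - H (r u) (?x u) - Im (cnj (V (r u) (?x u)) * (?y u - ?x u)))"
      by (simp add: D'_def Lag_def \<delta>_def algebra_simps)
    have "\<bar>Im \<delta> * Re (V (r u) (?y u) - V (r u) (?x u))\<bar> \<le> cmod \<delta> * (L * cmod \<delta>)"
      unfolding abs_mult using V_lip[OF ru n(2) n(1)] abs_Im_le_cmod[of \<delta>] abs_Re_le_cmod[of "V (r u) (?y u) - V (r u) (?x u)"]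
      by (intro mult_mono) (auto simp: \<delta>_def)
    moreover have "\<bar>H (r u) (?y u) - H (r u) (?x u) - Im (cnj (V (r u) (?x u)) * (?y u - ?x u))\<bar> \<le> L * (cmod \<delta>)\<^sup>2"
      using H_grad[OF ru n] by (simp add: \<delta>_def)
    moreover have "\<bar>x - y\<bar> \<le> 2 * (L * (cmod \<delta>)\<^sup>2)"
      if "\<bar>x\<bar> \<le> cmod \<delta> * (L * cmod \<delta>)" "\<bar>y\<bar> \<le> L * (cmod \<delta>)\<^sup>2" for x y
    proof -
      have "cmod \<delta> * (L * cmod \<delta>) = L * (cmod \<delta>)\<^sup>2" by (simp add: power2_eq_square)
      then show ?thesis using that by linarith
    qed
    ultimately have "\<bar>D' u\<bar> \<le> 2 * (L * (cmod \<delta>)\<^sup>2)" unfolding eq by blast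
    also have "\<dots> \<le> 2 * (L * (growth hi * \<bar>b - a\<bar>)\<^sup>2)" using dl pos by (intro mult_left_mono) auto
    finally show ?thesis by simp
  qed
  have "\<bar>D t - D 0\<bar> \<le> 2 * L * (growth hi * \<bar>b - a\<bar>)\<^sup>2 * (t - 0)"
    using t bd by (intro abs_diff_le_of_deriv_le[OF _ D]) auto
  also have "\<dots> \<le> 2 * L * (growth hi * \<bar>b - a\<bar>)\<^sup>2 * hi" using t pos by (intro mult_left_mono) auto
  finally show ?thesis by (simp add: D_def B_def orb_spec(1)[OF near1[OF r]])
qed

definition S :: "(real \<Rightarrow> real) \<Rightarrow> real \<Rightarrow> real" where
  "S r v = B r (amp r v) v"

lemma S_deriv:
  assumes r: "path_near \<kappa>0 r" and v: "lo < v" "v < hi"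
  shows "(S r has_real_derivative - H (r v) (of_real (amp (\<lambda>s. r (v - s)) v))) (at v)"
proof -
  define a where "a = amp r v"
  have vI: "v \<in> {lo..hi}" using v by auto
  have a: "a \<in> {a1..a4}" using amp[OF r vI] by (simp add: a_def)
  define E where "E = (\<lambda>u. S r u - B r a u)"
  define C where "C = 2 * L * (growth hi * (L * d * (L * L) / lam))\<^sup>2 * hi"
  have E: "\<bar>E u\<bar> \<le> C * \<bar>u - v\<bar>\<^sup>2" if u: "u \<in> {lo..hi}" for u
  proof -
    note U = amp[OF r u]
    have "\<bar>B r a u - B r (amp r u) u\<bar> \<le> 2 * L * (growth hi * \<bar>a - amp r u\<bar>)\<^sup>2 * hi"
      using action_first_variation[OF r U(1) a, of u] U u par by simp
    also have "\<dots> \<le> 2 * L * (growth hi * (L * d * (L * L) / lam * \<bar>v - u\<bar>))\<^sup>2 * hi"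
      using amp_lip[OF r u vI] growth_pos[of hi] pos par
      by (intro mult_left_mono mult_right_mono power_mono) (auto simp: a_def)
    finally show ?thesis by (simp add: E_def S_def C_def power_mult_distrib power_divide power2_commute[of u v] mult_ac)
  qed
  have Ev: "E v = 0" by (simp add: E_def S_def a_def)
  have "(E has_real_derivative 0) (at v)"
    unfolding has_field_derivative_iff
  proof (rule Lim_null_comparison)
    show "((\<lambda>u. C * \<bar>u - v\<bar>) \<longlongrightarrow> 0) (at v)" by (auto intro!: tendsto_eq_intros)
    have "\<forall>\<^sub>F u in at v. u \<in> {lo<..<hi}" using v by (intro eventually_at_in_open') auto
    then show "\<forall>\<^sub>F u in at v. norm ((E u - E v) / (u - v)) \<le> C * \<bar>u - v\<bar>"
    proof eventually_elim
      case (elim u)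
      then show ?case using E[of u] Ev
        by (cases "u = v") (auto simp: field_simps power2_eq_square)
    qed
  qed
  moreover have "(B r a has_real_derivative Lag r (orb r (of_real a)) v) (at v)"
    using B_deriv[OF r a, of v] at_within_Icc_at[of 0 v hi] v par by auto
  ultimately have "((\<lambda>u. E u + B r a u) has_real_derivative 0 + Lag r (orb r (of_real a)) v) (at v)"
    by (rule DERIV_add)
  then show ?thesis using amp_reverse(1)[OF r vI] by (simp add: E_def Lag_def a_def)
qed

lemma S_reverse:
  assumes r: "path_near \<kappa>0 r" and v: "v \<in> {lo..hi}"
  shows "S (\<lambda>s. r (v - s)) v = S r v"
proof -
  let ?a = "amp r v"
  note A = amp[OF r v]
  have "((\<lambda>s. Lag r (orb r (of_real ?a)) (v - s)) has_integral (- B r ?a (v - v) - - B r ?a (v - 0))) {0..v}"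
  proof (rule fundamental_theorem_of_calculus)
    fix s assume s: "s \<in> {0..v}"
    have "(B r ?a has_real_derivative Lag r (orb r (of_real ?a)) (v - s)) (at (v - s) within (\<lambda>s. v - s) ` {0..v})"
      using v s by (intro DERIV_subset[OF B_deriv[OF r A(1)]]) auto
    moreover have "((\<lambda>s. v - s) has_real_derivative - 1) (at s within {0..v})" by (auto intro!: derivative_eq_intros)
    ultimately have "((\<lambda>s. - B r ?a (v - s)) has_real_derivative - (Lag r (orb r (of_real ?a)) (v - s) * - 1)) (at s within {0..v})"
      by (intro DERIV_minus DERIV_image_chain[of "B r ?a", unfolded o_def])
    then show "((\<lambda>s. - B r ?a (v - s)) has_vector_derivative Lag r (orb r (of_real ?a)) (v - s)) (at s within {0..v})"
      by (simp add: has_real_derivative_iff_has_vector_derivative)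
  qed (use v par in auto)
  then have "((\<lambda>s. Lag r (orb r (of_real ?a)) (v - s)) has_integral S r v) {0..v}"
    by (simp add: S_def B_def)
  moreover have "Lag (\<lambda>s. r (v - s)) (orb (\<lambda>s. r (v - s)) (of_real (amp (\<lambda>s. r (v - s)) v))) s = Lag r (orb r (of_real ?a)) (v - s)"
    if "s \<in> {0..v}" for s
    using amp_reverse(2)[OF r v that] by (simp add: Lag_def V_rev H_rev)
  ultimately have "(Lag (\<lambda>s. r (v - s)) (orb (\<lambda>s. r (v - s)) (of_real (amp (\<lambda>s. r (v - s)) v))) has_integral S r v) {0..v}"
    by (subst has_integral_cong) auto
  then show ?thesis by (simp add: S_def[of "\<lambda>s. r (v - s)"] B_def integral_unique)
qed

end

context twist_section
begin

lemma S_close: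
  "\<exists>C>0. \<forall>r s v \<kappa>. path_near \<kappa>0 r \<longrightarrow> path_near \<kappa>0 s \<longrightarrow> v \<in> {lo..hi} \<longrightarrow> 0 \<le> \<kappa> \<longrightarrow> (\<forall>t. \<bar>r t - s t\<bar> \<le> \<kappa>) \<longrightarrow>
    \<bar>S s v - S r v\<bar> \<le> C * \<kappa>"
proof -
  define K where "K = growth hi * (L * d * (L * (growth hi * L)) / lam + L)"
  define M where "M = L * K + d * (L * K + L) + L * (1 + 2 * d) * K + L"
  have K: "K > 0" using growth_pos[of hi] pos par by (auto simp: K_def intro!: mult_pos_pos add_pos_pos divide_pos_pos)
  have M: "M > 0" using K pos by (auto simp: M_def intro!: mult_pos_pos add_pos_pos)
  have "\<bar>S s v - S r v\<bar> \<le> M * hi * \<kappa>"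
    if r: "path_near \<kappa>0 r" and s: "path_near \<kappa>0 s" and v: "v \<in> {lo..hi}" and k: "0 \<le> \<kappa>" and rs: "\<And>t. \<bar>r t - s t\<bar> \<le> \<kappa>" for r s v \<kappa>
  proof -
    define a where "a = amp r v"
    define b where "b = amp s v"
    have a: "a \<in> {a1..a4}" and b: "b \<in> {a1..a4}" using amp(1)[OF r v] amp(1)[OF s v] by (auto simp: a_def b_def)
    have ab: "\<bar>a - b\<bar> \<le> L * d * (L * (growth hi * (L * \<kappa>))) / lam"
      using amp_close[OF r s v rs k] by (simp add: a_def b_def abs_minus_commute)
    have D: "cmod (orb r (of_real a) t - orb s (of_real b) t) \<le> K * \<kappa>" if t: "t \<in> {0..v}" for t
    proof -
      have "cmod (orb r (of_real a) t - orb s (of_real b) t) \<le> growth t * (cmod (of_real a - of_real b) + L * \<kappa>)"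
        using t rs k by (intro orb_compare near1 r s) auto
      also have "cmod (of_real a - of_real b :: complex) = \<bar>a - b\<bar>" by (simp flip: of_real_diff)
      also have "growth t * (\<bar>a - b\<bar> + L * \<kappa>) \<le> growth hi * (L * d * (L * (growth hi * (L * \<kappa>))) / lam + L * \<kappa>)"
        using t v ab pos k growth_mono[of t hi] growth_pos[of t] growth_pos[of hi] by (intro mult_mono add_mono) auto
      also have "\<dots> = K * \<kappa>" by (simp add: K_def algebra_simps)
      finally show ?thesis .
    qed
    have LL: "\<bar>Lag s (orb s (of_real b)) t - Lag r (orb r (of_real a)) t\<bar> \<le> M * \<kappa>" if t: "t \<in> {0..v}" for t
    proof -
      define x where "x = orb r (of_real a) t"
      define y where "y = orb s (of_real b) t"
      have n: "cmod x \<le> d" "cmod y \<le> d" using orb_in[OF r a, of t] orb_in[OF s b, of t] t v by (auto simp: x_def y_def)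
      have xy: "cmod (y - x) \<le> K * \<kappa>" using D[OF t] by (simp add: x_def y_def norm_minus_commute)
      have R: "\<bar>r t - r0\<bar> \<le> \<kappa>1" "\<bar>s t - r0\<bar> \<le> \<kappa>1" using path_nearD near1 r s by blast+
      have Vd: "cmod (V (s t) y - V (r t) x) \<le> L * (K * \<kappa>) + L * \<kappa>"
      proof -
        have "cmod (V (s t) y - V (r t) x) \<le> cmod (V (s t) y - V (s t) x) + cmod (V (s t) x - V (r t) x)"
          using norm_triangle_ineq[of "V (s t) y - V (s t) x" "V (s t) x - V (r t) x"] by simp
        also have "\<dots> \<le> L * cmod (y - x) + L * \<bar>s t - r t\<bar>"
          using R n by (intro add_mono V_lip V_param) auto
        also have "\<dots> \<le> L * (K * \<kappa>) + L * \<kappa>"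
          using xy rs[of t] pos by (intro add_mono mult_left_mono) (auto simp: abs_minus_commute)
        finally show ?thesis .
      qed
      have "\<bar>H (s t) y - H (s t) x\<bar> \<le> L * (1 + 2 * d) * cmod (y - x)" using R n by (intro H_lip) auto
      also have "\<dots> \<le> L * (1 + 2 * d) * (K * \<kappa>)" using xy pos by (intro mult_left_mono) auto
      finally have H1: "\<bar>H (s t) y - H (s t) x\<bar> \<le> L * (1 + 2 * d) * (K * \<kappa>)" .
      have "\<bar>H (s t) x - H (r t) x\<bar> \<le> L * \<bar>s t - r t\<bar>" using R n by (intro H_param) auto
      also have "\<dots> \<le> L * \<kappa>" using rs[of t] pos by (intro mult_left_mono) (auto simp: abs_minus_commute)
      finally have H2: "\<bar>H (s t) x - H (r t) x\<bar> \<le> L * \<kappa>" .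
      have "Im y * Re (V (s t) y) - Im x * Re (V (r t) x) = Im (y - x) * Re (V (s t) y) + Im x * Re (V (s t) y - V (r t) x)"
        by (simp add: algebra_simps)
      moreover have "\<bar>Im (y - x) * Re (V (s t) y)\<bar> \<le> (K * \<kappa>) * L"
        unfolding abs_mult using abs_Im_le_cmod[of "y - x"] abs_Re_le_cmod[of "V (s t) y"] xy V_bound[OF R(2) n(2)] K k
        by (intro mult_mono) auto
      moreover have "\<bar>Im x * Re (V (s t) y - V (r t) x)\<bar> \<le> d * (L * (K * \<kappa>) + L * \<kappa>)"
        unfolding abs_mult using abs_Im_le_cmod[of x] abs_Re_le_cmod[of "V (s t) y - V (r t) x"] n Vd pos
        by (intro mult_mono) auto
      moreover have "M * \<kappa> = (K * \<kappa>) * L + d * (L * (K * \<kappa>) + L * \<kappa>) + L * (1 + 2 * d) * (K * \<kappa>) + L * \<kappa>"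
        by (simp add: M_def algebra_simps)
      ultimately have "\<bar>(Im y * Re (V (s t) y) - H (s t) y) - (Im x * Re (V (r t) x) - H (r t) x)\<bar> \<le> M * \<kappa>"
        using H1 H2 by linarith
      then show ?thesis by (simp add: Lag_def x_def y_def)
    qed
    have "\<bar>(\<lambda>t. B s b t - B r a t) v - (\<lambda>t. B s b t - B r a t) 0\<bar> \<le> M * \<kappa> * (v - 0)"
    proof (rule abs_diff_le_of_deriv_le)
      fix t assume t: "t \<in> {0..v}"
      show "((\<lambda>t. B s b t - B r a t) has_real_derivative (Lag s (orb s (of_real b)) t - Lag r (orb r (of_real a)) t)) (at t within {0..v})"
        using t v by (intro DERIV_diff DERIV_subset[OF B_deriv] r s a b) auto
    qed (use LL v par in auto)
    also have "\<dots> \<le> M * \<kappa> * hi" using v M k by (intro mult_left_mono) auto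
    finally show ?thesis by (simp add: S_def B_def a_def b_def mult_ac)
  qed
  then show ?thesis using M par by (intro exI[of _ "M * hi"]) auto
qed

lemma S_convex:
  "\<exists>\<mu>>0. \<exists>s. \<forall>v w. v \<in> {lo<..<hi} \<longrightarrow> w \<in> {lo<..<hi} \<longrightarrow>
    S (\<lambda>_. r0) w + s w * (v - w) + \<mu> * (v - w)\<^sup>2 \<le> S (\<lambda>_. r0) v"
proof -
  let ?r = "\<lambda>_::real. r0"
  have r: "path_near \<kappa>0 ?r" using par by (intro path_near_const) auto
  define \<mu> where "\<mu> = lam * lam / (L * growth hi) / 2"
  have mu: "\<mu> > 0" using par pos growth_pos[of hi] by (simp add: \<mu>_def)
  define s where "s = (\<lambda>v. - H r0 (of_real (amp ?r v)))"
  have D: "(S ?r has_real_derivative s v) (at v)" if "lo < v" "v < hi" for v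
    using S_deriv[OF r that] by (simp add: s_def)
  have inc: "2 * \<mu> * (v - w) \<le> s v - s w" if "lo < w" "w \<le> v" "v < hi" for v w
  proof (cases "w = v")
    case False
    have "lam * (v - w) \<le> L * growth hi * (amp ?r v - amp ?r w)" "amp ?r w < amp ?r v"
      using amp_mono[OF r, of w v] that False by auto
    then have "lam * (lam * (v - w)) \<le> lam * (L * growth hi * (amp ?r v - amp ?r w))"
      using par by (intro mult_left_mono) auto
    then have "2 * \<mu> * (v - w) \<le> lam * (amp ?r v - amp ?r w)"
      using par pos growth_pos[of hi] by (simp add: \<mu>_def field_simps)
    also have "\<dots> \<le> H r0 (of_real (amp ?r w)) - H r0 (of_real (amp ?r v))"
      using \<open>amp ?r w < amp ?r v\<close> amp(1)[OF r, of v] amp(1)[OF r, of w] that par by (intro H_decr) auto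
    finally show ?thesis by (simp add: s_def)
  qed simp
  have "S ?r w + s w * (v - w) + \<mu> * (v - w)\<^sup>2 \<le> S ?r v" if v: "v \<in> {lo<..<hi}" and w: "w \<in> {lo<..<hi}" for v w
  proof -
    define g where "g = (\<lambda>u. S ?r u - s w * (u - w) - \<mu> * (u - w)\<^sup>2)"
    have g: "(g has_real_derivative (s u - s w - 2 * \<mu> * (u - w))) (at u within A)" if "lo < u" "u < hi" for u A
      unfolding g_def by (rule DERIV_subset[of _ _ _ UNIV]) (auto intro!: derivative_eq_intros D that simp: power2_eq_square algebra_simps)
    have "g w \<le> g v"
    proof (cases "w \<le> v")
      case True
      have "0 * (v - w) \<le> g v - g w"
        using v w inc True by (intro diff_ge_of_deriv_ge[OF True g]) auto
      then show ?thesis by simp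
    next
      case False
      have "g w - g v \<le> 0 * (w - v)"
      proof (intro diff_le_of_deriv_le[OF _ g])
        fix u assume "u \<in> {v..w}"
        then show "s u - s w - 2 * \<mu> * (u - w) \<le> 0" using inc[of u w] v w by (auto simp: algebra_simps)
      qed (use v w False in auto)
      then show ?thesis by simp
    qed
    then show ?thesis by (simp add: g_def)
  qed
  then show ?thesis using mu by blast
qed

definition h :: "(real \<Rightarrow> real) \<Rightarrow> real \<Rightarrow> real \<Rightarrow> real" where
  "h r x y = S (\<lambda>s. r (x + s)) (y - x)"

definition e0 :: "(real \<Rightarrow> real) \<Rightarrow> real \<Rightarrow> real \<Rightarrow> real" where
  "e0 r x y = H (r x) (of_real (amp (\<lambda>s. r (x + s)) (y - x)))"

definition e1 :: "(real \<Rightarrow> real) \<Rightarrow> real \<Rightarrow> real \<Rightarrow> real" where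
  "e1 r x y = H (r y) (of_real (amp (\<lambda>s. r (y - s)) (y - x)))"

lemma h_deriv2:
  assumes r: "path_near \<kappa>0 r" and v: "lo < y - x" "y - x < hi"
  shows "(h r x has_real_derivative - e1 r x y) (at y)"
proof -
  have "(S (\<lambda>s. r (x + s)) has_real_derivative - e1 r x y) (at (y - x))"
    using S_deriv[OF path_near_shift[OF r] v, of x] by (simp add: e1_def algebra_simps)
  then have "((\<lambda>y. S (\<lambda>s. r (x + s)) (y - x)) has_real_derivative - e1 r x y * 1) (at y)"
    by (intro DERIV_chain2[of "S (\<lambda>s. r (x + s))"]) (auto intro!: derivative_eq_intros)
  then show ?thesis by (simp add: h_def[abs_def])
qed

lemma h_reverse:
  assumes r: "path_near \<kappa>0 r" and v: "y - x \<in> {lo..hi}"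
  shows "h r x y = h (\<lambda>s. r (- s)) (- y) (- x)"
  using S_reverse[OF path_near_shift[OF r] v, of x] by (simp add: h_def algebra_simps)

lemma path_near_neg: "path_near \<kappa> r \<Longrightarrow> path_near \<kappa> (\<lambda>s. r (- s))"
  using path_near_reflect[of \<kappa> r 0] by simp

lemma h_deriv1:
  assumes r: "path_near \<kappa>0 r" and v: "lo < y - x" "y - x < hi"
  shows "((\<lambda>x. h r x y) has_real_derivative e0 r x y) (at x)"
proof -
  let ?q = "\<lambda>s. r (- s)"
  have "(h ?q (- y) has_real_derivative - e1 ?q (- y) (- x)) (at (- x))"
    using v by (intro h_deriv2 path_near_neg r) auto
  then have "((\<lambda>x. h ?q (- y) (- x)) has_real_derivative - e1 ?q (- y) (- x) * - 1) (at x)"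
    by (intro DERIV_chain2[of "h ?q (- y)"]) (auto intro!: derivative_eq_intros)
  moreover have "- e1 ?q (- y) (- x) * - 1 = e0 r x y" by (simp add: e0_def e1_def algebra_simps)
  ultimately have "((\<lambda>x. h ?q (- y) (- x)) has_real_derivative e0 r x y) (at x)" by simp
  then show ?thesis
    using v by (rule_tac has_field_derivative_transform_within_open[where S="{y - hi<..<y - lo}"])
      (auto simp: h_reverse[OF r])
qed

lemma e1_mono:
  assumes r: "path_near \<kappa>0 r" and v: "lo \<le> y - x2" "x1 \<le> x2" "y - x1 \<le> hi"
  shows "e1 r x1 y \<le> e1 r x2 y"
proof (cases "x1 = x2")
  case False
  have q: "path_near \<kappa>0 (\<lambda>s. r (y - s))" by (rule path_near_reflect[OF r])
  have lt: "amp (\<lambda>s. r (y - s)) (y - x2) < amp (\<lambda>s. r (y - s)) (y - x1)"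
    using amp_mono(1)[OF q, of "y - x2" "y - x1"] v False by auto
  have "0 \<le> lam * (amp (\<lambda>s. r (y - s)) (y - x1) - amp (\<lambda>s. r (y - s)) (y - x2))" using lt par by auto
  also have "\<dots> \<le> e1 r x2 y - e1 r x1 y"
    unfolding e1_def using lt v path_nearD[OF r] amp(1)[OF q, of "y - x1"] amp(1)[OF q, of "y - x2"]
    by (intro H_decr) auto
  finally show ?thesis by simp
qed simp

lemma h_submod:
  assumes r: "path_near \<kappa>0 r" and x: "x1 \<le> x2" "y1 \<le> y2" "lo < y1 - x2" "y2 - x1 < hi"
  shows "h r x1 y1 + h r x2 y2 \<le> h r x1 y2 + h r x2 y1"
proof -
  have "0 * (y2 - y1) \<le> (\<lambda>s. h r x1 s - h r x2 s) y2 - (\<lambda>s. h r x1 s - h r x2 s) y1"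
  proof (rule diff_ge_of_deriv_ge[OF x(2)])
    fix t assume t: "t \<in> {y1..y2}"
    show "((\<lambda>s. h r x1 s - h r x2 s) has_real_derivative (- e1 r x1 t - - e1 r x2 t)) (at t within {y1..y2})"
      using t x by (intro DERIV_diff has_field_derivative_at_within[OF h_deriv2[OF r]]) auto
    show "0 \<le> - e1 r x1 t - - e1 r x2 t" using e1_mono[OF r, of t x2 x1] t x by auto
  qed
  then show ?thesis by simp
qed

lemma H_bounded: "\<exists>C>0. \<forall>\<rho> x. \<bar>\<rho> - r0\<bar> \<le> \<kappa>1 \<longrightarrow> cmod x \<le> d \<longrightarrow> \<bar>H \<rho> x\<bar> \<le> C"
proof -
  have "\<bar>H \<rho> x\<bar> \<le> \<bar>H r0 0\<bar> + L * \<kappa>1 + L * (1 + 2 * d) * d" if "\<bar>\<rho> - r0\<bar> \<le> \<kappa>1" "cmod x \<le> d" for \<rho> x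
  proof -
    have "\<bar>H \<rho> x - H \<rho> 0\<bar> \<le> L * (1 + 2 * d) * cmod (x - 0)" using that pos by (intro H_lip) auto
    also have "\<dots> \<le> L * (1 + 2 * d) * d" using that pos by (intro mult_left_mono) auto
    moreover have "\<bar>H \<rho> 0 - H r0 0\<bar> \<le> L * \<bar>\<rho> - r0\<bar>" using that pos by (intro H_param) auto
    moreover have "L * \<bar>\<rho> - r0\<bar> \<le> L * \<kappa>1" using that pos by (intro mult_left_mono) auto
    ultimately show ?thesis by linarith
  qed
  moreover have "\<bar>H r0 0\<bar> + L * \<kappa>1 + L * (1 + 2 * d) * d > 0"
    using pos by (intro add_nonneg_pos add_pos_pos mult_pos_pos add_nonneg_pos) auto
  ultimately show ?thesis by blast
qed

lemma continuous_h:
  assumes r: "path_near \<kappa>0 r" and b: "lo < lo'" "hi' < hi"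
  shows "continuous_on {(x, y). lo' \<le> y - x \<and> y - x \<le> hi'} (\<lambda>(x, y). h r x y)"
proof -
  obtain C where C: "C > 0" "\<And>\<rho> x. \<bar>\<rho> - r0\<bar> \<le> \<kappa>1 \<Longrightarrow> cmod x \<le> d \<Longrightarrow> \<bar>H \<rho> x\<bar> \<le> C"
    using H_bounded by blast
  have E: "\<bar>e0 r x y\<bar> \<le> C \<and> \<bar>e1 r x y\<bar> \<le> C" if "lo < y - x" "y - x < hi" for x y
    unfolding e0_def e1_def
    using amp(1)[OF path_near_shift[OF r], of "y - x" x] amp(1)[OF path_near_reflect[OF r], of "y - x" y]
      that par path_nearD[OF near1[OF r]] by (intro conjI C) auto
  have s2: "\<bar>h r x y - h r x y'\<bar> \<le> C * \<bar>y - y'\<bar>" if "lo < y - x" "y - x < hi" "lo < y' - x" "y' - x < hi" for x y y'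
    unfolding real_norm_def[symmetric]
  proof (rule field_differentiable_bound[of "{x + lo<..<x + hi}" "h r x" "\<lambda>y. - e1 r x y"])
    fix z assume "z \<in> {x + lo<..<x + hi}"
    then have z: "lo < z - x" "z - x < hi" by auto
    show "(h r x has_field_derivative - e1 r x z) (at z within {x + lo<..<x + hi})"
      using z by (rule has_field_derivative_at_within[OF h_deriv2[OF r]])
    show "norm (- e1 r x z) \<le> C" using E[OF z] by simp
  qed (use that in auto)
  have s1: "\<bar>h r x y - h r x' y\<bar> \<le> C * \<bar>x - x'\<bar>" if "lo < y - x" "y - x < hi" "lo < y - x'" "y - x' < hi" for x x' y
    unfolding real_norm_def[symmetric]
  proof (rule field_differentiable_bound[of "{y - hi<..<y - lo}" "\<lambda>x. h r x y" "\<lambda>x. e0 r x y"])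
    fix z assume "z \<in> {y - hi<..<y - lo}"
    then have z: "lo < y - z" "y - z < hi" by auto
    show "((\<lambda>x. h r x y) has_field_derivative e0 r z y) (at z within {y - hi<..<y - lo})"
      using z by (rule has_field_derivative_at_within[OF h_deriv1[OF r]])
    show "norm (e0 r z y) \<le> C" using E[OF z] by simp
  qed (use that in auto)
  define s where "s = min (lo' - lo) (hi - hi')"
  have s: "s > 0" using b by (simp add: s_def)
  show ?thesis
    unfolding continuous_on_iff
  proof (intro ballI allI impI)
    fix z :: "real \<times> real" and e :: real assume z: "z \<in> {(x, y). lo' \<le> y - x \<and> y - x \<le> hi'}" and e: "e > 0"
    obtain x y where xy: "z = (x, y)" by (cases z)
    define \<delta> where "\<delta> = min s (e / (2 * C))"
    have \<delta>: "\<delta> > 0" "\<delta> \<le> s" "C * \<delta> \<le> e / 2" using s e C by (auto simp: \<delta>_def min_def field_simps)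
    have "dist (h r x' y') (h r x y) < e"
      if d: "dist (x', y') (x, y) < \<delta>" and b': "lo' \<le> y' - x'" "y' - x' \<le> hi'" for x' y'
    proof -
      have xx: "\<bar>x' - x\<bar> < \<delta>" "\<bar>y' - y\<bar> < \<delta>"
        using d dist_fst_le[of "(x',y')" "(x,y)"] dist_snd_le[of "(x',y')" "(x,y)"] by (auto simp: dist_real_def)
      have m: "lo < y - x'" "y - x' < hi" using z xy xx \<delta> by (auto simp: s_def)
      have "\<bar>h r x' y' - h r x' y\<bar> \<le> C * \<bar>y' - y\<bar>" using m b' b by (intro s2) auto
      moreover have "\<bar>h r x' y - h r x y\<bar> \<le> C * \<bar>x' - x\<bar>" using m z xy b by (intro s1) auto
      moreover have "C * \<bar>y' - y\<bar> < C * \<delta>" "C * \<bar>x' - x\<bar> < C * \<delta>" using xx C by auto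
      ultimately show ?thesis using \<delta> by (simp add: dist_real_def)
    qed
    then show "\<exists>\<delta>>0. \<forall>z'\<in>{(x, y). lo' \<le> y - x \<and> y - x \<le> hi'}. dist z' z < \<delta> \<longrightarrow>
        dist (case z' of (x, y) \<Rightarrow> h r x y) (case z of (x, y) \<Rightarrow> h r x y) < e"
      using \<delta>(1) xy by (intro exI[of _ \<delta>]) auto
  qed
qed

lemma glue_orbits:
  fixes x :: "int \<Rightarrow> real" and p q :: int and T :: real
  assumes r: "path_near \<kappa>0 r" and per: "\<And>t. r (t + T) = r t"
    and st: "\<And>n. lo \<le> x (n + 1) - x n \<and> x (n + 1) - x n \<le> hi"
    and xq: "\<And>n. x (n + q) = x n + p * T"
    and match: "\<And>n. amp (\<lambda>s. r (x n - s)) (x n - x (n - 1)) = amp (\<lambda>s. r (x n + s)) (x (n + 1) - x n)"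
  shows "\<exists>U. {t. Im (U t) = 0 \<and> Re (U t) > 0} = range x \<and> (\<forall>t. U (t + p * T) = U t)
    \<and> (\<forall>t. cmod (U t) < d \<and> (U has_vector_derivative V (r t) (U t)) (at t))"
proof -
  define a where "a = (\<lambda>n. amp (\<lambda>s. r (x n + s)) (x (n + 1) - x n))"
  define ob where "ob = (\<lambda>n. orb (\<lambda>s. r (x n + s)) (of_real (a n)))"
  have rn: "path_near \<kappa>0 (\<lambda>s. r (x n + s))" for n by (rule path_near_shift[OF r])
  have vI: "x (n + 1) - x n \<in> {lo..hi}" for n using st by auto
  have aI: "a n \<in> {a1..a4}" for n using amp(1)[OF rn vI] by (simp add: a_def)
  have ob0: "ob n 0 = of_real (a n)" for n by (simp add: ob_def orb_spec(1)[OF near1[OF rn]])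
  have ob1: "ob n (x (n + 1) - x n) = of_real (a (n + 1))" for n
    using amp_reverse(1)[OF rn vI, of n n] match[of "n + 1"] by (simp add: ob_def a_def algebra_simps)
  have ob_step: "ob n (x (n + 1) - x n + s) = ob (n + 1) s" if "0 \<le> s" for n s
  proof -
    have "ob n (x (n + 1) - x n + s) = orb (\<lambda>u. r (x n + (x (n + 1) - x n + u))) (ob n (x (n + 1) - x n)) s"
      unfolding ob_def using that st[of n] par by (intro orb_semiflow near1 rn) auto
    then show ?thesis using ob1[of n] by (simp add: ob_def add.assoc[symmetric])
  qed
  have x_step: "x n < x (n + 1)" for n using st[of n] par by linarith
  have x_mono: "x n \<le> x m" if "n \<le> m" for n m
    using that by (induction m rule: int_ge_induct) (auto intro: order_trans less_imp_le[OF x_step])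
  have consist: "ob n (t - x n) = ob m (t - x m)" if "n \<le> m" "x m \<le> t" for n m t
    using that
  proof (induction m rule: int_ge_induct)
    case (step m)
    then have "x m \<le> t" using x_step[of m] by linarith
    then have "ob n (t - x n) = ob m (t - x m)" using step by simp
    also have "\<dots> = ob m (x (m + 1) - x m + (t - x (m + 1)))" by simp
    also have "\<dots> = ob (m + 1) (t - x (m + 1))" using step.prems by (intro ob_step) simp
    finally show ?case .
  qed simp
  have consist': "ob n (t - x n) = ob m (t - x m)" if "x n \<le> t" "x m \<le> t" for n m t
    using linorder_linear[of n m] consist[OF _ that(2), of n] consist[OF _ that(1), of m] by metis
  have low: "x n \<le> x 0 + n * lo" if "n \<le> 0" for n
    using that
  proof (induction n rule: int_le_induct)
    case (step i) then show ?case using st[of "i - 1"] by (simp add: algebra_simps)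
  qed simp
  have high: "x 0 + n * lo \<le> x n" if "0 \<le> n" for n
    using that
  proof (induction n rule: int_ge_induct)
    case (step i) then show ?case using st[of i] by (simp add: algebra_simps)
  qed simp
  have ex_low: "\<exists>n. x n \<le> t" for t
  proof -
    define k where "k = \<lceil>\<bar>x 0 - t\<bar> / lo\<rceil>"
    have "\<bar>x 0 - t\<bar> / lo \<le> k" by (simp add: k_def)
    then have k: "\<bar>x 0 - t\<bar> \<le> k * lo" using par by (simp add: field_simps)
    have "0 \<le> \<bar>x 0 - t\<bar> / lo" using par by simp
    then have "0 \<le> k" unfolding k_def by linarith
    then have "x (- k) \<le> t" using low[of "- k"] k by simp
    then show ?thesis by blast
  qed
  have ex_seg: "\<exists>n. x n \<le> t \<and> t < x (n + 1)" for t
  proof -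
    obtain n0 where n0: "x n0 \<le> t" using ex_low by blast
    have "\<exists>k::nat. t < x (n0 + int k)"
    proof -
      define k where "k = \<lceil>\<bar>x 0 - t\<bar> / lo\<rceil> + 1"
      have "\<bar>x 0 - t\<bar> / lo < k" by (simp add: k_def) linarith
      then have k: "\<bar>x 0 - t\<bar> < k * lo" using par by (simp add: field_simps)
      have "0 \<le> \<bar>x 0 - t\<bar> / lo" using par by simp
      then have "0 \<le> k" unfolding k_def by linarith
      then have tk: "t < x k" using high[of k] k by linarith
      then have "n0 \<le> k" using n0 x_mono[of k n0] by linarith
      then show ?thesis using tk by (intro exI[of _ "nat (k - n0)"]) simp
    qed
    then obtain k where k: "t < x (n0 + int k)" "\<And>j. j < k \<Longrightarrow> \<not> t < x (n0 + int j)"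
      using exists_least_iff[of "\<lambda>k. t < x (n0 + int k)"] by auto
    then have "k \<noteq> 0" using n0 by (cases k) auto
    then obtain j where j: "k = Suc j" by (cases k) auto
    then show ?thesis using k(1) k(2)[of j] by (intro exI[of _ "n0 + int j"]) (auto simp: algebra_simps)
  qed
  define U where "U = (\<lambda>t. let n = SOME n. x n \<le> t in ob n (t - x n))"
  have U: "U t = ob n (t - x n)" if "x n \<le> t" for n t
    unfolding U_def Let_def by (rule consist'[OF someI[of "\<lambda>n. x n \<le> t", OF that] that])
  have ind: "cmod (U t) < d" for t
  proof -
    obtain n where n: "x n \<le> t" "t < x (n + 1)" using ex_seg by blast
    then have "cmod (ob n (t - x n)) < d"
      unfolding ob_def using st[of n] by (intro orb_in rn aI) auto
    then show ?thesis using U[OF n(1)] by simp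
  qed
  have der: "(U has_vector_derivative V (r t) (U t)) (at t)" for t
  proof -
    obtain n where n: "x n \<le> t - 1" using ex_low by blast
    have "((\<lambda>t. ob n (t - x n)) has_vector_derivative V (r (x n + (t - x n))) (proj (ob n (t - x n)))) (at t)"
    proof -
      have 1: "(ob n has_vector_derivative V (r (x n + (t - x n))) (proj (ob n (t - x n)))) (at (t - x n))"
        unfolding ob_def using n by (intro orb_deriv_at near1 rn) auto
      have 2: "((\<lambda>t. t - x n) has_vector_derivative 1) (at t)" by (auto intro!: derivative_eq_intros)
      show ?thesis using vector_diff_chain_at[OF 2 1] by (simp add: o_def)
    qed
    also have "proj (ob n (t - x n)) = U t" using U[of n t] n ind[of t] by simp
    finally have "((\<lambda>t. ob n (t - x n)) has_vector_derivative V (r t) (U t)) (at t)" by simp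
    then show ?thesis
      by (rule has_vector_derivative_transform_within_open[where S="{t - 1<..}"]) (use n in \<open>auto intro!: U[symmetric]\<close>)
  qed
  have perU: "U (t + p * T) = U t" for t
  proof -
    obtain n where n: "x n \<le> t" using ex_low by blast
    have rp: "r (t + k * T) = r t" for t :: real and k :: int
    proof (induction k rule: int_induct[where k=0])
      case (step1 i) then show ?case using per[of "t + i*T"] by (simp add: algebra_simps)
    next
      case (step2 i) then show ?case using per[of "t + (i-1)*T"] by (simp add: algebra_simps)
    qed simp
    have "x (n + q + 1) - x (n + q) = x (n + 1) - x n" using xq[of n] xq[of "n + 1"] by (simp add: ac_simps)
    moreover have "(\<lambda>s. r (x (n + q) + s)) = (\<lambda>s. r (x n + s))"
    proof
      fix s show "r (x (n + q) + s) = r (x n + s)" using rp[where t="x n + s" and k=p] xq[of n] by (simp add: ac_simps)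
    qed
    ultimately have "ob (n + q) = ob n" by (simp add: ob_def a_def)
    then show ?thesis using U[of n t] U[of "n + q" "t + p * T"] n xq by simp
  qed
  have cross: "{t. Im (U t) = 0 \<and> Re (U t) > 0} = range x"
  proof (intro equalityI subsetI)
    fix t assume "t \<in> range x"
    then obtain n where "t = x n" by auto
    then have "U t = of_real (a n)" using U[of n t] ob0 by simp
    then show "t \<in> {t. Im (U t) = 0 \<and> Re (U t) > 0}" using aI[of n] par by auto
  next
    fix t assume t: "t \<in> {t. Im (U t) = 0 \<and> Re (U t) > 0}"
    obtain n where n: "x n \<le> t" "t < x (n + 1)" using ex_seg by blast
    have "t = x n"
    proof (rule ccontr)
      assume "t \<noteq> x n"
      then have "\<not> (Im (ob n (t - x n)) = 0 \<and> Re (ob n (t - x n)) > 0)"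
        unfolding ob_def using n ob1[of n] by (intro first_return[OF rn aI vI[of n]]) (auto simp: ob_def)
      then show False using t U[OF n(1)] by simp
    qed
    then show "t \<in> range x" by simp
  qed
  show ?thesis by (intro exI[of _ U] conjI allI cross perU ind der)
qed

end

context twist_section
begin

theorem ex_periodic_orbits:
  fixes T :: real
  assumes T: "T > 0"
  shows "\<exists>\<kappa>>0. \<kappa> \<le> \<kappa>0 \<and> (\<exists>q0 c1 c2. 0 < c1 \<and> c1 < c2 \<and> (\<forall>r. path_near \<kappa> r \<longrightarrow> (\<forall>t. r (t + T) = r t) \<longrightarrow>
    (\<forall>p q. q0 \<le> q \<longrightarrow> 0 < q \<longrightarrow> c1 \<le> real_of_int p * T / real_of_int q \<longrightarrow> real_of_int p * T / real_of_int q \<le> c2 \<longrightarrow>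
      (\<exists>U x. strict_mono (x :: int \<Rightarrow> real) \<and> (\<forall>n. x (n + q) = x n + p * T) \<and>
        {t. Im (U t) = 0 \<and> Re (U t) > 0} = range x \<and> (\<forall>t. U (t + p * T) = U t)
        \<and> (\<forall>t. cmod (U t) < d \<and> (U has_vector_derivative V (r t) (U t)) (at t))))))"
proof -
  define s where "s = (hi - lo) / 4"
  define lo' where "lo' = lo + s"
  define hi' where "hi' = hi - s"
  define \<eta> where "\<eta> = s / 2"
  have s: "s > 0" using par by (simp add: s_def)
  have b: "lo < lo'" "hi' < hi" "lo' + \<eta> < hi' - \<eta>" "\<eta> > 0"
  proof -
    have "hi = lo + 4 * s" by (simp add: s_def field_simps)
    then show "lo < lo'" "hi' < hi" "lo' + \<eta> < hi' - \<eta>" "\<eta> > 0"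
      using s by (auto simp: lo'_def hi'_def \<eta>_def)
  qed
  obtain C where C: "C > 0" "\<And>r s v \<kappa>. path_near \<kappa>0 r \<Longrightarrow> path_near \<kappa>0 s \<Longrightarrow> v \<in> {lo..hi} \<Longrightarrow> 0 \<le> \<kappa> \<Longrightarrow>
      (\<And>t. \<bar>r t - s t\<bar> \<le> \<kappa>) \<Longrightarrow> \<bar>S s v - S r v\<bar> \<le> C * \<kappa>" using S_close by meson
  obtain \<mu> s0 where mu: "\<mu> > 0" "\<And>v w. v \<in> {lo<..<hi} \<Longrightarrow> w \<in> {lo<..<hi} \<Longrightarrow>
    S (\<lambda>_. r0) w + s0 w * (v - w) + \<mu> * (v - w)\<^sup>2 \<le> S (\<lambda>_. r0) v" using S_convex by meson
  define m where "m = \<lceil>4 * T / \<eta>\<rceil> + 1"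
  have m: "m \<ge> 2" "T / m \<le> \<eta> / 4"
  proof -
    have "4 * T / \<eta> > 0" using T b by simp
    then show "m \<ge> 2" by (simp add: m_def)
    have "4 * T / \<eta> \<le> m" by (simp add: m_def) linarith
    then show "T / m \<le> \<eta> / 4" using \<open>m \<ge> 2\<close> b T by (simp add: field_simps)
  qed
  define \<kappa>' where "\<kappa>' = \<mu> * (\<eta> / 4)\<^sup>2 / (2 * m)"
  have k': "\<kappa>' > 0" "sqrt (2 * m * \<kappa>' / \<mu>) = \<eta> / 4"
    using mu m b by (auto simp: \<kappa>'_def)
  define \<kappa> where "\<kappa> = min \<kappa>0 (\<kappa>' / C)"
  have k: "\<kappa> > 0" "\<kappa> \<le> \<kappa>0" "C * \<kappa> \<le> \<kappa>'" using k' C par by (auto simp: \<kappa>_def min_def field_simps)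
  have main: "\<exists>U x. strict_mono (x :: int \<Rightarrow> real) \<and> (\<forall>n. x (n + q) = x n + p * T) \<and>
        {t. Im (U t) = 0 \<and> Re (U t) > 0} = range x \<and> (\<forall>t. U (t + p * T) = U t)
        \<and> (\<forall>t. cmod (U t) < d \<and> (U has_vector_derivative V (r t) (U t)) (at t))"
    if r: "path_near \<kappa> r" and rper: "\<And>t. r (t + T) = r t" and q: "m \<le> q"
      and W: "lo' + \<eta> \<le> p * T / q" "p * T / q \<le> hi' - \<eta>" for r and p q :: int
  proof -
    have r': "path_near \<kappa>0 r" using r k path_near_mono by blast
    interpret discrete_action "h r" T lo' hi'
    proof
      show "h r (x + T) (y + T) = h r x y" for x y
      proof -
        have "r (x + T + s) = r (x + s)" for s using rper[of "x + s"] by (simp add: ac_simps)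
        then show ?thesis by (simp add: h_def)
      qed
      show "h r x1 y1 + h r x2 y2 \<le> h r x1 y2 + h r x2 y1"
        if "x1 \<le> x2" "y1 \<le> y2" "lo' \<le> y1 - x2" "y2 - x1 \<le> hi'" for x1 x2 y1 y2
        using that b by (intro h_submod[OF r']) auto
    qed (use T continuous_h[OF r' b(1,2)] in auto)
    have q0: "q > 0" "2 \<le> q" using q m by auto
    obtain x where x: "minimal p q x" "\<And>a b n. 0 \<le> a * p + b * q \<Longrightarrow> x n \<le> x (n + a) + real_of_int b * T"
      using ex_ordered_minimal[OF q0(1), of p] W b by auto
    have near: "\<bar>h r x y - S (\<lambda>_. r0) (y - x)\<bar> \<le> \<kappa>'" if "lo' \<le> y - x" "y - x \<le> hi'" for x y
    proof -
      have "\<bar>S (\<lambda>s. r (x + s)) (y - x) - S (\<lambda>_. r0) (y - x)\<bar> \<le> C * \<kappa>"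
        using that b k path_nearD[OF r] par
        by (intro C(2) path_near_shift[OF r'] path_near_const) (auto simp: abs_minus_commute)
      then show ?thesis using k by (simp add: h_def)
    qed
    have loc: "\<bar>x (n + 1) - x n - p * T / q\<bar> \<le> T / m + sqrt (2 * m * \<kappa>' / \<mu>)" for n
      using b m q by (intro minimal_localised[OF x(1) _ _ x(2) near, where ?s0.0=s0] mu) auto
    have st: "lo' < x (n + 1) - x n \<and> x (n + 1) - x n < hi'" for n
      using loc[of n] W m(2) b unfolding k'(2) abs_le_iff by linarith
    have xq: "x (n + q) = x n + p * T" for n using x(1) by (auto simp: minimal_def adm_def)
    have stat: "e1 r (x (n - 1)) (x n) = e0 r (x n) (x (n + 1))" for n
      using b by (intro minimal_stationary[OF x(1) q0(2) st] h_deriv1[OF r'] h_deriv2[OF r']) auto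
    have match: "amp (\<lambda>s. r (x n - s)) (x n - x (n - 1)) = amp (\<lambda>s. r (x n + s)) (x (n + 1) - x n)" (is "?u = ?v") for n
    proof -
      have u: "?u \<in> {a1..a4}" using st[of "n - 1"] b by (intro amp(1) path_near_reflect r') auto
      have v: "?v \<in> {a1..a4}" using st[of n] b by (intro amp(1) path_near_shift r') auto
      have "H (r (x n)) (of_real ?u) = H (r (x n)) (of_real ?v)" using stat[of n] by (simp add: e0_def e1_def)
      then have "lam * (?v - ?u) \<le> 0" if "?u \<le> ?v"
        using H_decr[OF path_nearD[OF r'], of ?u ?v "x n"] u v that by simp
      moreover have "lam * (?u - ?v) \<le> 0" if "?v \<le> ?u"
        using H_decr[OF path_nearD[OF r'], of ?v ?u "x n"] u v that \<open>H (r (x n)) (of_real ?u) = H (r (x n)) (of_real ?v)\<close> by simp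
      ultimately show ?thesis using par by (simp add: mult_le_0_iff) linarith
    qed
    have "strict_mono x"
    proof (rule strict_monoI)
      fix i j :: int assume "i < j"
      then have "i + 1 \<le> j" by simp
      then show "x i < x j"
      proof (induction j rule: int_ge_induct)
        case base show ?case using st[of i] b par by linarith
      next
        case (step j) then show ?case using st[of j] b par by linarith
      qed
    qed
    moreover have st': "lo \<le> x (n + 1) - x n \<and> x (n + 1) - x n \<le> hi" for n using st[of n] b by auto
    moreover obtain U where "{t. Im (U t) = 0 \<and> Re (U t) > 0} = range x" "\<forall>t. U (t + p * T) = U t"
      "\<forall>t. cmod (U t) < d \<and> (U has_vector_derivative V (r t) (U t)) (at t)"
      using glue_orbits[OF r' rper st' xq match] by (elim exE conjE) (rule that)
    ultimately show ?thesis using xq by (intro exI[of _ U] exI[of _ x] conjI) simp_all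
  qed
  have c: "0 < lo' + \<eta>" using b par by linarith
  show ?thesis
    by (rule exI[of _ \<kappa>], intro conjI k, rule exI[of _ m], rule exI[of _ "lo' + \<eta>"], rule exI[of _ "hi' - \<eta>"],
        intro conjI c b allI impI, rule main) (assumption | erule spec)+
qed

end

section \<open>Twist near an elliptic equilibrium\<close>

lemma vector_diff_bound:
  fixes f :: "real \<Rightarrow> 'a::real_normed_vector"
  assumes ab: "a \<le> b" and f: "\<And>t. t \<in> {a..b} \<Longrightarrow> (f has_vector_derivative f' t) (at t within {a..b})"
    and B: "\<And>t. t \<in> {a..b} \<Longrightarrow> norm (f' t) \<le> B"
  shows "norm (f b - f a) \<le> B * (b - a)"
proof -
  have "norm (f b - f a) \<le> B * norm (b - a)"
  proof (rule differentiable_bound[of "{a..b}"])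
    fix u :: real assume u: "u \<in> {a..b}"
    show "(f has_derivative (\<lambda>h. h *\<^sub>R f' u)) (at u within {a..b})"
      using f[OF u] by (simp add: has_vector_derivative_def)
    show "onorm (\<lambda>h. h *\<^sub>R f' u) \<le> B"
    proof (rule onorm_le)
      fix h :: real
      have "\<bar>h\<bar> * norm (f' u) \<le> \<bar>h\<bar> * B" using B[OF u] by (intro mult_left_mono) auto
      then show "norm (h *\<^sub>R f' u) \<le> B * norm h" by (simp add: mult.commute)
    qed
  qed (use ab in auto)
  then show ?thesis using ab by simp
qed

lemma cos_le_off_axis:
  assumes "pi / 4 \<le> x" "x \<le> 7 * pi / 4"
  shows "cos x \<le> sqrt 2 / 2"
proof -
  have *: "cos y \<le> sqrt 2 / 2" if "pi / 4 \<le> y" "y \<le> pi" for y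
    using cos_monotone_0_pi_le[of "pi / 4" y] that by (simp add: cos_45)
  show ?thesis
  proof (cases "x \<le> pi")
    case False
    have "cos x = cos (2 * pi - x)" by (simp add: cos_diff)
    then show ?thesis using *[of "2 * pi - x"] assms False by simp
  qed (use * assms in auto)
qed

lemma cos_ge_near_axis:
  assumes "\<bar>x\<bar> \<le> pi / 4"
  shows "sqrt 2 / 2 \<le> cos x"
  using cos_monotone_0_pi_le[of "\<bar>x\<bar>" "pi / 4"] assms by (simp add: cos_45)

lemma cos_ge_near_axis': "\<bar>x - 2 * pi\<bar> \<le> pi / 4 \<Longrightarrow> sqrt 2 / 2 \<le> cos x"
  using cos_ge_near_axis[of "x - 2 * pi"] by (simp add: cos_diff)

lemma sqrt2_bounds: "5 / 4 < sqrt 2" "sqrt 2 < 3 / 2"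
proof -
  show "5 / 4 < sqrt 2" by (rule real_less_rsqrt) (simp add: power2_eq_square)
  show "sqrt 2 < 3 / 2" by (rule real_less_lsqrt) (auto simp: power2_eq_square)
qed

locale rotating =
  fixes w q :: "real \<Rightarrow> complex" and \<omega> w0 \<eta> S :: real
  assumes om: "\<omega> > 0" and w0: "w0 > 0" and S: "S = 3 * pi / \<omega>" and start: "w 0 = of_real w0"
    and der: "\<And>s. s \<in> {0..S} \<Longrightarrow> (w has_vector_derivative w s * (\<i> * of_real \<omega> + q s)) (at s within {0..S})"
    and pert: "\<And>s. s \<in> {0..S} \<Longrightarrow> cmod (w s * q s) \<le> \<eta> * w0"
    and eta: "0 \<le> \<eta>" "\<eta> * S \<le> 1 / 8" "\<eta> \<le> \<omega> / 4"
begin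

lemma near_rotation:
  assumes s: "s \<in> {0..S}"
  shows "cmod (w s - of_real w0 * cis (\<omega> * s)) \<le> \<eta> * S * w0"
proof -
  define p where "p = (\<lambda>s. w s * cis (- \<omega> * s))"
  have "cmod (p s - p 0) \<le> \<eta> * w0 * (s - 0)"
  proof (rule vector_diff_bound[where f'="\<lambda>s. w s * q s * cis (- \<omega> * s)"])
    fix u assume u: "u \<in> {0..s}"
    have "((\<lambda>s. exp (\<i> * of_real (- \<omega> * s))) has_vector_derivative exp (\<i> * of_real (- \<omega> * u)) * (\<i> * of_real (- \<omega>))) (at u within {0..s})"
      by (auto intro!: derivative_eq_intros has_vector_derivative_real_field simp: scaleR_conv_of_real)
    then have c: "((\<lambda>s. cis (- \<omega> * s)) has_vector_derivative cis (- \<omega> * u) * (\<i> * of_real (- \<omega>))) (at u within {0..s})"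
      by (simp add: cis_conv_exp)
    have "(w has_vector_derivative w u * (\<i> * of_real \<omega> + q u)) (at u within {0..s})"
      using u s by (intro has_vector_derivative_within_subset[OF der]) auto
    from has_vector_derivative_mult[OF this c]
    show "(p has_vector_derivative w u * q u * cis (- \<omega> * u)) (at u within {0..s})"
      unfolding p_def by (rule has_vector_derivative_eq_rhs) (simp add: algebra_simps)
    show "cmod (w u * q u * cis (- \<omega> * u)) \<le> \<eta> * w0"
      using pert[of u] u s by (simp add: norm_mult)
  qed (use s in auto)
  also have "\<eta> * w0 * (s - 0) \<le> \<eta> * w0 * S" using s eta w0 by (intro mult_left_mono) auto
  also have "\<dots> = \<eta> * S * w0" by simp
  finally have "cmod (p s - p 0) \<le> \<eta> * S * w0" .
  moreover have "w s - of_real w0 * cis (\<omega> * s) = (p s - p 0) * cis (\<omega> * s)"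
    by (simp add: p_def start algebra_simps cis_mult)
  ultimately show ?thesis by (simp add: norm_mult)
qed

lemma eta_w0: "\<eta> * S * w0 \<le> w0 / 8"
  using mult_right_mono[OF eta(2), of w0] w0 by linarith

lemma near_rotation8:
  assumes s: "s \<in> {0..S}"
  shows "cmod (w s - of_real w0 * cis (\<omega> * s)) \<le> w0 / 8"
  using near_rotation[OF s] eta_w0 by linarith

lemma Re_near: "s \<in> {0..S} \<Longrightarrow> \<bar>Re (w s) - w0 * cos (\<omega> * s)\<bar> \<le> w0 / 8"
  using abs_Re_le_cmod[of "w s - of_real w0 * cis (\<omega> * s)"] near_rotation8[of s] by simp

lemma Im_near: "s \<in> {0..S} \<Longrightarrow> \<bar>Im (w s) - w0 * sin (\<omega> * s)\<bar> \<le> w0 / 8"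
  using abs_Im_le_cmod[of "w s - of_real w0 * cis (\<omega> * s)"] near_rotation8[of s] by simp

lemma norm_near:
  assumes "s \<in> {0..S}"
  shows "\<bar>cmod (w s) - w0\<bar> \<le> \<eta> * S * w0"
proof -
  have "\<bar>cmod (w s) - cmod (of_real w0 * cis (\<omega> * s))\<bar> \<le> cmod (w s - of_real w0 * cis (\<omega> * s))"
    by (rule norm_triangle_ineq3)
  then show ?thesis using near_rotation[OF assms] w0 by (simp add: norm_mult)
qed

lemma Re_ge:
  assumes "s \<in> {0..S}" "sqrt 2 / 2 \<le> cos (\<omega> * s)"
  shows "w0 / 2 \<le> Re (w s)"
proof -
  have "w0 * (5 / 8) \<le> w0 * cos (\<omega> * s)" using assms w0 sqrt2_bounds by (intro mult_left_mono) auto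
  then show ?thesis using Re_near[OF assms(1)] by linarith
qed

lemma Im_increasing:
  assumes s: "0 \<le> s" "s \<le> s'" "s' \<le> S" and c: "\<And>u. u \<in> {s..s'} \<Longrightarrow> sqrt 2 / 2 \<le> cos (\<omega> * u)"
  shows "\<omega> * w0 / 4 * (s' - s) \<le> Im (w s') - Im (w s)"
proof (rule diff_ge_of_deriv_ge[where u="\<lambda>s. Im (w s)" and u'="\<lambda>s. Im (w s * (\<i> * of_real \<omega> + q s))"])
  fix u assume u: "u \<in> {s..s'}"
  have u': "u \<in> {0..S}" using u s by auto
  have "(w has_vector_derivative w u * (\<i> * of_real \<omega> + q u)) (at u within {s..s'})"
    using u s by (intro has_vector_derivative_within_subset[OF der]) auto
  from bounded_linear.has_vector_derivative[OF bounded_linear_Im this]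
  show "((\<lambda>s. Im (w s)) has_real_derivative Im (w u * (\<i> * of_real \<omega> + q u))) (at u within {s..s'})"
    by (simp add: has_real_derivative_iff_has_vector_derivative)
  have "\<omega> * (w0 / 2) \<le> \<omega> * Re (w u)" using Re_ge[OF u' c[OF u]] om by (intro mult_left_mono) auto
  moreover have "\<bar>Im (w u * q u)\<bar> \<le> \<eta> * w0" using abs_Im_le_cmod[of "w u * q u"] pert[OF u'] by linarith
  moreover have "\<eta> * w0 \<le> \<omega> / 4 * w0" using eta w0 by (intro mult_right_mono) auto
  moreover have "Im (w u * (\<i> * of_real \<omega> + q u)) = \<omega> * Re (w u) + Im (w u * q u)" by (simp add: algebra_simps)
  ultimately show "\<omega> * w0 / 4 \<le> Im (w u * (\<i> * of_real \<omega> + q u))" by (simp add: field_simps)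
qed (use s in auto)

definition t1 :: real where "t1 = 7 * pi / 4 / \<omega>"
definition t2 :: real where "t2 = 9 * pi / 4 / \<omega>"

lemma window: "0 < t1" "t1 < t2" "t2 < S" "s \<in> {t1..t2} \<Longrightarrow> sqrt 2 / 2 \<le> cos (\<omega> * s)"
proof -
  show "0 < t1" "t1 < t2" using om by (auto simp: t1_def t2_def divide_strict_right_mono)
  show "t2 < S" unfolding t2_def S using om by (intro divide_strict_right_mono) auto
  assume s: "s \<in> {t1..t2}"
  then have "7 * pi / 4 \<le> \<omega> * s" "\<omega> * s \<le> 9 * pi / 4" using om by (auto simp: t1_def t2_def field_simps)
  then show "sqrt 2 / 2 \<le> cos (\<omega> * s)" by (intro cos_ge_near_axis') linarith
qed

lemma Im_increasing_window:
  assumes "t1 \<le> s" "s \<le> s'" "s' \<le> t2"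
  shows "\<omega> * w0 / 4 * (s' - s) \<le> Im (w s') - Im (w s)"
  using assms window by (intro Im_increasing) auto

lemma Re_ge_window: "s \<in> {t1..t2} \<Longrightarrow> w0 / 2 \<le> Re (w s)"
  using window by (intro Re_ge) auto

lemma Im_ends: "Im (w t1) < 0" "0 < Im (w t2)"
proof -
  have 1: "sin (\<omega> * t1) = - (sqrt 2 / 2)"
  proof -
    have "sin (\<omega> * t1) = sin (2 * pi - pi / 4)" using om by (simp add: t1_def algebra_simps)
    then show ?thesis unfolding sin_diff by (simp add: sin_45)
  qed
  have 2: "sin (\<omega> * t2) = sqrt 2 / 2"
  proof -
    have "sin (\<omega> * t2) = sin (2 * pi + pi / 4)" using om by (simp add: t2_def algebra_simps)
    then show ?thesis unfolding sin_add by (simp add: sin_45)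
  qed
  have "w0 * (5 / 8) \<le> w0 * (sqrt 2 / 2)" using sqrt2_bounds w0 by (intro mult_left_mono) auto
  moreover have "\<bar>Im (w t1) - w0 * - (sqrt 2 / 2)\<bar> \<le> w0 / 8" "\<bar>Im (w t2) - w0 * (sqrt 2 / 2)\<bar> \<le> w0 / 8"
    using Im_near[of t1] Im_near[of t2] window(1-3) unfolding 1 2 by auto
  ultimately show "Im (w t1) < 0" "0 < Im (w t2)" using w0 by linarith+
qed

lemma no_early_return:
  assumes s1: "s1 \<in> {t1..t2}" "Im (w s1) = 0" and s: "0 < s" "s < s1"
  shows "\<not> (Im (w s) = 0 \<and> Re (w s) > 0)"
proof
  assume z: "Im (w s) = 0 \<and> Re (w s) > 0"
  have sS: "s \<in> {0..S}" using s s1 window by auto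
  consider "\<omega> * s \<le> pi / 4" | "pi / 4 \<le> \<omega> * s" "\<omega> * s \<le> 7 * pi / 4" | "7 * pi / 4 < \<omega> * s" by linarith
  then show False
  proof cases
    case 1
    have "\<omega> * w0 / 4 * (s - 0) \<le> Im (w s) - Im (w 0)"
    proof (rule Im_increasing)
      fix u assume u: "u \<in> {0..s}"
      then have "0 \<le> \<omega> * u" "\<omega> * u \<le> \<omega> * s" using om by auto
      then show "sqrt 2 / 2 \<le> cos (\<omega> * u)" using 1 by (intro cos_ge_near_axis) auto
    qed (use sS in auto)
    moreover have "0 < \<omega> * w0 / 4 * (s - 0)" using om w0 s by simp
    ultimately show False using z start by simp
  next
    case 2
    define c where "c = cos (\<omega> * s)"
    have c: "c \<le> sqrt 2 / 2" using cos_le_off_axis 2 by (simp add: c_def)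
    have "cmod (w s) \<ge> w0 - w0 / 8" using norm_near[OF sS] eta_w0 by linarith
    moreover have "cmod (w s) = Re (w s)" using z by (simp add: cmod_eq_Re)
    ultimately have "w0 * (7 / 8) \<le> Re (w s)" by simp
    then have "w0 * (3 / 4) \<le> w0 * c" using Re_near[OF sS] unfolding c_def by linarith
    then have "3 / 4 \<le> c" using w0 by simp
    then show False using c sqrt2_bounds by simp
  next
    case 3
    then have "t1 \<le> s" using om by (simp add: t1_def field_simps)
    then have "\<omega> * w0 / 4 * (s1 - s) \<le> Im (w s1) - Im (w s)" using s s1 by (intro Im_increasing_window) auto
    moreover have "0 < \<omega> * w0 / 4 * (s1 - s)" using om w0 s by simp
    ultimately show False using z s1 by simp
  qed
qed

end

lemma twist_estimate:
  fixes u v qu qv :: "real \<Rightarrow> complex" and \<omega> \<beta> K \<delta> S u0 v0 :: real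
  assumes S: "0 < S" and K: "1 \<le> K" and d: "0 < \<delta>" "\<delta> \<le> 1" and beta: "\<beta> < 0"
    and start: "u 0 = of_real u0" "v 0 = of_real v0" "0 < u0" "u0 \<le> v0"
    and du: "\<And>s. s \<in> {0..S} \<Longrightarrow> (u has_vector_derivative u s * (\<i> * of_real \<omega> + (\<i> * of_real (\<beta> * (cmod (u s))\<^sup>2) + qu s))) (at s within {0..S})"
    and dv: "\<And>s. s \<in> {0..S} \<Longrightarrow> (v has_vector_derivative v s * (\<i> * of_real \<omega> + (\<i> * of_real (\<beta> * (cmod (v s))\<^sup>2) + qv s))) (at s within {0..S})"
    and nu: "\<And>s. s \<in> {0..S} \<Longrightarrow> \<delta> / K \<le> cmod (u s) \<and> cmod (u s) \<le> K * \<delta>"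
    and nv: "\<And>s. s \<in> {0..S} \<Longrightarrow> cmod (v s) \<le> K * \<delta>"
    and q: "\<And>s. s \<in> {0..S} \<Longrightarrow> cmod (qv s - qu s) \<le> K * \<delta>\<^sup>2 * cmod (v s - u s)"
    and small: "K^4 * (\<bar>\<beta>\<bar> * (K\<^sup>2 + 1) + 1) * \<delta>\<^sup>2 \<le> 1"
      "K^4 * (\<bar>\<beta>\<bar> * (K\<^sup>2 + 1) + 1) * \<delta>\<^sup>2 * exp (2 * S) * S \<le> 1 / 2"
      "2 * K^6 * \<delta> \<le> \<bar>\<beta>\<bar> / 2"
    and s: "s \<in> {0..S}"
  shows "Im (v s * cnj (u s)) \<le> - (\<bar>\<beta>\<bar> / (2 * K^5)) * \<delta>^3 * (v0 - u0) * s"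
proof -
  define g where "g = (\<lambda>s. v s / u s)"
  define g' where "g' = (\<lambda>s. g s * (\<i> * of_real (\<beta> * ((cmod (v s))\<^sup>2 - (cmod (u s))\<^sup>2)) + (qv s - qu s)))"
  define e where "e = (\<lambda>s. g s - 1)"
  define A where "A = K^4 * (\<bar>\<beta>\<bar> * (K\<^sup>2 + 1) + 1) * \<delta>\<^sup>2"
  define e0 where "e0 = (v0 - u0) / u0"
  have A0: "0 \<le> A" using K by (simp add: A_def)
  have e0: "0 \<le> e0" using start by (simp add: e0_def)
  have dK: "\<delta> / K > 0" using d K by simp
  have une: "u s \<noteq> 0" if "s \<in> {0..S}" for s using nu[OF that] dK by auto
  have vg: "v s = g s * u s" if "s \<in> {0..S}" for s using une[OF that] by (simp add: g_def)
  have gd: "(g has_vector_derivative g' s) (at s within {0..S})" if s: "s \<in> {0..S}" for s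
  proof -
    have "((\<lambda>s. v s / u s) has_vector_derivative
      (v s * (\<i> * of_real \<omega> + (\<i> * of_real (\<beta> * (cmod (v s))\<^sup>2) + qv s)) * u s
        - v s * (u s * (\<i> * of_real \<omega> + (\<i> * of_real (\<beta> * (cmod (u s))\<^sup>2) + qu s)))) / (u s * u s)) (at s within {0..S})"
      unfolding has_vector_derivative_def
      by (rule has_derivative_eq_rhs[OF has_derivative_divide'[OF dv[OF s, unfolded has_vector_derivative_def]
              du[OF s, unfolded has_vector_derivative_def] une[OF s]]])
        (auto simp: fun_eq_iff scaleR_conv_of_real field_simps)
    then show ?thesis
      unfolding g_def g'_def
      by (rule has_vector_derivative_eq_rhs) (use une[OF s] in \<open>simp add: field_simps\<close>)
  qed
  have gn: "cmod (g s) \<le> K\<^sup>2" if s: "s \<in> {0..S}" for s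
  proof -
    have "cmod (v s) \<le> K\<^sup>2 * (\<delta> / K)" using nv[OF s] K by (simp add: power2_eq_square)
    also have "\<dots> \<le> K\<^sup>2 * cmod (u s)" using nu[OF s] by (intro mult_left_mono) auto
    finally show ?thesis using une[OF s] by (simp add: g_def norm_divide divide_le_eq)
  qed
  have vu: "cmod (v s - u s) \<le> K * \<delta> * cmod (e s)" if s: "s \<in> {0..S}" for s
  proof -
    have "v s - u s = u s * e s" using une[OF s] by (simp add: e_def g_def field_simps)
    then show ?thesis using nu[OF s] by (simp add: norm_mult mult_right_mono)
  qed
  have vu2: "(cmod (v s))\<^sup>2 - (cmod (u s))\<^sup>2 = (cmod (u s))\<^sup>2 * ((cmod (g s))\<^sup>2 - 1)" if s: "s \<in> {0..S}" for s
    by (simp add: vg[OF s] norm_mult power_mult_distrib algebra_simps)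
  have qb: "cmod (qv s - qu s) \<le> K\<^sup>2 * \<delta>\<^sup>2 * (\<delta> * cmod (e s))" if s: "s \<in> {0..S}" for s
  proof -
    have "cmod (qv s - qu s) \<le> K * \<delta>\<^sup>2 * (K * \<delta> * cmod (e s))"
      using K by (intro order_trans[OF q[OF s]] mult_left_mono vu[OF s]) auto
    then show ?thesis by (simp add: power2_eq_square mult_ac)
  qed
  have g'b: "cmod (g' s) \<le> A * cmod (e s)" if s: "s \<in> {0..S}" for s
  proof -
    have 1: "\<bar>(cmod (g s))\<^sup>2 - 1\<bar> \<le> (K\<^sup>2 + 1) * cmod (e s)"
    proof -
      have "(cmod (g s))\<^sup>2 - 1 = (cmod (g s) - 1) * (cmod (g s) + 1)"
        by (simp add: power2_eq_square algebra_simps)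
      then have "\<bar>(cmod (g s))\<^sup>2 - 1\<bar> = \<bar>cmod (g s) - 1\<bar> * \<bar>cmod (g s) + 1\<bar>"
        by (simp only: abs_mult)
      also have "\<dots> \<le> cmod (e s) * (K\<^sup>2 + 1)"
        using norm_triangle_ineq3[of "g s" 1] gn[OF s] by (intro mult_mono) (auto simp: e_def)
      finally show ?thesis by (simp add: mult.commute)
    qed
    have "\<bar>\<beta> * ((cmod (v s))\<^sup>2 - (cmod (u s))\<^sup>2)\<bar> \<le> \<bar>\<beta>\<bar> * ((K * \<delta>)\<^sup>2 * ((K\<^sup>2 + 1) * cmod (e s)))"
    proof -
      have "(cmod (u s))\<^sup>2 \<le> (K * \<delta>)\<^sup>2" using nu[OF s] by (intro power_mono) auto
      then show ?thesis unfolding vu2[OF s] abs_mult using 1 by (intro mult_left_mono mult_mono) auto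
    qed
    moreover have "K\<^sup>2 * \<delta>\<^sup>2 * (\<delta> * cmod (e s)) \<le> K\<^sup>2 * \<delta>\<^sup>2 * (1 * cmod (e s))"
      using d by (intro mult_left_mono mult_right_mono) auto
    moreover have "cmod (\<i> * of_real (\<beta> * ((cmod (v s))\<^sup>2 - (cmod (u s))\<^sup>2)) + (qv s - qu s))
      \<le> \<bar>\<beta> * ((cmod (v s))\<^sup>2 - (cmod (u s))\<^sup>2)\<bar> + cmod (qv s - qu s)"
      using norm_triangle_ineq[of "\<i> * of_real (\<beta> * ((cmod (v s))\<^sup>2 - (cmod (u s))\<^sup>2))" "qv s - qu s"] by (simp only: norm_mult norm_ii norm_of_real mult_1)
    ultimately have "cmod (\<i> * of_real (\<beta> * ((cmod (v s))\<^sup>2 - (cmod (u s))\<^sup>2)) + (qv s - qu s))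
      \<le> K\<^sup>2 * ((\<bar>\<beta>\<bar> * (K\<^sup>2 + 1) + 1) * \<delta>\<^sup>2 * cmod (e s))"
      using qb[OF s] by (simp add: power_mult_distrib algebra_simps)
    then have "cmod (g' s) \<le> K\<^sup>2 * (K\<^sup>2 * ((\<bar>\<beta>\<bar> * (K\<^sup>2 + 1) + 1) * \<delta>\<^sup>2 * cmod (e s)))"
      unfolding g'_def norm_mult using gn[OF s] by (intro mult_mono) auto
    then show ?thesis by (simp add: A_def power4_eq_xxxx power2_eq_square mult_ac)
  qed
  have ed: "(e has_vector_derivative g' s) (at s within {0..S})" if s: "s \<in> {0..S}" for s
    unfolding e_def using gd[OF s] by (auto intro!: derivative_eq_intros)
  have e00: "e 0 = of_real e0" using start by (simp add: e_def g_def e0_def field_simps)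
  have eb: "cmod (e s) \<le> exp (2 * S) * e0" if s: "s \<in> {0..S}" for s
  proof -
    have "cmod (e s) \<le> exp ((A + 1) * s) * (cmod (e 0) + 0)"
      using g'b A0 s by (intro gronwall_norm[OF ed]) auto
    also have "\<dots> \<le> exp (2 * S) * e0"
    proof -
      have "(A + 1) * s \<le> 2 * S" using small(1) s A0 by (intro mult_mono) (auto simp: A_def)
      then show ?thesis using e0 e00 by (auto intro: mult_right_mono)
    qed
    finally show ?thesis .
  qed
  have e1: "cmod (e s - of_real e0) \<le> e0 / 2" if s: "s \<in> {0..S}" for s
  proof -
    have "cmod (e s - e 0) \<le> A * (exp (2 * S) * e0) * (s - 0)"
    proof (rule vector_diff_bound[where f'=g'])
      fix t assume t: "t \<in> {0..s}"
      show "(e has_vector_derivative g' t) (at t within {0..s})"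
        using t s by (intro has_vector_derivative_within_subset[OF ed]) auto
      show "cmod (g' t) \<le> A * (exp (2 * S) * e0)"
        using g'b[of t] mult_left_mono[OF eb[of t] A0] t s by auto
    qed (use s in auto)
    also have "\<dots> \<le> A * (exp (2 * S) * e0) * S" using s A0 e0 by (intro mult_left_mono) auto
    also have "\<dots> = (A * exp (2 * S) * S) * e0" by simp
    also have "\<dots> \<le> 1 / 2 * e0" using small(2) e0 by (intro mult_right_mono) (auto simp: A_def)
    finally show ?thesis by (simp add: e00)
  qed
  have Ree: "e0 / 2 \<le> Re (e s)" "cmod (e s) \<le> 2 * e0" if s: "s \<in> {0..S}" for s
  proof -
    show "e0 / 2 \<le> Re (e s)" using e1[OF s] abs_Re_le_cmod[of "e s - of_real e0"] by simp
    have "cmod (e s) \<le> cmod (e s - of_real e0) + cmod (of_real e0 :: complex)" using norm_triangle_ineq[of "e s - of_real e0" "of_real e0"] by simp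
    then show "cmod (e s) \<le> 2 * e0" using e1[OF s] e0 by simp
  qed
  define c where "c = \<bar>\<beta>\<bar> / (2 * K\<^sup>2) * \<delta>\<^sup>2 * e0"
  have Img': "Im (g' t) \<le> - c" if t: "t \<in> {0..S}" for t
  proof -
    have g1: "(cmod (g t))\<^sup>2 - 1 \<ge> e0"
    proof -
      have "(cmod (g t))\<^sup>2 = (1 + Re (e t))\<^sup>2 + (Im (e t))\<^sup>2" by (simp add: cmod_power2 e_def)
      then have "(cmod (g t))\<^sup>2 - 1 = 2 * Re (e t) + (Re (e t))\<^sup>2 + (Im (e t))\<^sup>2" by (simp add: power2_eq_square algebra_simps)
      moreover have "0 \<le> (Re (e t))\<^sup>2" "0 \<le> (Im (e t))\<^sup>2" by auto
      ultimately show ?thesis using Ree(1)[OF t] e0 by linarith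
    qed
    have Reg: "1 \<le> Re (g t)" using Ree(1)[OF t] e0 by (simp add: e_def)
    have "(\<delta> / K)\<^sup>2 * e0 * 1 \<le> (cmod (u t))\<^sup>2 * ((cmod (g t))\<^sup>2 - 1) * Re (g t)"
      using nu[OF t] dK g1 Reg e0 by (intro mult_mono power_mono mult_nonneg_nonneg) auto
    then have 1: "\<beta> * ((cmod (v t))\<^sup>2 - (cmod (u t))\<^sup>2) * Re (g t) \<le> - (\<bar>\<beta>\<bar> * ((\<delta> / K)\<^sup>2 * e0))"
      unfolding vu2[OF t] using beta mult_left_mono[of "(\<delta> / K)\<^sup>2 * e0" "(cmod (u t))\<^sup>2 * ((cmod (g t))\<^sup>2 - 1) * Re (g t)" "\<bar>\<beta>\<bar>"]
      by (simp add: mult.assoc)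
    have "\<bar>Im (g t * (qv t - qu t))\<bar> \<le> cmod (g t) * cmod (qv t - qu t)"
      using abs_Im_le_cmod[of "g t * (qv t - qu t)"] by (simp add: norm_mult)
    also have "\<dots> \<le> K\<^sup>2 * (K\<^sup>2 * \<delta>\<^sup>2 * (\<delta> * (2 * e0)))"
      using gn[OF t] order_trans[OF qb[OF t], of "K\<^sup>2 * \<delta>\<^sup>2 * (\<delta> * (2 * e0))"] Ree(2)[OF t] d K
      by (intro mult_mono) (auto intro!: mult_left_mono)
    also have "\<dots> = (2 * K^6 * \<delta>) * (\<delta>\<^sup>2 * e0) / K\<^sup>2" using K by (simp add: field_simps power_numeral_reduce)
    also have "\<dots> \<le> (\<bar>\<beta>\<bar> / 2) * (\<delta>\<^sup>2 * e0) / K\<^sup>2"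
      using small(3) e0 K by (intro divide_right_mono mult_right_mono) auto
    finally have 2: "\<bar>Im (g t * (qv t - qu t))\<bar> \<le> c" by (simp add: c_def field_simps)
    have "Im (g' t) = \<beta> * ((cmod (v t))\<^sup>2 - (cmod (u t))\<^sup>2) * Re (g t) + Im (g t * (qv t - qu t))"
      by (simp add: g'_def algebra_simps)
    also have "\<dots> \<le> - (\<bar>\<beta>\<bar> * ((\<delta> / K)\<^sup>2 * e0)) + c" using 1 2 by linarith
    also have "\<dots> = - c" by (simp add: c_def power_divide field_simps)
    finally show ?thesis .
  qed
  have "Im (g s) - Im (g 0) \<le> - c * (s - 0)"
  proof (rule diff_le_of_deriv_le[where u="\<lambda>t. Im (g t)" and u'="\<lambda>t. Im (g' t)"])
    fix t assume t: "t \<in> {0..s}"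
    have "(g has_vector_derivative g' t) (at t within {0..s})"
      using t s by (intro has_vector_derivative_within_subset[OF gd]) auto
    from bounded_linear.has_vector_derivative[OF bounded_linear_Im this]
    show "((\<lambda>t. Im (g t)) has_real_derivative Im (g' t)) (at t within {0..s})"
      by (simp add: has_real_derivative_iff_has_vector_derivative)
  qed (use Img' s in auto)
  then have Img: "Im (g s) \<le> - c * s" using start by (simp add: g_def)
  have "v s * cnj (u s) = of_real ((cmod (u s))\<^sup>2) * g s"
    unfolding vg[OF s] mult.assoc complex_norm_square[symmetric] by (rule mult.commute)
  then have "Im (v s * cnj (u s)) = (cmod (u s))\<^sup>2 * Im (g s)" by simp
  also have "\<dots> \<le> (cmod (u s))\<^sup>2 * (- c * s)" using Img by (intro mult_left_mono) auto
  also have "\<dots> \<le> (\<delta> / K)\<^sup>2 * (- c * s)"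
  proof -
    have "0 \<le> c * s" using s e0 by (simp add: c_def)
    moreover have "(\<delta> / K)\<^sup>2 \<le> (cmod (u s))\<^sup>2" using nu[OF s] dK by (intro power_mono) auto
    ultimately show ?thesis using mult_right_mono[of "(\<delta> / K)\<^sup>2" "(cmod (u s))\<^sup>2" "c * s"] by simp
  qed
  also have "\<dots> \<le> - (\<bar>\<beta>\<bar> / (2 * K^5)) * \<delta>^3 * (v0 - u0) * s"
  proof -
    have "u0 \<le> K * \<delta>" using nu[of 0] start S by simp
    then have "(v0 - u0) / (K * \<delta>) \<le> e0" unfolding e0_def using start K d by (intro divide_left_mono) auto
    then have "\<bar>\<beta>\<bar> / (2 * K\<^sup>2) * \<delta>\<^sup>2 * ((v0 - u0) / (K * \<delta>)) \<le> c" unfolding c_def by (intro mult_left_mono) auto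
    then have "(\<delta> / K)\<^sup>2 * (\<bar>\<beta>\<bar> / (2 * K\<^sup>2) * \<delta>\<^sup>2 * ((v0 - u0) / (K * \<delta>)) * s) \<le> (\<delta> / K)\<^sup>2 * (c * s)"
      using s by (intro mult_left_mono mult_right_mono) auto
    moreover have "(\<delta> / K)\<^sup>2 * (\<bar>\<beta>\<bar> / (2 * K\<^sup>2) * \<delta>\<^sup>2 * ((v0 - u0) / (K * \<delta>)) * s) = (\<bar>\<beta>\<bar> / (2 * K^5)) * \<delta>^3 * (v0 - u0) * s"
      using K d by (simp add: field_simps power_numeral_reduce)
    ultimately show ?thesis by simp
  qed
  finally show ?thesis .
qed

lemma eventually_small:
  fixes C c :: real and k :: nat
  assumes "c > 0" "k > 0"
  shows "\<forall>\<^sub>F \<delta> in at_right 0. C * \<delta> ^ k \<le> c"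
proof -
  have "((\<lambda>\<delta>. C * \<delta> ^ k) \<longlongrightarrow> C * 0 ^ k) (at_right 0)" by (intro tendsto_intros)
  moreover have "C * 0 ^ k = 0" using assms by simp
  ultimately have "((\<lambda>\<delta>. C * \<delta> ^ k) \<longlongrightarrow> 0) (at_right 0)" by (simp only:)
  from order_tendstoD(2)[OF this assms(1)] show ?thesis by (auto elim: eventually_mono)
qed

locale elliptic_field = reversible_field V H r0 \<kappa>1 d L
  for V H r0 \<kappa>1 d L +
  fixes W :: "complex \<Rightarrow> complex" and DW :: "complex \<Rightarrow> complex \<Rightarrow> complex" and \<omega> \<beta> M l :: real
  assumes par: "\<omega> > 0" "\<beta> < 0" "M > 0" "l > 0"
    and equilibrium: "V r0 0 = 0"
    and V_mixed: "\<And>\<rho> x y. \<bar>\<rho> - r0\<bar> \<le> \<kappa>1 \<Longrightarrow> cmod x \<le> d \<Longrightarrow> cmod y \<le> d \<Longrightarrow>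
      cmod ((V \<rho> x - V r0 x) - (V \<rho> y - V r0 y)) \<le> L * \<bar>\<rho> - r0\<bar> * cmod (x - y)"
    and W_0: "W 0 = 0"
    and W_lip: "\<And>x y. cmod x \<le> d \<Longrightarrow> cmod y \<le> d \<Longrightarrow> cmod (W x - W y) \<le> L * cmod (x - y)"
    and W_low: "\<And>x y. cmod x \<le> d \<Longrightarrow> cmod y \<le> d \<Longrightarrow> l * cmod (x - y) \<le> cmod (W x - W y)"
    and W_mono: "\<And>a b. - d \<le> a \<Longrightarrow> a \<le> b \<Longrightarrow> b \<le> d \<Longrightarrow> l * (b - a) \<le> Re (W (of_real b)) - Re (W (of_real a))"
    and W_real: "\<And>a. \<bar>a\<bar> \<le> d \<Longrightarrow> Im (W (of_real a)) = 0"
    and W_Im: "\<And>x. cmod x \<le> d \<Longrightarrow> l * (Im x)\<^sup>2 \<le> Im x * Im (W x)"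
    and W_der: "\<And>x. cmod x < d \<Longrightarrow> (W has_derivative DW x) (at x)"
    and DW_linear: "\<And>x. linear (DW x)"
    and DW_bound: "\<And>x v. cmod x \<le> d \<Longrightarrow> cmod (DW x v) \<le> L * cmod v"
    and DW_lip: "\<And>x y v. cmod x \<le> d \<Longrightarrow> cmod y \<le> d \<Longrightarrow> cmod (DW x v - DW y v) \<le> L * cmod (x - y) * cmod v"
    and normal_form: "\<And>x \<rho>. cmod x \<le> \<rho> \<Longrightarrow> \<rho> \<le> d \<Longrightarrow>
      cmod (DW x (V r0 x) - W x * (\<i> * of_real \<omega> + \<i> * of_real (\<beta> * (cmod (W x))\<^sup>2))) \<le> M * \<rho>^4"
    and normal_form_lip: "\<And>x y \<rho>. cmod x \<le> \<rho> \<Longrightarrow> cmod y \<le> \<rho> \<Longrightarrow> \<rho> \<le> d \<Longrightarrow>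
      cmod ((DW x (V r0 x) - W x * (\<i> * of_real \<omega> + \<i> * of_real (\<beta> * (cmod (W x))\<^sup>2)))
          - (DW y (V r0 y) - W y * (\<i> * of_real \<omega> + \<i> * of_real (\<beta> * (cmod (W y))\<^sup>2)))) \<le> M * \<rho>^3 * cmod (x - y)"
    and V_Im: "\<And>a. 0 \<le> a \<Longrightarrow> a \<le> d \<Longrightarrow> l * a \<le> Im (V r0 (of_real a))"
begin

definition S :: real where "S = 3 * pi / \<omega>"

lemma S_pos: "S > 0" using par by (simp add: S_def)

lemma orb_upper:
  assumes r: "path_near \<kappa> r" "0 \<le> \<kappa>" "\<kappa> \<le> \<kappa>1" and s: "0 \<le> s"
  shows "cmod (orb r x s) \<le> growth s * (cmod x + L * \<kappa>)" "cmod x \<le> growth s * (cmod (orb r x s) + L * \<kappa>)"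
proof -
  have r1: "path_near \<kappa>1 r" using r path_near_mono by blast
  have b: "cmod (V (r t) (proj (orb r x t))) \<le> L * cmod (orb r x t) + L * \<kappa>" for t
  proof -
    have "cmod (V (r t) (proj (orb r x t))) \<le> cmod (V (r t) (proj (orb r x t)) - V r0 (proj (orb r x t))) + cmod (V r0 (proj (orb r x t)) - V r0 (proj 0))"
      using norm_triangle_ineq[of "V (r t) (proj (orb r x t)) - V r0 (proj (orb r x t))" "V r0 (proj (orb r x t)) - V r0 (proj 0)"] pos
      by (simp add: equilibrium)
    also have "\<dots> \<le> L * \<bar>r t - r0\<bar> + L * cmod (orb r x t - 0)"
      using pos path_nearD[OF r1] by (intro add_mono V_param V_proj_lip proj_le) auto
    also have "L * \<bar>r t - r0\<bar> \<le> L * \<kappa>" using path_nearD[OF r(1)] pos by (intro mult_left_mono) auto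
    finally show ?thesis by simp
  qed
  have "cmod (orb r x s) \<le> exp ((L + 1) * s) * (cmod (orb r x 0) + L * \<kappa>)"
    by (rule gronwall_norm[where T=s, OF orb_deriv_Icc[OF r1] b]) (use pos r s in auto)
  then show "cmod (orb r x s) \<le> growth s * (cmod x + L * \<kappa>)" by (simp add: growth_def orb_spec(1)[OF r1])
  have "cmod (orb r x 0) \<le> exp ((L + 1) * s) * (cmod (orb r x s) + L * \<kappa>)"
    by (rule gronwall_norm_backward[where T=s, OF orb_deriv_Icc[OF r1] b]) (use pos r s in auto)
  then show "cmod x \<le> growth s * (cmod (orb r x s) + L * \<kappa>)" by (simp add: growth_def orb_spec(1)[OF r1])
qed

definition Q :: "real \<Rightarrow> complex \<Rightarrow> complex" where
  "Q \<rho> x = DW x (V \<rho> x) / W x - (\<i> * of_real \<omega> + \<i> * of_real (\<beta> * (cmod (W x))\<^sup>2))"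

lemma Q_bounds:
  assumes c: "0 < c" "0 < C"
  shows "\<exists>K>0. \<forall>\<delta> \<rho> x y. 0 < \<delta> \<longrightarrow> \<delta> \<le> 1 \<longrightarrow> C * \<delta> \<le> d \<longrightarrow> \<bar>\<rho> - r0\<bar> \<le> \<delta>^4 \<longrightarrow> \<bar>\<rho> - r0\<bar> \<le> \<kappa>1 \<longrightarrow>
    c * \<delta> \<le> cmod x \<longrightarrow> cmod x \<le> C * \<delta> \<longrightarrow> c * \<delta> \<le> cmod y \<longrightarrow> cmod y \<le> C * \<delta> \<longrightarrow>
    cmod (Q \<rho> x) \<le> K * \<delta>^3 \<and> cmod (Q \<rho> x - Q \<rho> y) \<le> K * \<delta>\<^sup>2 * cmod (x - y)"
proof -
  define M1 where "M1 = M * C^4 + M * C^3 + 2 * L * L"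
  define K where "K = M1 / (l * c) + M1 * L / (l * c)\<^sup>2"
  have M1: "M1 > 0" using par pos c by (simp add: M1_def add_pos_pos)
  have lc: "l * c > 0" using par c by simp
  have K: "K > 0" unfolding K_def using M1 lc pos par c by (intro add_pos_pos divide_pos_pos mult_pos_pos) auto
  have "cmod (Q \<rho> x) \<le> K * \<delta>^3 \<and> cmod (Q \<rho> x - Q \<rho> y) \<le> K * \<delta>\<^sup>2 * cmod (x - y)"
    if d: "0 < \<delta>" "\<delta> \<le> 1" "C * \<delta> \<le> d" and rho: "\<bar>\<rho> - r0\<bar> \<le> \<delta>^4" "\<bar>\<rho> - r0\<bar> \<le> \<kappa>1"
      and x: "c * \<delta> \<le> cmod x" "cmod x \<le> C * \<delta>" and y: "c * \<delta> \<le> cmod y" "cmod y \<le> C * \<delta>" for \<delta> \<rho> x y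
  proof -
    define N where "N = (\<lambda>x. DW x (V r0 x) - W x * (\<i> * of_real \<omega> + \<i> * of_real (\<beta> * (cmod (W x))\<^sup>2)))"
    define D where "D = (\<lambda>x. V \<rho> x - V r0 x)"
    define R where "R = (\<lambda>x. N x + DW x (D x))"
    have xd: "cmod x \<le> d" "cmod y \<le> d" using x y d by auto
    have wlow: "l * c * \<delta> \<le> cmod (W z)" if "c * \<delta> \<le> cmod z" "cmod z \<le> d" for z
    proof -
      have "l * (c * \<delta>) \<le> l * cmod z" using that par by (intro mult_left_mono) auto
      also have "\<dots> \<le> cmod (W z)" using W_low[OF that(2), of 0] pos by (simp add: W_0)
      finally show ?thesis by simp
    qed
    have lcd: "l * c * \<delta> > 0" using lc d by simp
    note wx = wlow[OF x(1) xd(1)] and wy = wlow[OF y(1) xd(2)]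
    have Dz: "cmod (D z) \<le> L * \<delta>^4" if "cmod z \<le> d" for z
    proof -
      have "cmod (D z) \<le> L * \<bar>\<rho> - r0\<bar>" unfolding D_def using rho pos that by (intro V_param) auto
      also have "\<dots> \<le> L * \<delta>^4" using rho pos by (intro mult_left_mono) auto
      finally show ?thesis .
    qed
    have Rz: "cmod (R z) \<le> M1 * \<delta>^4" if z: "cmod z \<le> C * \<delta>" for z
    proof -
      have "cmod (N z) \<le> M * (C * \<delta>)^4" unfolding N_def using z d by (intro normal_form) auto
      moreover have "cmod (DW z (D z)) \<le> L * (L * \<delta>^4)"
        using z d pos by (intro order_trans[OF DW_bound[of z "D z"]] mult_left_mono Dz) auto
      moreover have "cmod (R z) \<le> cmod (N z) + cmod (DW z (D z))" unfolding R_def by (rule norm_triangle_ineq)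
      ultimately have "cmod (R z) \<le> (M * C^4 + L * L) * \<delta>^4" by (simp add: power_mult_distrib algebra_simps)
      also have "\<dots> \<le> M1 * \<delta>^4" using par pos c d by (intro mult_right_mono) (auto simp: M1_def)
      finally show ?thesis .
    qed
    have RR: "cmod (R x - R y) \<le> M1 * \<delta>^3 * cmod (x - y)"
    proof -
      have d43: "\<delta>^4 \<le> \<delta>^3" using d by (intro power_decreasing) auto
      have 1: "cmod (N x - N y) \<le> M * (C * \<delta>)^3 * cmod (x - y)"
        unfolding N_def using x y d by (intro normal_form_lip) auto
      have "cmod (DW x (D x - D y)) \<le> L * (L * \<bar>\<rho> - r0\<bar> * cmod (x - y))"
        using V_mixed[OF rho(2) xd] pos by (intro order_trans[OF DW_bound[OF xd(1)]] mult_left_mono) (auto simp: D_def)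
      also have "\<dots> \<le> L * (L * \<delta>^3 * cmod (x - y))"
        using rho d43 pos by (intro mult_left_mono mult_right_mono) auto
      finally have 2: "cmod (DW x (D x - D y)) \<le> L * (L * \<delta>^3 * cmod (x - y))" .
      have "cmod (DW x (D y) - DW y (D y)) \<le> L * cmod (x - y) * cmod (D y)" by (rule DW_lip[OF xd])
      also have "\<dots> \<le> L * cmod (x - y) * (L * \<delta>^3)"
        using Dz[OF xd(2)] d43 pos by (intro mult_left_mono order_trans[OF Dz[OF xd(2)]]) auto
      finally have 3: "cmod (DW x (D y) - DW y (D y)) \<le> L * cmod (x - y) * (L * \<delta>^3)" .
      have "R x - R y = (N x - N y) + DW x (D x - D y) + (DW x (D y) - DW y (D y))"
        by (simp add: R_def linear_diff[OF DW_linear])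
      then have "cmod (R x - R y) \<le> cmod (N x - N y) + cmod (DW x (D x - D y)) + cmod (DW x (D y) - DW y (D y))"
        by (metis norm_triangle_ineq norm_triangle_mono order_refl)
      also have "\<dots> \<le> (M * C^3 + 2 * L * L) * \<delta>^3 * cmod (x - y)"
        using 1 2 3 by (simp add: power_mult_distrib algebra_simps)
      also have "\<dots> \<le> M1 * \<delta>^3 * cmod (x - y)" using par c d by (intro mult_right_mono) (auto simp: M1_def)
      finally show ?thesis .
    qed
    have wz: "W z \<noteq> 0" if "l * c * \<delta> \<le> cmod (W z)" for z using that lcd by auto
    have QR: "Q \<rho> z = R z / W z" if "l * c * \<delta> \<le> cmod (W z)" for z
    proof -
      have "DW z (V \<rho> z) = DW z (V r0 z) + DW z (D z)" by (simp add: D_def linear_add[OF DW_linear, symmetric])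
      then show ?thesis using wz[OF that] by (simp add: Q_def R_def N_def field_simps)
    qed
    have "cmod (Q \<rho> x) \<le> M1 * \<delta>^4 / (l * c * \<delta>)"
      unfolding QR[OF wx] norm_divide using Rz[OF x(2)] wx lcd M1 d by (intro frac_le) auto
    also have "\<dots> = M1 / (l * c) * \<delta>^3" using d lc by (simp add: field_simps power_numeral_reduce)
    also have "\<dots> \<le> K * \<delta>^3" using M1 pos lc d by (intro mult_right_mono) (auto simp: K_def)
    finally have q1: "cmod (Q \<rho> x) \<le> K * \<delta>^3" .
    have "Q \<rho> x - Q \<rho> y = (R x - R y) / W x + R y * (W y - W x) / (W x * W y)"
      unfolding QR[OF wx] QR[OF wy] using wz[OF wx] wz[OF wy] by (simp add: field_simps)
    then have "cmod (Q \<rho> x - Q \<rho> y) \<le> cmod ((R x - R y) / W x) + cmod (R y * (W y - W x) / (W x * W y))"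
      by (metis norm_triangle_ineq)
    also have "cmod ((R x - R y) / W x) \<le> M1 * \<delta>^3 * cmod (x - y) / (l * c * \<delta>)"
      unfolding norm_divide using RR wx lcd M1 d by (intro frac_le) auto
    also have "cmod (R y * (W y - W x) / (W x * W y)) \<le> (M1 * \<delta>^4) * (L * cmod (x - y)) / ((l * c * \<delta>) * (l * c * \<delta>))"
      unfolding norm_divide norm_mult
      using Rz[OF y(2)] W_lip[OF xd(2,1)] wx wy lcd M1 d pos par c
      by (intro frac_le mult_mono mult_nonneg_nonneg mult_pos_pos) (auto simp: norm_minus_commute)
    also have "M1 * \<delta>^3 * cmod (x - y) / (l * c * \<delta>) + (M1 * \<delta>^4) * (L * cmod (x - y)) / ((l * c * \<delta>) * (l * c * \<delta>)) = K * \<delta>\<^sup>2 * cmod (x - y)"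
      using d lc by (simp add: K_def field_simps power_numeral_reduce)
    finally show ?thesis using q1 by simp
  qed
  then show ?thesis using K by (intro exI[of _ K]) blast
qed

lemma W_orb_deriv:
  assumes r: "path_near \<kappa>1 r" and s: "s \<in> {0..S}" and b: "cmod (orb r x s) < d" "W (orb r x s) \<noteq> 0"
  shows "((\<lambda>s. W (orb r x s)) has_vector_derivative
    W (orb r x s) * (\<i> * of_real \<omega> + (\<i> * of_real (\<beta> * (cmod (W (orb r x s)))\<^sup>2) + Q (r s) (orb r x s)))) (at s within {0..S})"
proof -
  have 1: "(orb r x has_vector_derivative V (r s) (orb r x s)) (at s within {0..S})"
    using orb_deriv_Icc[OF r s, of x] b by simp
  have "((W \<circ> orb r x) has_vector_derivative DW (orb r x s) (V (r s) (orb r x s))) (at s within {0..S})"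
    by (rule vector_derivative_diff_chain_within[OF 1 has_derivative_at_withinI[OF W_der[OF b(1)]]])
  then show ?thesis
    by (rule_tac has_vector_derivative_eq_rhs) (use b(2) in \<open>auto simp: Q_def o_def field_simps\<close>)
qed

end

lemma continuous_on_of_lipschitz:
  fixes f :: "real \<Rightarrow> complex"
  assumes "\<And>x y. cmod (f x - f y) \<le> C * \<bar>x - y\<bar>"
  shows "continuous_on A f"
proof (rule lipschitz_on_continuous_on)
  show "\<bar>C\<bar>-lipschitz_on A f"
    using order_trans[OF assms mult_right_mono[of C "\<bar>C\<bar>"]] by (intro lipschitz_onI) (auto simp: dist_norm)
qed

context elliptic_field
begin

definition wv :: "(real \<Rightarrow> real) \<Rightarrow> real \<Rightarrow> real \<Rightarrow> complex" where
  "wv r a s = W (orb r (of_real a) s)"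

lemma ex_scale:
  "\<exists>\<delta>>0. \<exists>\<eta>\<ge>0. \<exists>lam>0. 4 * \<delta> < d \<and> \<eta> * S \<le> l / (4 * L) \<and>
    (\<forall>r. path_near (\<delta>^4) r \<longrightarrow> path_near \<kappa>1 r \<longrightarrow>
      (\<forall>a\<in>{\<delta>..4 * \<delta>}. (\<forall>s\<in>{0..S}. cmod (orb r (of_real a) s) < d) \<and>
        (\<exists>q. rotating (wv r a) q \<omega> (Re (W (of_real a))) \<eta> S)) \<and>
      (\<forall>a b s. \<delta> \<le> a \<longrightarrow> a \<le> b \<longrightarrow> b \<le> 4 * \<delta> \<longrightarrow> s \<in> {0..S} \<longrightarrow>
        Im (wv r b s * cnj (wv r a s)) \<le> - lam * (b - a) * s))"
proof -
  define G where "G = growth S"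
  have G: "G > 0" "1 \<le> G" using growth_mono[of 0 S] S_pos growth_pos by (auto simp: G_def growth_def)
  define c where "c = 1 / (2 * G)"
  define C where "C = G * (4 + L)"
  have cC: "c > 0" "C > 0" using G pos by (auto simp: c_def C_def)
  obtain Kq where Kq: "Kq > 0" "\<And>\<delta> \<rho> x y. 0 < \<delta> \<Longrightarrow> \<delta> \<le> 1 \<Longrightarrow> C * \<delta> \<le> d \<Longrightarrow> \<bar>\<rho> - r0\<bar> \<le> \<delta>^4 \<Longrightarrow> \<bar>\<rho> - r0\<bar> \<le> \<kappa>1 \<Longrightarrow>
    c * \<delta> \<le> cmod x \<Longrightarrow> cmod x \<le> C * \<delta> \<Longrightarrow> c * \<delta> \<le> cmod y \<Longrightarrow> cmod y \<le> C * \<delta> \<Longrightarrow>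
    cmod (Q \<rho> x) \<le> Kq * \<delta>^3 \<and> cmod (Q \<rho> x - Q \<rho> y) \<le> Kq * \<delta>\<^sup>2 * cmod (x - y)"
    using Q_bounds[OF cC] by blast
  define K where "K = 1 + L * C + 1 / (l * c) + Kq + Kq / l"
  have lc: "l * c > 0" using par cC by simp
  have K: "1 \<le> K" "L * C \<le> K" "1 / (l * c) \<le> K" "Kq \<le> K" "Kq / l \<le> K"
    using pos cC lc Kq(1) par by (auto simp: K_def)
  define A where "A = \<bar>\<beta>\<bar> * K^3 + K\<^sup>2"
  have A: "A \<ge> 0" using K by (simp add: A_def)
  have "\<forall>\<^sub>F \<delta> in at_right 0. 0 < \<delta> \<and> \<delta> \<le> 1 \<and> C * \<delta>^1 \<le> d / 2 \<and> 4 * \<delta>^1 \<le> d / 2 \<and> L * \<delta>^3 \<le> c / 1 \<and>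
      A / l * S * \<delta>\<^sup>2 \<le> min (1 / 8) (l / (4 * L)) \<and> A / l * \<delta>\<^sup>2 \<le> \<omega> / 4 \<and>
      K^4 * (\<bar>\<beta>\<bar> * (K\<^sup>2 + 1) + 1) * \<delta>\<^sup>2 \<le> 1 \<and>
      (K^4 * (\<bar>\<beta>\<bar> * (K\<^sup>2 + 1) + 1) * exp (2 * S) * S) * \<delta>\<^sup>2 \<le> 1 / 2 \<and> (2 * K^6) * \<delta>^1 \<le> \<bar>\<beta>\<bar> / 2"
    using pos par cC
    by (intro eventually_conj eventually_small eventually_at_right_less)
      (auto simp: eventually_at_right_field intro!: exI[of _ 1])
  then obtain \<delta> where \<delta>: "0 < \<delta>" "\<delta> \<le> 1" "C * \<delta> \<le> d / 2" "4 * \<delta> \<le> d / 2" "L * \<delta>^3 \<le> c"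
      "A / l * S * \<delta>\<^sup>2 \<le> min (1 / 8) (l / (4 * L))" "A / l * \<delta>\<^sup>2 \<le> \<omega> / 4"
      "K^4 * (\<bar>\<beta>\<bar> * (K\<^sup>2 + 1) + 1) * \<delta>\<^sup>2 \<le> 1"
      "K^4 * (\<bar>\<beta>\<bar> * (K\<^sup>2 + 1) + 1) * \<delta>\<^sup>2 * exp (2 * S) * S \<le> 1 / 2" "2 * K^6 * \<delta> \<le> \<bar>\<beta>\<bar> / 2"
    using eventually_happens[of _ "at_right (0::real)"] by (force simp: mult_ac)
  define \<eta> where "\<eta> = A / l * \<delta>\<^sup>2"
  define lam where "lam = (\<bar>\<beta>\<bar> / (2 * K^5)) * \<delta>^3 * l"
  have ball: "c * \<delta> \<le> cmod (orb r (of_real a) s) \<and> cmod (orb r (of_real a) s) \<le> C * \<delta>"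
    if r: "path_near (\<delta>^4) r" "path_near \<kappa>1 r" and a: "a \<in> {\<delta>..4 * \<delta>}" and s: "s \<in> {0..S}" for r a s
  proof -
    define k where "k = min (\<delta>^4) \<kappa>1"
    have rk: "path_near k r" "0 \<le> k" "k \<le> \<kappa>1" "k \<le> \<delta>^4" using r pos by (auto simp: k_def path_near_def min_def)
    have gs: "growth s \<le> G" using growth_mono[of s S] s by (simp add: G_def)
    have d4: "\<delta>^4 \<le> \<delta>" using power_decreasing[of 1 4 \<delta>] \<delta> by simp
    have s0: "0 \<le> s" using s by simp
    have "cmod (orb r (of_real a) s) \<le> growth s * (cmod (of_real a) + L * k)" by (rule orb_upper(1)[OF rk(1-3) s0])
    also have "\<dots> \<le> G * (4 * \<delta> + L * \<delta>)"
      using gs a rk d4 pos \<delta> G growth_pos by (intro mult_mono add_mono) auto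
    finally have 1: "cmod (orb r (of_real a) s) \<le> C * \<delta>" by (simp add: C_def algebra_simps)
    have "\<delta> \<le> cmod (of_real a :: complex)" using a \<delta> by simp
    also have "\<dots> \<le> growth s * (cmod (orb r (of_real a) s) + L * k)" by (rule orb_upper(2)[OF rk(1-3) s0])
    also have "\<dots> \<le> G * (cmod (orb r (of_real a) s) + L * \<delta>^4)"
      using gs rk pos G growth_pos[of s] by (intro mult_mono add_mono) auto
    finally have "\<delta> / G \<le> cmod (orb r (of_real a) s) + (L * \<delta>^3) * \<delta>" using G by (simp add: field_simps power_numeral_reduce)
    moreover have "(L * \<delta>^3) * \<delta> \<le> c * \<delta>" using \<delta> by (intro mult_right_mono) auto
    moreover have "\<delta> / G = 2 * (c * \<delta>)" by (simp add: c_def)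
    ultimately show ?thesis using 1 by simp
  qed
  have in_d: "C * \<delta> < d" using \<delta> pos by simp
  have wb: "\<delta> / K \<le> cmod (wv r a s) \<and> cmod (wv r a s) \<le> K * \<delta>"
    if "path_near (\<delta>^4) r" "path_near \<kappa>1 r" "a \<in> {\<delta>..4 * \<delta>}" "s \<in> {0..S}" for r a s
  proof -
    note b = ball[OF that]
    have n: "cmod (orb r (of_real a) s) \<le> d" using b in_d by simp
    have "\<delta> / K \<le> l * (c * \<delta>)"
    proof -
      have "1 / K \<le> l * c" using K(1,3) lc by (simp add: field_simps)
      then have "1 / K * \<delta> \<le> l * c * \<delta>" using \<delta> by (intro mult_right_mono) auto
      then show ?thesis by simp
    qed
    also have "\<dots> \<le> l * cmod (orb r (of_real a) s)" using b par by (intro mult_left_mono) auto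
    also have "\<dots> \<le> cmod (wv r a s)" using W_low[OF n, of 0] pos by (simp add: W_0 wv_def)
    finally have 1: "\<delta> / K \<le> cmod (wv r a s)" .
    have "cmod (wv r a s) \<le> L * cmod (orb r (of_real a) s)" using W_lip[OF n, of 0] pos by (simp add: W_0 wv_def)
    also have "\<dots> \<le> L * (C * \<delta>)" using b pos by (intro mult_left_mono) auto
    also have "\<dots> \<le> K * \<delta>" using K(2) \<delta> mult_right_mono[of "L * C" K \<delta>] by simp
    finally show ?thesis using 1 by simp
  qed
  have dK: "\<delta> / K > 0" using \<delta> K by simp
  have der: "(wv r a has_vector_derivative wv r a s * (\<i> * of_real \<omega> + (\<i> * of_real (\<beta> * (cmod (wv r a s))\<^sup>2) + Q (r s) (orb r (of_real a) s)))) (at s within {0..S})"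
    if "path_near (\<delta>^4) r" "path_near \<kappa>1 r" "a \<in> {\<delta>..4 * \<delta>}" "s \<in> {0..S}" for r a s
    unfolding wv_def[abs_def]
    using ball[OF that] in_d wb[OF that] dK that by (intro W_orb_deriv) (auto simp: wv_def)
  have qb: "cmod (Q (r s) (orb r (of_real a) s)) \<le> K * \<delta>^3"
       "cmod (Q (r s) (orb r (of_real b) s) - Q (r s) (orb r (of_real a) s)) \<le> K * \<delta>\<^sup>2 * cmod (wv r b s - wv r a s)"
    if r: "path_near (\<delta>^4) r" "path_near \<kappa>1 r" and a: "a \<in> {\<delta>..4 * \<delta>}" and b: "b \<in> {\<delta>..4 * \<delta>}" and s: "s \<in> {0..S}" for r a b s
  proof -
    note Ba = ball[OF r a s] and Bb = ball[OF r b s]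
    have kq: "cmod (Q (r s) (orb r (of_real b) s)) \<le> Kq * \<delta>^3 \<and> cmod (Q (r s) (orb r (of_real b) s) - Q (r s) (orb r (of_real a) s)) \<le> Kq * \<delta>\<^sup>2 * cmod (orb r (of_real b) s - orb r (of_real a) s)" if "b \<in> {\<delta>..4 * \<delta>}" for b
      using ball[OF r that s] Ba in_d \<delta> path_nearD[OF r(1)] path_nearD[OF r(2)] by (intro Kq(2)) auto
    have "Kq * \<delta>^3 \<le> K * \<delta>^3" using K \<delta> by (intro mult_right_mono) auto
    then show "cmod (Q (r s) (orb r (of_real a) s)) \<le> K * \<delta>^3" using kq[OF a] by simp
    have "l * cmod (orb r (of_real b) s - orb r (of_real a) s) \<le> cmod (wv r b s - wv r a s)"
      unfolding wv_def using Ba Bb in_d by (intro W_low) auto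
    then have "cmod (orb r (of_real b) s - orb r (of_real a) s) \<le> cmod (wv r b s - wv r a s) / l" using par by (simp add: field_simps)
    then have "Kq * \<delta>\<^sup>2 * cmod (orb r (of_real b) s - orb r (of_real a) s) \<le> Kq * \<delta>\<^sup>2 * (cmod (wv r b s - wv r a s) / l)"
      using Kq(1) by (intro mult_left_mono) auto
    also have "\<dots> = (Kq / l) * (\<delta>\<^sup>2 * cmod (wv r b s - wv r a s))" by simp
    also have "\<dots> \<le> K * (\<delta>\<^sup>2 * cmod (wv r b s - wv r a s))" using K by (intro mult_right_mono) auto
    finally show "cmod (Q (r s) (orb r (of_real b) s) - Q (r s) (orb r (of_real a) s)) \<le> K * \<delta>\<^sup>2 * cmod (wv r b s - wv r a s)"
      using kq[OF b] by simp
  qed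
  have start: "wv r a 0 = of_real (Re (W (of_real a)))" "l * a \<le> Re (W (of_real a))" if "path_near \<kappa>1 r" "a \<in> {\<delta>..4 * \<delta>}" for r a
    using W_real[of a] W_mono[of 0 a] that \<delta> pos by (auto simp: wv_def orb_spec(1) complex_eq_iff W_0)
  have rot: "rotating (wv r a) (\<lambda>s. \<i> * of_real (\<beta> * (cmod (wv r a s))\<^sup>2) + Q (r s) (orb r (of_real a) s)) \<omega> (Re (W (of_real a))) \<eta> S"
    if r: "path_near (\<delta>^4) r" "path_near \<kappa>1 r" and a: "a \<in> {\<delta>..4 * \<delta>}" for r a
  proof
    have "l * \<delta> \<le> l * a" using a par by (intro mult_left_mono) auto
    then have lw: "l * \<delta> \<le> Re (W (of_real a))" using start(2)[OF r(2) a] by linarith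
    have "0 < l * \<delta>" using par \<delta> by simp
    then show "0 < Re (W (of_real a))" using lw by linarith
    show "S = 3 * pi / \<omega>" by (simp add: S_def)
    show "0 \<le> \<eta>" "\<eta> * S \<le> 1 / 8" "\<eta> \<le> \<omega> / 4" using \<delta>(6,7) A par by (auto simp: \<eta>_def mult_ac)
    fix s assume s: "s \<in> {0..S}"
    have "cmod (\<i> * of_real (\<beta> * (cmod (wv r a s))\<^sup>2) + Q (r s) (orb r (of_real a) s)) \<le> \<bar>\<beta>\<bar> * (K * \<delta>)\<^sup>2 + K * \<delta>\<^sup>2"
    proof -
      have "cmod (\<i> * of_real (\<beta> * (cmod (wv r a s))\<^sup>2) + Q (r s) (orb r (of_real a) s)) \<le> \<bar>\<beta> * (cmod (wv r a s))\<^sup>2\<bar> + cmod (Q (r s) (orb r (of_real a) s))"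
        using norm_triangle_ineq[of "\<i> * of_real (\<beta> * (cmod (wv r a s))\<^sup>2)" "Q (r s) (orb r (of_real a) s)"]
        by (simp only: norm_mult norm_ii norm_of_real mult_1)
      moreover have "(cmod (wv r a s))\<^sup>2 \<le> (K * \<delta>)\<^sup>2" using wb[OF r a s] by (intro power_mono) auto
      then have "\<bar>\<beta> * (cmod (wv r a s))\<^sup>2\<bar> \<le> \<bar>\<beta>\<bar> * (K * \<delta>)\<^sup>2" unfolding abs_mult by (intro mult_left_mono) auto
      moreover have "K * \<delta>^3 \<le> K * \<delta>\<^sup>2" using K \<delta> by (intro mult_left_mono power_decreasing) auto
      ultimately show ?thesis using qb(1)[OF r a a s] by linarith
    qed
    then have "cmod (wv r a s * (\<i> * of_real (\<beta> * (cmod (wv r a s))\<^sup>2) + Q (r s) (orb r (of_real a) s))) \<le> (K * \<delta>) * (\<bar>\<beta>\<bar> * (K * \<delta>)\<^sup>2 + K * \<delta>\<^sup>2)"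
      unfolding norm_mult using wb[OF r a s] K(1) \<delta>(1) by (intro mult_mono) auto
    also have "\<dots> = \<eta> * (l * \<delta>)" using par by (simp add: \<eta>_def A_def field_simps power_numeral_reduce)
    also have "\<dots> \<le> \<eta> * Re (W (of_real a))" using lw A par by (intro mult_left_mono) (auto simp: \<eta>_def)
    finally show "cmod (wv r a s * (\<i> * of_real (\<beta> * (cmod (wv r a s))\<^sup>2) + Q (r s) (orb r (of_real a) s))) \<le> \<eta> * Re (W (of_real a))" .
  qed (use par start(1)[OF r(2) a] der[OF r a] in auto)
  have tw: "Im (wv r b s * cnj (wv r a s)) \<le> - lam * (b - a) * s"
    if r: "path_near (\<delta>^4) r" "path_near \<kappa>1 r" and ab: "\<delta> \<le> a" "a \<le> b" "b \<le> 4 * \<delta>" and s: "s \<in> {0..S}" for r a b s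
  proof -
    have a: "a \<in> {\<delta>..4 * \<delta>}" and b: "b \<in> {\<delta>..4 * \<delta>}" using ab by auto
    interpret ra: rotating "wv r a" "\<lambda>s. \<i> * of_real (\<beta> * (cmod (wv r a s))\<^sup>2) + Q (r s) (orb r (of_real a) s)" \<omega> "Re (W (of_real a))" \<eta> S
      by (rule rot[OF r a])
    have mono: "l * (b - a) \<le> Re (W (of_real b)) - Re (W (of_real a))" using ab \<delta> pos by (intro W_mono) auto
    have le: "Re (W (of_real a)) \<le> Re (W (of_real b))" using mono ab par mult_nonneg_nonneg[of l "b - a"] by linarith
    have "Im (wv r b s * cnj (wv r a s)) \<le> - (\<bar>\<beta>\<bar> / (2 * K^5)) * \<delta>^3 * (Re (W (of_real b)) - Re (W (of_real a))) * s"
      by (rule twist_estimate[OF S_pos K(1) \<delta>(1,2) par(2) start(1)[OF r(2) a] start(1)[OF r(2) b] ra.w0 le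
            der[OF r a] der[OF r b] wb[OF r a] _ qb(2)[OF r a b] \<delta>(8,9,10) s]) (use wb[OF r b] in auto)
    also have "\<dots> \<le> - (\<bar>\<beta>\<bar> / (2 * K^5)) * \<delta>^3 * (l * (b - a)) * s"
    proof -
      have "(\<bar>\<beta>\<bar> / (2 * K^5)) * \<delta>^3 * (l * (b - a)) * s \<le> (\<bar>\<beta>\<bar> / (2 * K^5)) * \<delta>^3 * (Re (W (of_real b)) - Re (W (of_real a))) * s"
        using mono s K \<delta> by (intro mult_right_mono mult_left_mono) auto
      then show ?thesis by simp
    qed
    also have "\<dots> = - lam * (b - a) * s" by (simp add: lam_def)
    finally show ?thesis .
  qed
  have lam: "lam > 0" unfolding lam_def using K(1) \<delta>(1) par by (intro mult_pos_pos divide_pos_pos) auto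
  have eta: "0 \<le> \<eta>" "\<eta> * S \<le> l / (4 * L)" using \<delta>(6) A par by (auto simp: \<eta>_def mult_ac)
  have d4: "4 * \<delta> < d" using \<delta> pos by simp
  have inball: "cmod (orb r (of_real a) s) < d"
    if "path_near (\<delta>^4) r" "path_near \<kappa>1 r" "a \<in> {\<delta>..4 * \<delta>}" "s \<in> {0..S}" for r a s
    using ball[OF that] in_d by linarith
  have "\<forall>r. path_near (\<delta>^4) r \<longrightarrow> path_near \<kappa>1 r \<longrightarrow>
      (\<forall>a\<in>{\<delta>..4 * \<delta>}. (\<forall>s\<in>{0..S}. cmod (orb r (of_real a) s) < d) \<and>
        (\<exists>q. rotating (wv r a) q \<omega> (Re (W (of_real a))) \<eta> S)) \<and>
      (\<forall>a b s. \<delta> \<le> a \<longrightarrow> a \<le> b \<longrightarrow> b \<le> 4 * \<delta> \<longrightarrow> s \<in> {0..S} \<longrightarrow>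
        Im (wv r b s * cnj (wv r a s)) \<le> - lam * (b - a) * s)"
  proof (intro allI impI conjI ballI inball tw)
    fix r a assume "path_near (\<delta>^4) r" "path_near \<kappa>1 r" "a \<in> {\<delta>..4 * \<delta>}"
    then show "\<exists>q. rotating (wv r a) q \<omega> (Re (W (of_real a))) \<eta> S" using rot by blast
  qed
  then show ?thesis using \<delta>(1) eta lam d4 by blast
qed


lemma H_decreasing:
  assumes rho: "\<bar>\<rho> - r0\<bar> \<le> \<kappa>1" "L * \<bar>\<rho> - r0\<bar> \<le> l * a0 / 2" and ab: "0 < a0" "a0 \<le> a" "a \<le> b" "b \<le> d"
  shows "l * a0 / 2 * (b - a) \<le> H \<rho> (of_real a) - H \<rho> (of_real b)"
proof -
  have "l * a0 / 2 * (b - a) \<le> (\<lambda>t. - H \<rho> (of_real t)) b - (\<lambda>t. - H \<rho> (of_real t)) a"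
  proof (rule diff_ge_of_deriv_ge[OF ab(3)])
    fix t assume t: "t \<in> {a..b}"
    show "((\<lambda>t. - H \<rho> (of_real t)) has_real_derivative Im (V \<rho> (of_real t))) (at t within {a..b})"
      unfolding has_field_derivative_iff
    proof (subst Lim_null, rule Lim_null_comparison)
      show "((\<lambda>u. L * \<bar>u - t\<bar>) \<longlongrightarrow> 0) (at t within {a..b})" by (auto intro!: tendsto_eq_intros)
      show "\<forall>\<^sub>F u in at t within {a..b}. norm ((- H \<rho> (of_real u) - - H \<rho> (of_real t)) / (u - t) - Im (V \<rho> (of_real t))) \<le> L * \<bar>u - t\<bar>"
        unfolding eventually_at_filter
      proof (intro always_eventually allI impI)
        fix u assume u: "u \<noteq> t" "u \<in> {a..b}"
        have "\<bar>H \<rho> (of_real u) - H \<rho> (of_real t) - Im (cnj (V \<rho> (of_real t)) * (of_real u - of_real t))\<bar> \<le> L * (cmod (of_real u - of_real t))\<^sup>2"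
          using rho(1) t u ab by (intro H_grad) auto
        moreover have "Im (cnj (V \<rho> (of_real t)) * (of_real u - of_real t)) = - (Im (V \<rho> (of_real t)) * (u - t))"
          by (simp add: algebra_simps)
        moreover have "cmod (of_real u - of_real t :: complex) = \<bar>u - t\<bar>" by (simp flip: of_real_diff)
        ultimately have 1: "\<bar>(H \<rho> (of_real u) - H \<rho> (of_real t)) + Im (V \<rho> (of_real t)) * (u - t)\<bar> \<le> L * \<bar>u - t\<bar>\<^sup>2" by simp
        have "(- H \<rho> (of_real u) - - H \<rho> (of_real t)) / (u - t) - Im (V \<rho> (of_real t))
           = - ((H \<rho> (of_real u) - H \<rho> (of_real t)) + Im (V \<rho> (of_real t)) * (u - t)) / (u - t)"
          using u by (simp add: field_simps)
        also have "norm \<dots> \<le> L * \<bar>u - t\<bar>\<^sup>2 / \<bar>u - t\<bar>"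
          unfolding real_norm_def abs_divide abs_minus_cancel by (rule divide_right_mono[OF 1]) simp
        also have "\<dots> = L * \<bar>u - t\<bar>" unfolding power2_eq_square using u by (simp del: abs_mult_self_eq)
        finally show "norm ((- H \<rho> (of_real u) - - H \<rho> (of_real t)) / (u - t) - Im (V \<rho> (of_real t))) \<le> L * \<bar>u - t\<bar>" .
      qed
    qed
    have "cmod (V \<rho> (of_real t) - V r0 (of_real t)) \<le> L * \<bar>\<rho> - r0\<bar>" using rho t ab pos by (intro V_param) auto
    then have "\<bar>Im (V \<rho> (of_real t)) - Im (V r0 (of_real t))\<bar> \<le> l * a0 / 2"
      using abs_Im_le_cmod[of "V \<rho> (of_real t) - V r0 (of_real t)"] rho(2) by simp
    moreover have "l * a0 \<le> l * t" using t ab par by (intro mult_left_mono) auto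
    moreover have "l * t \<le> Im (V r0 (of_real t))" using t ab by (intro V_Im) auto
    ultimately show "l * a0 / 2 \<le> Im (V \<rho> (of_real t))" by linarith
  qed
  then show ?thesis by simp
qed

lemma Im_pos: 
  assumes "cmod x \<le> d" "0 < Im (W x)" shows "0 < Im x"
proof (rule ccontr)
  assume "\<not> 0 < Im x"
  moreover have "Im x \<noteq> 0"
  proof
    assume "Im x = 0"
    then have "x = of_real (Re x)" by (simp add: complex_eq_iff)
    then show False using W_real[of "Re x"] abs_Re_le_cmod[of x] assms by (metis less_irrefl order_trans)
  qed
  ultimately have "Im x < 0" by simp
  then have "Im x * Im (W x) < 0" using assms(2) by (simp add: mult_neg_pos)
  moreover have "0 \<le> l * (Im x)\<^sup>2" using par by simp
  ultimately show False using W_Im[OF assms(1)] by linarith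
qed

lemma Im_neg: 
  assumes "cmod x \<le> d" "Im (W x) < 0" shows "Im x < 0"
proof (rule ccontr)
  assume "\<not> Im x < 0"
  moreover have "Im x \<noteq> 0"
  proof
    assume "Im x = 0"
    then have "x = of_real (Re x)" by (simp add: complex_eq_iff)
    then show False using W_real[of "Re x"] abs_Re_le_cmod[of x] assms by (metis less_irrefl order_trans)
  qed
  ultimately have "Im x > 0" by simp
  then have "Im x * Im (W x) < 0" using assms(2) by (simp add: mult_pos_neg)
  moreover have "0 \<le> l * (Im x)\<^sup>2" using par by simp
  ultimately show False using W_Im[OF assms(1)] by linarith
qed

lemma W_pos_iff: "\<bar>x\<bar> \<le> d \<Longrightarrow> 0 < Re (W (of_real x)) \<longleftrightarrow> 0 < x"
proof -
  assume x: "\<bar>x\<bar> \<le> d"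
  show ?thesis
  proof
    assume "0 < x"
    then have "0 < l * (x - 0)" using par by simp
    then show "0 < Re (W (of_real x))" using W_mono[of 0 x] x pos \<open>0 < x\<close> by (simp add: W_0)
  next
    assume w: "0 < Re (W (of_real x))"
    show "0 < x"
    proof (rule ccontr)
      assume "\<not> 0 < x"
      then have "0 \<le> l * (0 - x)" "l * (0 - x) \<le> 0 - Re (W (of_real x))"
        using W_mono[of x 0] x par pos by (auto simp: W_0 mult_nonneg_nonpos)
      then show False using w by linarith
    qed
  qed
qed

end

context elliptic_field
begin

theorem ex_twist_section:
  "\<exists>a1 a4 lo hi lam \<kappa>0. twist_section V H r0 \<kappa>1 d L W a1 a4 lo hi lam \<kappa>0"
proof -
  obtain \<delta> \<eta> lm where \<delta>: "0 < \<delta>" "4 * \<delta> < d" and \<eta>: "\<eta> \<ge> 0" "\<eta> * S \<le> l / (4 * L)" and lm: "lm > 0"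
    and inb: "\<And>r a s. path_near (\<delta>^4) r \<Longrightarrow> path_near \<kappa>1 r \<Longrightarrow> a \<in> {\<delta>..4 * \<delta>} \<Longrightarrow> s \<in> {0..S} \<Longrightarrow> cmod (orb r (of_real a) s) < d"
    and rot: "\<And>r a. path_near (\<delta>^4) r \<Longrightarrow> path_near \<kappa>1 r \<Longrightarrow> a \<in> {\<delta>..4 * \<delta>} \<Longrightarrow> \<exists>q. rotating (wv r a) q \<omega> (Re (W (of_real a))) \<eta> S"
    and tw: "\<And>r a b s. path_near (\<delta>^4) r \<Longrightarrow> path_near \<kappa>1 r \<Longrightarrow> \<delta> \<le> a \<Longrightarrow> a \<le> b \<Longrightarrow> b \<le> 4 * \<delta> \<Longrightarrow> s \<in> {0..S} \<Longrightarrow>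
        Im (wv r b s * cnj (wv r a s)) \<le> - lm * (b - a) * s"
    using ex_scale by blast
  define k where "k = min (\<delta>^4) \<kappa>1"
  have k: "k > 0" "k \<le> \<kappa>1" using \<delta> pos by (auto simp: k_def)
  have kk: "path_near (\<delta>^4) r" "path_near \<kappa>1 r" if "path_near k r" for r
    using that path_near_mono[of k r] by (auto simp: k_def)
  define t1 where "t1 = rotating.t1 \<omega>"
  define t2 where "t2 = rotating.t2 \<omega>"
  let ?c = "\<lambda>_::real. r0"
  have c: "path_near k ?c" using k by (intro path_near_const) auto
  have w0: "l * a \<le> Re (W (of_real a))" "Re (W (of_real a)) \<le> L * a" if "a \<in> {\<delta>..4 * \<delta>}" for a
  proof -
    show "l * a \<le> Re (W (of_real a))" using W_mono[of 0 a] that \<delta> pos by (simp add: W_0)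
    have "cmod (W (of_real a) - W 0) \<le> L * cmod (of_real a - 0)" using that \<delta> pos by (intro W_lip) auto
    then show "Re (W (of_real a)) \<le> L * a" using complex_Re_le_cmod[of "W (of_real a)"] that \<delta> by (simp add: W_0)
  qed
  have "2 * \<delta> \<in> {\<delta>..4 * \<delta>}" using \<delta> by simp
  from rot[OF kk[OF c] this] obtain q2 where q2: "rotating (wv ?c (2 * \<delta>)) q2 \<omega> (Re (W (of_real (2 * \<delta>)))) \<eta> S" ..
  interpret c2: rotating "wv ?c (2 * \<delta>)" q2 \<omega> "Re (W (of_real (2 * \<delta>)))" \<eta> S by (rule q2)
  have win: "0 < t1" "t1 < t2" "t2 < S" unfolding t1_def t2_def by (rule c2.window)+
  have "continuous_on {0..S} (wv ?c (2 * \<delta>))" by (rule continuous_on_vector_derivative) (rule c2.der)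
  then have "continuous_on {t1..t2} (\<lambda>s. Im (wv ?c (2 * \<delta>) s))"
    using win by (intro continuous_on_Im) (auto elim: continuous_on_subset)
  then obtain ss where ss: "t1 \<le> ss" "ss \<le> t2" "Im (wv ?c (2 * \<delta>) ss) = 0"
    using IVT'[of "\<lambda>s. Im (wv ?c (2 * \<delta>) s)" t1 0 t2] c2.Im_ends win by (auto simp: t1_def t2_def)
  have ss': "t1 < ss" "ss < t2" using ss c2.Im_ends by (auto simp: t1_def t2_def less_le)
  have ssS: "ss \<in> {0..S}" using ss' win by auto
  define \<rho> where "\<rho> = Re (wv ?c (2 * \<delta>) ss)"
  have rho: "\<rho> > 0" using c2.Re_ge_window[of ss] ss c2.w0 by (auto simp: \<rho>_def t1_def t2_def)
  have wr: "wv ?c (2 * \<delta>) ss = of_real \<rho>" using ss by (simp add: \<rho>_def complex_eq_iff)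
  have up: "0 < Im (wv ?c (3 / 2 * \<delta>) ss)"
  proof -
    have "Im (of_real \<rho> * cnj (wv ?c (3 / 2 * \<delta>) ss)) \<le> - lm * (2 * \<delta> - 3 / 2 * \<delta>) * ss"
      using tw[OF kk[OF c], of "3 / 2 * \<delta>" "2 * \<delta>" ss] \<delta> ssS by (simp add: wr)
    moreover have "0 < lm * (2 * \<delta> - 3 / 2 * \<delta>) * ss" using lm \<delta> ss' win by simp
    ultimately have "0 < \<rho> * Im (wv ?c (3 / 2 * \<delta>) ss)" by simp
    then show ?thesis using rho by (simp add: zero_less_mult_iff)
  qed
  have dn: "Im (wv ?c (5 / 2 * \<delta>) ss) < 0"
  proof -
    have "Im (wv ?c (5 / 2 * \<delta>) ss * of_real \<rho>) \<le> - lm * (5 / 2 * \<delta> - 2 * \<delta>) * ss"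
      using tw[OF kk[OF c], of "2 * \<delta>" "5 / 2 * \<delta>" ss] \<delta> ssS by (simp add: wr)
    moreover have "0 < lm * (5 / 2 * \<delta> - 2 * \<delta>) * ss" using lm \<delta> ss' win by simp
    ultimately have "Im (wv ?c (5 / 2 * \<delta>) ss) * \<rho> < 0" by simp
    then show ?thesis using rho by (simp add: mult_less_0_iff)
  qed
  define \<theta> where "\<theta> = min (Im (wv ?c (3 / 2 * \<delta>) ss)) (- Im (wv ?c (5 / 2 * \<delta>) ss))"
  have th: "\<theta> > 0" using up dn by (simp add: \<theta>_def)
  have th_le: "\<theta> \<le> Im (wv ?c (3 / 2 * \<delta>) ss)" "\<theta> \<le> - Im (wv ?c (5 / 2 * \<delta>) ss)" by (simp_all add: \<theta>_def)
  define \<nu> where "\<nu> = min (\<theta> / (4 * L * L)) (min (ss - t1) (t2 - ss))"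
  define \<kappa>0 where "\<kappa>0 = min (\<theta> / (4 * L * L * growth S)) (min k (l * \<delta> / (2 * L)))"
  define lo where "lo = ss - \<nu>"
  define hi where "hi = ss + \<nu>"
  define lam where "lam = min (lm * t1) (min (\<omega> * (l * \<delta>) / 4) (l * \<delta> / 2))"
  have nu: "\<nu> > 0" "L * (L * \<nu>) \<le> \<theta> / 4"
    using th pos ss' by (auto simp: \<nu>_def min_def field_simps)
  have GS: "growth S > 0" by (rule growth_pos)
  have k0: "\<kappa>0 > 0" "L * (growth S * (L * \<kappa>0)) \<le> \<theta> / 4" "\<kappa>0 \<le> k" "L * \<kappa>0 \<le> l * \<delta> / 2"
  proof -
    show "\<kappa>0 > 0" using th pos GS k par \<delta> by (simp add: \<kappa>0_def)
    show "\<kappa>0 \<le> k" by (simp add: \<kappa>0_def)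
    have "\<kappa>0 \<le> \<theta> / (4 * L * L * growth S)" by (simp add: \<kappa>0_def)
    then show "L * (growth S * (L * \<kappa>0)) \<le> \<theta> / 4" using pos GS by (simp add: field_simps)
    have "\<kappa>0 \<le> l * \<delta> / (2 * L)" by (simp add: \<kappa>0_def)
    then show "L * \<kappa>0 \<le> l * \<delta> / 2" using pos by (simp add: field_simps)
  qed
  have lam: "lam > 0" "lam \<le> lm * t1" "lam \<le> \<omega> * (l * \<delta>) / 4" "lam \<le> l * \<delta> / 2"
    using lm win par \<delta> by (auto simp: lam_def)
  have lohi: "t1 \<le> lo" "lo < hi" "hi \<le> t2" "lo \<le> ss" "ss \<le> hi" using nu by (auto simp: lo_def hi_def \<nu>_def min_def)
  have kr: "path_near (\<delta>^4) r" "path_near \<kappa>1 r" "path_near k r" if "path_near \<kappa>0 r" for r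
    using kk path_near_mono[OF that k0(3)] by auto
  have close: "cmod (wv r a s - wv ?c a ss) \<le> \<theta> / 2"
    if r: "path_near \<kappa>0 r" and a: "a \<in> {\<delta>..4 * \<delta>}" and s: "s \<in> {lo..hi}" for r a s
  proof -
    have sS: "s \<in> {0..S}" using s lohi win by auto
    have "cmod (orb r (of_real a) s - orb ?c (of_real a) s) \<le> growth s * (cmod (of_real a - of_real a :: complex) + L * \<kappa>0)"
      using sS r k0 by (intro orb_compare kr kk[OF c]) (auto dest: path_nearD)
    also have "\<dots> \<le> growth S * (L * \<kappa>0)" using growth_mono[of s S] sS k0 pos by (simp add: mult_right_mono)
    finally have 1: "cmod (orb r (of_real a) s - orb ?c (of_real a) s) \<le> growth S * (L * \<kappa>0)" .
    have "cmod (orb ?c (of_real a) s - orb ?c (of_real a) ss) \<le> L * \<bar>s - ss\<bar>"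
      using sS ssS by (intro orb_time_lip kk[OF c]) auto
    also have "\<dots> \<le> L * \<nu>" using s pos by (intro mult_left_mono) (auto simp: lo_def hi_def abs_le_iff)
    finally have 2: "cmod (orb ?c (of_real a) s - orb ?c (of_real a) ss) \<le> L * \<nu>" .
    have "cmod (wv r a s - wv ?c a ss) \<le> L * cmod (orb r (of_real a) s - orb ?c (of_real a) ss)"
      unfolding wv_def using inb[OF kr(1,2)[OF r] a sS] inb[OF kk[OF c] a ssS] by (intro W_lip) auto
    also have "\<dots> \<le> L * (growth S * (L * \<kappa>0) + L * \<nu>)"
      using 1 2 norm_triangle_ineq[of "orb r (of_real a) s - orb ?c (of_real a) s" "orb ?c (of_real a) s - orb ?c (of_real a) ss"] pos
      by (intro mult_left_mono) auto
    also have "\<dots> = L * (growth S * (L * \<kappa>0)) + L * (L * \<nu>)" by (simp add: algebra_simps)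
    finally show ?thesis using k0(2) nu(2) by linarith
  qed
  have real_orb: "\<exists>x. orb r (of_real a) s = of_real x \<and> x = Re (orb r (of_real a) s) \<and> \<bar>x\<bar> \<le> d \<and> wv r a s = W (of_real x) \<and> Im (wv r a s) = 0"
    if r: "path_near \<kappa>0 r" and a: "a \<in> {\<delta>..4 * \<delta>}" and s: "s \<in> {0..S}" and z: "Im (orb r (of_real a) s) = 0" for r a s
  proof -
    define x where "x = Re (orb r (of_real a) s)"
    have x: "orb r (of_real a) s = of_real x" using z by (simp add: x_def complex_eq_iff)
    have "\<bar>x\<bar> \<le> d" using inb[OF kr(1,2)[OF r] a s] x by simp
    then show ?thesis using x W_real by (intro exI[of _ x]) (auto simp: wv_def)
  qed
  have pos_end: "0 < Re (orb r (of_real a) s)"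
    if r: "path_near \<kappa>0 r" and a: "a \<in> {\<delta>..4 * \<delta>}" and s: "s \<in> {lo..hi}" and z: "Im (orb r (of_real a) s) = 0" for r a s
  proof -
    have sS: "s \<in> {0..S}" using s lohi win by auto
    obtain q where q: "rotating (wv r a) q \<omega> (Re (W (of_real a))) \<eta> S" using rot[OF kr(1,2)[OF r] a] ..
    have "Re (W (of_real a)) / 2 \<le> Re (wv r a s)" "0 < Re (W (of_real a))"
      using rotating.Re_ge_window[OF q, of s] rotating.w0[OF q] s lohi by (auto simp: t1_def t2_def)
    then have "0 < Re (wv r a s)" by linarith
    then show ?thesis using real_orb[OF r a sS z] W_pos_iff by metis
  qed
  have "twist_section V H r0 \<kappa>1 d L W \<delta> (4 * \<delta>) lo hi lam \<kappa>0"
  proof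
    show "0 < \<delta>" "\<delta> < 4 * \<delta>" "4 * \<delta> \<le> d" "0 < lo" "lo < hi" "0 < lam" "0 < \<kappa>0" "\<kappa>0 \<le> \<kappa>1"
      using \<delta> lohi win lam k0 k by auto
    show "W 0 = 0" by (rule W_0)
    show "cmod (W x - W y) \<le> L * cmod (x - y)" if "cmod x \<le> d" "cmod y \<le> d" for x y using that by (rule W_lip)
    show "Im (W (of_real x)) = 0 \<and> 0 < Re (W (of_real x))" if "0 < x" "x \<le> d" for x
      using W_real[of x] W_pos_iff[of x] that by auto
    show "cmod (orb r (of_real a) s) < d" if "path_near \<kappa>0 r" "a \<in> {\<delta>..4 * \<delta>}" "s \<in> {0..hi}" for r a s
      using that lohi win by (intro inb kr) auto
    show "Im (W (orb r (of_real b) s) * cnj (W (orb r (of_real a) s))) \<le> - lam * (b - a)"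
      if "path_near \<kappa>0 r" "\<delta> \<le> a" "a \<le> b" "b \<le> 4 * \<delta>" "s \<in> {lo..hi}" for r a b s
    proof -
      have "Im (wv r b s * cnj (wv r a s)) \<le> - lm * (b - a) * s"
        using that lohi win by (intro tw kr) auto
      moreover have "lam * (b - a) \<le> lm * (b - a) * s"
      proof -
        have "lam * (b - a) \<le> lm * t1 * (b - a)" using lam that by (intro mult_right_mono) auto
        also have "\<dots> = lm * (b - a) * t1" by simp
        also have "\<dots> \<le> lm * (b - a) * s" using that lohi lm by (intro mult_left_mono) auto
        finally show ?thesis .
      qed
      ultimately show ?thesis by (simp add: wv_def)
    qed
    show "lam * (s' - s) \<le> Im (W (orb r (of_real a) s')) - Im (W (orb r (of_real a) s))"
      if "path_near \<kappa>0 r" "a \<in> {\<delta>..4 * \<delta>}" "lo \<le> s" "s \<le> s'" "s' \<le> hi" for r a s s'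
    proof -
      from rot[OF kr(1,2)[OF that(1)] that(2)]
      obtain q where q: "rotating (wv r a) q \<omega> (Re (W (of_real a))) \<eta> S" ..
      have "l * \<delta> \<le> l * a" using that par by (intro mult_left_mono) auto
      then have "l * \<delta> \<le> Re (W (of_real a))" using w0(1)[OF that(2)] by linarith
      then have "\<omega> * (l * \<delta>) / 4 \<le> \<omega> * Re (W (of_real a)) / 4" using par by simp
      then have "lam * (s' - s) \<le> \<omega> * Re (W (of_real a)) / 4 * (s' - s)" using lam that by (intro mult_right_mono) auto
      also have "\<dots> \<le> Im (wv r a s') - Im (wv r a s)"
        using that lohi by (intro rotating.Im_increasing_window[OF q]) (auto simp: t1_def t2_def)
      finally show ?thesis by (simp add: wv_def)
    qed
    show "0 < Re (orb r (of_real a) s)"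
      if "path_near \<kappa>0 r" "a \<in> {\<delta>..4 * \<delta>}" "s \<in> {lo..hi}" "Im (orb r (of_real a) s) = 0" for r a s
      using that by (rule pos_end)
    show "\<not> (Im (orb r (of_real a) s') = 0 \<and> Re (orb r (of_real a) s') > 0)"
      if "path_near \<kappa>0 r" "a \<in> {\<delta>..4 * \<delta>}" "s \<in> {lo..hi}" "Im (orb r (of_real a) s) = 0" "0 < s'" "s' < s" for r a s s'
    proof
      assume z: "Im (orb r (of_real a) s') = 0 \<and> Re (orb r (of_real a) s') > 0"
      from rot[OF kr(1,2)[OF that(1)] that(2)]
      obtain q where q: "rotating (wv r a) q \<omega> (Re (W (of_real a))) \<eta> S" ..
      have sS: "s \<in> {0..S}" "s' \<in> {0..S}" using that lohi win by auto
      have "Im (wv r a s) = 0" using real_orb[OF that(1,2) sS(1) that(4)] by auto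
      moreover have "Im (wv r a s') = 0 \<and> Re (wv r a s') > 0"
        using real_orb[OF that(1,2) sS(2)] z W_pos_iff by metis
      moreover have "s \<in> {rotating.t1 \<omega>..rotating.t2 \<omega>}" using that lohi by (auto simp: t1_def t2_def)
      ultimately show False using rotating.no_early_return[OF q, of s s'] that by auto
    qed
    show "lam * (b - a) \<le> H \<rho> (of_real a) - H \<rho> (of_real b)"
      if "\<bar>\<rho> - r0\<bar> \<le> \<kappa>0" "\<delta> \<le> a" "a \<le> b" "b \<le> 4 * \<delta>" for \<rho> a b
    proof -
      have "L * \<bar>\<rho> - r0\<bar> \<le> L * \<kappa>0" using that pos by (intro mult_left_mono) auto
      then have "l * \<delta> / 2 * (b - a) \<le> H \<rho> (of_real a) - H \<rho> (of_real b)"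
        using that k0 k \<delta> by (intro H_decreasing) auto
      moreover have "lam * (b - a) \<le> l * \<delta> / 2 * (b - a)" using lam that by (intro mult_right_mono) auto
      ultimately show ?thesis by linarith
    qed
    show "\<exists>a\<in>{\<delta>..4 * \<delta>}. Im (orb r (of_real a) s) = 0 \<and> Re (orb r (of_real a) s) \<in> {\<delta>..4 * \<delta>}"
      if r: "path_near \<kappa>0 r" and s: "s \<in> {lo..hi}" for r s
    proof -
      have sS: "s \<in> {0..S}" using s lohi win by auto
      have a32: "3 / 2 * \<delta> \<in> {\<delta>..4 * \<delta>}" and a52: "5 / 2 * \<delta> \<in> {\<delta>..4 * \<delta>}" using \<delta> by auto
      have Im_close: "\<bar>Im (wv r a s) - Im (wv ?c a ss)\<bar> \<le> \<theta> / 2" if "a \<in> {\<delta>..4 * \<delta>}" for a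
        using abs_Im_le_cmod[of "wv r a s - wv ?c a ss"] close[OF r that s] by simp
      have "0 < Im (wv r (3 / 2 * \<delta>) s)"
        using Im_close[OF a32] th th_le by linarith
      then have p: "0 < Im (orb r (of_real (3 / 2 * \<delta>)) s)"
        unfolding wv_def by (rule Im_pos[OF less_imp_le[OF inb[OF kr(1,2)[OF r] a32 sS]]])
      have "Im (wv r (5 / 2 * \<delta>) s) < 0"
        using Im_close[OF a52] th th_le by linarith
      then have n: "Im (orb r (of_real (5 / 2 * \<delta>)) s) < 0"
        unfolding wv_def by (rule Im_neg[OF less_imp_le[OF inb[OF kr(1,2)[OF r] a52 sS]]])
      have "continuous_on {3 / 2 * \<delta>..5 / 2 * \<delta>} (\<lambda>a. orb r (of_real a) s)"
      proof (rule continuous_on_of_lipschitz)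
        fix a b :: real
        show "cmod (orb r (of_real a) s - orb r (of_real b) s) \<le> growth s * \<bar>a - b\<bar>"
          using orb_lip[OF kr(2)[OF r], of s "of_real a" "of_real b"] sS by (simp flip: of_real_diff)
      qed
      then have "continuous_on {3 / 2 * \<delta>..5 / 2 * \<delta>} (\<lambda>a. Im (orb r (of_real a) s))" by (intro continuous_intros)
      then obtain a where a: "3 / 2 * \<delta> \<le> a" "a \<le> 5 / 2 * \<delta>" "Im (orb r (of_real a) s) = 0"
        using IVT2'[of "\<lambda>a. Im (orb r (of_real a) s)" "5 / 2 * \<delta>" 0 "3 / 2 * \<delta>"] p n \<delta> by (auto simp del: of_real_mult of_real_divide)
      have aI: "a \<in> {\<delta>..4 * \<delta>}" using a \<delta> by auto
      obtain x where x: "orb r (of_real a) s = of_real x" "\<bar>x\<bar> \<le> d" "wv r a s = W (of_real x)" "Im (wv r a s) = 0"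
        using real_orb[OF r aI sS a(3)] by blast
      have x0: "0 < x" using pos_end[OF r aI s a(3)] x by simp
      obtain q where q: "rotating (wv r a) q \<omega> (Re (W (of_real a))) \<eta> S" using rot[OF kr(1,2)[OF r] aI] ..
      have y0: "0 < Re (W (of_real x))" using W_pos_iff x x0 by simp
      have "cmod (wv r a s) = Re (W (of_real x))" using x y0 by (simp add: cmod_eq_Re)
      then have "\<bar>Re (W (of_real x)) - Re (W (of_real a))\<bar> \<le> \<eta> * S * Re (W (of_real a))"
        using rotating.norm_near[OF q sS] by simp
      also have "\<dots> \<le> l / (4 * L) * (L * a)"
        using \<eta> w0[OF aI] rotating.w0[OF q] aI \<delta> pos par by (intro mult_mono) auto
      also have "\<dots> = l * (a / 4)" using pos by simp
      finally have ye: "\<bar>Re (W (of_real x)) - Re (W (of_real a))\<bar> \<le> l * (a / 4)" .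
      have "\<bar>x - a\<bar> \<le> a / 4"
      proof (cases "x \<le> a")
        case True
        have "l * (a - x) \<le> Re (W (of_real a)) - Re (W (of_real x))" using True x x0 aI \<delta> by (intro W_mono) auto
        then have "l * (a - x) \<le> l * (a / 4)" using ye by linarith
        then show ?thesis using par True by simp
      next
        case False
        have "l * (x - a) \<le> Re (W (of_real x)) - Re (W (of_real a))" using False x x0 aI \<delta> by (intro W_mono) auto
        then have "l * (x - a) \<le> l * (a / 4)" using ye by linarith
        then show ?thesis using par False by simp
      qed
      then have "\<delta> \<le> x" "x \<le> 4 * \<delta>" using a \<delta> by linarith+
      then have "x \<in> {\<delta>..4 * \<delta>}" by simp
      then show ?thesis using aI a x by (intro bexI[of _ a]) auto
    qed
  qed
  then show ?thesis by blast
qed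

end

section \<open>Normal form at the vortex equilibrium\<close>

text \<open>The factor \<open>\<rho>\<close> on the left of the Lipschitz bound stands for the exponent \<open>k - 1\<close> on the right,
  which would be truncated for \<open>k = 0\<close>.\<close>

definition ordf :: "real \<Rightarrow> nat \<Rightarrow> (complex \<Rightarrow> complex) \<Rightarrow> bool" where
  "ordf d k f \<longleftrightarrow> (\<exists>M\<ge>0. \<forall>\<rho> x y. 0 < \<rho> \<longrightarrow> \<rho> \<le> d \<longrightarrow> cmod x \<le> \<rho> \<longrightarrow> cmod y \<le> \<rho> \<longrightarrow>
    cmod (f x) \<le> M * \<rho>^k \<and> \<rho> * cmod (f x - f y) \<le> M * \<rho>^k * cmod (x - y))"

lemma ordfI:
  assumes "0 \<le> M" "\<And>\<rho> x y. 0 < \<rho> \<Longrightarrow> \<rho> \<le> d \<Longrightarrow> cmod x \<le> \<rho> \<Longrightarrow> cmod y \<le> \<rho> \<Longrightarrow> cmod (f x) \<le> M * \<rho>^k"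
    "\<And>\<rho> x y. 0 < \<rho> \<Longrightarrow> \<rho> \<le> d \<Longrightarrow> cmod x \<le> \<rho> \<Longrightarrow> cmod y \<le> \<rho> \<Longrightarrow> \<rho> * cmod (f x - f y) \<le> M * \<rho>^k * cmod (x - y)"
  shows "ordf d k f"
  using assms unfolding ordf_def by blast

lemma ordfE:
  assumes "ordf d k f"
  obtains M where "0 \<le> M" "\<And>\<rho> x. 0 < \<rho> \<Longrightarrow> \<rho> \<le> d \<Longrightarrow> cmod x \<le> \<rho> \<Longrightarrow> cmod (f x) \<le> M * \<rho>^k"
    "\<And>\<rho> x y. 0 < \<rho> \<Longrightarrow> \<rho> \<le> d \<Longrightarrow> cmod x \<le> \<rho> \<Longrightarrow> cmod y \<le> \<rho> \<Longrightarrow> \<rho> * cmod (f x - f y) \<le> M * \<rho>^k * cmod (x - y)"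
  using assms unfolding ordf_def by blast

lemma ordf_add:
  assumes "ordf d k f" "ordf d k g" shows "ordf d k (\<lambda>x. f x + g x)"
proof -
  obtain M where M: "0 \<le> M" "\<And>\<rho> x. 0 < \<rho> \<Longrightarrow> \<rho> \<le> d \<Longrightarrow> cmod x \<le> \<rho> \<Longrightarrow> cmod (f x) \<le> M * \<rho>^k"
    "\<And>\<rho> x y. 0 < \<rho> \<Longrightarrow> \<rho> \<le> d \<Longrightarrow> cmod x \<le> \<rho> \<Longrightarrow> cmod y \<le> \<rho> \<Longrightarrow> \<rho> * cmod (f x - f y) \<le> M * \<rho>^k * cmod (x - y)"
    using ordfE[OF assms(1)] by blast
  obtain N where N: "0 \<le> N" "\<And>\<rho> x. 0 < \<rho> \<Longrightarrow> \<rho> \<le> d \<Longrightarrow> cmod x \<le> \<rho> \<Longrightarrow> cmod (g x) \<le> N * \<rho>^k"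
    "\<And>\<rho> x y. 0 < \<rho> \<Longrightarrow> \<rho> \<le> d \<Longrightarrow> cmod x \<le> \<rho> \<Longrightarrow> cmod y \<le> \<rho> \<Longrightarrow> \<rho> * cmod (g x - g y) \<le> N * \<rho>^k * cmod (x - y)"
    using ordfE[OF assms(2)] by blast
  show ?thesis
  proof (rule ordfI[of "M + N"])
    fix \<rho> x y assume a: "0 < \<rho>" "\<rho> \<le> d" "cmod x \<le> \<rho>" "cmod y \<le> \<rho>"
    show "cmod (f x + g x) \<le> (M + N) * \<rho>^k"
      using norm_triangle_ineq[of "f x" "g x"] M(2)[OF a(1-3)] N(2)[OF a(1-3)] by (simp add: algebra_simps)
    have "\<rho> * cmod (f x + g x - (f y + g y)) \<le> \<rho> * (cmod (f x - f y) + cmod (g x - g y))"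
      using norm_triangle_ineq[of "f x - f y" "g x - g y"] a by (intro mult_left_mono) (auto simp: algebra_simps)
    then show "\<rho> * cmod (f x + g x - (f y + g y)) \<le> (M + N) * \<rho>^k * cmod (x - y)"
      using M(3)[OF a] N(3)[OF a] by (simp add: algebra_simps)
  qed (use M N in auto)
qed

lemma ordf_mult:
  assumes "ordf d j f" "ordf d k g" shows "ordf d (j + k) (\<lambda>x. f x * g x)"
proof -
  obtain M where M: "0 \<le> M" "\<And>\<rho> x. 0 < \<rho> \<Longrightarrow> \<rho> \<le> d \<Longrightarrow> cmod x \<le> \<rho> \<Longrightarrow> cmod (f x) \<le> M * \<rho>^j"
    "\<And>\<rho> x y. 0 < \<rho> \<Longrightarrow> \<rho> \<le> d \<Longrightarrow> cmod x \<le> \<rho> \<Longrightarrow> cmod y \<le> \<rho> \<Longrightarrow> \<rho> * cmod (f x - f y) \<le> M * \<rho>^j * cmod (x - y)"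
    using ordfE[OF assms(1)] by blast
  obtain N where N: "0 \<le> N" "\<And>\<rho> x. 0 < \<rho> \<Longrightarrow> \<rho> \<le> d \<Longrightarrow> cmod x \<le> \<rho> \<Longrightarrow> cmod (g x) \<le> N * \<rho>^k"
    "\<And>\<rho> x y. 0 < \<rho> \<Longrightarrow> \<rho> \<le> d \<Longrightarrow> cmod x \<le> \<rho> \<Longrightarrow> cmod y \<le> \<rho> \<Longrightarrow> \<rho> * cmod (g x - g y) \<le> N * \<rho>^k * cmod (x - y)"
    using ordfE[OF assms(2)] by blast
  show ?thesis
  proof (rule ordfI[of "2 * M * N"])
    fix \<rho> x y assume a: "0 < \<rho>" "\<rho> \<le> d" "cmod x \<le> \<rho>" "cmod y \<le> \<rho>"
    have MN: "0 \<le> M * \<rho>^j" "0 \<le> N * \<rho>^k" using M N a by auto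
    have "cmod (f x * g x) \<le> (M * \<rho>^j) * (N * \<rho>^k)"
      unfolding norm_mult using M(2)[OF a(1-3)] N(2)[OF a(1-3)] MN by (intro mult_mono) auto
    also have "\<dots> \<le> 2 * ((M * \<rho>^j) * (N * \<rho>^k))" using mult_nonneg_nonneg[OF MN] by linarith
    finally show "cmod (f x * g x) \<le> 2 * M * N * \<rho>^(j + k)" by (simp add: power_add mult_ac)
    have "f x * g x - f y * g y = (f x - f y) * g x + f y * (g x - g y)" by (simp add: algebra_simps)
    then have "\<rho> * cmod (f x * g x - f y * g y) \<le> \<rho> * (cmod (f x - f y) * cmod (g x) + cmod (f y) * cmod (g x - g y))"
      using norm_triangle_ineq[of "(f x - f y) * g x" "f y * (g x - g y)"] a by (intro mult_left_mono) (auto simp: norm_mult)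
    also have "\<dots> = (\<rho> * cmod (f x - f y)) * cmod (g x) + cmod (f y) * (\<rho> * cmod (g x - g y))" by (simp add: algebra_simps)
    also have "\<dots> \<le> (M * \<rho>^j * cmod (x - y)) * (N * \<rho>^k) + (M * \<rho>^j) * (N * \<rho>^k * cmod (x - y))"
      using MN a by (intro add_mono mult_mono[OF M(3)[OF a] N(2)[OF a(1-3)]] mult_mono[OF M(2)[OF a(1,2,4)] N(3)[OF a]]) auto
    finally show "\<rho> * cmod (f x * g x - f y * g y) \<le> 2 * M * N * \<rho>^(j + k) * cmod (x - y)" by (simp add: power_add mult_ac)
  qed (use M N in auto)
qed

lemma ordf_const: "ordf d 0 (\<lambda>x. c)"
  by (rule ordfI[of "cmod c"]) auto

lemma ordf_cmult: "ordf d k f \<Longrightarrow> ordf d k (\<lambda>x. c * f x)"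
  using ordf_mult[OF ordf_const, of d k f c] by simp

lemma ordf_minus: "ordf d k f \<Longrightarrow> ordf d k (\<lambda>x. - f x)"
  using ordf_cmult[of d k f "-1"] by simp

lemma ordf_diff: "ordf d k f \<Longrightarrow> ordf d k g \<Longrightarrow> ordf d k (\<lambda>x. f x - g x)"
  using ordf_add[of d k f "\<lambda>x. - g x"] ordf_minus by simp

lemma ordf_cnj: "ordf d k f \<Longrightarrow> ordf d k (\<lambda>x. cnj (f x))"
  unfolding ordf_def by (simp add: complex_cnj_diff[symmetric] del: complex_cnj_diff)

lemma ordf_weaken:
  assumes "ordf d k f" "j \<le> k" "d \<le> 1" shows "ordf d j f"
proof -
  obtain M where M: "0 \<le> M" "\<And>\<rho> x. 0 < \<rho> \<Longrightarrow> \<rho> \<le> d \<Longrightarrow> cmod x \<le> \<rho> \<Longrightarrow> cmod (f x) \<le> M * \<rho>^k"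
    "\<And>\<rho> x y. 0 < \<rho> \<Longrightarrow> \<rho> \<le> d \<Longrightarrow> cmod x \<le> \<rho> \<Longrightarrow> cmod y \<le> \<rho> \<Longrightarrow> \<rho> * cmod (f x - f y) \<le> M * \<rho>^k * cmod (x - y)"
    using ordfE[OF assms(1)] by blast
  have p: "M * \<rho>^k \<le> M * \<rho>^j" if "0 < \<rho>" "\<rho> \<le> d" for \<rho>
    using that assms M by (intro mult_left_mono power_decreasing) auto
  show ?thesis
  proof (rule ordfI[OF M(1)])
    fix \<rho> x y assume a: "0 < \<rho>" "\<rho> \<le> d" "cmod x \<le> \<rho>" "cmod y \<le> \<rho>"
    show "cmod (f x) \<le> M * \<rho>^j" using M(2)[OF a(1-3)] p[OF a(1,2)] by linarith
    show "\<rho> * cmod (f x - f y) \<le> M * \<rho>^j * cmod (x - y)"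
      using M(3)[OF a] mult_right_mono[OF p[OF a(1,2)], of "cmod (x - y)"] by simp
  qed
qed

lemma ordf_linear:
  assumes "\<And>x y. f x - f y = f (x - y)" "\<And>x. cmod (f x) \<le> C * cmod x" shows "ordf d 1 f"
proof (rule ordfI[of "\<bar>C\<bar>"])
  have le: "cmod (f x) \<le> \<bar>C\<bar> * cmod x" for x
    using order_trans[OF assms(2) mult_right_mono[of C "\<bar>C\<bar>" "cmod x"]] by simp
  fix \<rho> x y assume a: "0 < \<rho>" "\<rho> \<le> d" "cmod x \<le> \<rho>" "cmod y \<le> \<rho>"
  show "cmod (f x) \<le> \<bar>C\<bar> * \<rho>^1" using le[of x] mult_left_mono[OF a(3), of "\<bar>C\<bar>"] by simp
  show "\<rho> * cmod (f x - f y) \<le> \<bar>C\<bar> * \<rho>^1 * cmod (x - y)"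
    using mult_left_mono[OF le[of "x - y"], of \<rho>] a by (simp add: assms(1) mult_ac)
qed auto

lemma ordf_id: "ordf d 1 (\<lambda>x. x)"
  by (rule ordf_linear[of _ 1]) auto

lemma ordf_power: "ordf d 1 f \<Longrightarrow> ordf d n (\<lambda>x. f x ^ n)"
proof (induction n)
  case (Suc n) then show ?case using ordf_mult[of d 1 f n "\<lambda>x. f x ^ n"] by simp
qed (simp add: ordf_const)

lemma ordf_inverse_affine:
  assumes "0 < d" "cmod u * d \<le> 1 / 2" shows "ordf d 0 (\<lambda>x. 1 / (1 + u * x))"
proof (rule ordfI[of "2"])
  have le: "1 / 2 \<le> cmod (1 + u * x)" if "cmod x \<le> d" for x
  proof -
    have "cmod (u * x) \<le> cmod u * d" unfolding norm_mult using that by (intro mult_left_mono) auto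
    moreover have "1 \<le> cmod (1 + u * x) + cmod (u * x)" using norm_triangle_ineq4[of "1 + u * x" "u * x"] by simp
    ultimately show ?thesis using assms by linarith
  qed
  fix \<rho> x y assume a: "0 < \<rho>" "\<rho> \<le> d" "cmod x \<le> \<rho>" "cmod y \<le> \<rho>"
  have x: "1 / 2 \<le> cmod (1 + u * x)" and y: "1 / 2 \<le> cmod (1 + u * y)" using le[OF order_trans[OF a(3,2)]] le[OF order_trans[OF a(4,2)]] by auto
  show "cmod (1 / (1 + u * x)) \<le> 2 * \<rho>^0" using x by (simp add: norm_divide divide_le_eq)
  have "1 + u * x \<noteq> 0" "1 + u * y \<noteq> 0" using x y by auto
  then have "1 / (1 + u * x) - 1 / (1 + u * y) = u * (y - x) / ((1 + u * x) * (1 + u * y))"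
    by (simp add: field_simps)
  then have "\<rho> * cmod (1 / (1 + u * x) - 1 / (1 + u * y)) = (\<rho> * cmod u) * cmod (x - y) / (cmod (1 + u * x) * cmod (1 + u * y))"
    by (simp add: norm_divide norm_mult norm_minus_commute)
  also have "\<dots> \<le> (1 / 2) * cmod (x - y) / ((1 / 2) * (1 / 2))"
  proof (intro frac_le mult_mono mult_right_mono)
    have "\<rho> * cmod u \<le> d * cmod u" using a by (intro mult_right_mono) auto
    then show "\<rho> * cmod u \<le> 1 / 2" using assms by (simp add: mult.commute)
  qed (use x y in auto)
  finally show "\<rho> * cmod (1 / (1 + u * x) - 1 / (1 + u * y)) \<le> 2 * \<rho>^0 * cmod (x - y)" by simp
qed auto

text \<open>The change of variable \<open>a + Q\<^sub>2 + Q\<^sub>3\<close> removes all quadratic and non-resonant cubic terms of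
  \<open>a' = i (w a + P\<^sub>2 + P\<^sub>3)\<close>; here \<open>b\<close> is the conjugate of \<open>a\<close>. The coefficients of the field are written in terms of those of the transformation, which makes the
  cancellation of all terms of degree at most three a polynomial identity.\<close>

lemma normal_form_identity:
  fixes a b w q20 q11 q02 s30 s12 s03 \<beta> p20 p11 p02 p30 p21 p12 p03 P2 P2' P3 P3' Q2 Q3 Q2a Q2b Q3a Q3b :: complex
  assumes p20_def: "p20 = - w * q20" and p11_def: "p11 = w * q11" and p02_def: "p02 = 3 * w * q02"
    and p30_def: "p30 = - 2 * w * s30 - 2 * q20 * p20 + q11 * p02"
    and p21_def: "p21 = \<beta> - 2 * q20 * p11 - q11 * p20 + q11 * p11 + 2 * q02 * p02"
    and p12_def: "p12 = 2 * w * s12 - 2 * q20 * p02 - q11 * p11 + q11 * p20 + 2 * q02 * p11"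
    and p03_def: "p03 = 4 * w * s03 - q11 * p02 + 2 * q02 * p20"
    and P2_def: "P2 = p20 * a^2 + p11 * (a * b) + p02 * b^2" and P2'_def: "P2' = p20 * b^2 + p11 * (a * b) + p02 * a^2"
    and P3_def: "P3 = p30 * a^3 + p21 * (a^2 * b) + p12 * (a * b^2) + p03 * b^3"
    and P3'_def: "P3' = p30 * b^3 + p21 * (b^2 * a) + p12 * (b * a^2) + p03 * a^3"
    and Q2_def: "Q2 = q20 * a^2 + q11 * (a * b) + q02 * b^2" and Q3_def: "Q3 = s30 * a^3 + s12 * (a * b^2) + s03 * b^3"
    and Q2a_def: "Q2a = 2 * q20 * a + q11 * b" and Q2b_def: "Q2b = q11 * a + 2 * q02 * b"
    and Q3a_def: "Q3a = 3 * s30 * a^2 + s12 * b^2" and Q3b_def: "Q3b = 2 * s12 * (a * b) + 3 * s03 * b^2"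
  shows "(1 + Q2a + Q3a) * (w * a + P2 + P3) - (Q2b + Q3b) * (w * b + P2' + P3') - w * (a + Q2 + Q3)
    = \<beta> * (a^2 * b) + (Q2a * P3 + Q3a * (P2 + P3) - Q2b * P3' - Q3b * (P2' + P3'))"
proof -
  have 2: "P2 + Q2a * (w * a) - Q2b * (w * b) - w * Q2 = 0"
    unfolding P2_def Q2a_def Q2b_def Q2_def p20_def p11_def p02_def by (simp add: algebra_simps power2_eq_square)
  have 3: "P3 + Q2a * P2 + Q3a * (w * a) - Q2b * P2' - Q3b * (w * b) - w * Q3 = \<beta> * (a^2 * b)"
    unfolding P3_def P2_def P2'_def Q2a_def Q2b_def Q3a_def Q3b_def Q3_def p30_def p21_def p12_def p03_def
    by (simp add: algebra_simps power2_eq_square power3_eq_cube)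
  have "(1 + Q2a + Q3a) * (w * a + P2 + P3) - (Q2b + Q3b) * (w * b + P2' + P3') - w * (a + Q2 + Q3)
    = (P2 + Q2a * (w * a) - Q2b * (w * b) - w * Q2) + (P3 + Q2a * P2 + Q3a * (w * a) - Q2b * P2' - Q3b * (w * b) - w * Q3)
      + (Q2a * P3 + Q3a * (P2 + P3) - Q2b * P3' - Q3b * (P2' + P3'))"
    by (simp add: algebra_simps)
  then show ?thesis unfolding 2 3 by simp
qed

lemma inverse_lip:
  fixes a b :: complex
  assumes "0 < \<mu>" "\<mu> \<le> cmod a" "\<mu> \<le> cmod b"
  shows "cmod (1 / a - 1 / b) \<le> cmod (a - b) / \<mu>\<^sup>2"
proof -
  have "a \<noteq> 0" "b \<noteq> 0" using assms by auto
  then have "1 / a - 1 / b = (b - a) / (a * b)" by (simp add: field_simps)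
  then have "cmod (1 / a - 1 / b) = cmod (a - b) / (cmod a * cmod b)" by (simp add: norm_divide norm_mult norm_minus_commute)
  also have "\<dots> \<le> cmod (a - b) / \<mu>\<^sup>2"
    unfolding power2_eq_square using assms by (intro divide_left_mono mult_mono mult_pos_pos) auto
  finally show ?thesis .
qed

lemma inverse_mixed:
  fixes a b s :: complex
  assumes m: "0 < \<mu>" "\<mu> \<le> cmod a" "\<mu> \<le> cmod b" "\<mu> \<le> cmod (a - s)" "\<mu> \<le> cmod (b - s)"
  shows "cmod ((1 / (a - s) - 1 / a) - (1 / (b - s) - 1 / b)) \<le> 2 / \<mu>^3 * cmod s * cmod (a - b)"
proof -
  have nz: "a \<noteq> 0" "b \<noteq> 0" "a - s \<noteq> 0" "b - s \<noteq> 0" using m by auto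
  have "(1 / (a - s) - 1 / a) - (1 / (b - s) - 1 / b)
      = s * (b - a) * (1 / (a * (a - s) * (b - s)) + 1 / (a * b * (b - s)))"
    using nz by (simp add: divide_simps) (simp add: algebra_simps)
  moreover have "cmod (1 / (a * (a - s) * (b - s))) \<le> 1 / \<mu>^3"
    unfolding norm_divide norm_mult power3_eq_cube norm_one using m by (intro divide_left_mono mult_mono mult_pos_pos) auto
  moreover have "cmod (1 / (a * b * (b - s))) \<le> 1 / \<mu>^3"
    unfolding norm_divide norm_mult power3_eq_cube norm_one using m by (intro divide_left_mono mult_mono mult_pos_pos) auto
  ultimately have "cmod ((1 / (a - s) - 1 / a) - (1 / (b - s) - 1 / b)) \<le> cmod s * cmod (b - a) * (1 / \<mu>^3 + 1 / \<mu>^3)"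
    using norm_triangle_ineq[of "1 / (a * (a - s) * (b - s))" "1 / (a * b * (b - s))"]
    by (simp only: norm_mult) (intro mult_left_mono, auto)
  then show ?thesis by (simp add: norm_minus_commute mult_ac)
qed

lemma ln_cmod_grad:
  fixes a h :: complex
  assumes "0 < \<mu>" "\<mu> \<le> cmod a" "cmod h \<le> \<mu> / 2"
  shows "\<bar>ln (cmod (a + h)) - ln (cmod a) - Re (h / a)\<bar> \<le> 2 / \<mu>\<^sup>2 * (cmod h)\<^sup>2"
proof -
  have a: "a \<noteq> 0" using assms by auto
  define z where "z = h / a"
  have zb: "cmod z \<le> cmod h / \<mu>" unfolding z_def norm_divide using assms by (intro divide_left_mono mult_pos_pos) auto
  also have "\<dots> \<le> 1 / 2" using assms by (simp add: field_simps)
  finally have z: "cmod z \<le> 1 / 2" .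
  have z1: "1 + z \<noteq> 0"
  proof
    assume "1 + z = 0"
    then have "z = - 1" by (simp add: add_eq_0_iff)
    then show False using z by simp
  qed
  have "a + h = a * (1 + z)" using a by (simp add: z_def field_simps)
  then have "ln (cmod (a + h)) = ln (cmod a) + ln (cmod (1 + z))"
    using a z1 by (simp add: norm_mult ln_mult)
  also have "ln (cmod (1 + z)) = Re (Ln (1 + z))" using z1 by simp
  finally have "ln (cmod (a + h)) - ln (cmod a) - Re (h / a) = Re (Ln (1 + z) - z)" by (simp add: z_def)
  then have "\<bar>ln (cmod (a + h)) - ln (cmod a) - Re (h / a)\<bar> \<le> cmod (Ln (1 + z) - z)"
    using abs_Re_le_cmod by metis
  also have "\<dots> \<le> (cmod z)\<^sup>2 / (1 - cmod z)" using z by (intro Ln_approx_linear) auto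
  also have "\<dots> \<le> (cmod h / \<mu>)\<^sup>2 / (1 / 2)" using zb z by (intro frac_le power_mono) auto
  finally show ?thesis by (simp add: power_divide mult.commute)
qed

lemma ln_lip:
  fixes a b :: real
  assumes "0 < \<mu>" "\<mu> \<le> a" "\<mu> \<le> b" shows "\<bar>ln a - ln b\<bar> \<le> \<bar>a - b\<bar> / \<mu>"
proof -
  have *: "ln a - ln b \<le> \<bar>a - b\<bar> / \<mu>" if "\<mu> \<le> a" "\<mu> \<le> b" for a b
  proof -
    have "ln a - ln b \<le> (a - b) / b" using that assms by (intro ln_diff_le) auto
    also have "\<dots> \<le> \<bar>a - b\<bar> / b" using that assms by (intro divide_right_mono) auto
    also have "\<dots> \<le> \<bar>a - b\<bar> / \<mu>" using that assms by (intro divide_left_mono mult_pos_pos) auto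
    finally show ?thesis .
  qed
  show ?thesis using *[of a b] *[of b a] assms by (auto simp: abs_le_iff abs_minus_commute)
qed

locale vortex_center =
  fixes R r0 k \<theta> c :: real
  assumes r0: "0 < r0" "r0 < R" and theta: "\<theta> > 0" and k: "k \<noteq> 0"
    and c: "\<bar>c\<bar> < R" "c < r0"
    and equil: "\<theta> * c = k * (1 / (c - r0) - 1 / (c - R\<^sup>2 / r0))"
    and ellip: "\<bar>k\<bar> * ((1 / (c - r0))\<^sup>2 - (1 / (c - R\<^sup>2 / r0))\<^sup>2) < \<theta>"
begin

definition V :: "real \<Rightarrow> complex \<Rightarrow> complex" where
  "V \<rho> x = \<i> * (of_real \<theta> * (of_real c + x)
     - of_real k * cnj (1 / (of_real c + x - of_real \<rho>) - 1 / (of_real c + x - of_real (R\<^sup>2 / \<rho>))))"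

definition H :: "real \<Rightarrow> complex \<Rightarrow> real" where
  "H \<rho> x = - (\<theta> / 2) * (cmod (of_real c + x))\<^sup>2
     + k * (ln (cmod (of_real c + x - of_real \<rho>)) - ln (cmod (of_real c + x - of_real (R\<^sup>2 / \<rho>))))"

definition \<mu> :: real where "\<mu> = (r0 - c) / 2"
definition d0 :: real where "d0 = \<mu> / 4"
definition \<kappa>1 :: real where "\<kappa>1 = min (r0 / 2) (min (\<mu> / 2) (\<mu> * r0\<^sup>2 / (8 * R\<^sup>2)))"
definition K1 :: real where "K1 = 1 + 4 * R\<^sup>2 / r0\<^sup>2"

lemma constants_pos: "\<mu> > 0" "d0 > 0" "\<kappa>1 > 0" "K1 > 0"
  using r0 c by (auto simp: \<mu>_def d0_def \<kappa>1_def K1_def add_pos_nonneg)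

lemma image_lip:
  assumes "\<bar>\<rho> - r0\<bar> \<le> \<kappa>1" "\<bar>\<sigma> - r0\<bar> \<le> \<kappa>1"
  shows "\<bar>R\<^sup>2 / \<rho> - R\<^sup>2 / \<sigma>\<bar> \<le> 4 * R\<^sup>2 / r0\<^sup>2 * \<bar>\<rho> - \<sigma>\<bar>"
proof -
  have k: "\<kappa>1 \<le> r0 / 2" by (simp add: \<kappa>1_def)
  have p: "r0 / 2 \<le> \<rho>" "r0 / 2 \<le> \<sigma>" using assms k by (auto simp: abs_le_iff)
  have "R\<^sup>2 / \<rho> - R\<^sup>2 / \<sigma> = R\<^sup>2 * (\<sigma> - \<rho>) / (\<rho> * \<sigma>)" using p r0 by (simp add: field_simps)
  then have "\<bar>R\<^sup>2 / \<rho> - R\<^sup>2 / \<sigma>\<bar> = R\<^sup>2 * \<bar>\<rho> - \<sigma>\<bar> / (\<rho> * \<sigma>)" using p r0 by (simp add: abs_mult abs_minus_commute)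
  also have "\<dots> \<le> R\<^sup>2 * \<bar>\<rho> - \<sigma>\<bar> / ((r0 / 2) * (r0 / 2))" using p r0 by (intro divide_left_mono mult_mono mult_pos_pos) auto
  finally show ?thesis by (simp add: power2_eq_square field_simps)
qed

lemma far_from_vortices:
  assumes x: "cmod x \<le> d0" and rho: "\<bar>\<rho> - r0\<bar> \<le> \<kappa>1"
  shows "\<mu> \<le> cmod (of_real c + x - of_real \<rho>)" "\<mu> \<le> cmod (of_real c + x - of_real (R\<^sup>2 / \<rho>))"
proof -
  have "\<kappa>1 \<le> \<mu> / 2" by (simp add: \<kappa>1_def)
  then have 1: "\<bar>\<rho> - r0\<bar> \<le> \<mu> / 2" using rho by simp
  have "\<kappa>1 \<le> \<mu> * r0\<^sup>2 / (8 * R\<^sup>2)" by (simp add: \<kappa>1_def)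
  then have "4 * R\<^sup>2 / r0\<^sup>2 * \<kappa>1 \<le> \<mu> / 2" using r0 by (simp add: field_simps)
  moreover have "4 * R\<^sup>2 / r0\<^sup>2 * \<bar>\<rho> - r0\<bar> \<le> 4 * R\<^sup>2 / r0\<^sup>2 * \<kappa>1" using rho by (intro mult_left_mono) auto
  ultimately have 2: "\<bar>R\<^sup>2 / \<rho> - R\<^sup>2 / r0\<bar> \<le> \<mu> / 2"
    using image_lip[OF rho, of r0] constants_pos by simp
  have g: "2 * \<mu> \<le> R\<^sup>2 / r0 - c"
  proof -
    have "r0 * r0 \<le> R * R" using r0 by (intro mult_mono) auto
    then have "r0 \<le> R\<^sup>2 / r0" using r0 by (simp add: field_simps power2_eq_square)
    moreover have "2 * \<mu> = r0 - c" by (simp add: \<mu>_def)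
    ultimately show ?thesis by simp
  qed
  have *: "\<mu> \<le> cmod (of_real c + x - of_real s)" if s: "2 * \<mu> \<le> s0 - c" "\<bar>s - s0\<bar> \<le> \<mu> / 2" for s s0
  proof -
    have "\<bar>c - s\<bar> \<ge> 2 * \<mu> - \<mu> / 2" using s by linarith
    have "cmod (of_real (c - s)) \<le> cmod (of_real c + x - of_real s) + cmod x"
      using norm_triangle_ineq4[of "of_real c + x - of_real s" x] by (simp add: algebra_simps)
    then have "\<bar>c - s\<bar> \<le> cmod (of_real c + x - of_real s) + cmod x" by (simp only: norm_of_real)
    moreover have "cmod x \<le> \<mu> / 4" using x by (simp add: d0_def)
    ultimately show ?thesis using \<open>\<bar>c - s\<bar> \<ge> 2 * \<mu> - \<mu> / 2\<close> constants_pos by linarith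
  qed
  show "\<mu> \<le> cmod (of_real c + x - of_real \<rho>)" by (rule *[OF _ 1]) (simp add: \<mu>_def)
  show "\<mu> \<le> cmod (of_real c + x - of_real (R\<^sup>2 / \<rho>))" by (rule *[OF g 2])
qed

definition L0 :: real where
  "L0 = (\<theta> * (R + d0) + \<bar>k\<bar> * (2 / \<mu>)) + (\<theta> + \<bar>k\<bar> * (2 / \<mu>\<^sup>2)) + \<bar>k\<bar> * (K1 / \<mu>\<^sup>2)
     + (\<theta> / 2 + \<bar>k\<bar> * (4 / \<mu>\<^sup>2)) + \<bar>k\<bar> * (K1 / \<mu>) + \<bar>k\<bar> * (2 / \<mu>^3 * K1)"

lemma L0_parts:
  "\<theta> * (R + d0) + \<bar>k\<bar> * (2 / \<mu>) \<le> L0" "\<theta> + \<bar>k\<bar> * (2 / \<mu>\<^sup>2) \<le> L0" "\<bar>k\<bar> * (K1 / \<mu>\<^sup>2) \<le> L0"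
  "\<theta> / 2 + \<bar>k\<bar> * (4 / \<mu>\<^sup>2) \<le> L0" "\<bar>k\<bar> * (K1 / \<mu>) \<le> L0" "\<bar>k\<bar> * (2 / \<mu>^3 * K1) \<le> L0"
proof -
  have "0 \<le> \<theta> * (R + d0) + \<bar>k\<bar> * (2 / \<mu>)" "0 \<le> \<theta> + \<bar>k\<bar> * (2 / \<mu>\<^sup>2)" "0 \<le> \<bar>k\<bar> * (K1 / \<mu>\<^sup>2)"
    "0 \<le> \<theta> / 2 + \<bar>k\<bar> * (4 / \<mu>\<^sup>2)" "0 \<le> \<bar>k\<bar> * (K1 / \<mu>)" "0 \<le> \<bar>k\<bar> * (2 / \<mu>^3 * K1)"
    using constants_pos theta r0 by (auto intro!: add_nonneg_nonneg mult_nonneg_nonneg)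
  then show "\<theta> * (R + d0) + \<bar>k\<bar> * (2 / \<mu>) \<le> L0" "\<theta> + \<bar>k\<bar> * (2 / \<mu>\<^sup>2) \<le> L0" "\<bar>k\<bar> * (K1 / \<mu>\<^sup>2) \<le> L0"
  "\<theta> / 2 + \<bar>k\<bar> * (4 / \<mu>\<^sup>2) \<le> L0" "\<bar>k\<bar> * (K1 / \<mu>) \<le> L0" "\<bar>k\<bar> * (2 / \<mu>^3 * K1) \<le> L0"
    unfolding L0_def by linarith+
qed

lemma norm_V_diff:
  "cmod (V \<rho> x - V \<sigma> y) \<le> \<theta> * cmod (x - y) + \<bar>k\<bar> * (cmod (1 / (of_real c + x - of_real \<rho>) - 1 / (of_real c + y - of_real \<sigma>))
    + cmod (1 / (of_real c + x - of_real (R\<^sup>2 / \<rho>)) - 1 / (of_real c + y - of_real (R\<^sup>2 / \<sigma>))))"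
proof -
  define a1 where "a1 = 1 / (of_real c + x - of_real \<rho>)"
  define a2 where "a2 = 1 / (of_real c + y - of_real \<sigma>)"
  define b1 where "b1 = 1 / (of_real c + x - of_real (R\<^sup>2 / \<rho>))"
  define b2 where "b2 = 1 / (of_real c + y - of_real (R\<^sup>2 / \<sigma>))"
  have "V \<rho> x - V \<sigma> y = \<i> * (of_real \<theta> * (x - y) - of_real k * cnj ((a1 - a2) - (b1 - b2)))"
    unfolding V_def a1_def[symmetric] a2_def[symmetric] b1_def[symmetric] b2_def[symmetric] by (simp add: algebra_simps)
  then have "cmod (V \<rho> x - V \<sigma> y) = cmod (of_real \<theta> * (x - y) - of_real k * cnj ((a1 - a2) - (b1 - b2)))"
    by (simp only: norm_mult norm_ii mult_1)
  also have "\<dots> \<le> cmod (of_real \<theta> * (x - y)) + cmod (of_real k * cnj ((a1 - a2) - (b1 - b2)))" by (rule norm_triangle_ineq4)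
  also have "cmod (of_real \<theta> * (x - y)) = \<theta> * cmod (x - y)" using theta by (simp add: norm_mult)
  also have "cmod (of_real k * cnj ((a1 - a2) - (b1 - b2))) = \<bar>k\<bar> * cmod ((a1 - a2) - (b1 - b2))"
    unfolding norm_mult complex_mod_cnj norm_of_real ..
  also have "\<dots> \<le> \<bar>k\<bar> * (cmod (a1 - a2) + cmod (b1 - b2))" by (intro mult_left_mono norm_triangle_ineq4) auto
  finally show ?thesis by (simp add: a1_def a2_def b1_def b2_def)
qed

lemma V_mixed0:
  assumes rho: "\<bar>\<rho> - r0\<bar> \<le> \<kappa>1" and x: "cmod x \<le> d0" and y: "cmod y \<le> d0"
  shows "cmod ((V \<rho> x - V r0 x) - (V \<rho> y - V r0 y)) \<le> L0 * \<bar>\<rho> - r0\<bar> * cmod (x - y)"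
proof -
  have r: "\<bar>r0 - r0\<bar> \<le> \<kappa>1" using constants_pos by simp
  define ax where "ax = of_real c + x - of_real r0"
  define ay where "ay = of_real c + y - of_real r0"
  define s where "s = complex_of_real (\<rho> - r0)"
  define bx where "bx = of_real c + x - of_real (R\<^sup>2 / r0)"
  define bw where "bw = of_real c + y - of_real (R\<^sup>2 / r0)"
  define s' where "s' = complex_of_real (R\<^sup>2 / \<rho> - R\<^sup>2 / r0)"
  have e: "of_real c + x - of_real \<rho> = ax - s" "of_real c + y - of_real \<rho> = ay - s"
    "of_real c + x - of_real (R\<^sup>2 / \<rho>) = bx - s'" "of_real c + y - of_real (R\<^sup>2 / \<rho>) = bw - s'"
    unfolding ax_def ay_def s_def bx_def bw_def s'_def by (simp_all only: of_real_diff) (simp_all add: algebra_simps)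
  have fx: "\<mu> \<le> cmod ax" "\<mu> \<le> cmod bx" "\<mu> \<le> cmod (ax - s)" "\<mu> \<le> cmod (bx - s')"
    using far_from_vortices[OF x r] far_from_vortices[OF x rho] unfolding e by (auto simp: ax_def bx_def)
  have fy: "\<mu> \<le> cmod ay" "\<mu> \<le> cmod bw" "\<mu> \<le> cmod (ay - s)" "\<mu> \<le> cmod (bw - s')"
    using far_from_vortices[OF y r] far_from_vortices[OF y rho] unfolding e by (auto simp: ay_def bw_def)
  define U where "U = ((1 / (ax - s) - 1 / ax) - (1 / (ay - s) - 1 / ay))"
  define U' where "U' = ((1 / (bx - s') - 1 / bx) - (1 / (bw - s') - 1 / bw))"
  have "(V \<rho> x - V r0 x) - (V \<rho> y - V r0 y) = - (\<i> * (of_real k * cnj (U - U')))"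
    unfolding V_def e ax_def[symmetric] ay_def[symmetric] bx_def[symmetric] bw_def[symmetric] U_def U'_def
    by (simp add: algebra_simps)
  then have "cmod ((V \<rho> x - V r0 x) - (V \<rho> y - V r0 y)) = \<bar>k\<bar> * cmod (U - U')"
    by (simp only: norm_minus_cancel norm_mult norm_ii mult_1 complex_mod_cnj norm_of_real)
  also have "\<dots> \<le> \<bar>k\<bar> * (2 / \<mu>^3 * cmod s * cmod (ax - ay) + 2 / \<mu>^3 * cmod s' * cmod (bx - bw))"
    using inverse_mixed[OF constants_pos(1) fx(1) fy(1) fx(3) fy(3)] inverse_mixed[OF constants_pos(1) fx(2) fy(2) fx(4) fy(4)]
    by (intro mult_left_mono order_trans[OF norm_triangle_ineq4] add_mono) (auto simp: U_def U'_def)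
  also have "ax - ay = x - y" by (simp add: ax_def ay_def)
  also have "bx - bw = x - y" by (simp add: bx_def bw_def)
  also have "\<bar>k\<bar> * (2 / \<mu>^3 * cmod s * cmod (x - y) + 2 / \<mu>^3 * cmod s' * cmod (x - y)) = \<bar>k\<bar> * (2 / \<mu>^3 * ((cmod s + cmod s') * cmod (x - y)))"
    by (simp add: algebra_simps)
  also have "\<dots> \<le> \<bar>k\<bar> * (2 / \<mu>^3 * ((K1 * \<bar>\<rho> - r0\<bar>) * cmod (x - y)))"
  proof -
    have "cmod s + cmod s' \<le> K1 * \<bar>\<rho> - r0\<bar>"
      unfolding s_def s'_def norm_of_real using image_lip[OF rho r] by (simp add: K1_def algebra_simps)
    then show ?thesis using constants_pos by (intro mult_left_mono mult_right_mono) auto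
  qed
  also have "\<dots> = \<bar>k\<bar> * (2 / \<mu>^3 * K1) * (\<bar>\<rho> - r0\<bar> * cmod (x - y))" by simp
  also have "\<dots> \<le> L0 * (\<bar>\<rho> - r0\<bar> * cmod (x - y))" using L0_parts(6) by (intro mult_right_mono) auto
  finally show ?thesis by simp
qed

lemma H_grad0:
  assumes rho: "\<bar>\<rho> - r0\<bar> \<le> \<kappa>1" and x: "cmod x \<le> d0" and y: "cmod y \<le> d0"
  shows "\<bar>H \<rho> y - H \<rho> x - Im (cnj (V \<rho> x) * (y - x))\<bar> \<le> L0 * (cmod (y - x))\<^sup>2"
proof -
  define \<eta> where "\<eta> = of_real c + x"
  define h where "h = y - x"
  define a where "a = \<eta> - of_real \<rho>"
  define b where "b = \<eta> - of_real (R\<^sup>2 / \<rho>)"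
  have h: "cmod h \<le> \<mu> / 2" using norm_triangle_ineq4[of y x] x y by (simp add: h_def d0_def)
  have ab: "\<mu> \<le> cmod a" "\<mu> \<le> cmod b" using far_from_vortices[OF x rho] by (auto simp: a_def b_def \<eta>_def)
  have e: "of_real c + y = \<eta> + h" "of_real c + y - of_real \<rho> = a + h" "of_real c + y - of_real (R\<^sup>2 / \<rho>) = b + h"
    by (simp_all add: \<eta>_def h_def a_def b_def)
  have sq: "(cmod (\<eta> + h))\<^sup>2 = (cmod \<eta>)\<^sup>2 + 2 * Re (cnj \<eta> * h) + (cmod h)\<^sup>2"
    unfolding cmod_power2 by (simp add: power2_eq_square algebra_simps)
  have "cnj (V \<rho> x) = - \<i> * (of_real \<theta> * cnj \<eta> - of_real k * (1 / a - 1 / b))"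
    by (simp add: V_def \<eta>_def a_def b_def)
  then have im: "Im (cnj (V \<rho> x) * h) = - \<theta> * Re (cnj \<eta> * h) + k * (Re (h / a) - Re (h / b))"
  proof -
    assume 0: "cnj (V \<rho> x) = - \<i> * (of_real \<theta> * cnj \<eta> - of_real k * (1 / a - 1 / b))"
    have "cnj (V \<rho> x) * h = - (\<i> * (of_real \<theta> * (cnj \<eta> * h) - of_real k * (h / a - h / b)))"
      unfolding 0 by (simp add: algebra_simps)
    then show ?thesis by simp
  qed
  have "H \<rho> y - H \<rho> x - Im (cnj (V \<rho> x) * h) = - (\<theta> / 2) * (cmod h)\<^sup>2
     + k * ((ln (cmod (a + h)) - ln (cmod a) - Re (h / a)) - (ln (cmod (b + h)) - ln (cmod b) - Re (h / b)))"
    unfolding im H_def e(2,3) unfolding e(1) sq unfolding \<eta>_def[symmetric] a_def[symmetric] b_def[symmetric]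
    by (simp add: algebra_simps)
  also have "\<bar>\<dots>\<bar> \<le> \<theta> / 2 * (cmod h)\<^sup>2 + \<bar>k\<bar> * (2 / \<mu>\<^sup>2 * (cmod h)\<^sup>2 + 2 / \<mu>\<^sup>2 * (cmod h)\<^sup>2)"
  proof -
    have "\<bar>k * ((ln (cmod (a + h)) - ln (cmod a) - Re (h / a)) - (ln (cmod (b + h)) - ln (cmod b) - Re (h / b)))\<bar>
      \<le> \<bar>k\<bar> * (2 / \<mu>\<^sup>2 * (cmod h)\<^sup>2 + 2 / \<mu>\<^sup>2 * (cmod h)\<^sup>2)"
      unfolding abs_mult using ln_cmod_grad[OF constants_pos(1) ab(1) h] ln_cmod_grad[OF constants_pos(1) ab(2) h]
      by (intro mult_left_mono order_trans[OF abs_triangle_ineq4 add_mono]) auto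
    moreover have "\<bar>- (\<theta> / 2) * (cmod h)\<^sup>2\<bar> = \<theta> / 2 * (cmod h)\<^sup>2" using theta by (simp add: abs_mult)
    ultimately show ?thesis by linarith
  qed
  also have "\<dots> = (\<theta> / 2 + \<bar>k\<bar> * (4 / \<mu>\<^sup>2)) * (cmod h)\<^sup>2" by (simp add: algebra_simps)
  also have "\<dots> \<le> L0 * (cmod h)\<^sup>2" using L0_parts(4) by (intro mult_right_mono) auto
  finally show ?thesis by (simp add: h_def)
qed

lemma reversible:
  assumes d: "0 < d" "d \<le> d0" and L: "L0 \<le> L"
  shows "reversible_field V H r0 \<kappa>1 d L"
proof
  have "0 < \<theta> + \<bar>k\<bar> * (2 / \<mu>\<^sup>2)" using theta constants_pos by (intro add_pos_nonneg) auto
  then have L0: "0 < L0" using L0_parts(2) by linarith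
  show "0 < \<kappa>1" "0 < d" "0 < L" using constants_pos d L L0 by auto
  show "cmod (V \<rho> x) \<le> L" if rho: "\<bar>\<rho> - r0\<bar> \<le> \<kappa>1" and x: "cmod x \<le> d" for \<rho> x
  proof -
    have x0: "cmod x \<le> d0" using x d by simp
    have 1: "cmod (1 / (of_real c + x - of_real \<rho>)) \<le> 1 / \<mu>" "cmod (1 / (of_real c + x - of_real (R\<^sup>2 / \<rho>))) \<le> 1 / \<mu>"
      unfolding norm_divide norm_one using far_from_vortices[OF x0 rho] constants_pos by (intro divide_left_mono mult_pos_pos; force)+
    have "cmod (V \<rho> x) = cmod (of_real \<theta> * (of_real c + x) - of_real k * cnj (1 / (of_real c + x - of_real \<rho>) - 1 / (of_real c + x - of_real (R\<^sup>2 / \<rho>))))"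
      unfolding V_def norm_mult norm_ii mult_1 ..
    also have "\<dots> \<le> cmod (of_real \<theta> * (of_real c + x)) + cmod (of_real k * cnj (1 / (of_real c + x - of_real \<rho>) - 1 / (of_real c + x - of_real (R\<^sup>2 / \<rho>))))"
      by (rule norm_triangle_ineq4)
    also have "\<dots> \<le> \<theta> * (R + d0) + \<bar>k\<bar> * (1 / \<mu> + 1 / \<mu>)"
    proof (rule add_mono)
      have "cmod (of_real c + x) \<le> R + d0" using norm_triangle_ineq[of "of_real c" x] c x0 by simp
      then show "cmod (of_real \<theta> * (of_real c + x)) \<le> \<theta> * (R + d0)" unfolding norm_mult using theta by (simp add: mult_left_mono)
      show "cmod (of_real k * cnj (1 / (of_real c + x - of_real \<rho>) - 1 / (of_real c + x - of_real (R\<^sup>2 / \<rho>)))) \<le> \<bar>k\<bar> * (1 / \<mu> + 1 / \<mu>)"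
        unfolding norm_mult complex_mod_cnj norm_of_real using 1
        by (intro mult_left_mono order_trans[OF norm_triangle_ineq4] add_mono) auto
    qed
    finally show ?thesis using L0_parts(1) L by simp
  qed
  show "cmod (V \<rho> x - V \<rho> y) \<le> L * cmod (x - y)" if rho: "\<bar>\<rho> - r0\<bar> \<le> \<kappa>1" and x: "cmod x \<le> d" and y: "cmod y \<le> d" for \<rho> x y
  proof -
    have xy: "cmod x \<le> d0" "cmod y \<le> d0" using x y d by auto
    have "cmod (V \<rho> x - V \<rho> y) \<le> \<theta> * cmod (x - y) + \<bar>k\<bar> * (cmod (x - y) / \<mu>\<^sup>2 + cmod (x - y) / \<mu>\<^sup>2)"
      using inverse_lip[OF constants_pos(1) far_from_vortices(1)[OF xy(1) rho] far_from_vortices(1)[OF xy(2) rho]] inverse_lip[OF constants_pos(1) far_from_vortices(2)[OF xy(1) rho] far_from_vortices(2)[OF xy(2) rho]]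
      theta by (intro order_trans[OF norm_V_diff] add_mono mult_left_mono) auto
    also have "\<dots> = (\<theta> + \<bar>k\<bar> * (2 / \<mu>\<^sup>2)) * cmod (x - y)" by (simp add: algebra_simps)
    also have "\<dots> \<le> L * cmod (x - y)" using L0_parts(2) L by (intro mult_right_mono) auto
    finally show ?thesis .
  qed
  show "cmod (V \<rho> x - V \<sigma> x) \<le> L * \<bar>\<rho> - \<sigma>\<bar>" if rho: "\<bar>\<rho> - r0\<bar> \<le> \<kappa>1" and sig: "\<bar>\<sigma> - r0\<bar> \<le> \<kappa>1" and x: "cmod x \<le> d" for \<rho> \<sigma> x
  proof -
    have x0: "cmod x \<le> d0" using x d by simp
    have "cmod (V \<rho> x - V \<sigma> x) \<le> \<theta> * cmod (x - x) + \<bar>k\<bar> * (\<bar>\<rho> - \<sigma>\<bar> / \<mu>\<^sup>2 + \<bar>R\<^sup>2 / \<rho> - R\<^sup>2 / \<sigma>\<bar> / \<mu>\<^sup>2)"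
    proof (intro order_trans[OF norm_V_diff] add_mono mult_left_mono)
      have "cmod (1 / (of_real c + x - of_real \<rho>) - 1 / (of_real c + x - of_real \<sigma>)) \<le> cmod (of_real (\<sigma> - \<rho>)) / \<mu>\<^sup>2"
        using inverse_lip[OF constants_pos(1) far_from_vortices(1)[OF x0 rho] far_from_vortices(1)[OF x0 sig]] by simp
      then show "cmod (1 / (of_real c + x - of_real \<rho>) - 1 / (of_real c + x - of_real \<sigma>)) \<le> \<bar>\<rho> - \<sigma>\<bar> / \<mu>\<^sup>2"
        unfolding norm_of_real by (simp add: abs_minus_commute)
      have "cmod (1 / (of_real c + x - of_real (R\<^sup>2 / \<rho>)) - 1 / (of_real c + x - of_real (R\<^sup>2 / \<sigma>))) \<le> cmod (of_real (R\<^sup>2 / \<sigma> - R\<^sup>2 / \<rho>)) / \<mu>\<^sup>2"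
        using inverse_lip[OF constants_pos(1) far_from_vortices(2)[OF x0 rho] far_from_vortices(2)[OF x0 sig]] by simp
      then show "cmod (1 / (of_real c + x - of_real (R\<^sup>2 / \<rho>)) - 1 / (of_real c + x - of_real (R\<^sup>2 / \<sigma>))) \<le> \<bar>R\<^sup>2 / \<rho> - R\<^sup>2 / \<sigma>\<bar> / \<mu>\<^sup>2"
        unfolding norm_of_real by (simp add: abs_minus_commute)
    qed (use theta in auto)
    also have "\<dots> = \<bar>k\<bar> / \<mu>\<^sup>2 * (\<bar>\<rho> - \<sigma>\<bar> + \<bar>R\<^sup>2 / \<rho> - R\<^sup>2 / \<sigma>\<bar>)" by (simp add: distrib_left add_divide_distrib)
    also have "\<dots> \<le> \<bar>k\<bar> / \<mu>\<^sup>2 * (K1 * \<bar>\<rho> - \<sigma>\<bar>)"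
      using image_lip[OF rho sig] by (intro mult_left_mono) (auto simp: K1_def algebra_simps)
    also have "\<dots> = \<bar>k\<bar> * (K1 / \<mu>\<^sup>2) * \<bar>\<rho> - \<sigma>\<bar>" by simp
    also have "\<dots> \<le> L * \<bar>\<rho> - \<sigma>\<bar>" using L0_parts(3) L by (intro mult_right_mono) auto
    finally show ?thesis .
  qed
  show "V \<rho> (cnj x) = - cnj (V \<rho> x)" for \<rho> x by (simp add: V_def)
  show "H \<rho> (cnj x) = H \<rho> x" for \<rho> x
  proof -
    have "cmod (of_real a + cnj x) = cmod (of_real a + x)" for a
      using complex_mod_cnj[of "of_real a + x"] by simp
    from this[of c] this[of "c - \<rho>"] this[of "c - R\<^sup>2 / \<rho>"] show ?thesis by (simp add: H_def algebra_simps)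
  qed
  show "\<bar>H \<rho> y - H \<rho> x - Im (cnj (V \<rho> x) * (y - x))\<bar> \<le> L * (cmod (y - x))\<^sup>2"
    if rho: "\<bar>\<rho> - r0\<bar> \<le> \<kappa>1" and x: "cmod x \<le> d" and y: "cmod y \<le> d" for \<rho> x y
  proof -
    have "\<bar>H \<rho> y - H \<rho> x - Im (cnj (V \<rho> x) * (y - x))\<bar> \<le> L0 * (cmod (y - x))\<^sup>2"
      using x y d by (intro H_grad0 rho) auto
    also have "\<dots> \<le> L * (cmod (y - x))\<^sup>2" using L by (intro mult_right_mono) auto
    finally show ?thesis .
  qed
  show "\<bar>H \<rho> x - H \<sigma> x\<bar> \<le> L * \<bar>\<rho> - \<sigma>\<bar>" if rho: "\<bar>\<rho> - r0\<bar> \<le> \<kappa>1" and sig: "\<bar>\<sigma> - r0\<bar> \<le> \<kappa>1" and x: "cmod x \<le> d" for \<rho> \<sigma> x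
  proof -
    have x0: "cmod x \<le> d0" using x d by simp
    have *: "\<bar>ln (cmod (of_real c + x - of_real s)) - ln (cmod (of_real c + x - of_real t))\<bar> \<le> \<bar>s - t\<bar> / \<mu>"
      if "\<mu> \<le> cmod (of_real c + x - of_real s)" "\<mu> \<le> cmod (of_real c + x - of_real t)" for s t
    proof -
      have "\<bar>cmod (of_real c + x - of_real s) - cmod (of_real c + x - of_real t)\<bar> \<le> cmod (of_real (t - s))"
        using norm_triangle_ineq3[of "of_real c + x - of_real s" "of_real c + x - of_real t"] by simp
      then have "\<bar>cmod (of_real c + x - of_real s) - cmod (of_real c + x - of_real t)\<bar> / \<mu> \<le> \<bar>s - t\<bar> / \<mu>"
        unfolding norm_of_real using constants_pos by (intro divide_right_mono) (auto simp: abs_minus_commute)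
      then show ?thesis using ln_lip[OF constants_pos(1) that] by linarith
    qed
    have "H \<rho> x - H \<sigma> x = k * ((ln (cmod (of_real c + x - of_real \<rho>)) - ln (cmod (of_real c + x - of_real \<sigma>)))
        - (ln (cmod (of_real c + x - of_real (R\<^sup>2 / \<rho>))) - ln (cmod (of_real c + x - of_real (R\<^sup>2 / \<sigma>)))))"
      by (simp add: H_def algebra_simps)
    then have "\<bar>H \<rho> x - H \<sigma> x\<bar> \<le> \<bar>k\<bar> * (\<bar>\<rho> - \<sigma>\<bar> / \<mu> + \<bar>R\<^sup>2 / \<rho> - R\<^sup>2 / \<sigma>\<bar> / \<mu>)"
      unfolding abs_mult[symmetric]
      using *[OF far_from_vortices(1)[OF x0 rho] far_from_vortices(1)[OF x0 sig]] *[OF far_from_vortices(2)[OF x0 rho] far_from_vortices(2)[OF x0 sig]]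
      by (simp only: abs_mult) (intro mult_left_mono order_trans[OF abs_triangle_ineq4 add_mono], auto)
    also have "\<dots> = \<bar>k\<bar> / \<mu> * (\<bar>\<rho> - \<sigma>\<bar> + \<bar>R\<^sup>2 / \<rho> - R\<^sup>2 / \<sigma>\<bar>)" by (simp add: distrib_left add_divide_distrib)
    also have "\<dots> \<le> \<bar>k\<bar> / \<mu> * (K1 * \<bar>\<rho> - \<sigma>\<bar>)"
      using image_lip[OF rho sig] constants_pos by (intro mult_left_mono) (auto simp: K1_def algebra_simps)
    also have "\<dots> = \<bar>k\<bar> * (K1 / \<mu>) * \<bar>\<rho> - \<sigma>\<bar>" by simp
    also have "\<dots> \<le> L * \<bar>\<rho> - \<sigma>\<bar>" using L0_parts(5) L by (intro mult_right_mono) auto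
    finally show ?thesis .
  qed
qed

end

lemma ordf_mult':
  assumes "ordf d j f" "ordf d k g" "n \<le> j + k" "d \<le> 1" shows "ordf d n (\<lambda>x. f x * g x)"
  by (rule ordf_weaken[OF ordf_mult[OF assms(1,2)] assms(3,4)])

lemma ordf_form2:
  assumes "ordf d 1 a" "ordf d 1 b" shows "ordf d 2 (\<lambda>x. p * (a x)^2 + q * (a x * b x) + r * (b x)^2)"
proof -
  have "ordf d 2 (\<lambda>x. a x * b x)" using ordf_mult[OF assms] by (simp add: numeral_2_eq_2)
  then show ?thesis by (intro ordf_add ordf_cmult ordf_power assms)
qed

lemma ordf_form3:
  assumes "ordf d 1 a" "ordf d 1 b"
  shows "ordf d 3 (\<lambda>x. p * (a x)^3 + q * ((a x)^2 * b x) + r * (a x * (b x)^2) + s * (b x)^3)"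
proof -
  have "ordf d 3 (\<lambda>x. (a x)^2 * b x)" using ordf_mult[OF ordf_power[OF assms(1), of 2] assms(2)] by (simp add: numeral_3_eq_3)
  moreover have "ordf d 3 (\<lambda>x. a x * (b x)^2)" using ordf_mult[OF assms(1) ordf_power[OF assms(2), of 2]] by (simp add: numeral_3_eq_3)
  ultimately show ?thesis by (intro ordf_add ordf_cmult ordf_power assms)
qed

text \<open>Here \<open>u\<close> and \<open>v\<close> are the reciprocal distances to the
  vortex and its image; after clearing denominators the claim reduces to
  \<open>2 (4 A - 5 k D) (A - 2 k D) > 0\<close> and \<open>(u\<^sup>3 - v\<^sup>3)\<^sup>2 \<ge> (u\<^sup>4 - v\<^sup>4) (u\<^sup>2 - v\<^sup>2)\<close>.\<close>

lemma twist_coefficient_neg: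
  fixes u v k \<theta> D A B m \<omega> :: real
  assumes uv: "v\<^sup>2 < u\<^sup>2" "u^3 \<noteq> v^3" and D: "D = u\<^sup>2 - v\<^sup>2" and AB: "A = \<theta> + k * D" "B = \<theta> - k * D" "A > 0" "B > 0"
    and m: "m > 0" "m\<^sup>2 = A / B" and om: "\<omega> = m * B" and k: "k \<noteq> 0"
  shows "3 * k * (u^4 - v^4) / (8 * m^3) * (1 - m\<^sup>2)\<^sup>2
    - (k * (u^3 - v^3))\<^sup>2 * (9 * m^4 - 6 * m\<^sup>2 + 5) / (12 * m^4) / \<omega> < 0"
proof -
  have Dp: "D > 0" using uv D by simp
  have w4: "u^4 - v^4 = D * (u\<^sup>2 + v\<^sup>2)" by (simp add: D power2_eq_square algebra_simps power4_eq_xxxx)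
  have u0: "u\<^sup>2 > 0" using uv zero_le_power2[of v] by linarith
  have w4p: "u^4 - v^4 > 0" unfolding w4 using Dp u0 by (intro mult_pos_pos add_pos_nonneg) auto
  have f2: "(u^3 - v^3)\<^sup>2 > 0" using uv by simp
  have cs: "(u^4 - v^4) * D \<le> (u^3 - v^3)\<^sup>2"
  proof -
    have "(u^3 - v^3)\<^sup>2 - (u^4 - v^4) * D = (u * v)\<^sup>2 * (u - v)\<^sup>2"
      by (simp add: D power2_eq_square algebra_simps power4_eq_xxxx power3_eq_cube)
    moreover have "0 \<le> (u * v)\<^sup>2 * (u - v)\<^sup>2" by simp
    ultimately show ?thesis by linarith
  qed
  have key: "18 * k * (u^4 - v^4) * D\<^sup>2 * A < (u^3 - v^3)\<^sup>2 * (9 * A\<^sup>2 - 6 * A * B + 5 * B\<^sup>2)"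
  proof (cases "k > 0")
    case True
    have kD: "k * D > 0" using True Dp by simp
    have B': "B = A - 2 * (k * D)" using AB by simp
    have "9 * A\<^sup>2 - 6 * A * B + 5 * B\<^sup>2 - 18 * (k * D) * A = 2 * ((4 * A - 5 * (k * D)) * (A - 2 * (k * D)))"
      unfolding B' by (simp add: power2_eq_square algebra_simps)
    moreover have "0 < (4 * A - 5 * (k * D)) * (A - 2 * (k * D))" using AB(4) kD unfolding B' by (intro mult_pos_pos) auto
    ultimately have q: "18 * (k * D) * A < 9 * A\<^sup>2 - 6 * A * B + 5 * B\<^sup>2" by linarith
    have "18 * k * (u^4 - v^4) * D\<^sup>2 * A = (18 * (k * D) * A) * ((u^4 - v^4) * D)" by (simp add: power2_eq_square)
    also have "\<dots> \<le> (18 * (k * D) * A) * (u^3 - v^3)\<^sup>2" using cs kD AB by (intro mult_left_mono) auto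
    also have "\<dots> < (9 * A\<^sup>2 - 6 * A * B + 5 * B\<^sup>2) * (u^3 - v^3)\<^sup>2" using q f2 by (intro mult_strict_right_mono) auto
    finally show ?thesis by (simp add: mult.commute)
  next
    case False
    then have "k \<le> 0" using k by simp
    then have "k * (18 * (u^4 - v^4) * D\<^sup>2 * A) \<le> 0"
      by (rule mult_nonpos_nonneg) (use w4p AB(3) in \<open>intro mult_nonneg_nonneg; simp\<close>)
    then have "18 * k * (u^4 - v^4) * D\<^sup>2 * A \<le> 0" by (simp add: mult_ac)
    moreover have "9 * A\<^sup>2 - 6 * A * B + 5 * B\<^sup>2 = 9 * (A - B / 3)\<^sup>2 + 4 * B\<^sup>2" by (simp add: power2_eq_square algebra_simps)
    moreover have "0 \<le> 9 * (A - B / 3)\<^sup>2" "0 < 4 * B\<^sup>2" using AB(4) by simp_all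
    ultimately have "18 * k * (u^4 - v^4) * D\<^sup>2 * A \<le> 0" "0 < 9 * A\<^sup>2 - 6 * A * B + 5 * B\<^sup>2" by linarith+
    moreover from this(2) have "0 < (u^3 - v^3)\<^sup>2 * (9 * A\<^sup>2 - 6 * A * B + 5 * B\<^sup>2)" using f2 by (intro mult_pos_pos)
    ultimately show ?thesis by linarith
  qed
  have m2: "1 - m\<^sup>2 = - 2 * (k * D) / B" using AB m(2) by (simp add: field_simps)
  have m4: "m^4 = A\<^sup>2 / B\<^sup>2" using m(2) by (metis power_divide power2_eq_square power4_eq_xxxx mult.assoc)
  have "3 * k * (u^4 - v^4) / (8 * m^3) * (1 - m\<^sup>2)\<^sup>2 - (k * (u^3 - v^3))\<^sup>2 * (9 * m^4 - 6 * m\<^sup>2 + 5) / (12 * m^4) / \<omega>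
     = (3 * k * (u^4 - v^4) * m\<^sup>2 * (1 - m\<^sup>2)\<^sup>2 * 3 * B - 2 * (k * (u^3 - v^3))\<^sup>2 * (9 * m^4 - 6 * m\<^sup>2 + 5)) / (24 * m^5 * B)"
    unfolding om using m(1) AB by (simp add: field_simps power_numeral_reduce)
  also have "\<dots> = 2 * k\<^sup>2 * (18 * k * (u^4 - v^4) * D\<^sup>2 * A - (u^3 - v^3)\<^sup>2 * (9 * A\<^sup>2 - 6 * A * B + 5 * B\<^sup>2)) / B\<^sup>2 / (24 * m^5 * B)"
  proof -
    have "3 * k * X * (A' / B') * (- 2 * (k * D') / B')\<^sup>2 * 3 * B' - 2 * (k * Y)\<^sup>2 * (9 * (A'\<^sup>2 / B'\<^sup>2) - 6 * (A' / B') + 5)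
        = 2 * k\<^sup>2 * (18 * k * X * D'\<^sup>2 * A' - Y\<^sup>2 * (9 * A'\<^sup>2 - 6 * A' * B' + 5 * B'\<^sup>2)) / B'\<^sup>2" if "B' \<noteq> 0" for X Y A' B' D' :: real
      using that by (simp add: field_simps power2_eq_square)
    note eq = this[of B "u^4 - v^4" A D "u^3 - v^3"]
    have "B \<noteq> 0" using AB(4) by simp
    from eq[OF this] show ?thesis unfolding m2 unfolding m4 m(2) by (simp only:)
  qed
  also have "\<dots> < 0"
    using key AB m k by (intro divide_neg_pos mult_pos_neg) auto
  finally show ?thesis .
qed

context vortex_center
begin

definition uu :: real where "uu = 1 / (c - r0)"
definition vv :: real where "vv = 1 / (c - R\<^sup>2 / r0)"
definition D :: real where "D = uu\<^sup>2 - vv\<^sup>2"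
definition A :: real where "A = \<theta> + k * D"
definition B :: real where "B = \<theta> - k * D"
definition m :: real where "m = sqrt (A / B)"
definition \<omega> :: real where "\<omega> = m * B"

lemma uv: "uu < vv" "vv < 0" "vv\<^sup>2 < uu\<^sup>2" "D > 0"
proof -
  have "r0 * r0 < R * R" using r0 by (intro mult_strict_mono) auto
  then have r: "r0 < R\<^sup>2 / r0" using r0 by (simp add: field_simps power2_eq_square)
  have n: "c - R\<^sup>2 / r0 < c - r0" "c - r0 < 0" using r c by auto
  show uv: "uu < vv" unfolding uu_def vv_def using n by (simp add: divide_simps)
  show v: "vv < 0" unfolding vv_def using n by simp
  have "(- vv)\<^sup>2 < (- uu)\<^sup>2" using uv v by (intro power_strict_mono) auto
  then show "vv\<^sup>2 < uu\<^sup>2" by simp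
  then show "D > 0" by (simp add: D_def)
qed

lemma AB: "A > 0" "B > 0"
proof -
  have "\<bar>k * D\<bar> < \<theta>" using ellip uv(4) by (simp add: D_def uu_def vv_def abs_mult)
  then show "A > 0" "B > 0" by (auto simp: A_def B_def abs_less_iff)
qed

lemma m: "m > 0" "m\<^sup>2 = A / B" "\<omega> > 0"
  using AB by (auto simp: m_def \<omega>_def)

lemma theta_kD: "\<theta> = \<omega> * (m + 1 / m) / 2" "k * D = \<omega> * (m - 1 / m) / 2"
proof -
  have 1: "\<omega> * m = A" using m(2) AB unfolding \<omega>_def by (simp add: power2_eq_square field_simps)
  have 2: "\<omega> / m = B" using m(1) by (simp add: \<omega>_def)
  have "\<omega> * (m + 1 / m) / 2 = (A + B) / 2" "\<omega> * (m - 1 / m) / 2 = (A - B) / 2"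
    using 1 2 by (simp_all add: distrib_left right_diff_distrib)
  then show "\<theta> = \<omega> * (m + 1 / m) / 2" "k * D = \<omega> * (m - 1 / m) / 2" by (simp_all add: A_def B_def)
qed

definition Z :: "complex \<Rightarrow> complex" where
  "Z x = of_real ((m + 1) / 2) * x + of_real ((m - 1) / 2) * cnj x"

definition G :: "complex \<Rightarrow> complex" where
  "G s = of_real (uu^5) * (1 / (1 + of_real uu * s)) - of_real (vv^5) * (1 / (1 + of_real vv * s))"

definition f2 :: real where "f2 = uu^3 - vv^3"
definition f3 :: real where "f3 = - (uu^4 - vv^4)"

definition d1 :: real where "d1 = min 1 (min d0 (1 / (2 * \<bar>uu\<bar>)))"

lemma d1: "0 < d1" "d1 \<le> 1" "d1 \<le> d0" "\<bar>uu\<bar> * d1 \<le> 1 / 2" "\<bar>vv\<bar> * d1 \<le> 1 / 2"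
proof -
  show d: "0 < d1" "d1 \<le> 1" "d1 \<le> d0" using constants_pos uv by (auto simp: d1_def)
  have "d1 \<le> 1 / (2 * \<bar>uu\<bar>)" by (simp add: d1_def)
  then show u: "\<bar>uu\<bar> * d1 \<le> 1 / 2" using uv by (simp add: field_simps)
  have "\<bar>vv\<bar> * d1 \<le> \<bar>uu\<bar> * d1" using uv d by (intro mult_right_mono) auto
  then show "\<bar>vv\<bar> * d1 \<le> 1 / 2" using u by linarith
qed

lemma geometric_expansion:
  fixes s :: complex
  assumes "1 + of_real u * s \<noteq> 0" "u \<noteq> 0" "a = 1 / u"
  shows "1 / (of_real a + s) = of_real u - of_real (u\<^sup>2) * s + of_real (u^3) * s\<^sup>2 - of_real (u^4) * s^3
    + of_real (u^5) * s^4 * (1 / (1 + of_real u * s))"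
proof -
  have "of_real a + s = (1 + of_real u * s) / of_real u" unfolding assms(3) using assms(1,2) by (simp add: field_simps)
  then have "1 / (of_real a + s) = of_real u * (1 / (1 + of_real u * s))" by simp
  also have "\<dots> = of_real u - of_real (u\<^sup>2) * s + of_real (u^3) * s\<^sup>2 - of_real (u^4) * s^3
    + of_real (u^5) * s^4 * (1 / (1 + of_real u * s))"
    using assms(1) by (simp add: field_simps power_numeral_reduce)
  finally show ?thesis .
qed

lemma V_expansion:
  assumes x: "cmod x \<le> d1"
  shows "V r0 x = \<i> * (of_real \<theta> * x + of_real (k * D) * cnj x
    - of_real k * (of_real f2 * (cnj x)\<^sup>2 + of_real f3 * (cnj x)^3 + (cnj x)^4 * G (cnj x)))"
proof -
  have nz: "1 + of_real u * cnj x \<noteq> 0" if "\<bar>u\<bar> * d1 \<le> 1 / 2" for u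
  proof
    assume 0: "1 + of_real u * cnj x = 0"
    have "cmod (of_real u * cnj x) \<le> \<bar>u\<bar> * d1" unfolding norm_mult using x by (simp add: mult_left_mono)
    moreover have "of_real u * cnj x = - 1" using 0 by (simp add: add_eq_0_iff)
    ultimately show False using that by simp
  qed
  have "cnj (1 / (of_real c + x - of_real r0) - 1 / (of_real c + x - of_real (R\<^sup>2 / r0)))
      = 1 / (of_real (c - r0) + cnj x) - 1 / (of_real (c - R\<^sup>2 / r0) + cnj x)" by (simp add: algebra_simps)
  also have "1 / (of_real (c - r0) + cnj x) = of_real uu - of_real (uu\<^sup>2) * cnj x + of_real (uu^3) * (cnj x)\<^sup>2 - of_real (uu^4) * (cnj x)^3
    + of_real (uu^5) * (cnj x)^4 * (1 / (1 + of_real uu * cnj x))"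
    using uv by (intro geometric_expansion nz d1) (auto simp: uu_def)
  also have "1 / (of_real (c - R\<^sup>2 / r0) + cnj x) = of_real vv - of_real (vv\<^sup>2) * cnj x + of_real (vv^3) * (cnj x)\<^sup>2 - of_real (vv^4) * (cnj x)^3
    + of_real (vv^5) * (cnj x)^4 * (1 / (1 + of_real vv * cnj x))"
    using uv by (intro geometric_expansion nz d1) (auto simp: vv_def)
  finally have f: "cnj (1 / (of_real c + x - of_real r0) - 1 / (of_real c + x - of_real (R\<^sup>2 / r0)))
    = of_real (uu - vv) - of_real D * cnj x + of_real f2 * (cnj x)\<^sup>2 + of_real f3 * (cnj x)^3 + (cnj x)^4 * G (cnj x)"
    by (simp add: D_def f2_def f3_def G_def algebra_simps)
  have "\<theta> * c = k * (uu - vv)" using equil by (simp add: uu_def vv_def)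
  then have e: "of_real \<theta> * of_real c = (of_real k * of_real (uu - vv) :: complex)" by (metis of_real_mult)
  show ?thesis unfolding V_def f distrib_left e by (simp add: algebra_simps)
qed

end

lemma square_sum: "(x + y)\<^sup>2 = x\<^sup>2 + 2 * (x * y) + y\<^sup>2" for x y :: complex
  by (simp add: power2_eq_square algebra_simps)
lemma cube_sum: "(x + y)^3 = x^3 + 3 * (x\<^sup>2 * y) + 3 * (x * y\<^sup>2) + y^3" for x y :: complex
  by (simp add: power2_eq_square power3_eq_cube algebra_simps)

lemma quadratic_forms:
  fixes a b al ga al' ga' :: complex
  shows "al' * (al * b + ga * a)\<^sup>2 - ga' * (al * a + ga * b)\<^sup>2 = (al' * ga\<^sup>2 - ga' * al\<^sup>2) * a\<^sup>2
      + 2 * al * ga * (al' - ga') * (a * b) + (al' * al\<^sup>2 - ga' * ga\<^sup>2) * b\<^sup>2"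
  by (simp add: square_sum power_mult_distrib algebra_simps)

lemma cubic_forms:
  fixes a b al ga al' ga' :: complex
  shows "al' * (al * b + ga * a)^3 - ga' * (al * a + ga * b)^3 = (al' * ga^3 - ga' * al^3) * a^3
      + 3 * (al' * ga\<^sup>2 * al - ga' * al\<^sup>2 * ga) * (a\<^sup>2 * b)
      + 3 * (al' * ga * al\<^sup>2 - ga' * al * ga\<^sup>2) * (a * b\<^sup>2) + (al' * al^3 - ga' * ga^3) * b^3"
  unfolding cube_sum power_mult_distrib by (simp add: algebra_simps)
lemma coefficient_values:
  fixes m :: real
  assumes "m \<noteq> 0"
  shows "(m + 1) / 2 * ((1 - m) / (2 * m))\<^sup>2 - (m - 1) / 2 * ((m + 1) / (2 * m))\<^sup>2 = - (m\<^sup>2 - 1) / (4 * m\<^sup>2)"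
    and "2 * ((m + 1) / (2 * m)) * ((1 - m) / (2 * m)) = - (m\<^sup>2 - 1) / (2 * m\<^sup>2)"
    and "(m + 1) / 2 * ((m + 1) / (2 * m))\<^sup>2 - (m - 1) / 2 * ((1 - m) / (2 * m))\<^sup>2 = (3 * m\<^sup>2 + 1) / (4 * m\<^sup>2)"
    and "(m + 1) / 2 * ((1 - m) / (2 * m))\<^sup>2 * ((m + 1) / (2 * m)) - (m - 1) / 2 * ((m + 1) / (2 * m))\<^sup>2 * ((1 - m) / (2 * m))
      = (1 - m\<^sup>2)\<^sup>2 / (8 * m^3)"
proof -
  have n: "(m + 1) * (1 - m)\<^sup>2 - (m - 1) * (m + 1)\<^sup>2 = - 2 * (m\<^sup>2 - 1)"
    "(m + 1) * (m + 1)\<^sup>2 - (m - 1) * (1 - m)\<^sup>2 = 2 * (3 * m\<^sup>2 + 1)"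
    "(m + 1) * (1 - m)\<^sup>2 * (m + 1) - (m - 1) * (m + 1)\<^sup>2 * (1 - m) = 2 * (1 - m\<^sup>2)\<^sup>2"
    by (simp_all add: power2_eq_square algebra_simps)
  have d: "a / 2 * (b / (2 * m))\<^sup>2 = a * b\<^sup>2 / (8 * m\<^sup>2)"
    and d': "a / 2 * (b / (2 * m))\<^sup>2 * (c / (2 * m)) = a * b\<^sup>2 * c / (16 * m^3)" for a b c
    by (simp_all add: power_divide power_mult_distrib power2_eq_square power3_eq_cube)
  have h: "- 2 * x / (8 * y) = - x / (4 * y)" "2 * x / (8 * y) = x / (4 * y)" "2 * x / (16 * y) = x / (8 * y)" for x y :: real
    by simp_all
  show "(m + 1) / 2 * ((1 - m) / (2 * m))\<^sup>2 - (m - 1) / 2 * ((m + 1) / (2 * m))\<^sup>2 = - (m\<^sup>2 - 1) / (4 * m\<^sup>2)"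
    unfolding d diff_divide_distrib[symmetric] n h by (rule refl)
  show "(m + 1) / 2 * ((m + 1) / (2 * m))\<^sup>2 - (m - 1) / 2 * ((1 - m) / (2 * m))\<^sup>2 = (3 * m\<^sup>2 + 1) / (4 * m\<^sup>2)"
    unfolding d diff_divide_distrib[symmetric] n h by (rule refl)
  show "(m + 1) / 2 * ((1 - m) / (2 * m))\<^sup>2 * ((m + 1) / (2 * m)) - (m - 1) / 2 * ((m + 1) / (2 * m))\<^sup>2 * ((1 - m) / (2 * m))
      = (1 - m\<^sup>2)\<^sup>2 / (8 * m^3)"
    unfolding d' diff_divide_distrib[symmetric] n h by (rule refl)
  have "(m + 1) * (1 - m) = - (m\<^sup>2 - 1)" by (simp add: power2_eq_square algebra_simps)
  moreover have "2 * (a / (2 * m)) * (b / (2 * m)) = a * b / (2 * m\<^sup>2)" for a b by (simp add: power2_eq_square)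
  ultimately show "2 * ((m + 1) / (2 * m)) * ((1 - m) / (2 * m)) = - (m\<^sup>2 - 1) / (2 * m\<^sup>2)" by (simp only:)
qed
lemma quadratic_coefficient_sum:
  fixes m K :: real
  assumes "m \<noteq> 0"
  shows "(- K * (- (m\<^sup>2 - 1) / (4 * m\<^sup>2))) * (- K * (- (m\<^sup>2 - 1) / (2 * m\<^sup>2))) + (- K * (- (m\<^sup>2 - 1) / (2 * m\<^sup>2)))\<^sup>2
    + 2 / 3 * (- K * ((3 * m\<^sup>2 + 1) / (4 * m\<^sup>2)))\<^sup>2 = K\<^sup>2 * (9 * m^4 - 6 * m\<^sup>2 + 5) / (12 * m^4)"
proof -
  have "(- K * (- (n - 1) / (4 * n))) * (- K * (- (n - 1) / (2 * n))) + (- K * (- (n - 1) / (2 * n)))\<^sup>2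
    + 2 / 3 * (- K * ((3 * n + 1) / (4 * n)))\<^sup>2 = K\<^sup>2 * (9 * n\<^sup>2 - 6 * n + 5) / (12 * n\<^sup>2)" (is "?l = _") for n :: real
  proof -
    have "(- K * (- x / (4 * n))) * (- K * (- x / (2 * n))) + (- K * (- x / (2 * n)))\<^sup>2 + 2 / 3 * (- K * (y / (4 * n)))\<^sup>2
        = (9 * (K\<^sup>2 * x\<^sup>2) + K\<^sup>2 * y\<^sup>2) / (24 * n\<^sup>2)" for x y
    proof -
      have "(- K * (- x / (4 * n))) * (- K * (- x / (2 * n))) = (K\<^sup>2 * x\<^sup>2 / n\<^sup>2) / 8"
        "(- K * (- x / (2 * n)))\<^sup>2 = (K\<^sup>2 * x\<^sup>2 / n\<^sup>2) / 4"
        "2 / 3 * (- K * (y / (4 * n)))\<^sup>2 = (K\<^sup>2 * y\<^sup>2 / n\<^sup>2) / 24"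
        by (simp_all add: power2_eq_square mult_ac)
      moreover have "(9 * (K\<^sup>2 * x\<^sup>2) + K\<^sup>2 * y\<^sup>2) / (24 * n\<^sup>2) = (K\<^sup>2 * x\<^sup>2 / n\<^sup>2) * (9 / 24) + (K\<^sup>2 * y\<^sup>2 / n\<^sup>2) / 24"
        by (simp add: add_divide_distrib)
      moreover have "t / 8 + t / 4 + s / 24 = t * (9 / 24) + s / 24" for t s :: real by simp
  ultimately show ?thesis by (simp only:)
    qed
    then have "?l = (9 * (K\<^sup>2 * (n - 1)\<^sup>2) + K\<^sup>2 * (3 * n + 1)\<^sup>2) / (24 * n\<^sup>2)" .
    also have "9 * (K\<^sup>2 * (n - 1)\<^sup>2) + K\<^sup>2 * (3 * n + 1)\<^sup>2 = 2 * (K\<^sup>2 * (9 * n\<^sup>2 - 6 * n + 5))"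
      by (simp add: power2_eq_square algebra_simps)
    also have "2 * x / (24 * y) = x / (12 * y)" for x y :: real by simp
    finally show ?thesis .
  qed
  from this[of "m\<^sup>2"] show ?thesis using assms by (simp only: power_mult[symmetric]) simp
qed

lemma beta_sum: "a + 2 * (- b / w) * c + (c / w) * b - (c / w) * c - 2 * (e / (3 * w)) * e = a - (b * c + c\<^sup>2 + 2 / 3 * e\<^sup>2) / w"
  for a b c e w :: real
proof -
  have "2 * (- b / w) * c = - 2 * (b * c / w)" "(c / w) * b = b * c / w" "(c / w) * c = c\<^sup>2 / w" "2 * (e / (3 * w)) * e = 2 / 3 * (e\<^sup>2 / w)"
    "(b * c + c\<^sup>2 + 2 / 3 * e\<^sup>2) / w = b * c / w + c\<^sup>2 / w + 2 / 3 * (e\<^sup>2 / w)"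
    by (simp_all add: add_divide_distrib power2_eq_square)
  then show ?thesis by (simp only:)
qed

context vortex_center
begin

definition p20 :: real where "p20 = - k * f2 * ((m + 1) / 2 * ((1 - m) / (2 * m))\<^sup>2 - (m - 1) / 2 * ((m + 1) / (2 * m))\<^sup>2)"
definition p11 :: real where "p11 = - k * f2 * (2 * ((m + 1) / (2 * m)) * ((1 - m) / (2 * m)))"
definition p02 :: real where "p02 = - k * f2 * ((m + 1) / 2 * ((m + 1) / (2 * m))\<^sup>2 - (m - 1) / 2 * ((1 - m) / (2 * m))\<^sup>2)"
definition p30 :: real where "p30 = - k * f3 * ((m + 1) / 2 * ((1 - m) / (2 * m))^3 - (m - 1) / 2 * ((m + 1) / (2 * m))^3)"
definition p21 :: real where "p21 = - 3 * k * f3 * ((m + 1) / 2 * ((1 - m) / (2 * m))\<^sup>2 * ((m + 1) / (2 * m)) - (m - 1) / 2 * ((m + 1) / (2 * m))\<^sup>2 * ((1 - m) / (2 * m)))"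
definition p12 :: real where "p12 = - 3 * k * f3 * ((m + 1) / 2 * ((1 - m) / (2 * m)) * ((m + 1) / (2 * m))\<^sup>2 - (m - 1) / 2 * ((m + 1) / (2 * m)) * ((1 - m) / (2 * m))\<^sup>2)"
definition p03 :: real where "p03 = - k * f3 * ((m + 1) / 2 * ((m + 1) / (2 * m))^3 - (m - 1) / 2 * ((1 - m) / (2 * m))^3)"

definition q20 :: real where "q20 = - p20 / \<omega>"
definition q11 :: real where "q11 = p11 / \<omega>"
definition q02 :: real where "q02 = p02 / (3 * \<omega>)"
definition \<beta> :: real where "\<beta> = p21 + 2 * q20 * p11 + q11 * p20 - q11 * p11 - 2 * q02 * p02"
definition s30 :: real where "s30 = - (p30 + 2 * q20 * p20 - q11 * p02) / (2 * \<omega>)"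
definition s12 :: real where "s12 = (p12 + 2 * q20 * p02 + q11 * p11 - q11 * p20 - 2 * q02 * p11) / (2 * \<omega>)"
definition s03 :: real where "s03 = (p03 + q11 * p02 - 2 * q02 * p20) / (4 * \<omega>)"

lemma beta_neg: "\<beta> < 0"
proof -
  have m0: "m \<noteq> 0" "\<omega> \<noteq> 0" using m by auto
  have 1: "p21 = 3 * k * (uu^4 - vv^4) / (8 * m^3) * (1 - m\<^sup>2)\<^sup>2"
    unfolding p21_def f3_def coefficient_values[OF m0(1)]
    by (simp only: mult_minus_left mult_minus_right minus_minus times_divide_eq_left times_divide_eq_right)
  have 2: "p20 * p11 + p11\<^sup>2 + 2 / 3 * p02\<^sup>2 = (k * f2)\<^sup>2 * (9 * m^4 - 6 * m\<^sup>2 + 5) / (12 * m^4)"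
    using quadratic_coefficient_sum[OF m0(1), of "k * f2"]
    unfolding p20_def p11_def p02_def coefficient_values[OF m0(1)] by (simp only: minus_mult_left)
  have "\<beta> = p21 - (p20 * p11 + p11\<^sup>2 + 2 / 3 * p02\<^sup>2) / \<omega>"
    unfolding \<beta>_def q20_def q11_def q02_def by (rule beta_sum)
  also have "\<dots> < 0" unfolding 1 2 f2_def
  proof (rule twist_coefficient_neg)
    show "vv\<^sup>2 < uu\<^sup>2" by (rule uv)
    have "(- vv) ^ 3 < (- uu) ^ 3" using uv by (intro power_strict_mono) auto
    then show "uu^3 \<noteq> vv^3" by simp
    show "D = uu\<^sup>2 - vv\<^sup>2" "A = \<theta> + k * D" "B = \<theta> - k * D" "\<omega> = m * B" by (simp_all add: D_def A_def B_def \<omega>_def)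
  qed (use AB m k in auto)
  finally show ?thesis .
qed

definition P2 :: "complex \<Rightarrow> complex \<Rightarrow> complex" where
  "P2 a b = of_real p20 * a\<^sup>2 + of_real p11 * (a * b) + of_real p02 * b\<^sup>2"
definition P3 :: "complex \<Rightarrow> complex \<Rightarrow> complex" where
  "P3 a b = of_real p30 * a^3 + of_real p21 * (a\<^sup>2 * b) + of_real p12 * (a * b\<^sup>2) + of_real p03 * b^3"
definition Q2 :: "complex \<Rightarrow> complex \<Rightarrow> complex" where
  "Q2 a b = of_real q20 * a\<^sup>2 + of_real q11 * (a * b) + of_real q02 * b\<^sup>2"
definition Q3 :: "complex \<Rightarrow> complex \<Rightarrow> complex" where
  "Q3 a b = of_real s30 * a^3 + of_real s12 * (a * b\<^sup>2) + of_real s03 * b^3"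
definition Qa :: "complex \<Rightarrow> complex \<Rightarrow> complex" where
  "Qa a b = (2 * of_real q20 * a + of_real q11 * b) + (3 * of_real s30 * a\<^sup>2 + of_real s12 * b\<^sup>2)"
definition Qb :: "complex \<Rightarrow> complex \<Rightarrow> complex" where
  "Qb a b = (of_real q11 * a + 2 * of_real q02 * b) + (2 * of_real s12 * (a * b) + 3 * of_real s03 * b\<^sup>2)"

definition X :: "complex \<Rightarrow> complex" where
  "X x = Q2 (Z x) (cnj (Z x)) + Q3 (Z x) (cnj (Z x))"
definition W :: "complex \<Rightarrow> complex" where "W x = Z x + X x"
definition DW :: "complex \<Rightarrow> complex \<Rightarrow> complex" where
  "DW x v = (1 + Qa (Z x) (cnj (Z x))) * Z v + Qb (Z x) (cnj (Z x)) * cnj (Z v)"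
definition E :: "complex \<Rightarrow> complex" where
  "E x = - (\<i> * of_real k) * (of_real ((m + 1) / 2) * ((cnj x)^4 * G (cnj x)) - of_real ((m - 1) / 2) * (x^4 * G x))"

lemma Z_inverse: "x = of_real ((m + 1) / (2 * m)) * Z x + of_real ((1 - m) / (2 * m)) * cnj (Z x)"
proof -
  have "((m + 1) / (2 * m)) * ((m + 1) / 2) + ((1 - m) / (2 * m)) * ((m - 1) / 2) = 1"
    "((m + 1) / (2 * m)) * ((m - 1) / 2) + ((1 - m) / (2 * m)) * ((m + 1) / 2) = 0"
    using m by (simp_all add: field_simps)
  then have e: "complex_of_real ((m + 1) / (2 * m)) * of_real ((m + 1) / 2) + of_real ((1 - m) / (2 * m)) * of_real ((m - 1) / 2) = 1"
    "complex_of_real ((m + 1) / (2 * m)) * of_real ((m - 1) / 2) + of_real ((1 - m) / (2 * m)) * of_real ((m + 1) / 2) = 0"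
    by (simp_all only: of_real_mult[symmetric] of_real_add[symmetric] of_real_1 of_real_0)
  have "of_real ((m + 1) / (2 * m)) * Z x + of_real ((1 - m) / (2 * m)) * cnj (Z x)
    = (complex_of_real ((m + 1) / (2 * m)) * of_real ((m + 1) / 2) + of_real ((1 - m) / (2 * m)) * of_real ((m - 1) / 2)) * x
      + (complex_of_real ((m + 1) / (2 * m)) * of_real ((m - 1) / 2) + of_real ((1 - m) / (2 * m)) * of_real ((m + 1) / 2)) * cnj x"
    unfolding Z_def complex_cnj_add complex_cnj_mult complex_cnj_complex_of_real complex_cnj_cnj by (simp only: algebra_simps)
  then show ?thesis unfolding e by simp
qed

lemma Z_V:
  assumes "cmod x \<le> d1"
  shows "Z (V r0 x) = \<i> * (of_real \<omega> * Z x + P2 (Z x) (cnj (Z x)) + P3 (Z x) (cnj (Z x))) + E x"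
proof -
  define a where "a = Z x"
  define b where "b = cnj (Z x)"
  define al where "al = (m + 1) / (2 * m)"
  define ga where "ga = (1 - m) / (2 * m)"
  define al' where "al' = (m + 1) / 2"
  define ga' where "ga' = (m - 1) / 2"
  have x: "x = of_real al * a + of_real ga * b" unfolding a_def b_def al_def ga_def by (rule Z_inverse)
  have y: "cnj x = of_real al * b + of_real ga * a"
    using arg_cong[OF x, of cnj] by (simp add: a_def b_def)
  have cG: "cnj (G (cnj x)) = G x" by (simp add: G_def)
  have lin: "al' * \<theta> - ga' * (k * D) = \<omega> * al'" "al' * (k * D) - ga' * \<theta> = \<omega> * ga'"
  proof -
    have "((m + 1) / 2) * (w * (m + i) / 2) - ((m - 1) / 2) * (w * (m - i) / 2) = w * ((m + 1) / 2)"
      "((m + 1) / 2) * (w * (m - i) / 2) - ((m - 1) / 2) * (w * (m + i) / 2) = w * ((m - 1) / 2)"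
      if "m * i = 1" for w i :: real
    proof -
      have e: "(m + 1) * (m + i) - (m - 1) * (m - i) = 2 * (m + m * i)" "(m + 1) * (m - i) - (m - 1) * (m + i) = 2 * (m - m * i)"
        by (simp_all add: algebra_simps)
      have f: "(a / 2) * (w * x / 2) - (b / 2) * (w * y / 2) = w * (a * x - b * y) / 4" for a b x y
        by (simp add: right_diff_distrib diff_divide_distrib mult_ac)
      show "((m + 1) / 2) * (w * (m + i) / 2) - ((m - 1) / 2) * (w * (m - i) / 2) = w * ((m + 1) / 2)"
        "((m + 1) / 2) * (w * (m - i) / 2) - ((m - 1) / 2) * (w * (m + i) / 2) = w * ((m - 1) / 2)"
        unfolding f e that by simp_all
    qed
    moreover have "m * (1 / m) = 1" using m(1) by simp
    ultimately have l: "al' * (\<omega> * (m + 1 / m) / 2) - ga' * (\<omega> * (m - 1 / m) / 2) = \<omega> * al'"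
      "al' * (\<omega> * (m - 1 / m) / 2) - ga' * (\<omega> * (m + 1 / m) / 2) = \<omega> * ga'"
      unfolding al'_def ga'_def by blast+
    note t = arg_cong[OF theta_kD(1), of "\<lambda>s. x * s" for x] and t' = arg_cong[OF theta_kD(2), of "\<lambda>s. x * s" for x]
    show "al' * \<theta> - ga' * (k * D) = \<omega> * al'" using t[of al'] t'[of ga'] l(1) by linarith
    show "al' * (k * D) - ga' * \<theta> = \<omega> * ga'" using t[of ga'] t'[of al'] l(2) by linarith
  qed
  have lin': "of_real al' * of_real \<theta> - of_real ga' * of_real (k * D) = (of_real \<omega> * of_real al' :: complex)"
    "of_real al' * of_real (k * D) - of_real ga' * of_real \<theta> = (of_real \<omega> * of_real ga' :: complex)"
    by (simp_all only: of_real_mult[symmetric] of_real_diff[symmetric] lin)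
  have al1: "al' - ga' = 1" unfolding al'_def ga'_def diff_divide_distrib[symmetric] by simp
  have q: "of_real p20 * a\<^sup>2 + of_real p11 * (a * b) + of_real p02 * b\<^sup>2 = - of_real k * of_real f2 * (of_real al' * (cnj x)\<^sup>2 - of_real ga' * x\<^sup>2)"
  proof -
    have "p20 = - k * f2 * (al' * ga\<^sup>2 - ga' * al\<^sup>2)" "p11 = - k * f2 * (2 * al * ga * (al' - ga'))" "p02 = - k * f2 * (al' * al\<^sup>2 - ga' * ga\<^sup>2)"
      unfolding al1 by (simp_all only: p20_def p11_def p02_def al_def ga_def al'_def ga'_def mult_1_right)
    then have "complex_of_real p20 = - of_real k * of_real f2 * (of_real al' * (of_real ga)\<^sup>2 - of_real ga' * (of_real al)\<^sup>2)"
      "complex_of_real p11 = - of_real k * of_real f2 * (2 * of_real al * of_real ga * (of_real al' - of_real ga'))"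
      "complex_of_real p02 = - of_real k * of_real f2 * (of_real al' * (of_real al)\<^sup>2 - of_real ga' * (of_real ga)\<^sup>2)"
      by (simp_all only: of_real_mult of_real_minus of_real_diff of_real_power of_real_numeral)
    then show ?thesis unfolding quadratic_forms[of "of_real al'" "of_real al" b "of_real ga" a "of_real ga'", folded x y]
      by (simp only: distrib_left mult.assoc)
  qed
  have r: "of_real p30 * a^3 + of_real p21 * (a\<^sup>2 * b) + of_real p12 * (a * b\<^sup>2) + of_real p03 * b^3
      = - of_real k * of_real f3 * (of_real al' * (cnj x)^3 - of_real ga' * x^3)"
  proof -
    have "p30 = - k * f3 * (al' * ga^3 - ga' * al^3)" "p21 = - k * f3 * (3 * (al' * ga\<^sup>2 * al - ga' * al\<^sup>2 * ga))"
      "p12 = - k * f3 * (3 * (al' * ga * al\<^sup>2 - ga' * al * ga\<^sup>2))" "p03 = - k * f3 * (al' * al^3 - ga' * ga^3)"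
      by (simp_all add: p30_def p21_def p12_def p03_def al_def ga_def al'_def ga'_def)
    then have "complex_of_real p30 = - of_real k * of_real f3 * (of_real al' * (of_real ga)^3 - of_real ga' * (of_real al)^3)"
      "complex_of_real p21 = - of_real k * of_real f3 * (3 * (of_real al' * (of_real ga)\<^sup>2 * of_real al - of_real ga' * (of_real al)\<^sup>2 * of_real ga))"
      "complex_of_real p12 = - of_real k * of_real f3 * (3 * (of_real al' * of_real ga * (of_real al)\<^sup>2 - of_real ga' * of_real al * (of_real ga)\<^sup>2))"
      "complex_of_real p03 = - of_real k * of_real f3 * (of_real al' * (of_real al)^3 - of_real ga' * (of_real ga)^3)"
      by (simp_all only: of_real_mult of_real_minus of_real_diff of_real_power of_real_numeral)
    then show ?thesis unfolding cubic_forms[of "of_real al'" "of_real al" b "of_real ga" a "of_real ga'", folded x y]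
      by (simp only: distrib_left mult.assoc)
  qed
  define n where "n = of_real f2 * (cnj x)\<^sup>2 + of_real f3 * (cnj x)^3 + (cnj x)^4 * G (cnj x)"
  define Y where "Y = of_real \<theta> * x + of_real (k * D) * cnj x - of_real k * n"
  have cn: "cnj n = of_real f2 * x\<^sup>2 + of_real f3 * x^3 + x^4 * G x" by (simp add: n_def cG)
  have cY: "cnj Y = of_real \<theta> * cnj x + of_real (k * D) * x - of_real k * cnj n" by (simp add: Y_def)
  have "Z (V r0 x) = \<i> * (of_real al' * Y - of_real ga' * cnj Y)"
    unfolding V_expansion[OF assms] n_def[symmetric] Y_def[symmetric] Z_def al'_def[symmetric] ga'_def[symmetric]
    by (simp add: algebra_simps)
  also have "of_real al' * Y - of_real ga' * cnj Y
    = (of_real al' * of_real \<theta> - of_real ga' * of_real (k * D)) * x + (of_real al' * of_real (k * D) - of_real ga' * of_real \<theta>) * cnj x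
      - of_real k * (of_real al' * n - of_real ga' * cnj n)"
    unfolding cY unfolding Y_def by (simp only: algebra_simps)
  also have "\<dots> = of_real \<omega> * a - of_real k * (of_real al' * n - of_real ga' * cnj n)"
    unfolding lin' a_def Z_def al'_def[symmetric] ga'_def[symmetric] by (simp only: algebra_simps)
  also have "\<i> * \<dots> = \<i> * (of_real \<omega> * a + (- of_real k * of_real f2 * (of_real al' * (cnj x)\<^sup>2 - of_real ga' * x\<^sup>2))
     + (- of_real k * of_real f3 * (of_real al' * (cnj x)^3 - of_real ga' * x^3))) + E x"
    unfolding cn unfolding n_def E_def al'_def[symmetric] ga'_def[symmetric] by (simp only: algebra_simps) (simp add: algebra_simps)
  finally show ?thesis unfolding q[symmetric] r[symmetric] by (simp add: P2_def P3_def a_def b_def)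
qed

lemma Z_diff: "Z x - Z y = Z (x - y)"
  unfolding Z_def complex_cnj_diff right_diff_distrib by (rule add_diff_add)

lemma Z_Re_Im: "Re (Z x) = m * Re x" "Im (Z x) = Im x"
  by (simp_all add: Z_def field_simps)

lemma Z_bound: "cmod (Z x) \<le> (m + 1) * cmod x"
proof -
  have "cmod (Z x) \<le> \<bar>Re (Z x)\<bar> + \<bar>Im (Z x)\<bar>" by (rule cmod_le)
  also have "\<dots> \<le> m * cmod x + cmod x"
    unfolding Z_Re_Im abs_mult using m abs_Re_le_cmod[of x] abs_Im_le_cmod[of x] by (intro add_mono) auto
  finally show ?thesis by (simp add: algebra_simps)
qed

lemma Z_low: "min m 1 * cmod x \<le> cmod (Z x)"
proof -
  have "(min m 1 * cmod x)\<^sup>2 = (min m 1)\<^sup>2 * (Re x)\<^sup>2 + (min m 1)\<^sup>2 * (Im x)\<^sup>2"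
    unfolding power_mult_distrib cmod_power2 by (simp add: algebra_simps)
  also have "\<dots> \<le> m\<^sup>2 * (Re x)\<^sup>2 + 1\<^sup>2 * (Im x)\<^sup>2"
    using m by (intro add_mono mult_right_mono power_mono) auto
  also have "\<dots> = (cmod (Z x))\<^sup>2" unfolding cmod_power2 Z_Re_Im by (simp add: power_mult_distrib)
  finally show ?thesis by (rule power2_le_imp_le) simp
qed

lemma ordf_Z: "ordf d 1 Z" "ordf d 1 (\<lambda>x. cnj (Z x))"
proof -
  show "ordf d 1 Z" by (rule ordf_linear[OF Z_diff Z_bound])
  then show "ordf d 1 (\<lambda>x. cnj (Z x))" by (rule ordf_cnj)
qed

lemma ordf_forms:
  shows "ordf d 2 (\<lambda>x. P2 (Z x) (cnj (Z x)))" "ordf d 2 (\<lambda>x. P2 (cnj (Z x)) (Z x))"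
    "ordf d 3 (\<lambda>x. P3 (Z x) (cnj (Z x)))" "ordf d 3 (\<lambda>x. P3 (cnj (Z x)) (Z x))"
    "ordf d 2 (\<lambda>x. Q2 (Z x) (cnj (Z x)))" "ordf d 3 (\<lambda>x. Q3 (Z x) (cnj (Z x)))"
  unfolding P2_def P3_def Q2_def Q3_def
  using ordf_form2[OF ordf_Z] ordf_form2[OF ordf_Z(2,1)] ordf_form3[OF ordf_Z] ordf_form3[OF ordf_Z(2,1)]
    ordf_form3[OF ordf_Z, of d "of_real s30" 0 "of_real s12" "of_real s03"] by auto

definition Q2a :: "complex \<Rightarrow> complex \<Rightarrow> complex" where "Q2a a b = 2 * of_real q20 * a + of_real q11 * b"
definition Q2b :: "complex \<Rightarrow> complex \<Rightarrow> complex" where "Q2b a b = of_real q11 * a + 2 * of_real q02 * b"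
definition Q3a :: "complex \<Rightarrow> complex \<Rightarrow> complex" where "Q3a a b = 3 * of_real s30 * a\<^sup>2 + of_real s12 * b\<^sup>2"
definition Q3b :: "complex \<Rightarrow> complex \<Rightarrow> complex" where "Q3b a b = 2 * of_real s12 * (a * b) + 3 * of_real s03 * b\<^sup>2"

lemma Qa_Qb_split: "Qa a b = Q2a a b + Q3a a b" "Qb a b = Q2b a b + Q3b a b"
  by (simp_all add: Qa_def Qb_def Q2a_def Q2b_def Q3a_def Q3b_def)

lemma ordf_partials:
  "ordf d 1 (\<lambda>x. Q2a (Z x) (cnj (Z x)))" "ordf d 1 (\<lambda>x. Q2b (Z x) (cnj (Z x)))"
  "ordf d 2 (\<lambda>x. Q3a (Z x) (cnj (Z x)))" "ordf d 2 (\<lambda>x. Q3b (Z x) (cnj (Z x)))"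
proof -
  show "ordf d 1 (\<lambda>x. Q2a (Z x) (cnj (Z x)))" "ordf d 1 (\<lambda>x. Q2b (Z x) (cnj (Z x)))"
    unfolding Q2a_def Q2b_def by (intro ordf_add ordf_cmult ordf_Z)+
  show "ordf d 2 (\<lambda>x. Q3a (Z x) (cnj (Z x)))" "ordf d 2 (\<lambda>x. Q3b (Z x) (cnj (Z x)))"
    unfolding Q3a_def Q3b_def
    using ordf_form2[OF ordf_Z, of d "3 * of_real s30" 0 "of_real s12"] ordf_form2[OF ordf_Z, of d 0 "2 * of_real s12" "3 * of_real s03"]
    by simp_all
qed

lemma ordf_X: "d \<le> 1 \<Longrightarrow> ordf d 2 X"
  unfolding X_def[abs_def] using ordf_weaken[OF ordf_forms(6), of 2 d] by (intro ordf_add ordf_forms) auto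

lemma ordf_Qab:
  assumes "d \<le> 1"
  shows "ordf d 1 (\<lambda>x. Qa (Z x) (cnj (Z x)))" "ordf d 1 (\<lambda>x. Qb (Z x) (cnj (Z x)))"
  unfolding Qa_Qb_split by (intro ordf_add ordf_partials ordf_weaken[OF ordf_partials(3)] ordf_weaken[OF ordf_partials(4)] assms one_le_numeral)+

lemma ordf_G: "ordf d1 0 G" "ordf d1 0 (\<lambda>x. G (cnj x))"
proof -
  have 1: "ordf d1 0 (\<lambda>s. 1 / (1 + of_real uu * s))" "ordf d1 0 (\<lambda>s. 1 / (1 + of_real vv * s))"
    using d1 by (auto intro!: ordf_inverse_affine)
  show g: "ordf d1 0 G" unfolding G_def[abs_def] by (intro ordf_diff ordf_cmult 1)
  have "cnj (G x) = G (cnj x)" for x by (simp add: G_def)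
  then show "ordf d1 0 (\<lambda>x. G (cnj x))" using ordf_cnj[OF g] by simp
qed

lemma ordf_E: "ordf d1 4 E"
proof -
  have "ordf d1 4 (\<lambda>x. x^4 * G x)" using ordf_mult[OF ordf_power[OF ordf_id, of d1 4] ordf_G(1)] by simp
  moreover have "ordf d1 4 (\<lambda>x. (cnj x)^4 * G (cnj x))"
    using ordf_mult[OF ordf_power[OF ordf_cnj[OF ordf_id], of d1 4] ordf_G(2)] by simp
  ultimately show ?thesis unfolding E_def[abs_def] by (intro ordf_cmult ordf_diff)
qed

end

lemma ordf_Suc_lip:
  assumes "ordf d (Suc k) f"
  obtains M where "0 < M" "\<And>\<rho> x. 0 < \<rho> \<Longrightarrow> \<rho> \<le> d \<Longrightarrow> cmod x \<le> \<rho> \<Longrightarrow> cmod (f x) \<le> M * \<rho>^(Suc k)"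
    "\<And>\<rho> x y. 0 < \<rho> \<Longrightarrow> \<rho> \<le> d \<Longrightarrow> cmod x \<le> \<rho> \<Longrightarrow> cmod y \<le> \<rho> \<Longrightarrow> cmod (f x - f y) \<le> M * \<rho>^k * cmod (x - y)"
proof -
  obtain M where M: "0 \<le> M" "\<And>\<rho> x. 0 < \<rho> \<Longrightarrow> \<rho> \<le> d \<Longrightarrow> cmod x \<le> \<rho> \<Longrightarrow> cmod (f x) \<le> M * \<rho>^Suc k"
    "\<And>\<rho> x y. 0 < \<rho> \<Longrightarrow> \<rho> \<le> d \<Longrightarrow> cmod x \<le> \<rho> \<Longrightarrow> cmod y \<le> \<rho> \<Longrightarrow> \<rho> * cmod (f x - f y) \<le> M * \<rho>^Suc k * cmod (x - y)"
    using ordfE[OF assms] by blast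
  show ?thesis
  proof (rule that[of "M + 1"])
    show "0 < M + 1" using M by simp
    fix \<rho> x y assume a: "0 < \<rho>" "\<rho> \<le> d" "cmod x \<le> \<rho>"
    have "M * \<rho>^Suc k \<le> (M + 1) * \<rho>^Suc k" using a by (intro mult_right_mono) auto
    then show "cmod (f x) \<le> (M + 1) * \<rho>^Suc k" using M(2)[OF a] by linarith
    assume b: "cmod y \<le> \<rho>"
    have "\<rho> * cmod (f x - f y) \<le> \<rho> * (M * \<rho>^k * cmod (x - y))" using M(3)[OF a b] by (simp add: mult_ac)
    then have "cmod (f x - f y) \<le> M * \<rho>^k * cmod (x - y)" using a by simp
    also have "\<dots> \<le> (M + 1) * \<rho>^k * cmod (x - y)" using a by (intro mult_right_mono) auto
    finally show "cmod (f x - f y) \<le> (M + 1) * \<rho>^k * cmod (x - y)" .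
  qed
qed

lemma norm_conj_combination: "cmod (a * z + b * cnj z) \<le> cmod a * cmod z + cmod b * cmod z"
  using norm_triangle_ineq[of "a * z" "b * cnj z"] by (simp add: norm_mult)

context vortex_center
begin

definition Rem :: "complex \<Rightarrow> complex" where
  "Rem x = Q2a (Z x) (cnj (Z x)) * P3 (Z x) (cnj (Z x)) + Q3a (Z x) (cnj (Z x)) * (P2 (Z x) (cnj (Z x)) + P3 (Z x) (cnj (Z x)))
     - Q2b (Z x) (cnj (Z x)) * P3 (cnj (Z x)) (Z x) - Q3b (Z x) (cnj (Z x)) * (P2 (cnj (Z x)) (Z x) + P3 (cnj (Z x)) (Z x))"

definition N0 :: "complex \<Rightarrow> complex" where
  "N0 x = \<i> * Rem x + (E x + Qa (Z x) (cnj (Z x)) * E x + Qb (Z x) (cnj (Z x)) * cnj (E x))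
     - (\<i> * of_real \<beta>) * (Z x * Z x * cnj (X x) + 2 * (Z x * X x * cnj (Z x)) + 2 * (Z x * X x * cnj (X x))
        + X x * X x * cnj (Z x) + X x * X x * cnj (X x))"

lemma cnj_forms: "cnj (P2 a b) = P2 (cnj a) (cnj b)" "cnj (P3 a b) = P3 (cnj a) (cnj b)"
  "cnj (Q2 a b) = Q2 (cnj a) (cnj b)" "cnj (Q3 a b) = Q3 (cnj a) (cnj b)"
  by (simp_all add: P2_def P3_def Q2_def Q3_def)

lemma coefficient_relations:
  "p20 = - \<omega> * q20" "p11 = \<omega> * q11" "p02 = 3 * \<omega> * q02" "p30 = - 2 * \<omega> * s30 - 2 * q20 * p20 + q11 * p02"
  "p21 = \<beta> - 2 * q20 * p11 - q11 * p20 + q11 * p11 + 2 * q02 * p02"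
  "p12 = 2 * \<omega> * s12 - 2 * q20 * p02 - q11 * p11 + q11 * p20 + 2 * q02 * p11"
  "p03 = 4 * \<omega> * s03 - q11 * p02 + 2 * q02 * p20"
proof -
  have w: "\<omega> \<noteq> 0" using m(3) by simp
  show "p20 = - \<omega> * q20" "p11 = \<omega> * q11" "p02 = 3 * \<omega> * q02" using w by (simp_all add: q20_def q11_def q02_def)
  show "p30 = - 2 * \<omega> * s30 - 2 * q20 * p20 + q11 * p02" using w by (simp add: s30_def)
  show "p21 = \<beta> - 2 * q20 * p11 - q11 * p20 + q11 * p11 + 2 * q02 * p02" by (simp add: \<beta>_def)
  show "p12 = 2 * \<omega> * s12 - 2 * q20 * p02 - q11 * p11 + q11 * p20 + 2 * q02 * p11" using w by (simp add: s12_def)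
  show "p03 = 4 * \<omega> * s03 - q11 * p02 + 2 * q02 * p20" using w by (simp add: s03_def)
qed

lemma normal_form_eq:
  assumes x: "cmod x \<le> d1"
  shows "DW x (V r0 x) - W x * (\<i> * of_real \<omega> + \<i> * of_real (\<beta> * (cmod (W x))\<^sup>2)) = N0 x"
proof -
  define a where "a = Z x"
  define b where "b = cnj (Z x)"
  define e where "e = E x"
  define X1 where "X1 = X x"
  have ab: "cnj a = b" "cnj b = a" by (simp_all add: a_def b_def)
  define Y where "Y = of_real \<omega> * a + P2 a b + P3 a b"
  define Y' where "Y' = of_real \<omega> * b + P2 b a + P3 b a"
  have cY: "cnj Y = Y'" by (simp add: Y_def Y'_def cnj_forms ab)
  have ZV: "Z (V r0 x) = \<i> * Y + e" using Z_V[OF x] by (simp add: Y_def a_def b_def e_def)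
  have rel: "complex_of_real p20 = - of_real \<omega> * of_real q20" "complex_of_real p11 = of_real \<omega> * of_real q11"
    "complex_of_real p02 = 3 * of_real \<omega> * of_real q02"
    "complex_of_real p30 = - 2 * of_real \<omega> * of_real s30 - 2 * of_real q20 * of_real p20 + of_real q11 * of_real p02"
    "complex_of_real p21 = of_real \<beta> - 2 * of_real q20 * of_real p11 - of_real q11 * of_real p20 + of_real q11 * of_real p11 + 2 * of_real q02 * of_real p02"
    "complex_of_real p12 = 2 * of_real \<omega> * of_real s12 - 2 * of_real q20 * of_real p02 - of_real q11 * of_real p11 + of_real q11 * of_real p20 + 2 * of_real q02 * of_real p11"
    "complex_of_real p03 = 4 * of_real \<omega> * of_real s03 - of_real q11 * of_real p02 + 2 * of_real q02 * of_real p20"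
    using coefficient_relations[THEN arg_cong, where f = complex_of_real]
    by (simp_all only: of_real_mult of_real_minus of_real_diff of_real_add of_real_numeral)
  have id: "(1 + Q2a a b + Q3a a b) * Y - (Q2b a b + Q3b a b) * Y' - of_real \<omega> * (a + Q2 a b + Q3 a b)
    = of_real \<beta> * (a\<^sup>2 * b) + Rem x"
    unfolding Y_def Y'_def Rem_def a_def[symmetric] ab(1) Q2a_def Q3a_def Q2b_def Q3b_def
    by (rule normal_form_identity[OF rel]) (simp_all add: P2_def P3_def Q2_def Q3_def mult_ac)
  have W: "W x = a + X1" "cnj (W x) = b + cnj X1" "X1 = Q2 a b + Q3 a b"
    by (simp_all add: W_def X_def a_def b_def X1_def)
  have n: "complex_of_real ((cmod (W x))\<^sup>2) = W x * cnj (W x)" by (rule complex_norm_square)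
  have "DW x (V r0 x) = (1 + Q2a a b + Q3a a b) * (\<i> * Y + e) + (Q2b a b + Q3b a b) * (- \<i> * Y' + cnj e)"
    unfolding DW_def Qa_Qb_split ZV a_def[symmetric] ab(1) by (simp add: cY add.assoc)
  also have "\<dots> = \<i> * ((1 + Q2a a b + Q3a a b) * Y - (Q2b a b + Q3b a b) * Y')
     + (e + (Q2a a b + Q3a a b) * e + (Q2b a b + Q3b a b) * cnj e)" by (simp add: algebra_simps)
  also have "(1 + Q2a a b + Q3a a b) * Y - (Q2b a b + Q3b a b) * Y' = of_real \<omega> * W x + of_real \<beta> * (a\<^sup>2 * b) + Rem x"
    using id unfolding W by (simp add: algebra_simps)
  finally have "DW x (V r0 x) - W x * (\<i> * of_real \<omega> + \<i> * of_real (\<beta> * (cmod (W x))\<^sup>2))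
    = \<i> * Rem x + (e + (Q2a a b + Q3a a b) * e + (Q2b a b + Q3b a b) * cnj e)
      + (\<i> * of_real \<beta>) * (a\<^sup>2 * b - W x * (W x * cnj (W x)))"
    unfolding of_real_mult n by (simp add: algebra_simps)
  also have "a\<^sup>2 * b - W x * (W x * cnj (W x)) = - (a * a * cnj X1 + 2 * (a * X1 * b) + 2 * (a * X1 * cnj X1) + X1 * X1 * b + X1 * X1 * cnj X1)"
    unfolding W(2) unfolding W(1) by (simp add: algebra_simps power2_eq_square)
  finally show ?thesis unfolding N0_def Qa_Qb_split a_def[symmetric] ab(1) e_def[symmetric] X1_def[symmetric]
    by (simp only: mult_minus_right diff_conv_add_uminus)
qed

lemma ordf_N0: "ordf d1 4 N0"
proof -
  note d = d1(2)
  have Q: "ordf d1 1 (\<lambda>x. Qa (Z x) (cnj (Z x)))" "ordf d1 1 (\<lambda>x. Qb (Z x) (cnj (Z x)))" using ordf_Qab d by auto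
  have X: "ordf d1 2 X" "ordf d1 2 (\<lambda>x. cnj (X x))" using ordf_X[OF d] ordf_cnj by auto
  have P: "ordf d1 2 (\<lambda>x. P2 (Z x) (cnj (Z x)) + P3 (Z x) (cnj (Z x)))" "ordf d1 2 (\<lambda>x. P2 (cnj (Z x)) (Z x) + P3 (cnj (Z x)) (Z x))"
    by (intro ordf_add ordf_forms ordf_weaken[OF ordf_forms(3)] ordf_weaken[OF ordf_forms(4)] d; simp)+
  have R: "ordf d1 4 Rem" unfolding Rem_def[abs_def]
    by (intro ordf_add ordf_diff ordf_mult'[OF ordf_partials(1) ordf_forms(3)] ordf_mult'[OF ordf_partials(3) P(1)]
        ordf_mult'[OF ordf_partials(2) ordf_forms(4)] ordf_mult'[OF ordf_partials(4) P(2)] d) simp_all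
  have EE: "ordf d1 4 (\<lambda>x. E x + Qa (Z x) (cnj (Z x)) * E x + Qb (Z x) (cnj (Z x)) * cnj (E x))"
    by (intro ordf_add ordf_E ordf_mult'[OF Q(1) ordf_E] ordf_mult'[OF Q(2) ordf_cnj[OF ordf_E]] d) simp_all
  have XX: "ordf d1 4 (\<lambda>x. Z x * Z x * cnj (X x) + 2 * (Z x * X x * cnj (Z x)) + 2 * (Z x * X x * cnj (X x))
        + X x * X x * cnj (Z x) + X x * X x * cnj (X x))"
    by (intro ordf_add ordf_cmult ordf_mult'[OF ordf_mult[OF ordf_Z(1) ordf_Z(1)] X(2)]
        ordf_mult'[OF ordf_mult[OF ordf_Z(1) X(1)] ordf_Z(2)] ordf_mult'[OF ordf_mult[OF ordf_Z(1) X(1)] X(2)]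
        ordf_mult'[OF ordf_mult[OF X(1) X(1)] ordf_Z(2)] ordf_mult'[OF ordf_mult[OF X(1) X(1)] X(2)] d) simp_all
  show ?thesis unfolding N0_def[abs_def] by (rule ordf_diff[OF ordf_add[OF ordf_cmult[OF R] EE] ordf_cmult[OF XX]])
qed

lemma bounded_linear_Z: "bounded_linear Z"
proof (rule bounded_linear_intro)
  show "Z (x + y) = Z x + Z y" for x y unfolding Z_def complex_cnj_add distrib_left by (simp only: add_ac)
  show "Z (r *\<^sub>R x) = r *\<^sub>R Z x" for r x unfolding Z_def
    by (simp only: scaleR_conv_of_real complex_cnj_mult complex_cnj_complex_of_real distrib_left mult.left_commute)
  show "norm (Z x) \<le> norm x * (m + 1)" for x using Z_bound[of x] by (simp add: mult.commute)
qed

lemma W_deriv: "(W has_derivative DW x) (at x)"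
proof -
  have Z: "(Z has_derivative Z) (at x)" by (rule bounded_linear_imp_has_derivative[OF bounded_linear_Z])
  have Zc: "((\<lambda>x. cnj (Z x)) has_derivative (\<lambda>v. cnj (Z v))) (at x)"
    by (rule bounded_linear.has_derivative[OF bounded_linear_cnj Z])
  show ?thesis unfolding W_def[abs_def] X_def Q2_def Q3_def
    by (rule has_derivative_eq_rhs, (rule derivative_eq_intros Z Zc refl)+)
      (simp add: DW_def[abs_def] Qa_def Qb_def fun_eq_iff algebra_simps power2_eq_square)
qed

lemma Im_W_eq_0: "Z x = cnj (Z x) \<Longrightarrow> Im (W x) = 0"
proof -
  assume z: "Z x = cnj (Z x)"
  have "cnj (W x) = W x" unfolding W_def X_def by (simp add: cnj_forms z[symmetric])
  then show "Im (W x) = 0" by (metis complex_cnj_cancel_iff complex_cnj complex.sel(2) neg_equal_zero cnj.sel(2))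
qed

lemma V_zero: "V r0 0 = 0"
  using V_expansion[of 0] d1 by simp

lemma V_Im_bound:
  obtains M where "0 < M" "\<And>a. 0 < a \<Longrightarrow> a \<le> d1 \<Longrightarrow> A * a - M * a\<^sup>2 \<le> Im (V r0 (of_real a))"
proof -
  define n where "n = (\<lambda>x. of_real k * (of_real f2 * (cnj x)\<^sup>2 + (of_real f3 * (cnj x)^3 + (cnj x)^4 * G (cnj x))))"
  have 1: "ordf d1 1 (\<lambda>x. cnj x)" by (rule ordf_cnj[OF ordf_id])
  have "ordf d1 2 n" unfolding n_def
    by (intro ordf_cmult ordf_add ordf_power 1 ordf_weaken[OF ordf_power[OF 1, of 3]] ordf_mult'[OF ordf_power[OF 1] ordf_G(2)] d1) simp_all
  then obtain M where M: "0 < M" "\<And>\<rho> x. 0 < \<rho> \<Longrightarrow> \<rho> \<le> d1 \<Longrightarrow> cmod x \<le> \<rho> \<Longrightarrow> cmod (n x) \<le> M * \<rho>^Suc 1"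
    using ordf_Suc_lip[of d1 1 n] by (metis Suc_1)
  show ?thesis
  proof (rule that[OF M(1)])
    fix a :: real assume a: "0 < a" "a \<le> d1"
    have V: "V r0 (of_real a) = \<i> * (of_real (A * a) - n (of_real a))"
    proof -
      have "cmod (of_real a) \<le> d1" using a by simp
      from V_expansion[OF this] show ?thesis by (simp add: n_def A_def algebra_simps)
    qed
    have "\<bar>Re (n (of_real a))\<bar> \<le> M * a\<^sup>2" using M(2)[of a "of_real a"] a abs_Re_le_cmod[of "n (of_real a)"] by (simp add: power2_eq_square)
    then show "A * a - M * a\<^sup>2 \<le> Im (V r0 (of_real a))" unfolding V by simp
  qed
qed

theorem ex_elliptic_field:
  assumes "0 < \<delta>"
  shows "\<exists>d L M l. d \<le> d0 \<and> d \<le> \<delta> \<and> elliptic_field V H r0 \<kappa>1 d L W DW \<omega> \<beta> M l"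
proof -
  obtain MX where MX: "0 < MX" "\<And>\<rho> x y. 0 < \<rho> \<Longrightarrow> \<rho> \<le> d1 \<Longrightarrow> cmod x \<le> \<rho> \<Longrightarrow> cmod y \<le> \<rho> \<Longrightarrow> cmod (X x - X y) \<le> MX * \<rho>^1 * cmod (x - y)"
    using ordf_Suc_lip[of d1 1 X] ordf_X[OF d1(2)] by (metis Suc_1)
  obtain MV where MV: "0 < MV" "\<And>a. 0 < a \<Longrightarrow> a \<le> d1 \<Longrightarrow> A * a - MV * a\<^sup>2 \<le> Im (V r0 (of_real a))"
    using V_Im_bound by blast
  obtain Ma where Ma: "0 < Ma" "\<And>\<rho> x. 0 < \<rho> \<Longrightarrow> \<rho> \<le> d1 \<Longrightarrow> cmod x \<le> \<rho> \<Longrightarrow> cmod (Qa (Z x) (cnj (Z x))) \<le> Ma * \<rho>^Suc 0"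
    "\<And>\<rho> x y. 0 < \<rho> \<Longrightarrow> \<rho> \<le> d1 \<Longrightarrow> cmod x \<le> \<rho> \<Longrightarrow> cmod y \<le> \<rho> \<Longrightarrow> cmod (Qa (Z x) (cnj (Z x)) - Qa (Z y) (cnj (Z y))) \<le> Ma * \<rho>^0 * cmod (x - y)"
    by (rule ordf_Suc_lip[OF ordf_Qab(1)[OF d1(2), unfolded One_nat_def]]) blast
  obtain Mb where Mb: "0 < Mb" "\<And>\<rho> x. 0 < \<rho> \<Longrightarrow> \<rho> \<le> d1 \<Longrightarrow> cmod x \<le> \<rho> \<Longrightarrow> cmod (Qb (Z x) (cnj (Z x))) \<le> Mb * \<rho>^Suc 0"
    "\<And>\<rho> x y. 0 < \<rho> \<Longrightarrow> \<rho> \<le> d1 \<Longrightarrow> cmod x \<le> \<rho> \<Longrightarrow> cmod y \<le> \<rho> \<Longrightarrow> cmod (Qb (Z x) (cnj (Z x)) - Qb (Z y) (cnj (Z y))) \<le> Mb * \<rho>^0 * cmod (x - y)"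
    by (rule ordf_Suc_lip[OF ordf_Qab(2)[OF d1(2), unfolded One_nat_def]]) blast
  obtain MN where MN: "0 < MN" "\<And>\<rho> x. 0 < \<rho> \<Longrightarrow> \<rho> \<le> d1 \<Longrightarrow> cmod x \<le> \<rho> \<Longrightarrow> cmod (N0 x) \<le> MN * \<rho>^Suc 3"
    "\<And>\<rho> x y. 0 < \<rho> \<Longrightarrow> \<rho> \<le> d1 \<Longrightarrow> cmod x \<le> \<rho> \<Longrightarrow> cmod y \<le> \<rho> \<Longrightarrow> cmod (N0 x - N0 y) \<le> MN * \<rho>^3 * cmod (x - y)"
  proof -
    have "ordf d1 (Suc 3) N0" using ordf_N0 by simp
    then show thesis by (rule ordf_Suc_lip) (use that in blast)
  qed
  define mm where "mm = min m 1"
  have mm: "0 < mm" "mm \<le> m" "mm \<le> 1" using m by (auto simp: mm_def)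
  define d where "d = min (min d1 \<delta>) (min (mm / (2 * MX)) (A / (2 * MV)))"
  have d: "0 < d" "d \<le> d1" "d \<le> 1" "d \<le> d0" "d \<le> \<delta>" using assms d1 mm MX MV AB by (auto simp: d_def)
  have dX: "MX * d \<le> mm / 2"
  proof -
    have "d \<le> mm / (2 * MX)" by (simp add: d_def)
    then show ?thesis using MX by (simp add: field_simps)
  qed
  have dV: "MV * d \<le> A / 2"
  proof -
    have "d \<le> A / (2 * MV)" by (simp add: d_def)
    then show ?thesis using MV by (simp add: field_simps)
  qed
  define l where "l = min (mm / 2) (A / 2)"
  have l: "0 < l" "l \<le> mm / 2" "l \<le> A / 2" using mm AB by (auto simp: l_def)
  define L where "L = L0 + (m + 1 + mm) + (1 + Ma + Mb) * (m + 1)"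
  have C: "0 < (1 + Ma + Mb) * (m + 1)" using Ma Mb m by (intro mult_pos_pos) auto
  have L0: "0 < L0"
  proof -
    have "0 < \<theta> + \<bar>k\<bar> * (2 / \<mu>\<^sup>2)" using theta constants_pos by (intro add_pos_nonneg) auto
    then show ?thesis using L0_parts(2) by linarith
  qed
  have L: "L0 \<le> L" "m + 1 + mm \<le> L" "(1 + Ma + Mb) * (m + 1) \<le> L" using C L0 m mm by (auto simp: L_def)
  have X: "cmod (X x - X y) \<le> mm / 2 * cmod (x - y)" if "cmod x \<le> d" "cmod y \<le> d" for x y
  proof -
    have "cmod (X x - X y) \<le> (MX * d) * cmod (x - y)" using MX(2)[OF d(1,2) that] by simp
    also have "\<dots> \<le> mm / 2 * cmod (x - y)" using dX by (intro mult_right_mono) auto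
    finally show ?thesis .
  qed
  have WX: "W x - W y = Z (x - y) + (X x - X y)" for x y by (simp add: W_def Z_diff[symmetric])
  have Xr: "Im (X (of_real a)) = 0" "Im (W (of_real a)) = 0" for a
  proof -
    have z: "Z (of_real a) = cnj (Z (of_real a))" by (simp add: Z_def)
    then show 1: "Im (W (of_real a)) = 0" by (rule Im_W_eq_0)
    then show "Im (X (of_real a)) = 0" unfolding W_def using Z_Re_Im(2)[of "of_real a"] by simp
  qed
  have "elliptic_field V H r0 \<kappa>1 d L W DW \<omega> \<beta> MN l"
  proof (intro elliptic_field.intro elliptic_field_axioms.intro)
    show "reversible_field V H r0 \<kappa>1 d L" by (rule reversible[OF d(1,4) L(1)])
    show "0 < \<omega>" "\<beta> < 0" "0 < MN" "0 < l" using m beta_neg MN l by auto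
    show "V r0 0 = 0" by (rule V_zero)
    show "cmod ((V \<rho> x - V r0 x) - (V \<rho> y - V r0 y)) \<le> L * \<bar>\<rho> - r0\<bar> * cmod (x - y)"
      if "\<bar>\<rho> - r0\<bar> \<le> \<kappa>1" "cmod x \<le> d" "cmod y \<le> d" for \<rho> x y
    proof -
      have "cmod ((V \<rho> x - V r0 x) - (V \<rho> y - V r0 y)) \<le> L0 * \<bar>\<rho> - r0\<bar> * cmod (x - y)" using V_mixed0 that d by auto
      also have "\<dots> \<le> L * \<bar>\<rho> - r0\<bar> * cmod (x - y)" using L by (intro mult_right_mono) auto
      finally show ?thesis .
    qed
    show "W 0 = 0" by (simp add: W_def X_def Q2_def Q3_def Z_def)
    show "cmod (W x - W y) \<le> L * cmod (x - y)" if "cmod x \<le> d" "cmod y \<le> d" for x y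
    proof -
      have "cmod (W x - W y) \<le> (m + 1) * cmod (x - y) + mm / 2 * cmod (x - y)"
        unfolding WX using norm_triangle_ineq[of "Z (x - y)" "X x - X y"] Z_bound[of "x - y"] X[OF that] by linarith
      also have "\<dots> = (m + 1 + mm / 2) * cmod (x - y)" by (simp add: algebra_simps)
      also have "\<dots> \<le> L * cmod (x - y)" using L mm by (intro mult_right_mono) auto
      finally show ?thesis .
    qed
    show "l * cmod (x - y) \<le> cmod (W x - W y)" if "cmod x \<le> d" "cmod y \<le> d" for x y
    proof -
      have "l * cmod (x - y) \<le> mm / 2 * cmod (x - y)" using l by (intro mult_right_mono) auto
      moreover have "mm * cmod (x - y) \<le> cmod (Z (x - y))" using Z_low unfolding mm_def by blast
      ultimately show ?thesis unfolding WX using norm_diff_ineq[of "Z (x - y)" "X x - X y"] X[OF that] by simp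
    qed
    show "l * (b - a) \<le> Re (W (of_real b)) - Re (W (of_real a))" if "- d \<le> a" "a \<le> b" "b \<le> d" for a b
    proof -
      have "cmod (X (of_real b) - X (of_real a)) \<le> mm / 2 * cmod (of_real b - of_real a)" using that by (intro X) auto
      also have "cmod (of_real b - of_real a) = b - a" using that by (simp flip: of_real_diff)
      finally have "\<bar>Re (X (of_real b) - X (of_real a))\<bar> \<le> mm / 2 * (b - a)" using abs_Re_le_cmod order_trans by blast
      note abs_le_D2[OF this]
      moreover have "Re (W (of_real b)) - Re (W (of_real a)) = m * (b - a) + Re (X (of_real b) - X (of_real a))"
        using arg_cong[OF WX[of "of_real b" "of_real a"], of Re] by (simp add: Z_Re_Im)
      moreover have "l * (b - a) \<le> mm / 2 * (b - a)" "mm * (b - a) \<le> m * (b - a)" using l mm that by (intro mult_right_mono; simp)+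
      ultimately show ?thesis by linarith
    qed
    show "Im (W (of_real a)) = 0" if "\<bar>a\<bar> \<le> d" for a by (rule Xr)
    show "l * (Im x)\<^sup>2 \<le> Im x * Im (W x)" if x: "cmod x \<le> d" for x
    proof -
      have "cmod (X x - X (of_real (Re x))) \<le> mm / 2 * cmod (x - of_real (Re x))"
        using x abs_Re_le_cmod[of x] by (intro X) auto
      also have "x - of_real (Re x) = \<i> * of_real (Im x)" by (simp add: complex_eq_iff)
      finally have "\<bar>Im (X x)\<bar> \<le> mm / 2 * \<bar>Im x\<bar>"
        using abs_Im_le_cmod[of "X x - X (of_real (Re x))"] by (simp add: Xr norm_mult)
      also have "\<dots> \<le> 1 / 2 * \<bar>Im x\<bar>" using mm by (intro mult_right_mono) auto
      finally have "\<bar>Im x\<bar> * \<bar>Im (X x)\<bar> \<le> \<bar>Im x\<bar> * (1 / 2 * \<bar>Im x\<bar>)" by (intro mult_left_mono) auto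
      then have "\<bar>Im x * Im (X x)\<bar> \<le> \<bar>Im x\<bar> * \<bar>Im x\<bar> / 2" by (simp add: abs_mult)
      also have "\<bar>Im x\<bar> * \<bar>Im x\<bar> = (Im x)\<^sup>2" by (simp add: power2_eq_square)
      finally have "- (Im x * Im (X x)) \<le> (Im x)\<^sup>2 / 2" by (rule abs_le_D2)
      moreover have "l * (Im x)\<^sup>2 \<le> 1 / 2 * (Im x)\<^sup>2" using l mm by (intro mult_right_mono) auto
      moreover have "Im x * Im (W x) = (Im x)\<^sup>2 + Im x * Im (X x)" by (simp add: W_def Z_Re_Im power2_eq_square algebra_simps)
      ultimately show ?thesis by linarith
    qed
    show "(W has_derivative DW x) (at x)" if "cmod x < d" for x by (rule W_deriv)
    show "linear (DW x)" for x using W_deriv has_derivative_linear by blast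
    show "cmod (DW x v) \<le> L * cmod v" if "cmod x \<le> d" for x v
    proof -
      have q: "cmod (Qa (Z x) (cnj (Z x))) \<le> Ma" "cmod (Qb (Z x) (cnj (Z x))) \<le> Mb"
      proof -
        have "Ma * d \<le> Ma * 1" "Mb * d \<le> Mb * 1" using d Ma(1) Mb(1) by (intro mult_left_mono; simp)+
        then show "cmod (Qa (Z x) (cnj (Z x))) \<le> Ma" "cmod (Qb (Z x) (cnj (Z x))) \<le> Mb"
          using Ma(2)[OF d(1,2) that] Mb(2)[OF d(1,2) that] by simp_all
      qed
      have "cmod (DW x v) \<le> cmod (1 + Qa (Z x) (cnj (Z x))) * cmod (Z v) + cmod (Qb (Z x) (cnj (Z x))) * cmod (Z v)"
        unfolding DW_def by (rule norm_conj_combination)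
      also have "\<dots> \<le> (1 + Ma) * cmod (Z v) + Mb * cmod (Z v)"
        using q norm_triangle_ineq[of 1 "Qa (Z x) (cnj (Z x))"] by (intro add_mono mult_right_mono) auto
      also have "\<dots> = (1 + Ma + Mb) * cmod (Z v)" by (simp add: algebra_simps)
      also have "\<dots> \<le> (1 + Ma + Mb) * ((m + 1) * cmod v)" using Ma Mb Z_bound by (intro mult_left_mono) auto
      also have "\<dots> \<le> L * cmod v" unfolding mult.assoc[symmetric] using L by (intro mult_right_mono) auto
      finally show ?thesis .
    qed
    show "cmod (DW x v - DW y v) \<le> L * cmod (x - y) * cmod v" if "cmod x \<le> d" "cmod y \<le> d" for x y v
    proof -
      have e: "DW x v - DW y v = (Qa (Z x) (cnj (Z x)) - Qa (Z y) (cnj (Z y))) * Z v + (Qb (Z x) (cnj (Z x)) - Qb (Z y) (cnj (Z y))) * cnj (Z v)"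
        by (simp add: DW_def algebra_simps)
      have "cmod (DW x v - DW y v) \<le> cmod (Qa (Z x) (cnj (Z x)) - Qa (Z y) (cnj (Z y))) * cmod (Z v) + cmod (Qb (Z x) (cnj (Z x)) - Qb (Z y) (cnj (Z y))) * cmod (Z v)"
        unfolding e by (rule norm_conj_combination)
      also have "\<dots> \<le> (Ma * cmod (x - y)) * cmod (Z v) + (Mb * cmod (x - y)) * cmod (Z v)"
        using Ma(3)[OF d(1,2) that] Mb(3)[OF d(1,2) that] by (intro add_mono mult_right_mono) auto
      also have "\<dots> = ((Ma + Mb) * cmod (x - y)) * cmod (Z v)" by (simp add: algebra_simps)
      also have "\<dots> \<le> ((1 + Ma + Mb) * cmod (x - y)) * ((m + 1) * cmod v)" using Ma Mb m Z_bound by (intro mult_mono) auto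
      also have "\<dots> = ((1 + Ma + Mb) * (m + 1)) * cmod (x - y) * cmod v" by (simp add: mult_ac)
      also have "\<dots> \<le> L * cmod (x - y) * cmod v" using L by (intro mult_right_mono) auto
      finally show ?thesis .
    qed
    show "cmod (DW x (V r0 x) - W x * (\<i> * of_real \<omega> + \<i> * of_real (\<beta> * (cmod (W x))\<^sup>2))) \<le> MN * \<rho>^4"
      if "cmod x \<le> \<rho>" "\<rho> \<le> d" for x \<rho>
    proof (cases "\<rho> > 0")
      case True
      have "cmod x \<le> d1" using that d by linarith
      from normal_form_eq[OF this] show ?thesis using MN(2)[OF True order_trans[OF that(2) d(2)] that(1)] by simp
    next
      case False
      then have "x = 0" using that by (smt (verit) norm_ge_zero zero_less_norm_iff)
      moreover have "\<rho> = 0" using False that norm_ge_zero[of x] by linarith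
      ultimately show ?thesis by (simp add: V_zero W_def DW_def X_def Q2_def Q3_def Z_def)
    qed
    show "cmod ((DW x (V r0 x) - W x * (\<i> * of_real \<omega> + \<i> * of_real (\<beta> * (cmod (W x))\<^sup>2)))
          - (DW y (V r0 y) - W y * (\<i> * of_real \<omega> + \<i> * of_real (\<beta> * (cmod (W y))\<^sup>2)))) \<le> MN * \<rho>^3 * cmod (x - y)"
      if "cmod x \<le> \<rho>" "cmod y \<le> \<rho>" "\<rho> \<le> d" for x y \<rho>
    proof (cases "\<rho> > 0")
      case True
      have "cmod x \<le> d1" "cmod y \<le> d1" using that d by linarith+
      note e = normal_form_eq[OF this(1)] normal_form_eq[OF this(2)]
      show ?thesis unfolding e using MN(3)[OF True order_trans[OF that(3) d(2)] that(1,2)] .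
    next
      case False
      then have "x = 0" "y = 0" using that by (smt (verit) norm_ge_zero zero_less_norm_iff)+
      then show ?thesis by simp
    qed
    show "l * a \<le> Im (V r0 (of_real a))" if a: "0 \<le> a" "a \<le> d" for a
    proof (cases "a = 0")
      case False
      then have a0: "0 < a" using a by simp
      have "MV * a\<^sup>2 \<le> A / 2 * a"
      proof -
        have "MV * a \<le> MV * d" using MV a by (intro mult_left_mono) auto
        then have "MV * a \<le> A / 2" using dV by linarith
        from mult_right_mono[OF this a(1)] show ?thesis by (simp add: power2_eq_square mult_ac)
      qed
      moreover have "l * a \<le> A / 2 * a" using l a by (intro mult_right_mono) auto
      ultimately show ?thesis using MV(2)[OF a0] a d by simp
    qed (simp add: V_zero)
  qed
  then show ?thesis using d(4,5) by blast
qed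

end

section \<open>Existence of a non-degenerate center\<close>

lemma vortex_centerI:
  fixes R r0 k \<theta> x \<rho> \<phi> :: real
  assumes R: "0 < R" "0 < \<rho>" "\<rho> < 1" and theta: "0 < \<theta>" and k: "k \<noteq> 0" and \<phi>: "\<phi> = R\<^sup>2 * \<theta> / k"
    and x: "\<bar>x\<bar> < 1" "x < \<rho>"
    and cubic: "\<phi> * (\<rho> * x - (1 + \<rho>\<^sup>2) * x\<^sup>2 + \<rho> * x^3) = \<rho>\<^sup>2 - 1"
    and sum: "\<bar>x\<bar> * (1 / (\<rho> - x) + 1 / (1 / \<rho> - x)) < 1"
  shows "vortex_center R (R * \<rho>) k \<theta> (R * x)"
proof
  define a where "a = 1 / (x - \<rho>)"
  define b where "b = 1 / (x - 1 / \<rho>)"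
  have "1 < 1 / \<rho>" using R by simp
  then have nz: "x - \<rho> < 0" "x - 1 / \<rho> < 0" using x by auto
  have n: "x - \<rho> \<noteq> 0" "\<rho> * x - 1 \<noteq> 0" using nz R by (auto simp: field_simps)
  have ab: "a - b = \<phi> * x"
  proof -
    have b': "b = \<rho> / (\<rho> * x - 1)" unfolding b_def using R n by (simp add: field_simps)
    have "(a - b) * ((x - \<rho>) * (\<rho> * x - 1)) = (\<rho> * x - 1) - \<rho> * (x - \<rho>)"
    proof -
      have "a * (x - \<rho>) = 1" "b * (\<rho> * x - 1) = \<rho>" unfolding a_def b' using n by simp_all
      moreover have "(a - b) * ((x - \<rho>) * (\<rho> * x - 1)) = (a * (x - \<rho>)) * (\<rho> * x - 1) - (b * (\<rho> * x - 1)) * (x - \<rho>)"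
        by (simp add: algebra_simps)
      ultimately show ?thesis by simp
    qed
    also have "\<dots> = \<rho>\<^sup>2 - 1" by (simp add: power2_eq_square algebra_simps)
    also have "\<dots> = \<phi> * x * ((x - \<rho>) * (\<rho> * x - 1))"
      unfolding cubic[symmetric] by (simp add: power2_eq_square power3_eq_cube algebra_simps)
    finally show ?thesis using n by simp
  qed
  have c1: "1 / (R * x - R * \<rho>) = a / R" unfolding a_def right_diff_distrib[symmetric] by simp
  have c2: "1 / (R * x - R\<^sup>2 / (R * \<rho>)) = b / R"
  proof -
    have "R * x - R\<^sup>2 / (R * \<rho>) = R * (x - 1 / \<rho>)" using R by (simp add: power2_eq_square right_diff_distrib)
    then show ?thesis unfolding b_def by simp
  qed
  show "\<theta> * (R * x) = k * (1 / (R * x - R * \<rho>) - 1 / (R * x - R\<^sup>2 / (R * \<rho>)))"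
  proof -
    have "k * (a / R - b / R) = k * (\<phi> * x) / R" unfolding diff_divide_distrib[symmetric] ab by simp
    also have "\<dots> = \<theta> * (R * x)" unfolding \<phi> using k R by (simp add: power2_eq_square)
    finally show ?thesis unfolding c1 c2 by simp
  qed
  show "\<bar>k\<bar> * ((1 / (R * x - R * \<rho>))\<^sup>2 - (1 / (R * x - R\<^sup>2 / (R * \<rho>)))\<^sup>2) < \<theta>"
  proof -
    have "\<bar>a + b\<bar> = 1 / (\<rho> - x) + 1 / (1 / \<rho> - x)"
    proof -
      have "a < 0" "b < 0" unfolding a_def b_def using nz by simp_all
      moreover have "- a = 1 / (\<rho> - x)" "- b = 1 / (1 / \<rho> - x)" unfolding a_def b_def by (simp_all only: minus_divide_right minus_diff_eq)
      ultimately show ?thesis by linarith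
    qed
    then have s: "\<bar>x\<bar> * \<bar>a + b\<bar> < 1" using sum by simp
    have "(a / R)\<^sup>2 - (b / R)\<^sup>2 = (a - b) * (a + b) / R\<^sup>2" by (simp add: power_divide power2_eq_square algebra_simps diff_divide_distrib)
    also have "\<dots> \<le> \<bar>\<phi>\<bar> * (\<bar>x\<bar> * \<bar>a + b\<bar>) / R\<^sup>2" unfolding ab
      using abs_ge_self[of "\<phi> * x * (a + b)"] by (intro divide_right_mono) (simp_all add: abs_mult mult.assoc)
    finally have "\<bar>k\<bar> * ((a / R)\<^sup>2 - (b / R)\<^sup>2) \<le> \<bar>k\<bar> * (\<bar>\<phi>\<bar> * (\<bar>x\<bar> * \<bar>a + b\<bar>) / R\<^sup>2)" by (intro mult_left_mono) auto
    also have "\<dots> = \<theta> * (\<bar>x\<bar> * \<bar>a + b\<bar>)" unfolding \<phi> using k R theta by (simp add: abs_mult abs_divide)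
    also have "\<dots> < \<theta> * 1" using s theta by (intro mult_strict_left_mono) auto
    finally show ?thesis unfolding c1 c2 by simp
  qed
  show "\<bar>R * x\<bar> < R" "R * x < R * \<rho>" using R x by (auto simp: abs_mult)
qed (use R theta k in auto)

lemma center_opposite:
  fixes \<rho> \<phi> :: real
  assumes \<rho>: "0 < \<rho>" "\<rho> < 1" and \<phi>: "0 < \<phi>" and pos: "1 - \<rho> < \<phi> * (1 + \<rho>)"
  obtains x where "\<bar>x\<bar> < 1" "x < \<rho>" "\<phi> * (\<rho> * x - (1 + \<rho>\<^sup>2) * x\<^sup>2 + \<rho> * x^3) = \<rho>\<^sup>2 - 1"
    "\<bar>x\<bar> * (1 / (\<rho> - x) + 1 / (1 / \<rho> - x)) < 1"
proof -
  define q where "q x = \<phi> * (\<rho> * x - (1 + \<rho>\<^sup>2) * x\<^sup>2 + \<rho> * x^3)" for x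
  have q0: "q 0 = 0" by (simp add: q_def)
  have qm: "q (- 1) = - (\<phi> * (1 + \<rho>)) * (1 + \<rho>)" by (simp add: q_def power2_eq_square power3_eq_cube algebra_simps)
  have r: "\<rho>\<^sup>2 - 1 = - (1 - \<rho>) * (1 + \<rho>)" by (simp add: power2_eq_square algebra_simps)
  have "(1 - \<rho>) * (1 + \<rho>) < (\<phi> * (1 + \<rho>)) * (1 + \<rho>)" using pos \<rho> by (intro mult_strict_right_mono) auto
  then have l: "q (- 1) < \<rho>\<^sup>2 - 1" unfolding qm r by (simp only: mult_minus_left neg_less_iff_less)
  have u: "\<rho>\<^sup>2 - 1 < q 0" unfolding q0 using \<rho> by (simp add: power_less_one_iff)
  have "\<exists>x\<ge>- 1. x \<le> 0 \<and> q x = \<rho>\<^sup>2 - 1"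
    using l u by (intro IVT') (auto simp: q_def intro!: continuous_intros)
  then obtain x where x: "- 1 \<le> x" "x \<le> 0" "q x = \<rho>\<^sup>2 - 1" by blast
  have x': "- 1 < x" "x < 0" using x l u by (auto simp: le_less)
  show ?thesis
  proof (rule that)
    show "\<bar>x\<bar> < 1" "x < \<rho>" using x' \<rho> by auto
    show "\<phi> * (\<rho> * x - (1 + \<rho>\<^sup>2) * x\<^sup>2 + \<rho> * x^3) = \<rho>\<^sup>2 - 1" using x(3) by (simp add: q_def)
    define y where "y = - x"
    have y: "0 < y" "y < 1" using x' by (auto simp: y_def)
    have P: "0 < \<rho> + y" "0 < 1 / \<rho> + y" using y \<rho> by (auto intro: add_pos_pos)
    have "y * (2 * y + \<rho> + 1 / \<rho>) < (\<rho> + y) * (1 / \<rho> + y)"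
    proof -
      have "(\<rho> + y) * (1 / \<rho> + y) - y * (2 * y + \<rho> + 1 / \<rho>) = 1 - y * y" using \<rho> by (simp add: algebra_simps add_divide_distrib)
      moreover have "y * y < 1 * 1" using y by (intro mult_strict_mono) auto
      ultimately show ?thesis by linarith
    qed
    then have "y * (2 * y + \<rho> + 1 / \<rho>) / ((\<rho> + y) * (1 / \<rho> + y)) < 1" using P by (subst pos_divide_less_eq) auto
    moreover have "1 / (\<rho> + y) + 1 / (1 / \<rho> + y) = (2 * y + \<rho> + 1 / \<rho>) / ((\<rho> + y) * (1 / \<rho> + y))"
      using P by (subst add_frac_eq) auto
    ultimately show "\<bar>x\<bar> * (1 / (\<rho> - x) + 1 / (1 / \<rho> - x)) < 1" using x'(2) by (simp add: y_def)
  qed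
qed

lemma center_same_side:
  fixes \<rho> \<phi> :: real
  assumes \<rho>: "0 < \<rho>" "\<rho> < 1" and \<phi>: "\<phi> < 0" and F: "0 < F_region \<rho> \<phi>"
  obtains x where "\<bar>x\<bar> < 1" "x < \<rho>" "\<phi> * (\<rho> * x - (1 + \<rho>\<^sup>2) * x\<^sup>2 + \<rho> * x^3) = \<rho>\<^sup>2 - 1"
    "\<bar>x\<bar> * (1 / (\<rho> - x) + 1 / (1 / \<rho> - x)) < 1"
proof -
  define s where "s = sqrt (1 - \<rho>\<^sup>2 + \<rho>^4)"
  have r2: "\<rho>\<^sup>2 < 1" "0 < \<rho>\<^sup>2" using \<rho> by (auto simp: power_less_one_iff)
  have r4: "\<rho>^4 < \<rho>\<^sup>2" "0 < \<rho>^4" using \<rho> by (auto intro: power_strict_decreasing)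
  have D: "0 < 1 - \<rho>\<^sup>2 + \<rho>^4" using r2 r4 by linarith
  have s: "0 < s" "s\<^sup>2 = 1 - \<rho>\<^sup>2 + \<rho>^4" using D by (auto simp: s_def)
  have s1: "s < 1 + \<rho>\<^sup>2"
  proof (rule power2_less_imp_less)
    have "(1 + \<rho>\<^sup>2)\<^sup>2 = 1 + 2 * \<rho>\<^sup>2 + \<rho>^4" by (simp add: power2_eq_square power4_eq_xxxx algebra_simps)
    then show "s\<^sup>2 < (1 + \<rho>\<^sup>2)\<^sup>2" unfolding s using r2 by linarith
  qed (use r2 in auto)
  have s2: "1 - 2 * \<rho>\<^sup>2 < s"
  proof (rule power2_less_imp_less)
    have "(1 - 2 * \<rho>\<^sup>2)\<^sup>2 = 1 - 4 * \<rho>\<^sup>2 + 4 * \<rho>^4" by (simp add: power2_eq_square power4_eq_xxxx algebra_simps)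
    then show "(1 - 2 * \<rho>\<^sup>2)\<^sup>2 < s\<^sup>2" unfolding s using r4 by linarith
  qed (use s in auto)
  define X1 where "X1 = ((1 + \<rho>\<^sup>2) - s) / (3 * \<rho>)"
  define X2 where "X2 = ((1 + \<rho>\<^sup>2) + s) / (3 * \<rho>)"
  have X: "0 < X1" "X1 < \<rho>" "X1 < X2"
    unfolding X1_def X2_def using \<rho> s s1 s2 by (simp_all add: field_simps power2_eq_square)
  have roots: "\<rho> - 2 * (1 + \<rho>\<^sup>2) * x + 3 * \<rho> * x\<^sup>2 = 3 * \<rho> * ((X1 - x) * (X2 - x))" for x
  proof -
    have "X1 + X2 = 2 * (1 + \<rho>\<^sup>2) / (3 * \<rho>)" unfolding X1_def X2_def by (simp flip: add_divide_distrib)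
    then have 1: "3 * \<rho> * (X1 + X2) = 2 * (1 + \<rho>\<^sup>2)" using \<rho> by simp
    have "X1 * X2 = ((1 + \<rho>\<^sup>2)\<^sup>2 - s\<^sup>2) / (9 * \<rho>\<^sup>2)" unfolding X1_def X2_def by (simp add: power2_eq_square algebra_simps)
    also have "(1 + \<rho>\<^sup>2)\<^sup>2 - s\<^sup>2 = 3 * \<rho>\<^sup>2" unfolding s by (simp add: power2_eq_square power4_eq_xxxx algebra_simps)
    finally have 2: "3 * (X1 * X2) = 1" using \<rho> by simp
    have "3 * \<rho> * ((X1 - x) * (X2 - x)) = \<rho> * (3 * (X1 * X2)) - 3 * \<rho> * (X1 + X2) * x + 3 * \<rho> * x\<^sup>2"
      by (simp add: power2_eq_square algebra_simps)
    then show ?thesis unfolding 1 2 by simp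
  qed
  define q where "q x = \<rho> * x - (1 + \<rho>\<^sup>2) * x\<^sup>2 + \<rho> * x^3" for x
  have qX: "27 * \<rho>\<^sup>2 * q X1 = - (2 - 3 * \<rho>\<^sup>2 - 3 * \<rho>^4 + 2 * \<rho>^6 - 2 * s^3)"
  proof -
    define z where "z = 1 + \<rho>\<^sup>2 - s"
    have z: "z = 3 * \<rho> * X1" using \<rho> by (simp add: X1_def z_def)
    have "27 * \<rho>\<^sup>2 * q X1 = 9 * \<rho>\<^sup>2 * z - 3 * (1 + \<rho>\<^sup>2) * z\<^sup>2 + z^3"
      unfolding z by (simp add: q_def algebra_simps power2_eq_square power3_eq_cube)
    also have "\<dots> = 9 * \<rho>\<^sup>2 * (1 + \<rho>\<^sup>2) - 9 * \<rho>\<^sup>2 * s - 2 * (1 + \<rho>\<^sup>2)^3 + 3 * (1 + \<rho>\<^sup>2)\<^sup>2 * s - s * s\<^sup>2"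
      by (simp add: z_def algebra_simps power2_eq_square power3_eq_cube)
    also have "\<dots> = 9 * \<rho>\<^sup>2 * (1 + \<rho>\<^sup>2) - 2 * (1 + \<rho>\<^sup>2)^3 + 2 * (s * s\<^sup>2) + s * (3 * (1 + \<rho>\<^sup>2)\<^sup>2 - 9 * \<rho>\<^sup>2 - 3 * s\<^sup>2)"
      by (simp add: algebra_simps)
    also have "3 * (1 + \<rho>\<^sup>2)\<^sup>2 - 9 * \<rho>\<^sup>2 - 3 * s\<^sup>2 = 0" unfolding s by (simp add: power2_eq_square power4_eq_xxxx algebra_simps)
    also have "9 * \<rho>\<^sup>2 * (1 + \<rho>\<^sup>2) - 2 * (1 + \<rho>\<^sup>2)^3 = - (2 - 3 * \<rho>\<^sup>2 - 3 * \<rho>^4 + 2 * \<rho>^6)"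
      by (simp add: algebra_simps power_numeral_reduce)
    finally show ?thesis by (simp add: power2_eq_square power3_eq_cube)
  qed
  have sp: "(1 - \<rho>\<^sup>2 + \<rho>^4) powr (3 / 2) = s^3"
  proof -
    have "(1 - \<rho>\<^sup>2 + \<rho>^4) powr (3 / 2) = ((1 - \<rho>\<^sup>2 + \<rho>^4) powr (1 / 2)) powr 3" by (simp add: powr_powr)
    also have "\<dots> = s powr 3" using D by (simp add: s_def powr_half_sqrt)
    also have "\<dots> = s^3" using s by (simp add: powr_numeral)
    finally show ?thesis .
  qed
  have "27 * \<rho>\<^sup>2 * (\<phi> * q X1) = - (\<phi> * (2 - 3 * \<rho>\<^sup>2 - 3 * \<rho>^4 + 2 * \<rho>^6 - 2 * s^3))" 
    using arg_cong[OF qX, of "\<lambda>t. \<phi> * t"] by (simp add: algebra_simps)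
  also have "\<dots> < 27 * \<rho>\<^sup>2 * (\<rho>\<^sup>2 - 1)" using F unfolding F_region_def sp by simp
  finally have l: "\<phi> * q X1 < \<rho>\<^sup>2 - 1" using r2 by simp
  have u: "\<rho>\<^sup>2 - 1 < \<phi> * q 0" using r2 by (simp add: q_def)
  have "\<exists>x\<ge>0. x \<le> X1 \<and> \<phi> * q x = \<rho>\<^sup>2 - 1"
    using l u X by (intro IVT2') (auto simp: q_def intro!: continuous_intros)
  then obtain x where x: "0 \<le> x" "x \<le> X1" "\<phi> * q x = \<rho>\<^sup>2 - 1" by blast
  have x': "0 < x" "x < X1" using x l u by (auto simp: le_less)
  show ?thesis
  proof (rule that)
    show "\<bar>x\<bar> < 1" "x < \<rho>" using x' X \<rho> by auto
    show "\<phi> * (\<rho> * x - (1 + \<rho>\<^sup>2) * x\<^sup>2 + \<rho> * x^3) = \<rho>\<^sup>2 - 1" using x(3) by (simp add: q_def)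
    have "1 < 1 / \<rho>" using \<rho> by simp
    then have P: "0 < \<rho> - x" "0 < 1 / \<rho> - x" using x' X \<rho> by linarith+
    have "x * (\<rho> + 1 / \<rho> - 2 * x) < (\<rho> - x) * (1 / \<rho> - x)"
    proof -
      have "0 < 3 * \<rho> * ((X1 - x) * (X2 - x))" using \<rho> x' X by (intro mult_pos_pos) auto
      then have "0 < \<rho> - 2 * (1 + \<rho>\<^sup>2) * x + 3 * \<rho> * x\<^sup>2" unfolding roots .
      also have "\<dots> = \<rho> * ((\<rho> - x) * (1 / \<rho> - x) - x * (\<rho> + 1 / \<rho> - 2 * x))"
        using \<rho> by (simp add: algebra_simps diff_divide_distrib power2_eq_square)
      finally show ?thesis using \<rho> by (simp add: zero_less_mult_iff)
    qed
    then have "x * (\<rho> + 1 / \<rho> - 2 * x) / ((\<rho> - x) * (1 / \<rho> - x)) < 1" using P by (subst pos_divide_less_eq) auto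
    moreover have "1 / (\<rho> - x) + 1 / (1 / \<rho> - x) = (\<rho> + 1 / \<rho> - 2 * x) / ((\<rho> - x) * (1 / \<rho> - x))"
      using P by (subst add_frac_eq) auto
    ultimately show "\<bar>x\<bar> * (1 / (\<rho> - x) + 1 / (1 / \<rho> - x)) < 1" using x'(1) by simp
  qed
qed

theorem ex_vortex_center:
  assumes R: "0 < R" "0 < r0" "r0 < R" and theta: "0 < \<theta>" and k: "k \<noteq> 0"
    and reg: "(r0 / R, R\<^sup>2 * \<theta> / k) \<in> R2 \<union> R3 \<union> R4"
  shows "\<exists>c. vortex_center R r0 k \<theta> c"
proof -
  define \<rho> where "\<rho> = r0 / R"
  define \<phi> where "\<phi> = R\<^sup>2 * \<theta> / k"
  have \<rho>: "0 < \<rho>" "\<rho> < 1" "R * \<rho> = r0" using R by (auto simp: \<rho>_def)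
  have "\<exists>x. \<bar>x\<bar> < 1 \<and> x < \<rho> \<and> \<phi> * (\<rho> * x - (1 + \<rho>\<^sup>2) * x\<^sup>2 + \<rho> * x^3) = \<rho>\<^sup>2 - 1
    \<and> \<bar>x\<bar> * (1 / (\<rho> - x) + 1 / (1 / \<rho> - x)) < 1"
  proof (cases "(\<rho>, \<phi>) \<in> R4")
    case True
    then have "\<phi> < 0" "0 < F_region \<rho> \<phi>" by (auto simp: R4_def)
    from center_same_side[OF \<rho>(1,2) this] show ?thesis by metis
  next
    case False
    then have "(\<rho>, \<phi>) \<in> R2 \<or> (\<rho>, \<phi>) \<in> R3" using reg by (auto simp: \<rho>_def \<phi>_def)
    then have "0 < \<phi> \<and> (1 - \<phi>) / (1 + \<phi>) < \<rho>"
    proof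
      assume "(\<rho>, \<phi>) \<in> R3"
      then have a: "0 < \<phi>" "\<rho> < (\<phi> - 1) / (1 + \<phi>)" by (auto simp: R3_def)
      have "(1 - \<phi>) / (1 + \<phi>) = - ((\<phi> - 1) / (1 + \<phi>))" by (simp only: minus_divide_left minus_diff_eq)
      then show ?thesis using a \<rho> by linarith
    qed (auto simp: R2_def)
    then have p: "0 < \<phi>" "(1 - \<phi>) / (1 + \<phi>) < \<rho>" by auto
    then have "1 - \<rho> < \<phi> * (1 + \<rho>)" by (simp add: pos_divide_less_eq algebra_simps)
    from center_opposite[OF \<rho>(1,2) p(1) this] show ?thesis by metis
  qed
  then obtain x where x: "\<bar>x\<bar> < 1" "x < \<rho>" "\<phi> * (\<rho> * x - (1 + \<rho>\<^sup>2) * x\<^sup>2 + \<rho> * x^3) = \<rho>\<^sup>2 - 1"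
    "\<bar>x\<bar> * (1 / (\<rho> - x) + 1 / (1 / \<rho> - x)) < 1" by blast
  have "vortex_center R (R * \<rho>) k \<theta> (R * x)"
    by (rule vortex_centerI[OF R(1) \<rho>(1,2) theta k \<phi>_def x])
  then show ?thesis unfolding \<rho>(3) by blast
qed

section \<open>Periodic orbits of the vortex system\<close>

definition vortex_field :: "real \<Rightarrow> real \<Rightarrow> real \<Rightarrow> real \<Rightarrow> complex \<Rightarrow> complex" where
  "vortex_field R k \<theta> \<rho> \<eta> = \<i> * (of_real \<theta> * \<eta>
     - of_real k * cnj (1 / (\<eta> - of_real \<rho>) - 1 / (\<eta> - of_real (R\<^sup>2 / \<rho>))))"

lemma strict_mono_int_same_range:
  fixes x y :: "int \<Rightarrow> real"
  assumes x: "strict_mono x" and y: "strict_mono y" and xy: "range x = range y"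
  obtains j where "\<And>n. y n = x (n + j)"
proof -
  have "\<forall>n. \<exists>m. y n = x m" using xy by (metis rangeE rangeI)
  then obtain f where f: "\<And>n. y n = x (f n)" by metis
  have mono: "f m < f n" if "m < n" for m n using strict_monoD[OF y that] x unfolding f by (simp add: strict_mono_less)
  have step: "f (n + 1) = f n + 1" for n
  proof (rule ccontr)
    assume "f (n + 1) \<noteq> f n + 1"
    then have gt: "f n + 1 < f (n + 1)" using mono[of n "n + 1"] by simp
    obtain m where "x (f n + 1) = y m" using xy by (metis rangeE rangeI)
    then have m: "f m = f n + 1" unfolding f using x by (simp add: strict_mono_eq)
    consider "m \<le> n" | "n + 1 \<le> m" by linarith
    then show False
    proof cases
      case 1 then show False using m mono[of m n] by (cases "m = n") auto
    next
      case 2 then show False using m gt mono[of "n + 1" m] by (cases "m = n + 1") auto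
    qed
  qed
  have "f n = n + f 0" for n
  proof (induction n rule: int_induct[where k = 0])
    case (step2 i) then show ?case using step[of "i - 1"] by simp
  qed (use step in auto)
  then have "y n = x (n + f 0)" for n using f by metis
  then show ?thesis by (rule that)
qed

lemma translation_number_unique:
  fixes x y :: "int \<Rightarrow> real"
  assumes x: "strict_mono x" "\<And>n. x (n + q) = x n + a" and y: "strict_mono y" "\<And>n. y (n + q') = y n + a'"
    and xy: "range x = range (\<lambda>n. y n + s)" and q: "0 < q" "0 < q'"
  shows "of_int q * a' = of_int q' * a"
proof -
  have it: "z (n + int m * q) = z n + of_nat m * a" if "\<And>n. z (n + q) = z n + a" for z :: "int \<Rightarrow> real" and n q a m
  proof (induction m)
    case (Suc m)
    have "z (n + int (Suc m) * q) = z (n + int m * q + q)" by (simp add: algebra_simps)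
    then show ?case unfolding that Suc by (simp add: algebra_simps)
  qed simp
  have "strict_mono (\<lambda>n. y n + s)" using y(1) by (simp add: strict_mono_def)
  from strict_mono_int_same_range[OF x(1) this xy] obtain j where j: "\<And>n. y n + s = x (n + j)" by blast
  have "y (0 + int (nat q) * q') + s = x (0 + j + int (nat q') * q)"
    unfolding j using q by (simp add: mult.commute add.commute)
  then have "of_nat (nat q) * a' = of_nat (nat q') * a" unfolding it[of y, OF y(2)] it[of x, OF x(2)] using j[of 0] by simp
  then show ?thesis using q by simp
qed

lemma inner_vortex_field:
  assumes \<rho>: "0 < \<rho>" "\<rho> < R" and \<eta>: "cmod \<eta> < R" "\<eta> \<noteq> of_real \<rho>" and k: "k \<noteq> 0"
  shows "Re (cnj \<eta> * vortex_field R k \<theta> \<rho> \<eta>) = 0 \<longleftrightarrow> Im \<eta> = 0"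
proof -
  define s where "s = R\<^sup>2 / \<rho>"
  have "R * \<rho> < R * R" using \<rho> by (intro mult_strict_left_mono) auto
  then have s: "R < s" using \<rho> by (simp add: s_def power2_eq_square pos_less_divide_eq)
  have \<eta>s: "\<eta> \<noteq> of_real s" using \<eta> s \<rho> by auto
  define Q where "Q = (\<eta> - of_real \<rho>) * (\<eta> - of_real s)"
  have Q: "Q \<noteq> 0" using \<eta> \<eta>s by (simp add: Q_def)
  have rs: "\<rho> * s = R\<^sup>2" using \<rho> by (simp add: s_def)
  have "1 / (\<eta> - of_real \<rho>) - 1 / (\<eta> - of_real s) = of_real (\<rho> - s) / Q"
    using \<eta> \<eta>s by (simp add: Q_def field_simps)
  then have "Re (cnj \<eta> * vortex_field R k \<theta> \<rho> \<eta>) = Re (\<i> * of_real \<theta> * (\<eta> * cnj \<eta>) - \<i> * of_real k * cnj (\<eta> * (of_real (\<rho> - s) / Q)))"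
    unfolding vortex_field_def s_def[symmetric] by (simp add: algebra_simps)
  also have "\<dots> = - k * (\<rho> - s) * Im (\<eta> / Q)"
  proof -
    have "Re (\<i> * of_real \<theta> * of_real a - \<i> * of_real k * cnj (of_real x * z)) = - k * x * Im z" for a x z by simp
    moreover have "\<eta> * (of_real (\<rho> - s) / Q) = of_real (\<rho> - s) * (\<eta> / Q)" by simp
    ultimately show ?thesis unfolding complex_norm_square[symmetric] by (simp only:)
  qed
  also have "\<eta> / Q = \<eta> * cnj Q / of_real ((cmod Q)\<^sup>2)" by (rule trans[OF complex_div_cnj]) simp
  also have "Im \<dots> = Im (\<eta> * cnj Q) / (cmod Q)\<^sup>2" by (rule Im_divide_of_real)
  also have "Im (\<eta> * cnj Q) = Im \<eta> * (R\<^sup>2 - (cmod \<eta>)\<^sup>2)"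
  proof -
    have "\<eta> * cnj Q = \<eta> * cnj \<eta> * cnj \<eta> - of_real (\<rho> + s) * (\<eta> * cnj \<eta>) + of_real (\<rho> * s) * \<eta>"
      by (simp add: Q_def algebra_simps)
    then show ?thesis unfolding rs by (simp only: complex_norm_square[symmetric]) (simp add: algebra_simps)
  qed
  finally have "Re (cnj \<eta> * vortex_field R k \<theta> \<rho> \<eta>) = - k * (\<rho> - s) * (Im \<eta> * (R\<^sup>2 - (cmod \<eta>)\<^sup>2) / (cmod Q)\<^sup>2)" .
  then show ?thesis using k \<rho> s Q \<eta>(1) by auto
qed

text \<open>A crossing of the ray \<open>{c + a | a > 0}\<close> is recognised by the modulus of the orbit alone, so it
  is the same notion in the corotating and in the inertial frame.\<close>

definition crossing :: "real \<Rightarrow> (real \<Rightarrow> real) \<Rightarrow> real \<Rightarrow> bool" where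
  "crossing c N t \<longleftrightarrow> deriv (\<lambda>t. (N t)\<^sup>2) t = 0 \<and> 0 < sgn c * (N t - \<bar>c\<bar>)"

lemma crossing_shift: "crossing c (\<lambda>t. N (t + s)) t \<longleftrightarrow> crossing c N (t + s)"
  unfolding crossing_def deriv_def by (simp only: DERIV_shift)

lemma crossing_iff:
  assumes sol: "\<And>t. (\<eta> has_vector_derivative vortex_field R k \<theta> (r t) (\<eta> t)) (at t)"
    and r: "0 < r t" "r t < R" "\<eta> t \<noteq> of_real (r t)" "cmod (\<eta> t) < R" and k: "k \<noteq> 0"
    and c: "c \<noteq> 0" "cmod (\<eta> t - of_real c) < \<bar>c\<bar>"
  shows "crossing c (\<lambda>t. cmod (\<eta> t)) t \<longleftrightarrow> Im (\<eta> t - of_real c) = 0 \<and> 0 < Re (\<eta> t - of_real c)"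
proof -
  have "((\<lambda>t. \<eta> t \<bullet> \<eta> t) has_vector_derivative (\<eta> t \<bullet> vortex_field R k \<theta> (r t) (\<eta> t) + vortex_field R k \<theta> (r t) (\<eta> t) \<bullet> \<eta> t)) (at t)"
    using bounded_bilinear.has_vector_derivative[OF bounded_bilinear_inner sol sol] .
  then have "deriv (\<lambda>t. (cmod (\<eta> t))\<^sup>2) t = 2 * Re (cnj (\<eta> t) * vortex_field R k \<theta> (r t) (\<eta> t))"
    by (intro DERIV_imp_deriv) (simp add: has_real_derivative_iff_has_vector_derivative power2_norm_eq_inner inner_complex_def mult.commute)
  then have 1: "deriv (\<lambda>t. (cmod (\<eta> t))\<^sup>2) t = 0 \<longleftrightarrow> Im (\<eta> t) = 0" 
    using inner_vortex_field[OF r(1,2,4,3) k, of \<theta>] by (metis mult_eq_0_iff zero_neq_numeral)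
  have 2: "sgn c * (cmod (\<eta> t) - \<bar>c\<bar>) = Re (\<eta> t) - c" if "Im (\<eta> t) = 0"
  proof -
    have "\<eta> t = of_real (Re (\<eta> t))" using that by (simp add: complex_eq_iff)
    then have n: "cmod (\<eta> t) = \<bar>Re (\<eta> t)\<bar>" by (metis norm_of_real)
    have "\<bar>Re (\<eta> t) - c\<bar> < \<bar>c\<bar>" using abs_Re_le_cmod[of "\<eta> t - of_real c"] c by simp
    then show ?thesis unfolding n using c by (auto simp: sgn_if abs_if split: if_splits)
  qed
  show ?thesis unfolding crossing_def 1 using 2 by auto
qed

definition vortex_orbit :: "real \<Rightarrow> real \<Rightarrow> real \<Rightarrow> real \<Rightarrow> (real \<Rightarrow> real) \<Rightarrow> (real \<Rightarrow> complex) \<Rightarrow> bool" where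
  "vortex_orbit R k \<theta> T r \<eta> \<longleftrightarrow>
     (\<forall>t. (\<eta> has_vector_derivative vortex_field R k \<theta> (r t) (\<eta> t)) (at t) \<and> cmod (\<eta> t) < R \<and> Re (\<eta> t) < r t)
     \<and> (\<exists>m>0. \<forall>t. \<eta> (t + of_nat m * T) = \<eta> t)"

definition orbit_family :: "real \<Rightarrow> real \<Rightarrow> real \<Rightarrow> real \<Rightarrow> (real \<Rightarrow> real) \<Rightarrow> (nat \<Rightarrow> real \<Rightarrow> complex) \<Rightarrow> bool" where
  "orbit_family R k \<theta> T r Y \<longleftrightarrow> (\<forall>n. vortex_orbit R k \<theta> T r (Y n)) \<and>
     (\<forall>m n. m \<noteq> n \<longrightarrow> \<not> time_translates (\<lambda>t. cmod (Y m t)) (\<lambda>t. cmod (Y n t)))"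

lemma ex_vortex_orbits_pos:
  fixes R r0 k \<theta> T :: real
  assumes R: "0 < R" "0 < r0" "r0 < R" and theta: "0 < \<theta>" and k: "k \<noteq> 0"
    and reg: "(r0 / R, R\<^sup>2 * \<theta> / k) \<in> R2 \<union> R3 \<union> R4" and T: "0 < T"
  shows "\<exists>\<kappa>>0. \<forall>r. continuous_on UNIV r \<longrightarrow> (\<forall>t. \<bar>r t - r0\<bar> \<le> \<kappa>) \<longrightarrow> (\<forall>t. r (t + T) = r t) \<longrightarrow>
    (\<exists>Y. orbit_family R k \<theta> T r Y)"
proof -
  obtain c where "vortex_center R r0 k \<theta> c" using ex_vortex_center[OF R theta k reg] by blast
  then interpret vc: vortex_center R r0 k \<theta> c .
  have c0: "c \<noteq> 0"
  proof
    assume "c = 0"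
    then have "1 / (c - r0) - 1 / (c - R\<^sup>2 / r0) = 0" using vc.equil k by simp
    then show False using vc.uv(1) by (simp add: vc.uu_def vc.vv_def)
  qed
  define \<delta> where "\<delta> = min (R - \<bar>c\<bar>) \<bar>c\<bar>"
  have "0 < \<delta>" using vc.c c0 by (simp add: \<delta>_def)
  then obtain d L M l where d: "d \<le> vc.d0" "d \<le> \<delta>"
    and "elliptic_field vc.V vc.H r0 vc.\<kappa>1 d L vc.W vc.DW vc.\<omega> vc.\<beta> M l"
    using vc.ex_elliptic_field by blast
  then interpret ef: elliptic_field vc.V vc.H r0 vc.\<kappa>1 d L vc.W vc.DW vc.\<omega> vc.\<beta> M l by blast
  obtain a1 a4 lo hi lam \<kappa>0 where "twist_section vc.V vc.H r0 vc.\<kappa>1 d L vc.W a1 a4 lo hi lam \<kappa>0"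
    using ef.ex_twist_section by blast
  then interpret ts: twist_section vc.V vc.H r0 vc.\<kappa>1 d L vc.W a1 a4 lo hi lam \<kappa>0 .
  obtain \<kappa> q0 c1 c2 where \<kappa>: "0 < \<kappa>" and cc: "0 < c1" "c1 < c2"
    and ex: "\<forall>r. ef.path_near \<kappa> r \<longrightarrow> (\<forall>t. r (t + T) = r t) \<longrightarrow>
      (\<forall>p q. q0 \<le> q \<longrightarrow> 0 < q \<longrightarrow> c1 \<le> real_of_int p * T / real_of_int q \<longrightarrow> real_of_int p * T / real_of_int q \<le> c2 \<longrightarrow>
      (\<exists>U x. strict_mono (x :: int \<Rightarrow> real) \<and> (\<forall>n. x (n + q) = x n + p * T) \<and>
        {t. Im (U t) = 0 \<and> Re (U t) > 0} = range x \<and> (\<forall>t. U (t + p * T) = U t)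
        \<and> (\<forall>t. cmod (U t) < d \<and> (U has_vector_derivative vc.V (r t) (U t)) (at t))))"
    using ts.ex_periodic_orbits[OF T] by (elim exE conjE) (rule that; assumption)
  define K where "K = min (min \<kappa> (r0 / 2)) (min vc.\<mu> ((R - r0) / 2))"
  have K: "0 < K" "K \<le> \<kappa>" "K \<le> r0 / 2" "K \<le> vc.\<mu>" "K \<le> (R - r0) / 2"
    unfolding K_def using \<kappa> R vc.constants_pos(1)
    by (auto simp only: min_less_iff_conj half_gt_zero_iff diff_gt_0_iff_gt intro: min.coboundedI1 min.coboundedI2)
  show ?thesis
  proof (intro exI[of _ K] conjI allI impI K(1))
    fix r assume r: "continuous_on UNIV r" "\<forall>t. \<bar>r t - r0\<bar> \<le> K" "\<forall>t. r (t + T) = r t"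
    have near: "ef.path_near \<kappa> r" using r K(2) unfolding ef.path_near_def by (meson order_trans)
    have rb: "0 < r t" "r t < R" for t using r(2)[rule_format, of t] K R by (auto simp: abs_le_iff)
    obtain a b where a: "a \<in> \<rat>" "c1 / T < a" "b \<in> \<rat>" "a < b" "b < c2 / T"
    proof -
      have "c1 / T < c2 / T" using cc T by (simp add: divide_strict_right_mono)
      then obtain a where "a \<in> \<rat>" "c1 / T < a" "a < c2 / T" using Rats_dense_in_real by blast
      moreover from this obtain b where "b \<in> \<rat>" "a < b" "b < c2 / T" using Rats_dense_in_real by blast
      ultimately show ?thesis using that by blast
    qed
    define al where "al n = a + (b - a) / (of_nat n + 1)" for n :: nat
    have al: "al n \<in> \<rat>" "c1 / T < al n" "al n < c2 / T" for n
    proof -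
      show "al n \<in> \<rat>" unfolding al_def using a by (intro Rats_add Rats_divide Rats_diff) auto
      have "0 < (b - a) / (of_nat n + 1)" "(b - a) / (of_nat n + 1) \<le> b - a"
        using a by (auto simp: divide_le_eq mult_le_cancel_left1)
      then show "c1 / T < al n" "al n < c2 / T" unfolding al_def using a by linarith+
    qed
    have al_inj: "al m = al n \<Longrightarrow> m = n" for m n using a by (auto simp: al_def)
    have "\<exists>p q. q0 \<le> q \<and> 0 < q \<and> al n = of_int p / of_int q" for n
    proof -
      obtain i j where ij: "al n = of_int i / of_nat j" "j \<noteq> 0" using al(1)[of n] unfolding Rats_eq_int_div_nat by blast
      define e where "e = max q0 1"
      have e: "q0 \<le> e" "0 < e" by (auto simp: e_def)
      have "1 \<le> int j" using ij by simp
      then have "e * 1 \<le> e * int j" using e by (intro mult_left_mono) auto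
      moreover have "al n = of_int (e * i) / of_int (e * int j)" using ij e by simp
      moreover from calculation have "q0 \<le> e * int j" "0 < e * int j" using e by linarith+
      ultimately show ?thesis by blast
    qed
    then obtain p q where pq: "\<And>n. q0 \<le> q n" "\<And>n. 0 < q n" "\<And>n. al n = of_int (p n) / of_int (q n)" by metis
    define Orb where "Orb n U x \<longleftrightarrow> strict_mono (x :: int \<Rightarrow> real) \<and> (\<forall>i. x (i + q n) = x i + p n * T) \<and>
        {t. Im (U t) = 0 \<and> Re (U t) > 0} = range x \<and> (\<forall>t. U (t + p n * T) = U t)
        \<and> (\<forall>t. cmod (U t) < d \<and> (U has_vector_derivative vc.V (r t) (U t)) (at t))" for n U x
    have "\<exists>U x. Orb n U x" for n
      unfolding Orb_def
    proof (rule ex[rule_format, OF near r(3)[rule_format] pq(1,2)])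
      have e: "of_int (p n) * T / of_int (q n) = al n * T" unfolding pq(3) by simp
      show "c1 \<le> of_int (p n) * T / of_int (q n)" "of_int (p n) * T / of_int (q n) \<le> c2"
        unfolding e using al(2,3)[of n] T by (auto simp: field_simps)
    qed
    then obtain U x where "\<And>n. Orb n (U n) (x n)" by metis
    then have x: "\<And>n. strict_mono (x n)" "\<And>n i. x n (i + q n) = x n i + p n * T"
      and ray: "\<And>n. {t. Im (U n t) = 0 \<and> Re (U n t) > 0} = range (x n)" and per: "\<And>n t. U n (t + p n * T) = U n t"
      and U: "\<And>n t. cmod (U n t) < d" "\<And>n t. (U n has_vector_derivative vc.V (r t) (U n t)) (at t)"
      unfolding Orb_def by blast+
    define Y where "Y n t = of_real c + U n t" for n t
    have YU: "Y n t - of_real c = U n t" for n t by (simp add: Y_def)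
    have Yd: "(Y n has_vector_derivative vortex_field R k \<theta> (r t) (Y n t)) (at t)" for n t
    proof -
      have "vortex_field R k \<theta> (r t) (Y n t) = vc.V (r t) (U n t)" by (simp add: vortex_field_def vc.V_def Y_def)
      moreover have "((\<lambda>t. of_real c + U n t) has_vector_derivative 0 + vc.V (r t) (U n t)) (at t)"
        by (intro has_vector_derivative_add U has_vector_derivative_const)
      ultimately show ?thesis unfolding Y_def[abs_def] by simp
    qed
    have YR: "cmod (Y n t) < R" for n t
      using norm_triangle_ineq[of "of_real c" "U n t"] U(1)[of n t] d(2) by (simp add: Y_def \<delta>_def)
    have Yr: "Re (Y n t) < r t" for n t
    proof -
      have "Re (U n t) < vc.\<mu> / 4" using U(1)[of n t] d(1) abs_Re_le_cmod[of "U n t"] by (simp add: vc.d0_def)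
      moreover have "r0 - K \<le> r t" using r(2)[rule_format, of t] by (simp add: abs_le_iff)
      moreover have "r0 - c = 2 * vc.\<mu>" by (simp add: vc.\<mu>_def)
      ultimately show ?thesis using K(4) vc.constants_pos by (simp add: Y_def)
    qed
    have cross: "{t. crossing c (\<lambda>t. cmod (Y n t)) t} = range (x n)" for n
    proof -
      have "crossing c (\<lambda>t. cmod (Y n t)) t \<longleftrightarrow> Im (U n t) = 0 \<and> 0 < Re (U n t)" for t
      proof -
        have "Y n t \<noteq> of_real (r t)" using Yr[of n t] by auto
        moreover have "cmod (U n t) < \<bar>c\<bar>" using U(1)[of n t] d(2) by (simp add: \<delta>_def)
        ultimately show ?thesis using crossing_iff[of "Y n" R k \<theta> r t c] Yd rb YR k c0 unfolding YU by blast
      qed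
      then show ?thesis unfolding ray[symmetric] by simp
    qed
    show "\<exists>Y. orbit_family R k \<theta> T r Y"
      unfolding orbit_family_def
    proof (intro exI[of _ Y] conjI allI impI)
      fix n
      have "0 < al n" using al(2)[of n] cc T by (meson divide_pos_pos less_trans)
      then have "0 < p n" using pq(2,3)[of n] by (simp add: zero_less_divide_iff)
      then have "\<exists>m>0. \<forall>t. Y n (t + of_nat m * T) = Y n t" using per[of n] by (intro exI[of _ "nat (p n)"]) (simp add: Y_def)
      then show "vortex_orbit R k \<theta> T r (Y n)" unfolding vortex_orbit_def using Yd YR Yr by blast
    next
      fix m n :: nat assume mn: "m \<noteq> n"
      show "\<not> time_translates (\<lambda>t. cmod (Y m t)) (\<lambda>t. cmod (Y n t))"
      proof
        assume "time_translates (\<lambda>t. cmod (Y m t)) (\<lambda>t. cmod (Y n t))"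
        then obtain s where s: "(\<lambda>t. cmod (Y n t)) = (\<lambda>t. cmod (Y m (t + s)))" unfolding time_translates_def by blast
        have sh: "t \<in> range (x n) \<longleftrightarrow> t + s \<in> range (x m)" for t
          unfolding cross[symmetric] mem_Collect_eq s by (rule crossing_shift)
        have "range (x m) = range (\<lambda>i. x n i + s)"
        proof (intro set_eqI iffI)
          fix t assume "t \<in> range (x m)"
          then have "t - s \<in> range (x n)" unfolding sh by simp
          then obtain i where "t = x n i + s" by (auto simp: diff_eq_eq)
          then show "t \<in> range (\<lambda>i. x n i + s)" by blast
        qed (use sh in auto)
        from translation_number_unique[OF x(1) x(2) x(1) x(2) this pq(2) pq(2)]
        have "of_int (q m) * (of_int (p n) * T) = of_int (q n) * (of_int (p m) * T)" .
        then have "al m = al n" unfolding pq(3) using T pq(2)[of m] pq(2)[of n] by (simp add: field_simps)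
        then show False using al_inj mn by blast
      qed
    qed
  qed
qed

lemma time_translates_reverse: "time_translates (\<lambda>t. u (- t)) (\<lambda>t. v (- t)) \<Longrightarrow> time_translates u v"
  unfolding time_translates_def by (metis add.commute add.inverse_inverse minus_add_distrib)

theorem ex_vortex_orbits:
  fixes R r0 k \<theta> T :: real
  assumes R: "0 < R" "0 < r0" "r0 < R" and theta: "\<theta> \<noteq> 0" and k: "k \<noteq> 0"
    and reg: "(r0 / R, R\<^sup>2 * \<theta> / k) \<in> R2 \<union> R3 \<union> R4" and T: "0 < T"
  shows "\<exists>\<kappa>>0. \<forall>r. continuous_on UNIV r \<longrightarrow> (\<forall>t. \<bar>r t - r0\<bar> \<le> \<kappa>) \<longrightarrow> (\<forall>t. r (t + T) = r t) \<longrightarrow>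
    (\<exists>Y. orbit_family R k \<theta> T r Y)"
proof (cases "0 < \<theta>")
  case True
  then show ?thesis by (rule ex_vortex_orbits_pos[OF R _ k reg T])
next
  case False
  have reg': "(r0 / R, R\<^sup>2 * (- \<theta>) / (- k)) \<in> R2 \<union> R3 \<union> R4" using reg by simp
  have "0 < - \<theta>" "- k \<noteq> 0" using False theta k by auto
  from ex_vortex_orbits_pos[OF R this reg' T] obtain \<kappa> where \<kappa>: "0 < \<kappa>"
    and ex: "\<And>r. continuous_on UNIV r \<Longrightarrow> \<forall>t. \<bar>r t - r0\<bar> \<le> \<kappa> \<Longrightarrow> \<forall>t. r (t + T) = r t \<Longrightarrow>
    \<exists>Y. orbit_family R (- k) (- \<theta>) T r Y" by blast
  show ?thesis
  proof (intro exI[of _ \<kappa>] conjI allI impI \<kappa>)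
    fix r :: "real \<Rightarrow> real" assume r: "continuous_on UNIV r" "\<forall>t. \<bar>r t - r0\<bar> \<le> \<kappa>" "\<forall>t. r (t + T) = r t"
    have "continuous_on UNIV (\<lambda>t. r (- t))" by (rule continuous_on_compose2[OF r(1)]) (auto intro!: continuous_intros)
    moreover have "r (- (t + T)) = r (- t)" for t using r(3)[rule_format, of "- t - T"] by simp
    ultimately obtain Y where Y: "\<And>n::nat. vortex_orbit R (- k) (- \<theta>) T (\<lambda>t. r (- t)) (Y n)"
      and dist: "\<And>m n. m \<noteq> n \<Longrightarrow> \<not> time_translates (\<lambda>t. cmod (Y m t)) (\<lambda>t. cmod (Y n t))"
      using ex[of "\<lambda>t. r (- t)"] r(2) unfolding orbit_family_def by blast
    have rev: "vortex_orbit R k \<theta> T r (\<lambda>t. Y n (- t))" for n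
    proof -
      note o = Y[of n, unfolded vortex_orbit_def]
      have "((\<lambda>t. Y n (- t)) has_vector_derivative vortex_field R k \<theta> (r t) (Y n (- t))) (at t)" for t
      proof -
        have "((Y n \<circ> uminus) has_vector_derivative (- 1) *\<^sub>R vortex_field R (- k) (- \<theta>) (r (- (- t))) (Y n (- t))) (at t)"
        proof (rule vector_diff_chain_at)
          show "(uminus has_vector_derivative - 1) (at t)" by (auto intro!: derivative_eq_intros)
          show "(Y n has_vector_derivative vortex_field R (- k) (- \<theta>) (r (- (- t))) (Y n (- t))) (at (- t))" using o by blast
        qed
        then show ?thesis by (simp add: o_def vortex_field_def algebra_simps)
      qed
      moreover have "cmod (Y n (- t)) < R" "Re (Y n (- t)) < r t" for t using o by (auto dest: spec[of _ "- t"])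
      moreover obtain m where m: "m > 0" "\<forall>t. Y n (t + of_nat m * T) = Y n t" using o by blast
      moreover have "Y n (- (t + of_nat m * T)) = Y n (- t)" for t
        using m(2)[rule_format, of "- (t + of_nat m * T)"] by simp
      ultimately show ?thesis unfolding vortex_orbit_def by blast
    qed
    show "\<exists>Y. orbit_family R k \<theta> T r Y"
      unfolding orbit_family_def using rev dist time_translates_reverse[of "\<lambda>t. cmod (Y _ t)" "\<lambda>t. cmod (Y _ t)"]
      by (intro exI[of _ "\<lambda>n t. Y n (- t)"]) blast
  qed
qed

lemma real_analytic_continuous:
  assumes "real_analytic f" shows "continuous_on UNIV f"
proof -
  have "isCont f t" for t
  proof -
    obtain A where "(\<lambda>h. f (t + h)) has_fps_expansion A" using assms unfolding real_analytic_def by blast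
    then have "isCont (\<lambda>h. f (t + h)) 0" by (rule has_fps_expansion_imp_continuous)
    then show ?thesis by (simp add: isCont_iff)
  qed
  then show ?thesis by (simp add: continuous_on_eq_continuous_at)
qed

lemma periodic_continuous_bounded:
  fixes f :: "real \<Rightarrow> real"
  assumes "continuous_on UNIV f" "periodic_fun_simple f T" "0 < T"
  obtains B where "0 < B" "\<And>t. \<bar>f t\<bar> \<le> B"
proof -
  interpret periodic_fun_simple f T by fact
  have "bounded (f ` {0..T})"
    by (intro compact_imp_bounded compact_continuous_image continuous_on_subset[OF assms(1)]) auto
  then obtain B where B: "0 < B" "\<And>t. t \<in> {0..T} \<Longrightarrow> \<bar>f t\<bar> \<le> B" by (auto simp: bounded_pos)
  have "\<bar>f t\<bar> \<le> B" for t
  proof -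
    define n where "n = \<lfloor>t / T\<rfloor>"
    have "of_int n \<le> t / T" "t / T < of_int n + 1" by (auto simp: n_def)
    then have "t - of_int n * T \<in> {0..T}" using assms(3) by (auto simp: field_simps)
    moreover have "f t = f (t - of_int n * T)" using minus_of_int[of t n] by simp
    ultimately show ?thesis using B(2) by metis
  qed
  then show ?thesis using that B(1) by blast
qed

lemma small_perturbation:
  fixes f :: "real \<Rightarrow> real" and g r :: "real \<Rightarrow> real \<Rightarrow> real"
  assumes T: "0 < T" and f: "periodic_fun_simple f T" "real_analytic f"
    and g: "\<And>\<epsilon>. periodic_fun_simple (g \<epsilon>) T" "\<And>\<epsilon>. real_analytic (g \<epsilon>)"
    and lim: "uniform_limit UNIV g (\<lambda>t. 0) (at 0)" and g0: "\<And>t. g 0 t = 0"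
    and r: "\<And>\<epsilon> t. r \<epsilon> t = r0 + \<epsilon> * f t + g \<epsilon> t" and \<kappa>: "0 < \<kappa>"
  shows "\<exists>\<epsilon>0>0. \<forall>\<epsilon>. \<bar>\<epsilon>\<bar> < \<epsilon>0 \<longrightarrow> continuous_on UNIV (r \<epsilon>) \<and> (\<forall>t. \<bar>r \<epsilon> t - r0\<bar> \<le> \<kappa>) \<and> (\<forall>t. r \<epsilon> (t + T) = r \<epsilon> t)"
proof -
  have cf: "continuous_on UNIV f" using f real_analytic_continuous by blast
  obtain B where B: "0 < B" "\<And>t. \<bar>f t\<bar> \<le> B" using periodic_continuous_bounded[OF cf f(1) T] by blast
  have "\<forall>\<^sub>F \<epsilon> in at 0. \<forall>t\<in>UNIV. dist (g \<epsilon> t) 0 < \<kappa> / 2" using uniform_limitD[OF lim, of "\<kappa> / 2"] \<kappa> by simp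
  then obtain d where d: "0 < d" "\<And>\<epsilon> t. \<epsilon> \<noteq> 0 \<Longrightarrow> \<bar>\<epsilon>\<bar> < d \<Longrightarrow> \<bar>g \<epsilon> t\<bar> < \<kappa> / 2"
    unfolding eventually_at by (auto simp: dist_real_def)
  show ?thesis
  proof (intro exI[of _ "min d (\<kappa> / (2 * B))"] conjI allI impI)
    show "0 < min d (\<kappa> / (2 * B))" using d \<kappa> B by simp
  next
    fix \<epsilon> :: real
    show "continuous_on UNIV (r \<epsilon>)" unfolding r[abs_def]
      using cf real_analytic_continuous[OF g(2)] by (intro continuous_intros)
  next
    fix \<epsilon> t :: real assume \<epsilon>: "\<bar>\<epsilon>\<bar> < min d (\<kappa> / (2 * B))"
    have "\<bar>\<epsilon>\<bar> * B \<le> \<kappa> / 2" using \<epsilon> B by (simp add: field_simps)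
    moreover have "\<bar>\<epsilon> * f t\<bar> \<le> \<bar>\<epsilon>\<bar> * B" unfolding abs_mult using B by (intro mult_left_mono) auto
    moreover have "\<bar>g \<epsilon> t\<bar> \<le> \<kappa> / 2"
    proof (cases "\<epsilon> = 0")
      case False
      then show ?thesis using d(2)[of \<epsilon> t] \<epsilon> by simp
    qed (use g0 \<kappa> in simp)
    ultimately show "\<bar>r \<epsilon> t - r0\<bar> \<le> \<kappa>" unfolding r by linarith
  next
    fix \<epsilon> t :: real
    interpret f: periodic_fun_simple f T by fact
    interpret g: periodic_fun_simple "g \<epsilon>" T by (rule g)
    show "r \<epsilon> (t + T) = r \<epsilon> t" by (simp add: r f.plus_1 g.plus_1)
  qed
qed

lemma distinct_family:
  fixes Z :: "nat \<Rightarrow> real \<Rightarrow> 'a" and N :: "'a \<Rightarrow> real"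
  assumes "\<And>m n. m \<noteq> n \<Longrightarrow> \<not> time_translates (\<lambda>t. N (Z m t)) (\<lambda>t. N (Z n t))"
  shows "infinite (range Z)" "geometrically_distinct (range Z)"
proof -
  have *: "\<not> time_translates (Z m) (Z n)" if "m \<noteq> n" for m n
    using assms[OF that] unfolding time_translates_def by metis
  have "inj Z"
  proof (rule injI, rule ccontr)
    fix m n assume "Z m = Z n" "m \<noteq> n"
    then show False using *[of m n] unfolding time_translates_def by (metis add.right_neutral)
  qed
  then show "infinite (range Z)" by (simp add: range_inj_infinite)
  show "geometrically_distinct (range Z)" unfolding geometrically_distinct_def
  proof (rule pairwiseI)
    fix u v assume "u \<in> range Z" "v \<in> range Z" "u \<noteq> v"
    then obtain m n where "u = Z m" "v = Z n" "m \<noteq> n" by blast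
    then show "\<not> time_translates u v" using * by simp
  qed
qed

lemma ln_sqrt_ratio_deriv:
  assumes A: "(A has_real_derivative A') (at y)" "A y > 0" and B: "(B has_real_derivative B') (at y)" "B y > 0"
  shows "((\<lambda>y. ln (sqrt (A y / B y))) has_real_derivative (A' / A y - B' / B y) / 2) (at y)"
proof -
  have d: "((\<lambda>y. (ln (A y) - ln (B y)) / 2) has_real_derivative (A' / A y - B' / B y) / 2) (at y)"
    using A B by (auto intro!: derivative_eq_intros simp: mult.commute)
  have ev: "\<forall>\<^sub>F z in nhds y. ln (sqrt (A z / B z)) = (ln (A z) - ln (B z)) / 2"
  proof -
    have "isCont A y" "isCont B y" using A B DERIV_isCont by blast+
    then have "\<forall>\<^sub>F z in nhds y. A z > 0" "\<forall>\<^sub>F z in nhds y. B z > 0"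
      using A(2) B(2) by (auto simp: isCont_def tendsto_at_iff_tendsto_nhds dest: order_tendstoD)
    then show ?thesis by eventually_elim (simp add: ln_sqrt ln_div)
  qed
  show ?thesis by (rule DERIV_cong_ev[OF refl ev refl, THEN iffD2, OF d])
qed

lemma vortex_field_Re_Im:
  "Re (vortex_field R k \<theta> \<rho> \<eta>) = - \<theta> * Im \<eta> + k * (Im \<eta> / ((Re \<eta> - \<rho>)\<^sup>2 + (Im \<eta>)\<^sup>2) - Im \<eta> / ((Re \<eta> - R\<^sup>2 / \<rho>)\<^sup>2 + (Im \<eta>)\<^sup>2))"
  "Im (vortex_field R k \<theta> \<rho> \<eta>) = \<theta> * Re \<eta> - k * ((Re \<eta> - \<rho>) / ((Re \<eta> - \<rho>)\<^sup>2 + (Im \<eta>)\<^sup>2)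
     - (Re \<eta> - R\<^sup>2 / \<rho>) / ((Re \<eta> - R\<^sup>2 / \<rho>)\<^sup>2 + (Im \<eta>)\<^sup>2))"
proof -
  have w: "Re (\<i> * (of_real \<theta> * \<eta> - of_real k * cnj (w - w'))) = - \<theta> * Im \<eta> + k * (- Im w - - Im w')"
    "Im (\<i> * (of_real \<theta> * \<eta> - of_real k * cnj (w - w'))) = \<theta> * Re \<eta> - k * (Re w - Re w')" for w w'
    by (simp_all add: right_diff_distrib)
  have i: "- Im (1 / (\<eta> - of_real s)) = Im \<eta> / ((Re \<eta> - s)\<^sup>2 + (Im \<eta>)\<^sup>2)"
    "Re (1 / (\<eta> - of_real s)) = (Re \<eta> - s) / ((Re \<eta> - s)\<^sup>2 + (Im \<eta>)\<^sup>2)" for s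
    by (simp_all add: Re_divide Im_divide)
  show "Re (vortex_field R k \<theta> \<rho> \<eta>) = - \<theta> * Im \<eta> + k * (Im \<eta> / ((Re \<eta> - \<rho>)\<^sup>2 + (Im \<eta>)\<^sup>2) - Im \<eta> / ((Re \<eta> - R\<^sup>2 / \<rho>)\<^sup>2 + (Im \<eta>)\<^sup>2))"
    "Im (vortex_field R k \<theta> \<rho> \<eta>) = \<theta> * Re \<eta> - k * ((Re \<eta> - \<rho>) / ((Re \<eta> - \<rho>)\<^sup>2 + (Im \<eta>)\<^sup>2)
     - (Re \<eta> - R\<^sup>2 / \<rho>) / ((Re \<eta> - R\<^sup>2 / \<rho>)\<^sup>2 + (Im \<eta>)\<^sup>2))"
    unfolding vortex_field_def w i by (rule refl)+
qed

lemma orbit_avoids_vortices: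
  assumes "vortex_orbit R k \<theta> T r \<eta>" "0 < r t" "r t < R"
  shows "\<eta> t \<noteq> of_real (r t)" "\<eta> t \<noteq> of_real (R\<^sup>2 / r t)"
proof -
  have o: "cmod (\<eta> t) < R" "Re (\<eta> t) < r t" using assms by (auto simp: vortex_orbit_def)
  then show "\<eta> t \<noteq> of_real (r t)" by auto
  have "r t * r t \<le> R * R" using assms by (intro mult_mono) auto
  then have "r t \<le> R\<^sup>2 / r t" using assms by (simp add: power2_eq_square pos_le_divide_eq)
  then show "\<eta> t \<noteq> of_real (R\<^sup>2 / r t)" using o by auto
qed

lemma hamiltonian_solution_orbit:
  assumes o: "vortex_orbit R (\<Gamma> / (2 * pi)) \<theta> T r \<eta>" and r: "\<And>t. 0 < r t" "\<And>t. r t < R"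
  shows "hamiltonian_solution R \<Gamma> \<theta> r (\<lambda>t. (Re (\<eta> t), Im (\<eta> t)))"
  unfolding hamiltonian_solution_def
proof (intro allI conjI)
  fix t
  have half: "(2 * u / a - 2 * v / b) / 2 = u / a - v / b" for u v a b :: real by (simp add: diff_divide_distrib)
  define x where "x = Re (\<eta> t)"
  define y where "y = Im (\<eta> t)"
  have ne: "\<eta> t \<noteq> of_real (r t)" "\<eta> t \<noteq> of_real (R\<^sup>2 / r t)" using orbit_avoids_vortices[OF o r] by auto
  then have nz: "0 < (x - r t)\<^sup>2 + y\<^sup>2" "0 < (x - R\<^sup>2 / r t)\<^sup>2 + y\<^sup>2"
    by (auto simp: x_def y_def complex_eq_iff sum_power2_gt_zero_iff)
  show "(Re (\<eta> t), Im (\<eta> t)) \<noteq> (r t, 0)" "(Re (\<eta> t), Im (\<eta> t)) \<noteq> (R\<^sup>2 / r t, 0)"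
    using ne by (auto simp: complex_eq_iff)
  have d: "(\<eta> has_vector_derivative vortex_field R (\<Gamma> / (2 * pi)) \<theta> (r t) (\<eta> t)) (at t)" using o by (auto simp: vortex_orbit_def)
  have "((\<lambda>y. Psi R \<Gamma> \<theta> r t x y) has_real_derivative - \<theta> * y + \<Gamma> / (2 * pi) * ((2 * y / ((x - r t)\<^sup>2 + y\<^sup>2) - 2 * y / ((x - R\<^sup>2 / r t)\<^sup>2 + y\<^sup>2)) / 2)) (at y)"
    unfolding Psi_def by (rule derivative_eq_intros ln_sqrt_ratio_deriv nz refl | simp)+
  from DERIV_imp_deriv[OF this]
  have Py: "deriv (\<lambda>y. Psi R \<Gamma> \<theta> r t x y) y = Re (vortex_field R (\<Gamma> / (2 * pi)) \<theta> (r t) (\<eta> t))"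
    unfolding vortex_field_Re_Im x_def[symmetric] y_def[symmetric] half by simp
  have "((\<lambda>x. Psi R \<Gamma> \<theta> r t x y) has_real_derivative - \<theta> * x + \<Gamma> / (2 * pi) * ((2 * (x - r t) / ((x - r t)\<^sup>2 + y\<^sup>2) - 2 * (x - R\<^sup>2 / r t) / ((x - R\<^sup>2 / r t)\<^sup>2 + y\<^sup>2)) / 2)) (at x)"
    unfolding Psi_def by (rule derivative_eq_intros ln_sqrt_ratio_deriv nz refl | simp)+
  from DERIV_imp_deriv[OF this]
  have Px: "- deriv (\<lambda>x. Psi R \<Gamma> \<theta> r t x y) x = Im (vortex_field R (\<Gamma> / (2 * pi)) \<theta> (r t) (\<eta> t))"
    unfolding vortex_field_Re_Im x_def[symmetric] y_def[symmetric] half by simp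
  show "((\<lambda>s. fst (Re (\<eta> s), Im (\<eta> s))) has_real_derivative deriv (Psi R \<Gamma> \<theta> r t (fst (Re (\<eta> t), Im (\<eta> t)))) (snd (Re (\<eta> t), Im (\<eta> t)))) (at t)"
    using bounded_linear.has_vector_derivative[OF bounded_linear_Re d] Py
    by (simp add: has_real_derivative_iff_has_vector_derivative x_def y_def)
  show "((\<lambda>s. snd (Re (\<eta> s), Im (\<eta> s))) has_real_derivative - deriv (\<lambda>x. Psi R \<Gamma> \<theta> r t x (snd (Re (\<eta> t), Im (\<eta> t)))) (fst (Re (\<eta> t), Im (\<eta> t)))) (at t)"
    using bounded_linear.has_vector_derivative[OF bounded_linear_Im d] Px
    by (simp add: has_real_derivative_iff_has_vector_derivative x_def y_def)
qed

lemma orbit_periodic: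
  assumes "vortex_orbit R k \<theta> T r \<eta>" "0 < T"
  obtains m where "0 < of_nat m * T" "\<And>t. \<eta> (t + of_nat m * T) = \<eta> t"
proof -
  obtain m where "0 < m" "\<forall>t. \<eta> (t + of_nat m * T) = \<eta> t" using assms(1) unfolding vortex_orbit_def by blast
  then show ?thesis using that[of m] assms(2) by simp
qed

lemma vortex_solution_orbit:
  assumes o: "vortex_orbit R (- (\<Gamma> / (2 * pi))) (- \<theta>) T r \<eta>" and r: "\<And>t. 0 < r t" "\<And>t. r t < R"
  shows "vortex_solution R \<Gamma> (protocol \<theta> r) (\<lambda>t. \<eta> t * exp (\<i> * of_real (\<theta> * t)))"
  unfolding vortex_solution_def
proof (intro allI conjI)
  fix t
  define e where "e = exp (\<i> * of_real (\<theta> * t))"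
  have e: "e \<noteq> 0" "cnj e * e = 1" "cmod e = 1" by (auto simp: e_def exp_cnj mult_exp_exp)
  define k where "k = \<Gamma> / (2 * pi)"
  have z: "protocol \<theta> r t = of_real (r t) * e" by (simp add: protocol_def e_def)
  have rt: "r t \<noteq> 0" using r(1)[of t] by simp
  have z2: "of_real (R\<^sup>2 / (cmod (protocol \<theta> r t))\<^sup>2) * protocol \<theta> r t = of_real (R\<^sup>2 / r t) * e"
    unfolding z norm_mult e(3) using rt by (simp add: power2_eq_square)
  have ne: "\<eta> t \<noteq> of_real (r t)" "\<eta> t \<noteq> of_real (R\<^sup>2 / r t)" using orbit_avoids_vortices[OF o r] by auto
  show "\<eta> t * exp (\<i> * of_real (\<theta> * t)) \<noteq> protocol \<theta> r t"
    "\<eta> t * exp (\<i> * of_real (\<theta> * t)) \<noteq> of_real (R\<^sup>2 / (cmod (protocol \<theta> r t))\<^sup>2) * protocol \<theta> r t"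
    unfolding z2 unfolding z e_def[symmetric] using ne e(1) by (simp_all only: mult_cancel_right simp_thms)
  have inv: "1 / (\<eta> t * e - w * e) = cnj e * (1 / (\<eta> t - w))" for w
  proof -
    have "1 / e = cnj e" using e by (simp add: field_simps)
    then have "cnj e * (1 / (\<eta> t - w)) = (1 / e) * (1 / (\<eta> t - w))" by (simp only:)
    then show ?thesis unfolding left_diff_distrib[symmetric] by (simp add: mult.commute)
  qed
  define F where "F = 1 / (\<eta> t - of_real (r t)) - 1 / (\<eta> t - of_real (R\<^sup>2 / r t))"
  have d: "(\<eta> has_vector_derivative \<i> * (of_real (- \<theta>) * \<eta> t - of_real (- k) * cnj F)) (at t)"
    using o unfolding vortex_orbit_def vortex_field_def F_def k_def by blast
  have de: "((\<lambda>t. exp (\<i> * of_real (\<theta> * t))) has_vector_derivative \<i> * of_real \<theta> * e) (at t)"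
  proof -
    have "((\<lambda>z. exp (\<i> * (of_real \<theta> * z))) has_field_derivative \<i> * of_real \<theta> * e) (at (of_real t))"
      by (auto intro!: derivative_eq_intros simp: e_def)
    from has_vector_derivative_real_field[OF this] show ?thesis by simp
  qed
  have "((\<lambda>t. \<eta> t * exp (\<i> * of_real (\<theta> * t))) has_vector_derivative
    \<eta> t * (\<i> * of_real \<theta> * e) + \<i> * (of_real (- \<theta>) * \<eta> t - of_real (- k) * cnj F) * e) (at t)"
    using has_vector_derivative_mult[OF d de] by (simp add: e_def)
  from bounded_linear.has_vector_derivative[OF bounded_linear_cnj this]
  have "((\<lambda>t. cnj (\<eta> t * exp (\<i> * of_real (\<theta> * t)))) has_vector_derivative - \<i> * of_real k * (cnj e * F)) (at t)"
    by (simp add: algebra_simps)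
  moreover have "of_real \<Gamma> / (2 * of_real pi * \<i>) = - \<i> * of_real k" by (simp add: k_def field_simps)
  ultimately show "((\<lambda>s. cnj (\<eta> s * exp (\<i> * of_real (\<theta> * s)))) has_vector_derivative
      of_real \<Gamma> / (2 * of_real pi * \<i>) * (1 / (\<eta> t * exp (\<i> * of_real (\<theta> * t)) - protocol \<theta> r t)
       - 1 / (\<eta> t * exp (\<i> * of_real (\<theta> * t)) - of_real (R\<^sup>2 / (cmod (protocol \<theta> r t))\<^sup>2) * protocol \<theta> r t))) (at t)"
    unfolding z2 unfolding z e_def[symmetric] inv F_def by (simp add: right_diff_distrib)
qed

lemma zero_winding_orbit:
  assumes o: "vortex_orbit R k \<theta>' T r \<eta>" and T: "0 < T" and r: "\<And>t. r (t + T) = r t" "continuous_on UNIV r"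
  shows "zero_winding \<theta> r (\<lambda>t. \<eta> t * exp (\<i> * of_real (\<theta> * t)))"
proof -
  obtain m where m: "0 < of_nat m * T" "\<And>t. \<eta> (t + of_nat m * T) = \<eta> t" using orbit_periodic[OF o T] by blast
  have c: "corotating \<theta> (\<lambda>t. \<eta> t * exp (\<i> * of_real (\<theta> * t))) = \<eta>"
    by (simp add: corotating_def fun_eq_iff mult.assoc mult_exp_exp)
  interpret rT: periodic_fun_simple r T by unfold_locales (rule r)
  have rm: "r (t + of_nat m * T) = r t" for t using rT.plus_of_nat[of t m] by simp
  define P where "P = of_nat m * T"
  define \<gamma> where "\<gamma> = (\<lambda>s. \<eta> (P * s) - of_real (r (P * s)))"
  have left: "Re (\<eta> t - of_real (r t)) < 0" for t using o by (auto simp: vortex_orbit_def)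
  have "\<eta> differentiable at t" for t
    using o by (auto simp: vortex_orbit_def has_vector_derivative_def differentiable_def)
  then have "continuous_on UNIV \<eta>" by (simp add: continuous_on_eq_continuous_at differentiable_imp_continuous_within)
  then have "continuous_on UNIV (\<lambda>t. \<eta> t - of_real (r t))" using r(2) by (intro continuous_on_diff continuous_on_of_real)
  then have "continuous_on {0..1} \<gamma>" unfolding \<gamma>_def
    by (rule continuous_on_compose2[of UNIV "\<lambda>t. \<eta> t - of_real (r t)" _ "\<lambda>s. P * s"]) (simp_all add: continuous_on_mult_left)
  then have "path \<gamma>" by (simp add: path_def)
  moreover have "pathfinish \<gamma> = pathstart \<gamma>"
    using m(2)[of 0] rm[of 0] by (simp add: pathfinish_def pathstart_def \<gamma>_def P_def)
  moreover have "path_image \<gamma> \<subseteq> {z. Re z < 0}" using left by (auto simp: path_image_def \<gamma>_def)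
  moreover have "convex {z. Re z < 0}" by (rule convex_halfspace_Re_lt)
  ultimately have "winding_number \<gamma> 0 = 0" by (intro winding_number_zero_outside[of _ "{z. Re z < 0}"]) auto
  moreover have "\<eta> t \<noteq> of_real (r t)" for t using left[of t] by auto
  ultimately show ?thesis unfolding zero_winding_def c \<gamma>_def
    using m rm by (intro exI[of _ P]) (auto simp: P_def intro!: periodic_fun_simple.intro)
qed

lemma protocol_periodic_exp:
  assumes "periodic_fun_simple (protocol \<theta> r) T" "\<And>t. r (t + T) = r t" "r 0 \<noteq> 0"
  shows "exp (\<i> * of_real (\<theta> * (t + of_nat m * T))) = exp (\<i> * of_real (\<theta> * t))"
proof -
  interpret periodic_fun_simple "protocol \<theta> r" T by fact
  have "protocol \<theta> r T = protocol \<theta> r 0" using plus_1[of 0] by simp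
  then have "exp (\<i> * of_real (\<theta> * T)) = 1" using assms(2)[of 0] assms(3) by (simp add: protocol_def)
  then have "exp (of_nat m * (\<i> * of_real (\<theta> * T))) = 1" by (simp add: exp_of_nat_mult)
  moreover have "\<i> * of_real (\<theta> * (t + of_nat m * T)) = \<i> * of_real (\<theta> * t) + of_nat m * (\<i> * of_real (\<theta> * T))"
    by (simp add: algebra_simps)
  ultimately show ?thesis by (simp add: exp_add)
qed

theorem theorem3p4:
  fixes R r0 \<Gamma> \<theta>0 \<rho>0 \<phi>0 T :: real
    and f :: "real \<Rightarrow> real"
    and g :: "real \<Rightarrow> real \<Rightarrow> real"
    and r :: "real \<Rightarrow> real \<Rightarrow> real"
  assumes "R > 0" and "0 < r0" and "r0 < R"
    and "\<Gamma> \<noteq> 0" and "\<theta>0 \<noteq> 0"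
    and "\<rho>0 = r0 / R" and "\<phi>0 = 2 * pi * R^2 * \<theta>0 / \<Gamma>"
    and "(\<rho>0, \<phi>0) \<in> R2 \<union> R3 \<union> R4"
    and "T > 0"
    and "periodic_fun_simple f T" and "real_analytic f"
    and "\<And>\<epsilon>. periodic_fun_simple (g \<epsilon>) T" and "\<And>\<epsilon>. real_analytic (g \<epsilon>)"
    and "uniform_limit UNIV g (\<lambda>t. 0) (at 0)"
    and "\<And>t. g 0 t = 0"
    and "\<And>\<epsilon> t. r \<epsilon> t = r0 + \<epsilon> * f t + g \<epsilon> t"
  shows "(\<forall>N::nat. N > 0 \<longrightarrow>
            (\<exists>\<epsilon>N>0. \<forall>\<epsilon>. \<bar>\<epsilon>\<bar> < \<epsilon>N \<longrightarrow>
               (\<exists>S. finite S \<and> card S \<ge> N \<and> geometrically_distinct S \<and>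
                  (\<forall>u\<in>S. hamiltonian_solution R \<Gamma> \<theta>0 (r \<epsilon>) u \<and> is_periodic u \<and>
                          range u \<subseteq> disc R))))
       \<and> (\<exists>\<epsilon>0>0. \<forall>\<epsilon>. \<bar>\<epsilon>\<bar> < \<epsilon>0 \<longrightarrow> periodic_fun_simple (protocol \<theta>0 (r \<epsilon>)) T \<longrightarrow>
            (\<exists>S. infinite S \<and> geometrically_distinct S \<and>
               (\<forall>\<zeta>\<in>S. vortex_solution R \<Gamma> (protocol \<theta>0 (r \<epsilon>)) \<zeta> \<and> is_periodic \<zeta> \<and>
                       (\<forall>t. cmod (\<zeta> t) \<le> R) \<and> zero_winding \<theta>0 (r \<epsilon>) \<zeta>)))"
proof (intro conjI allI impI)
  note T = \<open>T > 0\<close>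
  define k where "k = \<Gamma> / (2 * pi)"
  have k: "k \<noteq> 0" "- k \<noteq> 0" "- \<theta>0 \<noteq> 0" using assms by (auto simp: k_def)
  have "\<phi>0 = R\<^sup>2 * \<theta>0 / k" using assms by (simp add: k_def field_simps)
  then have reg: "(r0 / R, R\<^sup>2 * \<theta>0 / k) \<in> R2 \<union> R3 \<union> R4" "(r0 / R, R\<^sup>2 * (- \<theta>0) / (- k)) \<in> R2 \<union> R3 \<union> R4"
    using assms by auto
  have near: "\<exists>\<epsilon>0>0. \<forall>\<epsilon>. \<bar>\<epsilon>\<bar> < \<epsilon>0 \<longrightarrow> continuous_on UNIV (r \<epsilon>) \<and> (\<forall>t. \<bar>r \<epsilon> t - r0\<bar> \<le> \<kappa>) \<and> (\<forall>t. r \<epsilon> (t + T) = r \<epsilon> t)"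
    if "0 < \<kappa>" for \<kappa>
    using small_perturbation[OF T assms(10-16) that] .
  have main: "\<exists>\<epsilon>0>0. \<forall>\<epsilon>. \<bar>\<epsilon>\<bar> < \<epsilon>0 \<longrightarrow> continuous_on UNIV (r \<epsilon>) \<and> (\<forall>t. r \<epsilon> (t + T) = r \<epsilon> t) \<and> (\<forall>t. 0 < r \<epsilon> t \<and> r \<epsilon> t < R) \<and>
      (\<exists>Y. orbit_family R k' \<theta>' T (r \<epsilon>) Y)"
    if k': "k' \<noteq> 0" "\<theta>' \<noteq> 0" "(r0 / R, R\<^sup>2 * \<theta>' / k') \<in> R2 \<union> R3 \<union> R4" for k' \<theta>'
  proof -
    obtain \<kappa> where \<kappa>: "0 < \<kappa>" "\<forall>r. continuous_on UNIV r \<longrightarrow> (\<forall>t. \<bar>r t - r0\<bar> \<le> \<kappa>) \<longrightarrow> (\<forall>t. r (t + T) = r t) \<longrightarrow>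
      (\<exists>Y. orbit_family R k' \<theta>' T r Y)"
      using ex_vortex_orbits[OF assms(1-3) k'(2,1,3) T] by blast
    define K where "K = min \<kappa> (min (r0 / 2) ((R - r0) / 2))"
    have K: "0 < K" using \<kappa> assms by (simp add: K_def)
    from near[OF K] obtain \<epsilon>0 where \<epsilon>0: "0 < \<epsilon>0"
      "\<forall>\<epsilon>. \<bar>\<epsilon>\<bar> < \<epsilon>0 \<longrightarrow> continuous_on UNIV (r \<epsilon>) \<and> (\<forall>t. \<bar>r \<epsilon> t - r0\<bar> \<le> K) \<and> (\<forall>t. r \<epsilon> (t + T) = r \<epsilon> t)" by blast
    show ?thesis
    proof (intro exI[of _ \<epsilon>0] conjI[OF \<epsilon>0(1)] allI impI)
      fix \<epsilon> :: real assume "\<bar>\<epsilon>\<bar> < \<epsilon>0"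
      then have c: "continuous_on UNIV (r \<epsilon>)" "\<And>t. \<bar>r \<epsilon> t - r0\<bar> \<le> K" "\<forall>t. r \<epsilon> (t + T) = r \<epsilon> t" using \<epsilon>0(2) by auto
      have b: "\<bar>r \<epsilon> t - r0\<bar> \<le> \<kappa>" "\<bar>r \<epsilon> t - r0\<bar> \<le> r0 / 2" "\<bar>r \<epsilon> t - r0\<bar> \<le> (R - r0) / 2" for t
        using c(2)[of t] by (simp_all add: K_def)
      have "0 < r \<epsilon> t \<and> r \<epsilon> t < R" for t using b(2,3)[of t] assms(2,3) unfolding abs_le_iff by (simp add: field_simps)
      then show "continuous_on UNIV (r \<epsilon>) \<and> (\<forall>t. r \<epsilon> (t + T) = r \<epsilon> t) \<and> (\<forall>t. 0 < r \<epsilon> t \<and> r \<epsilon> t < R) \<and>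
      (\<exists>Y. orbit_family R k' \<theta>' T (r \<epsilon>) Y)"
        using \<kappa>(2) c b(1) by blast
    qed
  qed
  {
    fix N :: nat
    from main[OF k(1) assms(5) reg(1)] obtain \<epsilon>0 where \<epsilon>0: "0 < \<epsilon>0"
      "\<forall>\<epsilon>. \<bar>\<epsilon>\<bar> < \<epsilon>0 \<longrightarrow> continuous_on UNIV (r \<epsilon>) \<and> (\<forall>t. r \<epsilon> (t + T) = r \<epsilon> t) \<and> (\<forall>t. 0 < r \<epsilon> t \<and> r \<epsilon> t < R) \<and>
      (\<exists>Y. orbit_family R k \<theta>0 T (r \<epsilon>) Y)" by blast
    show "\<exists>\<epsilon>N>0. \<forall>\<epsilon>. \<bar>\<epsilon>\<bar> < \<epsilon>N \<longrightarrow> (\<exists>S. finite S \<and> card S \<ge> N \<and> geometrically_distinct S \<and>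
                  (\<forall>u\<in>S. hamiltonian_solution R \<Gamma> \<theta>0 (r \<epsilon>) u \<and> is_periodic u \<and> range u \<subseteq> disc R))"
    proof (intro exI[of _ \<epsilon>0] conjI[OF \<epsilon>0(1)] allI impI)
      fix \<epsilon> :: real assume "\<bar>\<epsilon>\<bar> < \<epsilon>0"
      then obtain Y where rb: "\<And>t. 0 < r \<epsilon> t" "\<And>t. r \<epsilon> t < R" and fam: "orbit_family R k \<theta>0 T (r \<epsilon>) Y" using \<epsilon>0(2) by blast
      have Y: "\<And>n. vortex_orbit R k \<theta>0 T (r \<epsilon>) (Y n)"
        and dist: "\<And>m n. m \<noteq> n \<Longrightarrow> \<not> time_translates (\<lambda>t. cmod (Y m t)) (\<lambda>t. cmod (Y n t))"
        using fam unfolding orbit_family_def by blast+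
      define Z where "Z n t = (Re (Y n t), Im (Y n t))" for n t
      have "\<not> time_translates (\<lambda>t. norm (Z m t)) (\<lambda>t. norm (Z n t))" if "m \<noteq> n" for m n
        using dist[OF that] by (simp add: Z_def norm_Pair cmod_def)
      note D = distinct_family[of norm Z, OF this]
      obtain S where S: "S \<subseteq> range Z" "finite S" "card S = N" using infinite_arbitrarily_large[OF D(1)] by blast
      have "hamiltonian_solution R \<Gamma> \<theta>0 (r \<epsilon>) (Z n) \<and> is_periodic (Z n) \<and> range (Z n) \<subseteq> disc R" for n
      proof (intro conjI)
        show "hamiltonian_solution R \<Gamma> \<theta>0 (r \<epsilon>) (Z n)"
          unfolding Z_def[abs_def] by (rule hamiltonian_solution_orbit[OF Y[unfolded k_def] rb])
        obtain m where "0 < of_nat m * T" "\<And>t. Y n (t + of_nat m * T) = Y n t" using orbit_periodic[OF Y T] by blast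
        then show "is_periodic (Z n)" unfolding is_periodic_def
          by (intro exI[of _ "of_nat m * T"]) (auto simp: Z_def intro!: periodic_fun_simple.intro)
        have "(Re (Y n t))\<^sup>2 + (Im (Y n t))\<^sup>2 \<le> R\<^sup>2" for t
          using Y[of n] unfolding vortex_orbit_def cmod_power2[symmetric] by (intro power_mono) (auto intro: less_imp_le)
        then show "range (Z n) \<subseteq> disc R" by (auto simp: Z_def disc_def)
      qed
      then have "\<forall>u\<in>S. hamiltonian_solution R \<Gamma> \<theta>0 (r \<epsilon>) u \<and> is_periodic u \<and> range u \<subseteq> disc R" using S(1) by blast
      moreover have "geometrically_distinct S" using D(2) S(1) unfolding geometrically_distinct_def by (rule pairwise_subset)
      ultimately show "\<exists>S. finite S \<and> card S \<ge> N \<and> geometrically_distinct S \<and>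
                  (\<forall>u\<in>S. hamiltonian_solution R \<Gamma> \<theta>0 (r \<epsilon>) u \<and> is_periodic u \<and> range u \<subseteq> disc R)"
        using S(2,3) by (intro exI[of _ S]) blast
    qed
  }
  from main[OF k(2,3) reg(2)] obtain \<epsilon>0 where \<epsilon>0: "0 < \<epsilon>0"
    "\<forall>\<epsilon>. \<bar>\<epsilon>\<bar> < \<epsilon>0 \<longrightarrow> continuous_on UNIV (r \<epsilon>) \<and> (\<forall>t. r \<epsilon> (t + T) = r \<epsilon> t) \<and> (\<forall>t. 0 < r \<epsilon> t \<and> r \<epsilon> t < R) \<and>
    (\<exists>Y. orbit_family R (- k) (- \<theta>0) T (r \<epsilon>) Y)" by blast
  show "\<exists>\<epsilon>0>0. \<forall>\<epsilon>. \<bar>\<epsilon>\<bar> < \<epsilon>0 \<longrightarrow> periodic_fun_simple (protocol \<theta>0 (r \<epsilon>)) T \<longrightarrow>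
            (\<exists>S. infinite S \<and> geometrically_distinct S \<and>
               (\<forall>\<zeta>\<in>S. vortex_solution R \<Gamma> (protocol \<theta>0 (r \<epsilon>)) \<zeta> \<and> is_periodic \<zeta> \<and>
                       (\<forall>t. cmod (\<zeta> t) \<le> R) \<and> zero_winding \<theta>0 (r \<epsilon>) \<zeta>))"
  proof (intro exI[of _ \<epsilon>0] conjI[OF \<epsilon>0(1)] allI impI)
    fix \<epsilon> :: real assume "\<bar>\<epsilon>\<bar> < \<epsilon>0" and prot: "periodic_fun_simple (protocol \<theta>0 (r \<epsilon>)) T"
    then obtain Y where cont: "continuous_on UNIV (r \<epsilon>)" and rT: "\<And>t. r \<epsilon> (t + T) = r \<epsilon> t"
      and rb: "\<And>t. 0 < r \<epsilon> t" "\<And>t. r \<epsilon> t < R" and fam: "orbit_family R (- k) (- \<theta>0) T (r \<epsilon>) Y" using \<epsilon>0(2) by blast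
    have Y: "\<And>n. vortex_orbit R (- k) (- \<theta>0) T (r \<epsilon>) (Y n)"
      and dist: "\<And>m n. m \<noteq> n \<Longrightarrow> \<not> time_translates (\<lambda>t. cmod (Y m t)) (\<lambda>t. cmod (Y n t))"
      using fam unfolding orbit_family_def by blast+
    define Z where "Z n t = Y n t * exp (\<i> * of_real (\<theta>0 * t))" for n t
    have cZ: "cmod (Z n t) = cmod (Y n t)" for n t by (simp add: Z_def norm_mult)
    have "\<not> time_translates (\<lambda>t. cmod (Z m t)) (\<lambda>t. cmod (Z n t))" if "m \<noteq> n" for m n
      unfolding cZ by (rule dist[OF that])
    note D = distinct_family[of cmod Z, OF this]
    have "vortex_solution R \<Gamma> (protocol \<theta>0 (r \<epsilon>)) (Z n) \<and> is_periodic (Z n) \<and>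
                       (\<forall>t. cmod (Z n t) \<le> R) \<and> zero_winding \<theta>0 (r \<epsilon>) (Z n)" for n
    proof (intro conjI allI)
      show "vortex_solution R \<Gamma> (protocol \<theta>0 (r \<epsilon>)) (Z n)"
        unfolding Z_def[abs_def] by (rule vortex_solution_orbit[OF Y[unfolded k_def] rb])
      show "zero_winding \<theta>0 (r \<epsilon>) (Z n)" unfolding Z_def[abs_def] by (rule zero_winding_orbit[OF Y T rT cont])
      show "cmod (Z n t) \<le> R" for t unfolding cZ using Y[of n] by (auto simp: vortex_orbit_def intro: less_imp_le)
      obtain m where m: "0 < of_nat m * T" "\<And>t. Y n (t + of_nat m * T) = Y n t" using orbit_periodic[OF Y T] by blast
      have "r \<epsilon> 0 \<noteq> 0" using rb(1)[of 0] by simp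
      from protocol_periodic_exp[OF prot rT this] have "Z n (t + of_nat m * T) = Z n t" for t
        unfolding Z_def m(2) by (simp only:)
      then show "is_periodic (Z n)" unfolding is_periodic_def
        using m(1) by (intro exI[of _ "of_nat m * T"]) (auto intro!: periodic_fun_simple.intro)
    qed
    then show "\<exists>S. infinite S \<and> geometrically_distinct S \<and>
               (\<forall>\<zeta>\<in>S. vortex_solution R \<Gamma> (protocol \<theta>0 (r \<epsilon>)) \<zeta> \<and> is_periodic \<zeta> \<and>
                       (\<forall>t. cmod (\<zeta> t) \<le> R) \<and> zero_winding \<theta>0 (r \<epsilon>) \<zeta>)"
      using D by (intro exI[of _ "range Z"]) auto
  qed
qed

end
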